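(* Under the standing assumptions (1)–(6) of the context, let $(X_k)_{k\ge0}$ be the Markov chain on $I$ with transition kernel $p_{\mathrm{dif}}$. There exists an invariant measure $\pi^{\mathrm{inv}}$ for $p_{\mathrm{dif}}$, unique up to scalar multiple. This measure has full support. For all measurable $f:I\to\mathbb R$ such that $|f(x)|\le F(|x|)$ for some decreasing $F:[0,\infty)\to[0,\infty)$ with $\sum_{k=0}^\infty F(k)<\infty$, one has $\int_I|f|\,d\pi^{\mathrm{inv}}<\infty$. Furthermore, for all $f,g\in L^1(\pi^{\mathrm{inv}})$ with $\int_Ig\,d\pi^{\mathrm{inv}}\ne0$, $$\lim_{r\to\infty}\frac{\sum_{k=0}^rf(X_k)}{\sum_{k=0}^rg(X_k)}=\frac{\int_If\,d\pi^{\mathrm{inv}}}{\int_Ig\,d\pi^{\mathrm{inv}}}$$ almost surely, starting from any point $X_0\in I$.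
   Context: Setting. Fix $I=\mathbb R$ or $I=c\mathbb Z$ ($c>0$). A Markov kernel on $I$ is a map $x\mapsto K(x,\cdot)$ from $I$ to the Borel probability measures on $I$, continuous for weak convergence. $\mathcal M(I)$ is the set of Markov kernels with the weakest topology making $K\mapsto\int_I f(y)K(x,dy)$ continuous for all $x\in I$ and all bounded continuous $f$, and with its Borel $\sigma$-algebra. For $a\in I$, $(\tau_aK)(x,A)=K(x+a,A+a)$. Let $(K_n)_{n\ge1}$ be $\mathcal M(I)$-valued random variables on a probability space with law $\mathbb P$ (expectation $\mathbb E$) such that: (1) $K_1,K_2,\dots$ are i.i.d. (for fixed $n$, $K_n(x,\cdot)$ and $K_n(x',\cdot)$ may be dependent); (2) $K_1$ has the same law as $\tau_aK_1$ for all $a\in I$; (3) $\mu(A):=\mathbb E[K_1(0,A)]$ satisfies $\int_I e^{\eta|x|}\mu(dx)<\infty$ for some $\eta>0$; with $m_k=\int_I x^k\mu(dx)$ one has $m_2-m_1^2=1$; (4) there is $p\in\mathbb N$ such that $\int_I y^kK_1(0,dy)=m_k$ almost surely for $1\le k\le p-1$, while $\int_I y^pK_1(0,dy)$ is non-deterministic; (5) with $p^{(k)}(\mathbf x,d\mathbf y):=\mathbb E[K_1(x_1,dy_1)\cdots K_1(x_k,dy_k)]$, there is a decreasing function $\mathrm F_{\mathrm{decay}}:[0,\infty)\to[0,\infty)$ with $x\mapsto x\mathrm F_{\mathrm{decay}}(x)$ decreasing for large $x$ and $\int_0^\infty x\mathrm F_{\mathrm{decay}}(x)dx<\infty$, such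 that for all $k\in\{2p,\dots,4p\}$, all $\mathbf x\in I^k$ and all integers $0\le r_1,\dots,r_k\le4p-1$ with $2p\le r_1+\dots+r_k\le4p$: $\big|\int_{I^k}\prod_j(y_j-x_j)^{r_j}p^{(k)}(\mathbf x,d\mathbf y)-\int_{I^k}\prod_jy_j^{r_j}\mu^{\otimes k}(d\mathbf y)\big|\le\mathrm F_{\mathrm{decay}}(\min_{i<j}|x_i-x_j|)$; (6) the Markov kernel $p_{\mathrm{dif}}(x,A):=\int_{I^2}\mathbf 1_{\{y_1-y_2\in A\}}p^{(2)}((x,0),(dy_1,dy_2))$ on $I$ is such that $x\mapsto p_{\mathrm{dif}}(x,\cdot)$ is continuous in total variation, and for all $x,y\in I$, $\varepsilon>0$ there is $m\in\mathbb N$ with $p_{\mathrm{dif}}^m(x,(y-\varepsilon,y+\varepsilon))>0$. *)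

theory Defs
  imports "HOL-Probability.Probability"
begin

text \<open>The state space \<open>I\<close> is a set of reals, and measures on \<open>I\<close> are measures on the
  trace \<open>\<sigma>\<close>-algebra, so that \<open>space\<close> is \<open>I\<close> itself.\<close>

definition state_space :: "real set \<Rightarrow> bool" where
  "state_space I \<longleftrightarrow> I = UNIV \<or> (\<exists>c>0. I = range (\<lambda>k::int. c * of_int k))"

abbreviation borel_on :: "real set \<Rightarrow> real measure" where
  "borel_on I \<equiv> restrict_space borel I"

definition bounded_continuous_on :: "real set \<Rightarrow> (real \<Rightarrow> real) \<Rightarrow> bool" where
  "bounded_continuous_on I f \<longleftrightarrow> continuous_on I f \<and> bounded (f ` I)"

text \<open>Kernels are extensional functions (\<open>undefined\<close> off \<open>I\<close>), so that equality of kernels is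
  equality on \<open>I\<close>.\<close>

definition markov_kernels :: "real set \<Rightarrow> (real \<Rightarrow> real measure) set" where
  "markov_kernels I =
    {K \<in> I \<rightarrow>\<^sub>E space (prob_algebra (borel_on I)).
      \<forall>f. bounded_continuous_on I f \<longrightarrow> continuous_on I (\<lambda>x. \<integral>y. f y \<partial>K x)}"

text \<open>The weakest topology making all \<open>K \<mapsto> \<integral> f dK(x)\<close> continuous; the choice \<open>U = UNIV\<close> makes
  \<open>markov_kernels I\<close> its underlying set.\<close>

definition kernel_topology :: "real set \<Rightarrow> (real \<Rightarrow> real measure) topology" where
  "kernel_topology I = topology_generated_by
    {{K \<in> markov_kernels I. (\<integral>y. f y \<partial>K x) \<in> U} | f x U.
      bounded_continuous_on I f \<and> x \<in> I \<and> open U}"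

definition kernel_space :: "real set \<Rightarrow> (real \<Rightarrow> real measure) measure" where
  "kernel_space I = sigma (markov_kernels I) {U. openin (kernel_topology I) U}"

text \<open>\<open>(\<tau>\<^sub>a K)(x, A) = K(x + a, A + a)\<close>, that is, the image of \<open>K(x + a, \<cdot>)\<close> under \<open>y \<mapsto> y - a\<close>.\<close>

definition shift_kernel ::
  "real set \<Rightarrow> real \<Rightarrow> (real \<Rightarrow> real measure) \<Rightarrow> real \<Rightarrow> real measure" where
  "shift_kernel I a K = (\<lambda>x\<in>I. distr (K (x + a)) (borel_on I) (\<lambda>y. y - a))"

text \<open>In the next three definitions \<open>K\<close> is a single random kernel on the probability space \<open>P\<close>;
  \<open>P \<bind> \<dots>\<close> is the expectation under \<open>P\<close> of a random probability measure.
  Coordinates are indexed by \<open>1, \<dots>, k\<close>.\<close>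

definition mean_measure :: "'w measure \<Rightarrow> ('w \<Rightarrow> real \<Rightarrow> real measure) \<Rightarrow> real measure" where
  "mean_measure P K = P \<bind> (\<lambda>\<omega>. K \<omega> 0)"

definition kpoint_kernel ::
  "'w measure \<Rightarrow> ('w \<Rightarrow> real \<Rightarrow> real measure) \<Rightarrow> nat \<Rightarrow> (nat \<Rightarrow> real) \<Rightarrow> (nat \<Rightarrow> real) measure"
where
  "kpoint_kernel P K k x = P \<bind> (\<lambda>\<omega>. \<Pi>\<^sub>M i\<in>{1..k}. K \<omega> (x i))"

definition difference_kernel ::
  "real set \<Rightarrow> 'w measure \<Rightarrow> ('w \<Rightarrow> real \<Rightarrow> real measure) \<Rightarrow> real \<Rightarrow> real measure" where
  "difference_kernel I P K x =
    distr (kpoint_kernel P K 2 ((\<lambda>_. 0)(1 := x))) (borel_on I) (\<lambda>y. y 1 - y 2)"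

definition decay_function :: "(real \<Rightarrow> real) \<Rightarrow> bool" where
  "decay_function F \<longleftrightarrow>
    (\<forall>x\<ge>0. 0 \<le> F x) \<and> antimono_on {0..} F \<and>
    (\<exists>R\<ge>0. antimono_on {R..} (\<lambda>x. x * F x)) \<and>
    set_integrable lborel {0..} (\<lambda>x. x * F x)"

definition tv_dist :: "'a measure \<Rightarrow> 'a measure \<Rightarrow> real" where
  "tv_dist M N = (SUP A\<in>sets M. \<bar>measure M A - measure N A\<bar>)"

definition tv_continuous_kernel :: "real set \<Rightarrow> (real \<Rightarrow> real measure) \<Rightarrow> bool" where
  "tv_continuous_kernel I q \<longleftrightarrow> (\<forall>x\<in>I. ((\<lambda>z. tv_dist (q z) (q x)) \<longlongrightarrow> 0) (at x within I))"

primrec kernel_power ::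
  "real set \<Rightarrow> (real \<Rightarrow> real measure) \<Rightarrow> nat \<Rightarrow> real \<Rightarrow> real measure" where
  "kernel_power I q 0 = return (borel_on I)"
| "kernel_power I q (Suc n) = (\<lambda>x. q x \<bind> kernel_power I q n)"

text \<open>As usual, invariant measures are nonzero and \<open>\<sigma>\<close>-finite. Without \<open>\<sigma>\<close>-finiteness, uniqueness up
  to a finite scalar could not hold, since \<open>\<infinity> \<cdot> \<pi>\<close> is invariant whenever \<open>\<pi>\<close> is.\<close>

definition invariant_measure ::
  "real set \<Rightarrow> (real \<Rightarrow> real measure) \<Rightarrow> real measure \<Rightarrow> bool" where
  "invariant_measure I q \<pi> \<longleftrightarrow>
    sets \<pi> = sets (borel_on I) \<and> sigma_finite_measure \<pi> \<and> emeasure \<pi> I \<noteq> 0 \<and>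
    (\<forall>A\<in>sets (borel_on I). (\<integral>\<^sup>+x. emeasure (q x) A \<partial>\<pi>) = emeasure \<pi> A)"

definition full_support :: "real set \<Rightarrow> real measure \<Rightarrow> bool" where
  "full_support I \<pi> \<longleftrightarrow> (\<forall>U. open U \<and> U \<inter> I \<noteq> {} \<longrightarrow> 0 < emeasure \<pi> (U \<inter> I))"

definition natural_filtration ::
  "real set \<Rightarrow> 'b measure \<Rightarrow> (nat \<Rightarrow> 'b \<Rightarrow> real) \<Rightarrow> nat \<Rightarrow> 'b measure" where
  "natural_filtration I Q X n =
    sigma (space Q) {X i -` A \<inter> space Q | i A. i \<le> n \<and> A \<in> sets (borel_on I)}"

definition markov_chain ::
  "real set \<Rightarrow> (real \<Rightarrow> real measure) \<Rightarrow> real \<Rightarrow> 'b measure \<Rightarrow> (nat \<Rightarrow> 'b \<Rightarrow> real) \<Rightarrow> bool" where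
  "markov_chain I q x\<^sub>0 Q X \<longleftrightarrow>
    prob_space Q \<and> (\<forall>n. X n \<in> Q \<rightarrow>\<^sub>M borel_on I) \<and> (AE \<omega> in Q. X 0 \<omega> = x\<^sub>0) \<and>
    (\<forall>n. \<forall>A\<in>sets (borel_on I). AE \<omega> in Q.
      real_cond_exp Q (natural_filtration I Q X n) (\<lambda>\<omega>'. indicator A (X (Suc n) \<omega>')) \<omega>
        = measure (q (X n \<omega>)) A)"

end

theory Submission
  imports Defs
begin

text \<open>Continuity in total variation makes \<open>p_dif\<close> strong Feller. By stationarity its increments have
  mean zero, and far from the origin their variance is at least 1: the variance is \<open>2 m\<^sub>2\<close> minus twice
  the mixed moment of the two increments, which is close to \<open>m\<^sub>1\<^sup>2\<close> by the decay assumption if \<open>p = 1\<close>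
  and equal to \<open>m\<^sub>1\<^sup>2\<close> if \<open>p \<ge> 2\<close>, the mean of \<open>K\<^sub>1(0, \<cdot>)\<close> being deterministic. Hence \<open>ln (1 + x\<^sup>2)\<close>
  is a proper supermartingale function outside a compact set, so that bounded subharmonic functions
  are constant (maximum principle). This Liouville property gives recurrence and, through Garsia's
  maximal inequality, the ratio limit theorem for every starting point; uniqueness of the invariant
  measure follows from the ratio limits.

  For existence, the two-step kernel is minorized near 0 and split. The invariant measure is the
  expected occupation measure of an excursion, and it is finite on compact sets by the Lyapunov
  function. Testing invariance against the translates \<open>sqrt (1 + x\<^sup>2) + sqrt (1 + a\<^sup>2) + 1 - sqrt (1 + (x - a)\<^sup>2)\<close>
  bounds the measure of unit intervals uniformly in their position \<open>a\<close>, which is the integrability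
  statement.\<close>

section \<open>Strong Feller chains and the Liouville property\<close>

text \<open>Far from the origin the chain resembles a centred random walk on the line, so the
  invariant measure need not be finite, and drift conditions that yield a stationary probability are
  out of reach. The two families of test functions divide the work. In one step
  \<open>ln (1 + x\<^sup>2)\<close> loses about variance / x^2, which dominates the Taylor remainder
  of order |x|^-3; this makes the expected sum of 1 / (1 + x^2) over an excursion finite. That sum
  then pays for the translates: each of them is superharmonic up to an error of order 1 / (1 + x^2),
  loses a fixed amount on the unit interval around \<open>a\<close>, and is bounded on compact sets
  independently of \<open>a\<close>.

  The Liouville property needs no regularity of the function it is applied to, because
  \<open>q\<close> turns bounded measurable functions into continuous ones. It can therefore be fed
  with probabilities of path events, which are only known to be measurable in the starting point;
  this is how statements for almost every starting point are avoided.\<close>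

locale feller_chain =
  fixes I :: "real set" and q :: "real \<Rightarrow> real measure"
  assumes closed_I: "closed I"
    and zero_in_I: "0 \<in> I"
    and q_prob: "\<And>x. x \<in> I \<Longrightarrow> q x \<in> space (prob_algebra (borel_on I))"
    and feller_set: "\<And>A. A \<in> sets (borel_on I) \<Longrightarrow> continuous_on I (\<lambda>x. measure (q x) A)"
    and irreducible: "\<And>x y \<epsilon>. x \<in> I \<Longrightarrow> y \<in> I \<Longrightarrow> \<epsilon> > 0 \<Longrightarrow>
      \<exists>n. 0 < measure (kernel_power I q n x) ({y - \<epsilon><..<y + \<epsilon>} \<inter> I)"
begin

abbreviation "B \<equiv> borel_on I"

lemma I_borel [measurable]: "I \<in> sets borel"
  using closed_I by auto

lemma space_B: "space B = I"
  by (simp add: space_restrict_space)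

lemma prob_q: "x \<in> I \<Longrightarrow> prob_space (q x)"
  using q_prob by (auto simp: space_prob_algebra)

lemma sets_q: "x \<in> I \<Longrightarrow> sets (q x) = sets B"
  using q_prob by (auto simp: space_prob_algebra)

lemma space_q: "x \<in> I \<Longrightarrow> space (q x) = I"
  using sets_eq_imp_space_eq[OF sets_q] by (simp add: space_B)

lemma q_measurable [measurable]: "q \<in> B \<rightarrow>\<^sub>M prob_algebra B"
proof (rule measurable_prob_algebraI)
  show "prob_space (q x)" if "x \<in> space B" for x
    using that prob_q by (simp add: space_B)
  show "q \<in> B \<rightarrow>\<^sub>M subprob_algebra B"
  proof (rule measurable_subprob_algebra)
    show "subprob_space (q x)" if "x \<in> space B" for x
      using that prob_space_imp_subprob_space[OF prob_q] by (simp add: space_B)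
    show "sets (q x) = sets B" if "x \<in> space B" for x
      using that sets_q by (simp add: space_B)
    fix A assume A: "A \<in> sets B"
    have "(\<lambda>x. measure (q x) A) \<in> borel_measurable B"
      using borel_measurable_continuous_on_restrict[OF feller_set[OF A]] .
    then have "(\<lambda>x. ennreal (measure (q x) A)) \<in> borel_measurable B"
      by measurable
    then show "(\<lambda>x. emeasure (q x) A) \<in> borel_measurable B"
      by (rule measurable_cong[THEN iffD1, rotated])
         (simp add: space_B finite_measure.emeasure_eq_measure prob_q prob_space.finite_measure)
  qed
qed

lemma q_measurable' [measurable]: "q \<in> B \<rightarrow>\<^sub>M subprob_algebra B"
  by (rule measurable_prob_algebraD[OF q_measurable])

lemma integrable_bounded:
  assumes "x \<in> I" "f \<in> borel_measurable B" "\<And>y. y \<in> I \<Longrightarrow> \<bar>f y\<bar> \<le> (c::real)"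
  shows "integrable (q x) f"
proof -
  interpret prob_space "q x" using assms prob_q by simp
  have "f \<in> borel_measurable (q x)"
    using assms(2) unfolding measurable_cong_sets[OF sets_q[OF assms(1)] refl] .
  then show ?thesis
    using assms by (intro integrable_const_bound[where B = c]) (auto intro!: AE_I2 simp: space_q)
qed

text \<open>A layer-cake approximation with grid 1/n: the integral of \<open>g n\<close> is an
  average of the probabilities of the level sets \<open>S n k\<close>, hence continuous, and it
  differs from the integral of \<open>f\<close> by at most 1/n uniformly in the starting point, so
  continuity survives the limit.\<close>

lemma strong_feller_aux:
  assumes [measurable]: "f \<in> borel_measurable B"
    and f: "\<And>y. y \<in> I \<Longrightarrow> 0 \<le> f y \<and> f y \<le> (1::real)"
  shows "continuous_on I (\<lambda>x. \<integral>y. f y \<partial>q x)"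
proof -
  define S where "S n k = {y \<in> space B. real k \<le> real n * f y}" for n k
  have S [measurable]: "S n k \<in> sets B" for n k
    unfolding S_def by measurable
  define g where "g n y = (\<Sum>k=1..n. indicator (S n k) y) / real n" for n y
  have g [measurable]: "g n \<in> borel_measurable B" for n
    unfolding g_def by measurable
  have g_eq: "g n y = real (nat \<lfloor>real n * f y\<rfloor>) / real n" if "y \<in> I" for n y
  proof -
    let ?t = "real n * f y"
    have t: "0 \<le> ?t" "?t \<le> real n"
      using f[OF that] by (auto simp: mult_left_le)
    have "(\<Sum>k=1..n. indicator (S n k) y) = (\<Sum>k=1..n. if real k \<le> ?t then 1 else 0 :: real)"
      using that by (intro sum.cong) (auto simp: S_def space_B indicator_def)
    also have "\<dots> = real (card {k\<in>{1..n}. real k \<le> ?t})"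
      by (simp add: sum.If_cases Int_def)
    also have "{k\<in>{1..n}. real k \<le> ?t} = {1..nat \<lfloor>?t\<rfloor>}"
      using t by (auto simp: le_nat_floor) (linarith | (simp add: le_nat_iff le_floor_iff))+
    finally show ?thesis
      by (simp add: g_def)
  qed
  have approx: "\<bar>g n y - f y\<bar> \<le> 1 / real n" if "y \<in> I" "n > 0" for n y
  proof -
    have "0 \<le> real n * f y" using f[OF that(1)] by simp
    then have "\<bar>real (nat \<lfloor>real n * f y\<rfloor>) - real n * f y\<bar> \<le> 1"
      by linarith
    then have "\<bar>real (nat \<lfloor>real n * f y\<rfloor>) - real n * f y\<bar> / real n \<le> 1 / real n"
      using that by (intro divide_right_mono) auto
    also have "\<bar>real (nat \<lfloor>real n * f y\<rfloor>) - real n * f y\<bar> / real n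
      = \<bar>(real (nat \<lfloor>real n * f y\<rfloor>) - real n * f y) / real n\<bar>"
      by (simp only: abs_divide abs_of_nat)
    also have "\<dots> = \<bar>g n y - f y\<bar>"
      using that by (simp add: g_eq[OF that(1)] diff_divide_distrib)
    finally show ?thesis .
  qed
  have int_g: "integrable (q x) (g n)" if "x \<in> I" for x n
  proof (rule integrable_bounded[where c = 1])
    fix y assume y: "y \<in> I"
    have "real (nat \<lfloor>real n * f y\<rfloor>) \<le> real n"
      using f[OF y] mult_left_le[of "f y" "real n"] by (simp add: le_nat_iff) linarith
    then show "\<bar>g n y\<bar> \<le> 1"
      by (cases "n = 0") (simp_all add: g_eq[OF y])
  qed (use that in auto)
  have int_f: "integrable (q x) f" if "x \<in> I" for x
    by (rule integrable_bounded[where c = 1]) (use that f in fastforce)+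
  have cont: "continuous_on I (\<lambda>x. \<integral>y. g n y \<partial>q x)" for n
  proof -
    have "continuous_on I (\<lambda>x. (\<Sum>k=1..n. measure (q x) (S n k)) / real n)"
      by (cases "n = 0") (auto intro!: continuous_intros feller_set S)
    then show ?thesis
    proof (rule continuous_on_eq)
      fix x assume x: "x \<in> I"
      interpret prob_space "q x" using x prob_q by simp
      have "(\<integral>y. g n y \<partial>q x) = (\<Sum>k=1..n. \<integral>y. indicator (S n k) y \<partial>q x) / real n"
        unfolding g_def using S sets_q[OF x]
        by (subst integral_divide_zero, subst Bochner_Integration.integral_sum) (auto simp: emeasure_eq_measure)
      then show "(\<Sum>k=1..n. measure (q x) (S n k)) / real n = (\<integral>y. g n y \<partial>q x)"
        using S sets_q[OF x] by (simp add: sets.Int_space_eq2)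
    qed
  qed
  show ?thesis
  proof (rule uniform_limit_theorem[where F = sequentially])
    show "\<forall>\<^sub>F n in sequentially. continuous_on I (\<lambda>x. \<integral>y. g n y \<partial>q x)"
      using cont by simp
    show "uniform_limit I (\<lambda>n x. \<integral>y. g n y \<partial>q x) (\<lambda>x. \<integral>y. f y \<partial>q x) sequentially"
    proof (rule uniform_limitI)
      fix e :: real assume "e > 0"
      then obtain N where N: "N > 0" "1 / real N < e"
        using nat_approx_posE by (metis zero_less_Suc)
      have "dist (\<integral>y. g n y \<partial>q x) (\<integral>y. f y \<partial>q x) < e" if "n \<ge> N" "x \<in> I" for n x
      proof -
        interpret prob_space "q x" using that prob_q by simp
        have "\<bar>(\<integral>y. g n y \<partial>q x) - (\<integral>y. f y \<partial>q x)\<bar> = \<bar>\<integral>y. g n y - f y \<partial>q x\<bar>"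
          using int_g int_f that by (subst Bochner_Integration.integral_diff) auto
        also have "\<dots> \<le> (\<integral>y. \<bar>g n y - f y\<bar> \<partial>q x)"
          by (rule integral_abs_bound)
        also have "\<dots> \<le> (\<integral>y. 1 / real n \<partial>q x)"
          using approx that N int_g int_f
          by (intro integral_mono) (auto simp: space_q)
        also have "\<dots> = 1 / real n" by (simp add: prob_space)
        also have "\<dots> \<le> 1 / real N" using that N by (simp add: frac_le)
        finally show ?thesis using N by (simp add: dist_real_def)
      qed
      then show "\<forall>\<^sub>F n in sequentially. \<forall>x\<in>I. dist (\<integral>y. g n y \<partial>q x) (\<integral>y. f y \<partial>q x) < e"
        using eventually_sequentially by blast
    qed
  qed simp
qed

lemma strong_feller:
  assumes [measurable]: "f \<in> borel_measurable B"
    and f: "\<And>y. y \<in> I \<Longrightarrow> \<bar>f y\<bar> \<le> (c::real)"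
  shows "continuous_on I (\<lambda>x. \<integral>y. f y \<partial>q x)"
proof -
  have c: "c \<ge> 0" using f[OF zero_in_I] by linarith
  \<comment> \<open>Affine rescaling into the unit interval; \<open>c + 1\<close> instead of
    \<open>c\<close> keeps the denominator positive when \<open>c = 0\<close>.\<close>
  let ?g = "\<lambda>y. (f y + (c + 1)) / (2 * (c + 1))"
  have "continuous_on I (\<lambda>x. \<integral>y. ?g y \<partial>q x)"
  proof (rule strong_feller_aux)
    fix y assume "y \<in> I"
    then show "0 \<le> ?g y \<and> ?g y \<le> 1" using f[of y] c by (auto simp: field_simps)
  qed measurable
  then have "continuous_on I (\<lambda>x. 2 * (c + 1) * (\<integral>y. ?g y \<partial>q x) - (c + 1))"
    by (intro continuous_intros)
  then show ?thesis
  proof (rule continuous_on_eq)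
    fix x assume x: "x \<in> I"
    interpret prob_space "q x" using x prob_q by simp
    have "integrable (q x) f" using integrable_bounded[OF x assms] .
    then have "(\<integral>y. ?g y \<partial>q x) = ((\<integral>y. f y \<partial>q x) + (c + 1)) / (2 * (c + 1))"
      by (subst integral_divide_zero) (simp add: prob_space)
    then show "2 * (c + 1) * (\<integral>y. ?g y \<partial>q x) - (c + 1) = (\<integral>y. f y \<partial>q x)"
      using c by (simp add: field_simps)
  qed
qed

lemma kernel_power_measurable [measurable]: "kernel_power I q n \<in> B \<rightarrow>\<^sub>M prob_algebra B"
proof (induction n)
  case 0
  show ?case by (subst kernel_power.simps) (rule measurable_return_prob_space)
next
  case (Suc n)
  show ?case
    by (subst kernel_power.simps) (rule measurable_bind_prob_space[OF q_measurable Suc])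
qed

text \<open>Starting in \<open>Z\<close>, no power of the kernel ever charges the complement of
  \<open>Z\<close>, whereas irreducibility sends mass into every neighbourhood of \<open>y\<close>.
  In applications \<open>Z\<close> is the set where some function attains its maximum or vanishes,
  so that such a set turns out to be dense.\<close>

lemma absorbing_meets_open:
  assumes Z: "Z \<in> sets B" "x \<in> Z" and absorb: "\<And>y. y \<in> Z \<Longrightarrow> emeasure (q y) (I - Z) = 0"
    and U: "open U" "y \<in> U" "y \<in> I"
  shows "U \<inter> Z \<noteq> {}"
proof
  assume disj: "U \<inter> Z = {}"
  have ZI: "Z \<subseteq> I" using sets.sets_into_space[OF Z(1)] by (simp add: space_B)
  have IZ [measurable]: "I - Z \<in> sets B" using Z(1) sets.compl_sets[of Z B] by (simp add: space_B)
  have stay: "emeasure (kernel_power I q n z) (I - Z) = 0" if "z \<in> Z" for n z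
    using that
  proof (induction n arbitrary: z)
    case 0
    then show ?case using IZ by simp
  next
    case (Suc n)
    then have z: "z \<in> I" using ZI by auto
    have "emeasure (kernel_power I q (Suc n) z) (I - Z)
      = (\<integral>\<^sup>+w. emeasure (kernel_power I q n w) (I - Z) \<partial>q z)"
      unfolding kernel_power.simps
      by (rule emeasure_bind_prob_algebra[OF q_prob[OF z] kernel_power_measurable IZ])
    also have "\<dots> = (\<integral>\<^sup>+w. 0 \<partial>q z)"
    proof (rule nn_integral_cong_AE)
      have "AE w in q z. w \<notin> I - Z"
        using absorb[OF Suc.prems] IZ sets_q[OF z] by (intro AE_not_in) auto
      then show "AE w in q z. emeasure (kernel_power I q n w) (I - Z) = 0"
        using AE_space by eventually_elim (use Suc.IH space_q[OF z] in auto)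
    qed
    finally show ?case by simp
  qed
  obtain e where e: "e > 0" "ball y e \<subseteq> U"
    using U openE by blast
  then have sub: "{y - e<..<y + e} \<inter> I \<subseteq> I - Z"
    using disj by (auto simp: ball_eq_greaterThanLessThan)
  obtain n where n: "0 < measure (kernel_power I q n x) ({y - e<..<y + e} \<inter> I)"
    using irreducible[of x y e] Z ZI U e by blast
  have "kernel_power I q n x \<in> space (prob_algebra B)"
    using kernel_power_measurable Z ZI by (auto simp: measurable_def space_B)
  then interpret k: prob_space "kernel_power I q n x"
    by (simp add: space_prob_algebra)
  have "measure (kernel_power I q n x) ({y - e<..<y + e} \<inter> I) \<le> measure (kernel_power I q n x) (I - Z)"
    using IZ \<open>kernel_power I q n x \<in> _\<close> by (intro k.finite_measure_mono sub) (simp add: space_prob_algebra)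
  then show False
    using n stay[OF Z(2), of n] by (simp add: measure_def)
qed

end

section \<open>Lyapunov functions and the maximum principle\<close>

locale lyapunov_chain = feller_chain +
  fixes V :: "real \<Rightarrow> real" and R :: real
  assumes V_cont: "continuous_on I V"
    and V_nonneg: "\<And>x. 0 \<le> V x"
    and V_proper: "\<And>c. \<exists>r. \<forall>x\<in>I. V x \<le> c \<longrightarrow> \<bar>x\<bar> \<le> r"
    and V_integrable: "\<And>x. x \<in> I \<Longrightarrow> integrable (q x) V"
    and V_decreasing: "\<And>x. x \<in> I \<Longrightarrow> R < \<bar>x\<bar> \<Longrightarrow> (\<integral>y. V y \<partial>q x) \<le> V x"
    and R_nonneg: "0 \<le> R"
begin

lemma continuous_measurable: "continuous_on I f \<Longrightarrow> (f :: real \<Rightarrow> real) \<in> borel_measurable B"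
  by (rule borel_measurable_continuous_on_restrict)

text \<open>At a maximum point the submean inequality forces \<open>M - w\<close>, which is
  nonnegative, to have integral zero, so the next position is again a maximum point almost surely.
  The inequality is asked for at maximum points only, because the perturbed function in the
  Liouville theorem is known to satisfy it only away from a compact set.\<close>

lemma maximum_absorbing:
  assumes w: "continuous_on I w" "\<And>y. y \<in> I \<Longrightarrow> w y \<le> M" "w z = (M::real)" "z \<in> I"
    and int: "\<And>x. x \<in> I \<Longrightarrow> integrable (q x) w"
    and sub: "\<And>x. x \<in> I \<Longrightarrow> w x = M \<Longrightarrow> w x \<le> (\<integral>y. w y \<partial>q x)"
    and U: "open U" "y \<in> U" "y \<in> I"
  shows "\<exists>x\<in>U \<inter> I. w x = M"
proof -
  let ?Z = "{x\<in>space B. w x = M}"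
  have [measurable]: "w \<in> borel_measurable B" using w by (intro continuous_measurable)
  have "U \<inter> ?Z \<noteq> {}"
  proof (rule absorbing_meets_open[OF _ _ _ U])
    show "?Z \<in> sets B" by measurable
    show "z \<in> ?Z" using w by (simp add: space_B)
    fix x assume x: "x \<in> ?Z"
    then have xI: "x \<in> I" by (simp add: space_B)
    interpret prob_space "q x" using xI prob_q by simp
    have intMw: "integrable (q x) (\<lambda>y. M - w y)" using int[OF xI] by simp
    have "(\<integral>y. M - w y \<partial>q x) = M - (\<integral>y. w y \<partial>q x)"
      using int[OF xI] by (simp add: prob_space)
    also have "\<dots> \<le> 0" using sub[OF xI] x by simp
    finally have "(\<integral>y. M - w y \<partial>q x) = 0"
      using w(2) space_q[OF xI] by (intro antisym integral_nonneg_AE AE_I2) auto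
    then have "AE y in q x. M - w y = 0"
      using w(2) space_q[OF xI] by (subst (asm) integral_nonneg_eq_0_iff_AE[OF intMw]) (auto intro!: AE_I2)
    then have "AE y in q x. y \<notin> I - ?Z"
      by (rule AE_mp) (auto intro!: AE_I2 simp: space_B space_q[OF xI])
    moreover have "I - ?Z \<in> sets (q x)"
    proof -
      have "space B - ?Z \<in> sets B" by measurable
      then show ?thesis by (simp add: space_B sets_q[OF xI])
    qed
    ultimately show "emeasure (q x) (I - ?Z) = 0"
      using AE_iff_measurable[of "I - ?Z" "q x" "\<lambda>y. y \<notin> I - ?Z"] space_q[OF xI] by auto
  qed
  then show ?thesis by (auto simp: space_B)
qed

text \<open>The conclusion concerns \<open>q h\<close> and not \<open>h\<close>, since a measurable
  \<open>h\<close> may take arbitrary values on sets that the chain does not charge. The function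
  \<open>q h\<close> is again subharmonic and, by the strong Feller property, continuous.
  Subtracting a small multiple of the proper function \<open>V\<close> forces a maximum to exist,
  and letting the multiple tend to 0 shows that \<open>q h\<close> attains its supremum on a fixed
  compact set.\<close>

theorem liouville:
  assumes h [measurable]: "h \<in> borel_measurable B"
    and bdd: "\<And>x. x \<in> I \<Longrightarrow> \<bar>h x\<bar> \<le> (K::real)"
    and sub: "\<And>x. x \<in> I \<Longrightarrow> h x \<le> (\<integral>y. h y \<partial>q x)"
  obtains c where "\<And>x. x \<in> I \<Longrightarrow> (\<integral>y. h y \<partial>q x) = c"
proof -
  define k where "k x = (\<integral>y. h y \<partial>q x)" for x
  have k_cont: "continuous_on I k"
    unfolding k_def using bdd by (intro strong_feller[OF h]) auto
  have k_meas [measurable]: "k \<in> borel_measurable B"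
    using k_cont by (rule continuous_measurable)
  have k_bdd: "\<bar>k x\<bar> \<le> K" if x: "x \<in> I" for x
  proof -
    interpret prob_space "q x" using x prob_q by simp
    have "\<bar>k x\<bar> \<le> (\<integral>y. \<bar>h y\<bar> \<partial>q x)" unfolding k_def by (rule integral_abs_bound)
    also have "\<dots> \<le> (\<integral>y. K \<partial>q x)"
      using bdd integrable_bounded[OF x h bdd] by (intro integral_mono) (auto simp: space_q[OF x])
    finally show ?thesis by (simp add: prob_space)
  qed
  have int_k: "integrable (q x) k" if "x \<in> I" for x
    using integrable_bounded[OF that k_meas k_bdd] .
  have k_sub: "k x \<le> (\<integral>y. k y \<partial>q x)" if x: "x \<in> I" for x
    unfolding k_def[of x]
    by (rule integral_mono[OF integrable_bounded[OF x h bdd] int_k[OF x]])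
       (use sub in \<open>auto simp: space_q[OF x] k_def\<close>)
  \<comment> \<open>The radius exceeds \<open>R\<close> by one so that the open interval used below
    contains 0 even if \<open>R = 0\<close>, lies inside \<open>?C\<close>, and points outside
    \<open>?C\<close> still satisfy \<open>R < \<bar>y\<bar>\<close>.\<close>
  let ?C = "I \<inter> {-(R+1)..R+1}"
  have C: "compact ?C" using closed_I by (simp add: closed_Int_compact)
  have C0: "0 \<in> ?C" using zero_in_I R_nonneg by simp
  obtain z where z: "z \<in> ?C" "\<And>y. y \<in> ?C \<Longrightarrow> k y \<le> k z"
    using continuous_attains_sup[OF C _ continuous_on_subset[OF k_cont]] C0 by blast
  \<comment> \<open>Since \<open>V\<close> is proper and \<open>k\<close> is bounded,
    \<open>k - e * V\<close> has a maximum. If it were attained only outside \<open>?C\<close>, then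
    \<open>V_decreasing\<close> would apply at every maximum point, the maximum set would be
    absorbing, and by irreducibility it would have to enter \<open>?C\<close> after all.\<close>
  have k_le: "k x \<le> k z + e * V x" if x: "x \<in> I" and e: "e > 0" for x e
  proof -
    define w where "w y = k y - e * V y" for y
    have w_cont: "continuous_on I w"
      unfolding w_def by (intro continuous_intros k_cont V_cont)
    obtain r where r: "\<And>y. y \<in> I \<Longrightarrow> V y \<le> (K - w x) / e \<Longrightarrow> \<bar>y\<bar> \<le> r"
      using V_proper by blast
    let ?D = "I \<inter> {-r..r}"
    have D: "compact ?D" using closed_I by (simp add: closed_Int_compact)
    have inD: "y \<in> ?D" if "y \<in> I" "w x \<le> w y" for y
    proof -
      have "e * V y \<le> K - w x" using that k_bdd[OF that(1)] by (simp add: w_def)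
      then have "V y \<le> (K - w x) / e" using e by (simp add: field_simps)
      then show ?thesis using r[OF that(1)] that by auto
    qed
    obtain t where t: "t \<in> ?D" "\<And>y. y \<in> ?D \<Longrightarrow> w y \<le> w t"
      using continuous_attains_sup[OF D _ continuous_on_subset[OF w_cont]] inD[OF x] by blast
    have tmax: "w y \<le> w t" if "y \<in> I" for y
    proof (cases "w x \<le> w y")
      case True then show ?thesis using t inD that by blast
    next
      case False then show ?thesis using t(2)[OF inD[OF x]] by simp
    qed
    have "\<exists>y\<in>?C. w y = w t"
    proof (rule ccontr)
      assume no: "\<not> ?thesis"
      have "\<exists>y\<in>{-(R+1)<..<R+1} \<inter> I. w y = w t"
      proof (rule maximum_absorbing[OF w_cont tmax refl])
        show "t \<in> I" using t by simp
        show int: "integrable (q y) w" if "y \<in> I" for y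
          unfolding w_def using int_k[OF that] V_integrable[OF that] by simp
        fix y assume y: "y \<in> I" "w y = w t"
        then have "R < \<bar>y\<bar>" using no by force
        have "w y \<le> (\<integral>u. k u \<partial>q y) - e * (\<integral>u. V u \<partial>q y)"
          unfolding w_def using k_sub[OF y(1)] V_decreasing[OF y(1) \<open>R < \<bar>y\<bar>\<close>] e
          by (smt (verit) mult_left_mono)
        also have "\<dots> = (\<integral>u. w u \<partial>q y)"
          unfolding w_def using int_k[OF y(1)] V_integrable[OF y(1)] by simp
        finally show "w y \<le> (\<integral>u. w u \<partial>q y)" .
      qed (use zero_in_I R_nonneg in auto)
      then show False using no by auto
    qed
    then obtain y where y: "y \<in> ?C" "w y = w t" by blast
    have "w x \<le> w y" using tmax[OF x] y by simp
    also have "\<dots> \<le> k z" using z(2)[OF y(1)] mult_nonneg_nonneg[OF less_imp_le[OF e] V_nonneg[of y]] unfolding w_def by linarith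
    finally show ?thesis by (simp add: w_def)
  qed
  have k_max: "k x \<le> k z" if x: "x \<in> I" for x
  proof (rule field_le_epsilon)
    fix e :: real assume e: "e > 0"
    have "k x \<le> k z + e / (V x + 1) * V x"
      using k_le[OF x, of "e / (V x + 1)"] e V_nonneg[of x] by simp
    also have "\<dots> \<le> k z + e"
      using e V_nonneg[of x] by (simp add: field_simps)
    finally show "k x \<le> k z + e" .
  qed
  \<comment> \<open>The maximum set of \<open>k\<close> is absorbing, so it meets every nonempty
    relatively open set, in particular the set where \<open>k\<close> differs from its
    maximum.\<close>
  have "k x = k z" if x: "x \<in> I" for x
  proof (rule ccontr)
    assume ne: "k x \<noteq> k z"
    obtain A where A: "open A" "A \<inter> I = k -` (- {k z}) \<inter> I"
      using k_cont[unfolded continuous_on_open_invariant, rule_format, of "- {k z}"] by auto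
    then have "x \<in> A" using ne x by auto
    have "\<exists>y\<in>A \<inter> I. k y = k z"
      by (rule maximum_absorbing[OF k_cont k_max refl _ int_k k_sub A(1) \<open>x \<in> A\<close> x]) (use z in auto)
    then show False using A by auto
  qed
  then show thesis using that unfolding k_def by blast
qed

end

section \<open>The path space\<close>

context feller_chain
begin

abbreviation unit_interval :: "real measure" where
  "unit_interval \<equiv> restrict_space lborel {0<..<1}"

abbreviation N :: "(nat \<Rightarrow> real) measure" where
  "N \<equiv> \<Pi>\<^sub>M i\<in>UNIV. B"

lemma prob_space_unit_interval: "prob_space unit_interval"
  by (auto simp add: emeasure_restrict_space space_restrict_space intro!: prob_spaceI)

text \<open>Inverse transform sampling: the generalized inverse of the distribution function of
  \<open>q x\<close>. Joint measurability in \<open>x\<close> and \<open>u\<close> comes from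
  \<open>quantile_le_iff\<close>, which turns each sublevel set into a comparison of two measurable
  functions.\<close>

definition quantile :: "real \<Rightarrow> real \<Rightarrow> real" where
  "quantile x u = Inf {t. u \<le> measure (q x) ({..t} \<inter> I)}"

text \<open>The quantile is shown to lie in \<open>I\<close> for almost every \<open>u\<close>; the
  default value 0 keeps the next state in \<open>I\<close> for all \<open>u\<close>.\<close>

definition update :: "real \<Rightarrow> real \<Rightarrow> real" where
  "update x u = (if quantile x u \<in> I then quantile x u else 0)"

lemma sets_B_iff: "A \<in> sets B \<longleftrightarrow> A \<in> sets borel \<and> A \<subseteq> I"
  using sets_restrict_space_iff[of I borel A] by auto

lemma
  assumes x: "x \<in> I"
  shows quantile_le_iff: "u \<in> {0<..<1} \<Longrightarrow> quantile x u \<le> t \<longleftrightarrow> u \<le> measure (q x) ({..t} \<inter> I)"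
    and quantile_measurable: "quantile x \<in> unit_interval \<rightarrow>\<^sub>M borel"
    and distr_quantile: "distr unit_interval borel (quantile x) = distr (q x) borel (\<lambda>y. y)"
proof -
  interpret prob_space "q x" using x prob_q by simp
  have id: "(\<lambda>y. y) \<in> q x \<rightarrow>\<^sub>M borel"
    unfolding measurable_cong_sets[OF sets_q[OF x] refl] by (rule measurable_restrict_space1) simp
  interpret M: cdf_distribution "distr (q x) borel (\<lambda>y. y)"
    unfolding cdf_distribution_def using id by (rule real_distribution_distr)
  have cdf: "cdf (distr (q x) borel (\<lambda>y. y)) t = measure (q x) ({..t} \<inter> I)" for t
    unfolding cdf_def using id by (simp add: measure_distr space_q[OF x])
  have quant: "quantile x = M.I"
    by (simp add: quantile_def cdf fun_eq_iff)
  show "quantile x u \<le> t \<longleftrightarrow> u \<le> measure (q x) ({..t} \<inter> I)" if "u \<in> {0<..<1}"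
    using M.pseudoinverse[of u t] that unfolding quant cdf by simp
  show "quantile x \<in> unit_interval \<rightarrow>\<^sub>M borel"
    using M.measurable_CI unfolding quant by (subst measurable_cong_sets[OF sets_restrict_space_cong[OF sets_lborel] refl])
  show "distr unit_interval borel (quantile x) = distr (q x) borel (\<lambda>y. y)"
    unfolding quant by (rule M.distr_I_eq_M)
qed

lemma update_measurable [measurable]: "(\<lambda>(x, u). update x u) \<in> B \<Otimes>\<^sub>M unit_interval \<rightarrow>\<^sub>M B"
proof -
  have sp: "space (B \<Otimes>\<^sub>M unit_interval) = I \<times> {0<..<1}"
    by (simp add: space_pair_measure space_restrict_space)
  have [measurable]: "(\<lambda>p. quantile (fst p) (snd p)) \<in> borel_measurable (B \<Otimes>\<^sub>M unit_interval)"
  proof (rule borel_measurableI_le)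
    fix t
    have [measurable]: "{..t} \<inter> I \<in> sets B"
      by (simp add: sets_B_iff)
    have [measurable]: "snd \<in> borel_measurable (B \<Otimes>\<^sub>M unit_interval)"
      by (rule measurable_snd'') (auto intro: measurable_restrict_space1)
    have "{p \<in> space (B \<Otimes>\<^sub>M unit_interval). quantile (fst p) (snd p) \<le> t} =
      {p \<in> space (B \<Otimes>\<^sub>M unit_interval). snd p \<le> measure (q (fst p)) ({..t} \<inter> I)}"
      using quantile_le_iff by (auto simp: sp)
    also have "\<dots> \<in> sets (B \<Otimes>\<^sub>M unit_interval)"
      by measurable
    finally show "{p \<in> space (B \<Otimes>\<^sub>M unit_interval). quantile (fst p) (snd p) \<le> t} \<in> sets (B \<Otimes>\<^sub>M unit_interval)" .
  qed
  have [measurable]: "(\<lambda>p. update (fst p) (snd p)) \<in> borel_measurable (B \<Otimes>\<^sub>M unit_interval)"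
    unfolding update_def by measurable
  show ?thesis
    unfolding split_beta'
    by (rule measurable_restrict_space2) (auto simp: update_def zero_in_I)
qed

lemma distr_update: 
  assumes x: "x \<in> I"
  shows "distr unit_interval B (update x) = q x"
proof (rule measure_eqI)
  show "sets (distr unit_interval B (update x)) = sets (q x)"
    using sets_q[OF x] by simp
  fix A assume "A \<in> sets (distr unit_interval B (update x))"
  then have A: "A \<in> sets B" by simp
  then have Ab: "A \<in> sets borel" "A \<subseteq> I" by (auto simp: sets_B_iff)
  note [measurable] = quantile_measurable[OF x]
  have um: "update x \<in> unit_interval \<rightarrow>\<^sub>M B"
    using measurable_Pair2[OF update_measurable, of x] x by (simp add: space_B)
  have id: "(\<lambda>y. y) \<in> q x \<rightarrow>\<^sub>M borel"
    unfolding measurable_cong_sets[OF sets_q[OF x] refl] by (rule measurable_restrict_space1) simp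
  have quant: "emeasure unit_interval (quantile x -` C \<inter> space unit_interval) = emeasure (q x) (C \<inter> I)"
    if "C \<in> sets borel" for C
  proof -
    have "emeasure unit_interval (quantile x -` C \<inter> space unit_interval)
      = emeasure (distr unit_interval borel (quantile x)) C"
      using that by (intro emeasure_distr[symmetric] quantile_measurable[OF x])
    also have "\<dots> = emeasure (q x) ((\<lambda>y. y) -` C \<inter> space (q x))"
      unfolding distr_quantile[OF x] using that by (intro emeasure_distr id)
    finally show ?thesis by (simp add: space_q[OF x])
  qed
  have "emeasure unit_interval (quantile x -` (- I) \<inter> space unit_interval) = 0"
    by (subst quant) auto
  then have "AE u in unit_interval. quantile x u \<in> I"
    using measurable_sets[OF quantile_measurable[OF x], of "- I"]
    by (intro AE_I'[where N = "quantile x -` (- I) \<inter> space unit_interval"]) (auto intro!: null_setsI)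
  then have "emeasure unit_interval (update x -` A \<inter> space unit_interval)
    = emeasure unit_interval (quantile x -` A \<inter> space unit_interval)"
    using Ab(2) measurable_sets[OF um A] measurable_sets[OF quantile_measurable[OF x] Ab(1)]
    by (intro emeasure_eq_AE) (auto simp: update_def elim: AE_mp)
  also have "\<dots> = emeasure (q x) A"
    using quant[OF Ab(1)] Ab(2) by (simp add: Int_absorb2)
  finally show "emeasure (distr unit_interval B (update x)) A = emeasure (q x) A"
    using um A by (simp add: emeasure_distr)
qed

primrec walk :: "nat \<Rightarrow> real \<Rightarrow> real stream \<Rightarrow> real" where
  "walk 0 x u = x"
| "walk (Suc n) x u = walk n (update x (shd u)) (stl u)"

lemma walk_measurable [measurable]:
  "(\<lambda>(x, u). walk n x u) \<in> B \<Otimes>\<^sub>M stream_space unit_interval \<rightarrow>\<^sub>M B"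
proof (induction n)
  case 0
  show ?case by simp
next
  case (Suc n)
  have "(\<lambda>p. (\<lambda>(x, u). walk n x u) (update (fst p) (shd (snd p)), stl (snd p)))
    \<in> B \<Otimes>\<^sub>M stream_space unit_interval \<rightarrow>\<^sub>M B"
    using Suc by (rule measurable_compose_rev) measurable
  then show ?case by (simp add: split_beta')
qed

text \<open>The law of the chain started at \<open>x\<close>, as the image of i.i.d. uniform variables under an
  update function; joint measurability in the starting point is then automatic.\<close>

definition law :: "real \<Rightarrow> (nat \<Rightarrow> real) measure" where
  "law x = distr (stream_space unit_interval) N (\<lambda>u n. walk n x u)"

lemma path_measurable [measurable]:
  "(\<lambda>(x, u). \<lambda>n. walk n x u) \<in> B \<Otimes>\<^sub>M stream_space unit_interval \<rightarrow>\<^sub>M N"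
proof -
  have "(\<lambda>p n. (\<lambda>(x, u). walk n x u) p) \<in> B \<Otimes>\<^sub>M stream_space unit_interval \<rightarrow>\<^sub>M N"
    by (rule measurable_PiM_single'[OF walk_measurable]) (use measurable_space[OF walk_measurable] in auto)
  then show ?thesis by (simp add: split_beta')
qed

lemma law_measurable [measurable]: "law \<in> B \<rightarrow>\<^sub>M prob_algebra N"
proof -
  interpret prob_space "stream_space unit_interval"
    by (rule prob_space.prob_space_stream_space[OF prob_space_unit_interval])
  have "(\<lambda>_. stream_space unit_interval) \<in> B \<rightarrow>\<^sub>M prob_algebra (stream_space unit_interval)"
    by (rule measurable_const) (simp add: space_prob_algebra prob_space_axioms)
  then show ?thesis
    unfolding law_def[abs_def] by (rule measurable_distr_prob_space2) measurable
qed

lemma law_measurable' [measurable]: "law \<in> B \<rightarrow>\<^sub>M subprob_algebra N"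
  by (rule measurable_prob_algebraD[OF law_measurable])

lemma prob_law: "x \<in> I \<Longrightarrow> prob_space (law x)"
  using measurable_space[OF law_measurable, of x] by (auto simp: space_prob_algebra space_B)

lemma sets_law [simp, measurable_cong]: "sets (law x) = sets N"
  by (simp add: law_def)

lemma space_law [simp]: "space (law x) = space N"
  by (simp add: law_def)

lemma space_N: "w \<in> space N \<longleftrightarrow> (\<forall>n. w n \<in> I)"
  by (auto simp: space_PiM space_B)

text \<open>The first uniform variable of the stream decides the first move, whose law is
  \<open>q x\<close> by \<open>distr_update\<close>, and the remaining stream is an independent copy
  that drives the walk from the new position.\<close>

lemma law_step:
  assumes x: "x \<in> I" and F [measurable]: "F \<in> borel_measurable N"
  shows "(\<integral>\<^sup>+w. F w \<partial>law x) = (\<integral>\<^sup>+y. \<integral>\<^sup>+w. F (case_nat x w) \<partial>law y \<partial>q x)"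
proof -
  let ?S = "stream_space unit_interval"
  interpret U: prob_space unit_interval by (rule prob_space_unit_interval)
  interpret S: prob_space ?S by (rule U.prob_space_stream_space)
  have xB [measurable]: "x \<in> space B" using x by (simp add: space_B)
  have pm: "(\<lambda>u n. walk n y u) \<in> ?S \<rightarrow>\<^sub>M N" if "y \<in> I" for y
    using measurable_Pair2[OF path_measurable, of y] that by (simp add: space_B)
  note pmx [measurable] = pm[OF x]
  have um [measurable]: "update x \<in> unit_interval \<rightarrow>\<^sub>M B"
    using measurable_Pair2[OF update_measurable, of x] x by (simp add: space_B)
  have cn [measurable]: "(\<lambda>w. case_nat x w) \<in> N \<rightarrow>\<^sub>M N"
    by measurable
  have Fc [measurable]: "(\<lambda>w. F (case_nat x w)) \<in> borel_measurable N"
    using measurable_compose[OF cn F] .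
  have G: "(\<lambda>y. \<integral>\<^sup>+w. F (case_nat x w) \<partial>law y) \<in> borel_measurable B"
    by (rule measurable_compose[OF law_measurable' nn_integral_measurable_subprob_algebra[OF Fc]])
  have path: "(\<lambda>n. walk n x (s ## u)) = case_nat x (\<lambda>n. walk n (update x s) u)" for s u
    by (auto simp: fun_eq_iff split: nat.split)
  have "(\<integral>\<^sup>+w. F w \<partial>law x) = (\<integral>\<^sup>+u. F (\<lambda>n. walk n x u) \<partial>?S)"
    unfolding law_def by (subst nn_integral_distr) auto
  also have "\<dots> = (\<integral>\<^sup>+s. \<integral>\<^sup>+u. F (\<lambda>n. walk n x (s ## u)) \<partial>?S \<partial>unit_interval)"
    by (subst U.nn_integral_stream_space) auto
  also have "\<dots> = (\<integral>\<^sup>+s. \<integral>\<^sup>+w. F (case_nat x w) \<partial>law (update x s) \<partial>unit_interval)"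
  proof (rule nn_integral_cong)
    fix s assume "s \<in> space unit_interval"
    then have "update x s \<in> I" using measurable_space[OF um] by (simp add: space_B)
    then show "(\<integral>\<^sup>+u. F (\<lambda>n. walk n x (s ## u)) \<partial>?S) = (\<integral>\<^sup>+w. F (case_nat x w) \<partial>law (update x s))"
      unfolding path law_def by (subst nn_integral_distr) (auto intro: pm)
  qed
  also have "\<dots> = (\<integral>\<^sup>+y. \<integral>\<^sup>+w. F (case_nat x w) \<partial>law y \<partial>distr unit_interval B (update x))"
    by (rule nn_integral_distr[OF um, symmetric]) (simp add: G)
  finally show ?thesis by (simp add: distr_update[OF x])
qed

lemma AE_law_step:
  assumes x: "x \<in> I" and P [measurable]: "Measurable.pred N P"
  shows "(AE w in law x. P w) \<longleftrightarrow> (AE y in q x. AE w in law y. P (case_nat x w))"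
proof -
  have xB: "x \<in> space B" using x by (simp add: space_B)
  have cn: "(\<lambda>w. case_nat x w) \<in> N \<rightarrow>\<^sub>M N"
    using xB by measurable
  have F: "(indicator {w\<in>space N. \<not> P w} :: _ \<Rightarrow> ennreal) \<in> borel_measurable N"
    by measurable
  have Pc: "Measurable.pred N (\<lambda>w. P (case_nat x w))"
    using measurable_compose[OF cn P] .
  have Fc: "(\<lambda>w. indicator {w\<in>space N. \<not> P w} (case_nat x w) :: ennreal) \<in> borel_measurable N"
    using measurable_compose[OF cn F] .
  have G: "(\<lambda>y. \<integral>\<^sup>+w. indicator {w\<in>space N. \<not> P w} (case_nat x w) \<partial>law y) \<in> borel_measurable B"
    by (rule measurable_compose[OF law_measurable' nn_integral_measurable_subprob_algebra[OF Fc]])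
  have "(AE w in law x. P w) \<longleftrightarrow> (\<integral>\<^sup>+w. indicator {w\<in>space N. \<not> P w} w \<partial>law x) = 0"
    by (subst nn_integral_0_iff_AE) (auto intro!: AE_cong simp: indicator_def)
  also have "(\<integral>\<^sup>+w. indicator {w\<in>space N. \<not> P w} w \<partial>law x)
    = (\<integral>\<^sup>+y. \<integral>\<^sup>+w. indicator {w\<in>space N. \<not> P w} (case_nat x w) \<partial>law y \<partial>q x)"
    by (rule law_step[OF x F])
  also have "\<dots> = 0 \<longleftrightarrow> (AE y in q x. (\<integral>\<^sup>+w. indicator {w\<in>space N. \<not> P w} (case_nat x w) \<partial>law y) = 0)"
    using G by (intro nn_integral_0_iff_AE) (simp add: measurable_cong_sets[OF sets_q[OF x] refl])
  also have "\<dots> \<longleftrightarrow> (AE y in q x. AE w in law y. P (case_nat x w))"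
  proof (rule AE_cong)
    fix y
    show "(\<integral>\<^sup>+w. indicator {w\<in>space N. \<not> P w} (case_nat x w) \<partial>law y) = 0
      \<longleftrightarrow> (AE w in law y. P (case_nat x w))"
      using Fc measurable_space[OF cn]
      by (subst nn_integral_0_iff_AE) (auto intro!: AE_cong simp: indicator_def)
  qed
  finally show ?thesis .
qed

lemma component_measurable [measurable]: "(\<lambda>w. w n) \<in> N \<rightarrow>\<^sub>M B"
  by (rule measurable_component_singleton) simp

lemma component_measurable' [measurable]: "(\<lambda>w. w n) \<in> borel_measurable N"
  using component_measurable[of n] measurable_restrict_space2_iff by blast

lemma law_start:
  assumes x: "x \<in> I"
  shows "AE w in law x. w 0 = x"
  by (subst AE_law_step[OF x]) simp_all

lemma case_nat_in_N: "x \<in> I \<Longrightarrow> w \<in> space N \<Longrightarrow> case_nat x w \<in> space N"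
  by (auto simp: space_N split: nat.split)

lemma emeasure_law_space: "x \<in> I \<Longrightarrow> emeasure (law x) (space N) = 1"
  using prob_space.emeasure_space_1[OF prob_law] by simp

lemma nn_integral_q_eq:
  assumes "x \<in> I" "f \<in> borel_measurable B" "\<And>y. y \<in> I \<Longrightarrow> 0 \<le> f y" "\<And>y. y \<in> I \<Longrightarrow> f y \<le> (c::real)"
  shows "(\<integral>\<^sup>+y. ennreal (f y) \<partial>q x) = ennreal (\<integral>y. f y \<partial>q x)"
proof (rule nn_integral_eq_integral)
  show "integrable (q x) f"
    by (rule integrable_bounded[where c = c]) (use assms in auto)
  show "AE y in q x. 0 \<le> f y"
    using assms by (intro AE_I2) (simp add: space_q)
qed

text \<open>The one-step equation for events, the only form of the Markov property that is used.\<close>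

lemma law_event_step:
  assumes x: "x \<in> I" and E: "E \<in> sets N" and E': "E' \<in> sets N"
    and EE': "\<And>w. w \<in> space N \<Longrightarrow> case_nat x w \<in> E \<longleftrightarrow> w \<in> E'"
  shows "measure (law x) E = (\<integral>y. measure (law y) E' \<partial>q x)"
proof -
  have meas: "(\<lambda>y. measure (law y) E') \<in> borel_measurable B"
    by (rule measurable_compose[OF law_measurable' measurable_measure_subprob_algebra[OF E']])
  have em: "emeasure (law y) G = ennreal (measure (law y) G)" if "y \<in> I" for y G
    using prob_law[OF that] by (simp add: finite_measure.emeasure_eq_measure prob_space.finite_measure)
  have "ennreal (measure (law x) E) = (\<integral>\<^sup>+w. indicator E w \<partial>law x)"
    using E em[OF x] by simp
  also have "\<dots> = (\<integral>\<^sup>+y. \<integral>\<^sup>+w. indicator E (case_nat x w) \<partial>law y \<partial>q x)"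
    using E by (intro law_step[OF x]) simp
  also have "\<dots> = (\<integral>\<^sup>+y. \<integral>\<^sup>+w. indicator E' w \<partial>law y \<partial>q x)"
    using EE' by (intro nn_integral_cong) (simp add: indicator_def)
  also have "\<dots> = (\<integral>\<^sup>+y. ennreal (measure (law y) E') \<partial>q x)"
    using E' em by (intro nn_integral_cong) (simp add: space_q[OF x])
  also have "\<dots> = ennreal (\<integral>y. measure (law y) E' \<partial>q x)"
    using prob_law prob_space.prob_le_1 by (intro nn_integral_q_eq[OF x meas, where c = 1]) auto
  finally show ?thesis by (simp add: integral_nonneg_AE)
qed

text \<open>Each induction step removes the initial position with \<open>law_step\<close> and
  applies the hypothesis to the shifted path. Testing against products of indicators is exactly what
  the characterization of path measures below asks for.\<close>

lemma markov_property_law: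
  assumes x: "x \<in> I" and A: "\<And>i. A i \<in> sets B" and C: "C \<in> sets B"
  shows "(\<integral>\<^sup>+w. (\<Prod>i\<le>n. indicator (A i) (w i)) * indicator C (w (Suc n)) \<partial>law x)
    = (\<integral>\<^sup>+w. (\<Prod>i\<le>n. indicator (A i) (w i)) * emeasure (q (w n)) C \<partial>law x)"
  using x A
proof (induction n arbitrary: x A)
  case (0 x A)
  note [measurable] = 0(2) C
  have [measurable]: "(\<lambda>y. emeasure (q y) C) \<in> borel_measurable B"
    by (rule measurable_compose[OF q_measurable' measurable_emeasure_subprob_algebra[OF C]])
  have "(\<integral>\<^sup>+w. (\<Prod>i\<le>0. indicator (A i) (w i)) * indicator C (w (Suc 0)) \<partial>law x)
    = (\<integral>\<^sup>+y. \<integral>\<^sup>+w. indicator (A 0) x * indicator C (w 0) \<partial>law y \<partial>q x)"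
    by (subst law_step[OF 0(1)]) simp_all
  also have "\<dots> = (\<integral>\<^sup>+y. indicator (A 0) x * indicator C y \<partial>q x)"
  proof (rule nn_integral_cong)
    fix y assume "y \<in> space (q x)"
    then have y: "y \<in> I" using space_q[OF 0(1)] by simp
    have "(\<integral>\<^sup>+w. indicator (A 0) x * indicator C (w 0) \<partial>law y) = (\<integral>\<^sup>+w. indicator (A 0) x * indicator C y \<partial>law y)"
      using law_start[OF y] by (intro nn_integral_cong_AE) auto
    then show "(\<integral>\<^sup>+w. indicator (A 0) x * indicator C (w 0) \<partial>law y) = indicator (A 0) x * indicator C y"
      by (simp add: emeasure_law_space[OF y])
  qed
  also have "\<dots> = indicator (A 0) x * emeasure (q x) C"
    using C by (simp add: nn_integral_cmult_indicator sets_q[OF 0(1)])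
  also have "\<dots> = (\<integral>\<^sup>+w. indicator (A 0) x * emeasure (q x) C \<partial>law x)"
    by (simp add: emeasure_law_space[OF 0(1)])
  also have "\<dots> = (\<integral>\<^sup>+w. (\<Prod>i\<le>0. indicator (A i) (w i)) * emeasure (q (w 0)) C \<partial>law x)"
    using law_start[OF 0(1)] by (intro nn_integral_cong_AE) auto
  finally show ?case .
next
  case (Suc n x A)
  note [measurable] = Suc.prems(2) C
  have [measurable]: "(\<lambda>y. emeasure (q y) C) \<in> borel_measurable B"
    by (rule measurable_compose[OF q_measurable' measurable_emeasure_subprob_algebra[OF C]])
  let ?P = "\<lambda>w. (\<Prod>i\<le>n. indicator (A (Suc i)) (w i)) :: ennreal"
  have "(\<integral>\<^sup>+w. (\<Prod>i\<le>Suc n. indicator (A i) (w i)) * indicator C (w (Suc (Suc n))) \<partial>law x)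
    = (\<integral>\<^sup>+y. \<integral>\<^sup>+w. indicator (A 0) x * (?P w * indicator C (w (Suc n))) \<partial>law y \<partial>q x)"
    by (subst law_step[OF Suc.prems(1)]) (simp_all add: prod.atMost_Suc_shift mult.assoc del: prod.atMost_Suc)
  also have "\<dots> = (\<integral>\<^sup>+y. \<integral>\<^sup>+w. indicator (A 0) x * (?P w * emeasure (q (w n)) C) \<partial>law y \<partial>q x)"
  proof (rule nn_integral_cong)
    fix y assume "y \<in> space (q x)"
    then have y: "y \<in> I" using space_q[OF Suc.prems(1)] by simp
    show "(\<integral>\<^sup>+w. indicator (A 0) x * (?P w * indicator C (w (Suc n))) \<partial>law y)
      = (\<integral>\<^sup>+w. indicator (A 0) x * (?P w * emeasure (q (w n)) C) \<partial>law y)"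
      using Suc.IH[OF y, of "\<lambda>i. A (Suc i)"] by (simp add: nn_integral_cmult)
  qed
  also have "\<dots> = (\<integral>\<^sup>+w. (\<Prod>i\<le>Suc n. indicator (A i) (w i)) * emeasure (q (w (Suc n))) C \<partial>law x)"
    by (subst law_step[OF Suc.prems(1)]) (simp_all add: prod.atMost_Suc_shift mult.assoc del: prod.atMost_Suc)
  finally show ?case .
qed

text \<open>Cylinder probabilities are determined recursively by the initial law and the
  transitions, and cylinders generate the product sigma-algebra.\<close>

lemma markov_measure_unique:
  assumes sets: "sets M = sets N" "sets M' = sets N" and fin: "prob_space M" "prob_space M'"
    and start: "\<And>C. C \<in> sets B \<Longrightarrow> (\<integral>\<^sup>+w. indicator C (w 0) \<partial>M) = (\<integral>\<^sup>+w. indicator C (w 0) \<partial>M')"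
    and markov: "\<And>n A C. (\<And>i. A i \<in> sets B) \<Longrightarrow> C \<in> sets B \<Longrightarrow>
      (\<integral>\<^sup>+w. (\<Prod>i\<le>n. indicator (A i) (w i)) * indicator C (w (Suc n)) \<partial>M)
        = (\<integral>\<^sup>+w. (\<Prod>i\<le>n. indicator (A i) (w i)) * emeasure (q (w n)) C \<partial>M)"
    and markov': "\<And>n A C. (\<And>i. A i \<in> sets B) \<Longrightarrow> C \<in> sets B \<Longrightarrow>
      (\<integral>\<^sup>+w. (\<Prod>i\<le>n. indicator (A i) (w i)) * indicator C (w (Suc n)) \<partial>M')
        = (\<integral>\<^sup>+w. (\<Prod>i\<le>n. indicator (A i) (w i)) * emeasure (q (w n)) C \<partial>M')"
  shows "M = M'"
proof -
  \<comment> \<open>\<open>?D M n A\<close> is the law of the coordinate \<open>n\<close> restricted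
    to the event that the earlier coordinates lie in \<open>A 0, ..., A (n - 1)\<close>. The Markov
    identity expresses \<open>?D M (Suc n) A\<close> through \<open>?D M n A\<close>.\<close>
  let ?D = "\<lambda>M n A. distr (density M (\<lambda>w. \<Prod>i<n. indicator (A i) (w i))) B (\<lambda>w. w n)"
  have nn_D: "(\<integral>\<^sup>+y. f y \<partial>?D M n A) = (\<integral>\<^sup>+w. (\<Prod>i<n. indicator (A i) (w i)) * f (w n) \<partial>M)"
    if A: "\<And>i. A i \<in> sets B" and f: "f \<in> borel_measurable B" and M: "sets M = sets N" for M n A f
  proof -
    note [measurable] = A f and [measurable_cong] = M
    show ?thesis
      by (subst nn_integral_distr) (simp_all add: nn_integral_density measurable_compose[OF component_measurable f])
  qed
  have em_D: "emeasure (?D M n A) C = (\<integral>\<^sup>+w. (\<Prod>i<n. indicator (A i) (w i)) * indicator C (w n) \<partial>M)"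
    if A: "\<And>i. A i \<in> sets B" and C: "C \<in> sets B" and M: "sets M = sets N" for M n A C
  proof -
    have "(\<integral>\<^sup>+y. indicator C y \<partial>?D M n A) = (\<integral>\<^sup>+w. (\<Prod>i<n. indicator (A i) (w i)) * indicator C (w n) \<partial>M)"
      by (rule nn_D[OF A borel_measurable_indicator[OF C] M])
    then show ?thesis using C by simp
  qed
  have D_eq: "?D M n A = ?D M' n A" if A: "\<And>i. A i \<in> sets B" for n A
    using A
  proof (induction n arbitrary: A)
    case (0 A)
    show ?case
    proof (rule measure_eqI)
      fix C assume "C \<in> sets (?D M 0 A)"
      then have C: "C \<in> sets B" by simp
      show "emeasure (?D M 0 A) C = emeasure (?D M' 0 A) C"
        unfolding em_D[OF 0 C sets(1)] em_D[OF 0 C sets(2)] using start[OF C] by simp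
    qed simp
  next
    case (Suc n A)
    note A = Suc.prems
    show ?case
    proof (rule measure_eqI)
      fix C assume "C \<in> sets (?D M (Suc n) A)"
      then have C: "C \<in> sets B" by simp
      let ?f = "\<lambda>y. indicator (A n) y * emeasure (q y) C"
      have f: "?f \<in> borel_measurable B"
        using A measurable_compose[OF q_measurable' measurable_emeasure_subprob_algebra[OF C]] by simp
      have step: "(\<integral>\<^sup>+w. (\<Prod>i\<le>n. indicator (A i) (w i)) * emeasure (q (w n)) C \<partial>M)
        = (\<integral>\<^sup>+y. ?f y \<partial>?D M n A)" if "sets M = sets N" for M
        by (subst nn_D[OF A f that]) (simp add: lessThan_Suc_atMost[symmetric] mult.assoc)
      show "emeasure (?D M (Suc n) A) C = emeasure (?D M' (Suc n) A) C"
        unfolding em_D[OF A C sets(1)] em_D[OF A C sets(2)]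
        unfolding lessThan_Suc_atMost markov[OF A C] markov'[OF A C]
        unfolding step[OF sets(1)] step[OF sets(2)] Suc.IH[OF A] ..
    qed simp
  qed
  show ?thesis
  proof (rule measure_eqI_PiM_infinite[OF sets])
    show "finite_measure M" using fin by (simp add: prob_space.finite_measure)
    fix A :: "nat \<Rightarrow> real set" and J :: "nat set"
    assume J: "finite J" and A: "\<And>i. i \<in> J \<Longrightarrow> A i \<in> sets B"
    \<comment> \<open>Coordinates outside \<open>J\<close> are left unconstrained, so that the
      cylinder over \<open>J\<close> becomes a product over an initial segment of the time
      axis.\<close>
    define A' where "A' i = (if i \<in> J then A i else space B)" for i
    have A': "A' i \<in> sets B" for i using A by (auto simp: A'_def sets_B_iff)
    define n where "n = Suc (Max (insert 0 J))"
    have n: "i < n" if "i \<in> J" for i using J that by (simp add: n_def less_Suc_eq_le)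
    have "emeasure M (prod_emb UNIV (\<lambda>_. B) J (Pi\<^sub>E J A)) = emeasure (?D M n A') (space B)"
      if M: "sets M = sets N" for M
    proof -
      have "emeasure M (prod_emb UNIV (\<lambda>_. B) J (Pi\<^sub>E J A))
        = (\<integral>\<^sup>+w. indicator (prod_emb UNIV (\<lambda>_. B) J (Pi\<^sub>E J A)) w \<partial>M)"
        using J A M by (subst nn_integral_indicator) (auto intro!: sets_PiM_I)
      also have "\<dots> = (\<integral>\<^sup>+w. (\<Prod>i<n. indicator (A' i) (w i)) * indicator (space B) (w n) \<partial>M)"
      proof (rule nn_integral_cong)
        fix w assume "w \<in> space M"
        then have w: "w i \<in> I" for i using sets_eq_imp_space_eq[OF M] space_N by auto
        have "w \<in> prod_emb UNIV (\<lambda>_. B) J (Pi\<^sub>E J A) \<longleftrightarrow> (\<forall>i\<in>J. w i \<in> A i)"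
          using w by (auto simp: prod_emb_def space_B PiE_iff)
        also have "\<dots> \<longleftrightarrow> (\<forall>i<n. w i \<in> A' i)"
          using n w by (auto simp: A'_def space_B)
        finally show "indicator (prod_emb UNIV (\<lambda>_. B) J (Pi\<^sub>E J A)) w
          = ((\<Prod>i<n. indicator (A' i) (w i)) * indicator (space B) (w n) :: ennreal)"
          using w by (auto simp: indicator_def space_B intro!: prod.neutral[symmetric])
      qed
      finally show ?thesis unfolding em_D[OF A' sets.top M] .
    qed
    then show "emeasure M (prod_emb UNIV (\<lambda>_. B) J (Pi\<^sub>E J A)) = emeasure M' (prod_emb UNIV (\<lambda>_. B) J (Pi\<^sub>E J A))"
      using sets D_eq[OF A'] by simp
  qed
qed

end

section \<open>Invariant events and recurrence\<close>

context lyapunov_chain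
begin

text \<open>By the one-step equation the probability of a shift-invariant event is a bounded
  function of the starting point that equals its own image under \<open>q\<close>; hence the
  constancy of \<open>q h\<close> is here constancy of \<open>h\<close> itself.\<close>

lemma invariant_event_constant:
  assumes E: "E \<in> sets N" and inv: "\<And>x w. x \<in> I \<Longrightarrow> w \<in> space N \<Longrightarrow> case_nat x w \<in> E \<longleftrightarrow> w \<in> E"
  obtains c where "\<And>x. x \<in> I \<Longrightarrow> measure (law x) E = c"
proof -
  have meas: "(\<lambda>y. measure (law y) E) \<in> borel_measurable B"
    by (rule measurable_compose[OF law_measurable' measurable_measure_subprob_algebra[OF E]])
  have step: "measure (law x) E = (\<integral>y. measure (law y) E \<partial>q x)" if "x \<in> I" for x
    using law_event_step[OF that E E] inv that by simp
  obtain c where "\<And>x. x \<in> I \<Longrightarrow> (\<integral>y. measure (law y) E \<partial>q x) = c"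
  proof (rule liouville[OF meas])
    show "\<bar>measure (law x) E\<bar> \<le> 1" if "x \<in> I" for x
      using prob_space.prob_le_1[OF prob_law[OF that]] by simp
    show "measure (law x) E \<le> (\<integral>y. measure (law y) E \<partial>q x)" if "x \<in> I" for x
      using step[OF that] by simp
  qed (rule that)
  then show thesis using that step by metis
qed

text \<open>The probability \<open>u\<close> of avoiding \<open>A\<close> forever vanishes on
  \<open>A\<close> and is harmonic elsewhere, hence subharmonic, so \<open>q u\<close> is a constant
  \<open>c\<close> and \<open>u = c\<close> off \<open>A\<close>. Integrating against
  \<open>q x0\<close> gives \<open>c = c * (1 - measure (q x0) A)\<close>, which forces
  \<open>c = 0\<close>. Restarting at time \<open>m\<close> gives visits after every time
  \<open>m\<close>. Positivity is expressed through the kernel, so the lemma makes sense before any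
  invariant measure is available.\<close>

lemma hits_infinitely_often:
  assumes A: "A \<in> sets B" and x0: "x0 \<in> I" "emeasure (q x0) A > 0" and x: "x \<in> I"
  shows "AE w in law x. \<forall>m. \<exists>n\<ge>m. w n \<in> A"
proof -
  note [measurable] = A
  define H where "H m = {w \<in> space N. \<forall>n\<ge>m. w n \<notin> A}" for m
  have H: "H m \<in> sets N" for m
    unfolding H_def by measurable
  define u where "u y = measure (law y) (H 0)" for y
  have u_meas [measurable]: "u \<in> borel_measurable B"
    unfolding u_def by (rule measurable_compose[OF law_measurable' measurable_measure_subprob_algebra[OF H]])
  have u_bdd: "0 \<le> u y \<and> u y \<le> 1" if "y \<in> I" for y
    using prob_law[OF that] prob_space.prob_le_1 by (auto simp: u_def)
  have u_out: "u y = (\<integral>z. u z \<partial>q y)" if "y \<in> I" "y \<notin> A" for y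
    unfolding u_def using that case_nat_in_N[OF that(1)]
    by (intro law_event_step H) (auto simp: H_def split: nat.splits)
  have u_in: "u y = 0" if "y \<in> I" "y \<in> A" for y
  proof -
    have "u y = (\<integral>z. measure (law z) {} \<partial>q y)"
      unfolding u_def using that by (intro law_event_step H) (auto simp: H_def split: nat.splits)
    then show ?thesis by simp
  qed
  have u_sub: "u y \<le> (\<integral>z. u z \<partial>q y)" if "y \<in> I" for y
  proof (cases "y \<in> A")
    case True
    then show ?thesis using u_in that u_bdd space_q by (auto intro!: integral_nonneg_AE AE_I2)
  qed (use u_out that in auto)
  obtain c where c: "\<And>y. y \<in> I \<Longrightarrow> (\<integral>z. u z \<partial>q y) = c"
    by (rule liouville[OF u_meas _ u_sub, where K = 1]) (use u_bdd in fastforce)+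
  interpret X: prob_space "q x0" using prob_q[OF x0(1)] .
  have "c = (\<integral>z. u z \<partial>q x0)" using c x0 by simp
  also have "\<dots> = (\<integral>z. c - c * indicator A z \<partial>q x0)"
    using u_in u_out c space_q[OF x0(1)]
    by (intro Bochner_Integration.integral_cong refl) (auto simp: indicator_def)
  also have "\<dots> = c - c * measure (q x0) A"
    using A sets_q[OF x0(1)] by (simp add: X.prob_space X.emeasure_eq_measure)
  finally have "c * measure (q x0) A = 0" by simp
  then have "c = 0" using x0(2) by (simp add: X.emeasure_eq_measure)
  have null: "measure (law y) (H m) = 0" if "y \<in> I" for y m
    using that
  proof (induction m arbitrary: y)
    case 0
    then show ?case using u_in u_out c \<open>c = 0\<close> unfolding u_def by metis
  next
    case (Suc m)
    have "measure (law y) (H (Suc m)) = (\<integral>z. measure (law z) (H m) \<partial>q y)"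
    proof (intro law_event_step H Suc.prems)
      fix w assume w: "w \<in> space N"
      have "(\<forall>n\<ge>Suc m. case_nat y w n \<notin> A) \<longleftrightarrow> (\<forall>n\<ge>m. w n \<notin> A)"
        by (metis Suc_le_D Suc_le_mono old.nat.simps(5))
      then show "case_nat y w \<in> H (Suc m) \<longleftrightarrow> w \<in> H m"
        using w case_nat_in_N[OF Suc.prems w] by (simp add: H_def)
    qed
    also have "\<dots> = (\<integral>z. 0 \<partial>q y)"
      using Suc.IH space_q[OF Suc.prems] by (intro Bochner_Integration.integral_cong) auto
    finally show ?case by simp
  qed
  interpret L: prob_space "law x" using prob_law[OF x] .
  have "AE w in law x. w \<notin> H m" for m
    using null[OF x] H by (intro AE_not_in) (simp add: L.emeasure_eq_measure null_setsI)
  then have "AE w in law x. \<forall>m. w \<notin> H m" by (simp add: AE_all_countable)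
  then show ?thesis
    by (rule AE_mp) (auto intro!: AE_I2 simp: H_def)
qed

end

section \<open>The ratio limit theorem\<close>

text \<open>This is the maximum of 0 and the first \<open>n\<close> partial sums. The recursion
  peels off the first coordinate because the maximal inequality compares a path with its
  shift.\<close>

fun max_partial_sum :: "(real \<Rightarrow> real) \<Rightarrow> nat \<Rightarrow> (nat \<Rightarrow> real) \<Rightarrow> real" where
  "max_partial_sum \<phi> 0 w = 0"
| "max_partial_sum \<phi> (Suc n) w = max 0 (\<phi> (w 0) + max_partial_sum \<phi> n (\<lambda>k. w (Suc k)))"

lemma max_partial_sum_nonneg: "0 \<le> max_partial_sum \<phi> n w"
  by (cases n) auto

lemma max_partial_sum_mono: "max_partial_sum \<phi> n w \<le> max_partial_sum \<phi> (Suc n) w"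
proof (induction n arbitrary: w)
  case (Suc n)
  show ?case using Suc[of "\<lambda>k. w (Suc k)"] by auto
qed simp

lemma partial_sum_le_max: "(\<Sum>k<n. \<phi> (w k)) \<le> max_partial_sum \<phi> n w"
proof (induction n arbitrary: w)
  case (Suc n)
  show ?case using Suc[of "\<lambda>k. w (Suc k)"] by (simp add: sum.lessThan_Suc_shift del: sum.lessThan_Suc)
qed simp

text \<open>Where the maximum is positive, the summand 0 is not the one attaining it. The negative
  part of \<open>\<phi>\<close> stands on the left and the positive part on the right, so that the
  inequality can be integrated in \<open>ennreal\<close> without any subtraction.\<close>

lemma max_partial_sum_step:
  assumes "0 < max_partial_sum \<phi> (Suc n) w"
  shows "ennreal (max_partial_sum \<phi> (Suc n) w) + ennreal (- \<phi> (w 0))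
    \<le> ennreal (\<phi> (w 0)) + ennreal (max_partial_sum \<phi> (Suc n) (\<lambda>k. w (Suc k)))"
proof -
  let ?M = "max_partial_sum \<phi> n (\<lambda>k. w (Suc k))"
  have eq: "max_partial_sum \<phi> (Suc n) w = \<phi> (w 0) + ?M"
    using assms by (simp split: if_splits add: max_def)
  have M: "0 \<le> ?M" by (rule max_partial_sum_nonneg)
  have "ennreal (\<phi> (w 0) + ?M) + ennreal (- \<phi> (w 0)) = ennreal (\<phi> (w 0)) + ennreal ?M"
  proof (cases "\<phi> (w 0) \<ge> 0")
    case True
    then show ?thesis using M by (simp add: ennreal_neg)
  next
    case False
    then show ?thesis using assms unfolding eq
      by (subst ennreal_plus[symmetric]) (auto simp: ennreal_neg)
  qed
  also have "\<dots> \<le> ennreal (\<phi> (w 0)) + ennreal (max_partial_sum \<phi> (Suc n) (\<lambda>k. w (Suc k)))"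
    by (intro add_left_mono ennreal_leI max_partial_sum_mono)
  finally show ?thesis by (simp add: eq del: max_partial_sum.simps)
qed

lemma recurrent_sum_unbounded:
  fixes h :: "nat \<Rightarrow> real"
  assumes h: "\<And>n. 0 \<le> h n" and \<delta>: "\<delta> > 0" and io: "\<And>m. \<exists>n\<ge>m. \<delta> \<le> h n"
  shows "\<exists>n. K < (\<Sum>k<n. h k)"
proof -
  have "\<exists>n. real j * \<delta> \<le> (\<Sum>k<n. h k)" for j
  proof (induction j)
    case (Suc j)
    then obtain n where n: "real j * \<delta> \<le> (\<Sum>k<n. h k)" by blast
    obtain m where m: "m \<ge> n" "\<delta> \<le> h m" using io by blast
    have "(\<Sum>k<n. h k) \<le> (\<Sum>k<m. h k)" using m h by (intro sum_mono2) auto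
    then have "real (Suc j) * \<delta> \<le> (\<Sum>k<Suc m. h k)" using n m by (simp add: algebra_simps)
    then show ?case by blast
  qed (auto intro: exI[of _ 0])
  moreover obtain j where "K < real j * \<delta>" using \<delta> reals_Archimedean3 by blast
  ultimately show ?thesis by (meson less_le_trans)
qed

lemma AE_False_emeasure: "AE x in M. False \<Longrightarrow> emeasure M (space M) = 0"
  using AE_iff_measurable[OF sets.top, of M "\<lambda>_. False"] by simp

text \<open>One-sided bounds for the slopes \<open>L + 1 / (j + 1)\<close> and
  \<open>L - 1 / (j + 1)\<close> suffice, whatever the size of the bounds, since they disappear
  after division by a divergent sum. Only countably many slopes occur, so that the exceptional null
  sets of the application can be united.\<close>

lemma ratio_tendsto:
  fixes f h :: "nat \<Rightarrow> real"
  assumes h: "\<And>n. 0 \<le> h n" and div: "\<And>K. \<exists>n. K < (\<Sum>k<n. h k)"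
    and up: "\<And>j::nat. \<exists>K. \<forall>n. (\<Sum>k<n. f k - (L + 1 / real (Suc j)) * h k) \<le> K"
    and lo: "\<And>j::nat. \<exists>K. \<forall>n. (\<Sum>k<n. (L - 1 / real (Suc j)) * h k - f k) \<le> K"
  shows "(\<lambda>n. (\<Sum>k<n. f k) / (\<Sum>k<n. h k)) \<longlonglongrightarrow> L"
proof (rule LIMSEQ_I)
  fix e :: real assume e: "e > 0"
  let ?F = "\<lambda>n. \<Sum>k<n. f k" and ?H = "\<lambda>n. \<Sum>k<n. h k"
  obtain j where j: "1 / real (Suc j) < e / 2"
    using e nat_approx_posE[of "e / 2"] by auto
  obtain K1 where K1: "\<And>n. ?F n - (L + 1 / real (Suc j)) * ?H n \<le> K1"
    using up[of j] by (auto simp: sum_subtractf sum_distrib_left)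
  obtain K2 where K2: "\<And>n. (L - 1 / real (Suc j)) * ?H n - ?F n \<le> K2"
    using lo[of j] by (auto simp: sum_subtractf sum_distrib_left)
  \<comment> \<open>Beyond \<open>n0\<close> the additive bound \<open>K\<close> costs less than
    \<open>e / 2 * ?H n\<close>, and the error in the slope at most the same amount.\<close>
  define K where "K = max 1 (max K1 K2)"
  obtain n0 where n0: "2 * K / e < ?H n0" using div by blast
  have "norm (?F n / ?H n - L) < e" if "n \<ge> n0" for n
  proof -
    have "?H n0 \<le> ?H n" using that h by (intro sum_mono2) auto
    then have big: "2 * K / e < ?H n" using n0 by simp
    have K: "K \<ge> 1" "K1 \<le> K" "K2 \<le> K" by (auto simp: K_def)
    have "2 * K / e > 0" using K e by simp
    with big have pos: "?H n > 0" by linarith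
    have KH: "K < e / 2 * ?H n" using big e by (simp add: field_simps)
    have eH: "1 / real (Suc j) * ?H n \<le> e / 2 * ?H n" using j pos by (intro mult_right_mono) auto
    have "?F n - L * ?H n < e * ?H n" "L * ?H n - ?F n < e * ?H n"
      using K1[of n] K2[of n] K KH eH by (auto simp: algebra_simps)
    then have "\<bar>?F n - L * ?H n\<bar> < e * ?H n" by linarith
    then have "\<bar>?F n - L * ?H n\<bar> / ?H n < e" using pos by (simp add: field_simps)
    moreover have "?F n / ?H n - L = (?F n - L * ?H n) / ?H n" using pos by (simp add: field_simps)
    ultimately show ?thesis using pos by (simp add: abs_divide)
  qed
  then show "\<exists>no. \<forall>n\<ge>no. norm (?F n / ?H n - L) < e" by blast
qed

text \<open>Extends an identity from sets to nonnegative functions by the usual induction. It serves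
  three purposes: invariance under \<open>q\<close>, sums of two measures (a weighted two-point base
  space) and countable sums of measures (counting measure on the naturals).\<close>

lemma nn_integral_kernel_eq:
  assumes k: "k \<in> L \<rightarrow>\<^sub>M subprob_algebra C" and M: "sets M = sets L" and M': "sets M' = sets C"
    and eq: "\<And>A. A \<in> sets C \<Longrightarrow> (\<integral>\<^sup>+x. emeasure (k x) A \<partial>M) = emeasure M' A"
    and f: "f \<in> borel_measurable C"
  shows "(\<integral>\<^sup>+x. \<integral>\<^sup>+y. f y \<partial>k x \<partial>M) = (\<integral>\<^sup>+y. f y \<partial>M')"
  using f
proof induction
  have sets_k: "sets (k x) = sets C" if "x \<in> space M" for x
    using measurable_space[OF k] that sets_eq_imp_space_eq[OF M] by (simp add: space_subprob_algebra)
  have space_k: "space (k x) = space C" if "x \<in> space M" for x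
    using sets_eq_imp_space_eq[OF sets_k[OF that]] .
  have mk: "f \<in> borel_measurable (k x)" if "x \<in> space M" "f \<in> borel_measurable C" for f :: "_ \<Rightarrow> ennreal" and x
    using that(2) unfolding measurable_cong_sets[OF sets_k[OF that(1)] refl] .
  have mM: "(\<lambda>x. \<integral>\<^sup>+y. f y \<partial>k x) \<in> borel_measurable M" if "f \<in> borel_measurable C" for f
    unfolding measurable_cong_sets[OF M refl]
    by (rule measurable_compose[OF k nn_integral_measurable_subprob_algebra[OF that]])
  have mM': "f \<in> borel_measurable M'" if "f \<in> borel_measurable C" for f :: "_ \<Rightarrow> ennreal"
    using that unfolding measurable_cong_sets[OF M' refl] .
  {
    case (cong f g)
    have "(\<integral>\<^sup>+x. \<integral>\<^sup>+y. f y \<partial>k x \<partial>M) = (\<integral>\<^sup>+x. \<integral>\<^sup>+y. g y \<partial>k x \<partial>M)"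
      by (intro nn_integral_cong cong(3)) (simp only: space_k)
    also have "\<dots> = (\<integral>\<^sup>+y. g y \<partial>M')" by (rule cong(4))
    also have "\<dots> = (\<integral>\<^sup>+y. f y \<partial>M')"
      using sets_eq_imp_space_eq[OF M'] by (intro nn_integral_cong cong(3)[symmetric]) (simp only:)
    finally show ?case .
  next
    case (set A)
    have "(\<integral>\<^sup>+x. \<integral>\<^sup>+y. indicator A y \<partial>k x \<partial>M) = (\<integral>\<^sup>+x. emeasure (k x) A \<partial>M)"
      using set by (intro nn_integral_cong nn_integral_indicator) (simp only: sets_k)
    also have "\<dots> = emeasure M' A" by (rule eq[OF set])
    also have "\<dots> = (\<integral>\<^sup>+y. indicator A y \<partial>M')"
      using set M' by (intro nn_integral_indicator[symmetric]) (simp only:)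
    finally show ?case .
  next
    case (mult u c)
    have "(\<integral>\<^sup>+x. \<integral>\<^sup>+y. c * u y \<partial>k x \<partial>M) = (\<integral>\<^sup>+x. c * \<integral>\<^sup>+y. u y \<partial>k x \<partial>M)"
      by (intro nn_integral_cong nn_integral_cmult mk mult(2))
    also have "\<dots> = c * (\<integral>\<^sup>+x. \<integral>\<^sup>+y. u y \<partial>k x \<partial>M)" by (intro nn_integral_cmult mM mult(2))
    also have "\<dots> = (\<integral>\<^sup>+y. c * u y \<partial>M')"
      unfolding mult(4) by (intro nn_integral_cmult[symmetric] mM' mult(2))
    finally show ?case .
  next
    case (add u v)
    have "(\<integral>\<^sup>+x. \<integral>\<^sup>+y. v y + u y \<partial>k x \<partial>M) = (\<integral>\<^sup>+x. (\<integral>\<^sup>+y. v y \<partial>k x) + (\<integral>\<^sup>+y. u y \<partial>k x) \<partial>M)"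
      by (intro nn_integral_cong nn_integral_add mk add)
    also have "\<dots> = (\<integral>\<^sup>+x. \<integral>\<^sup>+y. v y \<partial>k x \<partial>M) + (\<integral>\<^sup>+x. \<integral>\<^sup>+y. u y \<partial>k x \<partial>M)"
      by (intro nn_integral_add mM add)
    also have "\<dots> = (\<integral>\<^sup>+y. v y \<partial>M') + (\<integral>\<^sup>+y. u y \<partial>M')" by (simp only: add.IH)
    also have "\<dots> = (\<integral>\<^sup>+y. v y + u y \<partial>M')" by (intro nn_integral_add[symmetric] mM' add)
    finally show ?case .
  next
    case (seq U)
    have "(\<integral>\<^sup>+x. \<integral>\<^sup>+y. (SUP i. U i) y \<partial>k x \<partial>M) = (\<integral>\<^sup>+x. (SUP i. \<integral>\<^sup>+y. U i y \<partial>k x) \<partial>M)"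
      unfolding SUP_apply by (intro nn_integral_cong nn_integral_monotone_convergence_SUP mk seq)
    also have "\<dots> = (SUP i. \<integral>\<^sup>+x. \<integral>\<^sup>+y. U i y \<partial>k x \<partial>M)"
    proof (intro nn_integral_monotone_convergence_SUP mM seq)
      show "incseq (\<lambda>i x. \<integral>\<^sup>+y. U i y \<partial>k x)"
        using \<open>incseq U\<close> unfolding incseq_def le_fun_def by (blast intro: nn_integral_mono)
    qed
    also have "\<dots> = (SUP i. \<integral>\<^sup>+y. U i y \<partial>M')" by (simp only: seq.IH)
    also have "\<dots> = (\<integral>\<^sup>+y. (SUP i. U i) y \<partial>M')"
      unfolding SUP_apply by (intro nn_integral_monotone_convergence_SUP[symmetric] mM' seq)
    finally show ?case .
  }
qed

context lyapunov_chain
begin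

lemma nn_integral_invariant:
  assumes \<pi>: "invariant_measure I q \<pi>" and f: "f \<in> borel_measurable B"
  shows "(\<integral>\<^sup>+x. \<integral>\<^sup>+y. f y \<partial>q x \<partial>\<pi>) = (\<integral>\<^sup>+x. f x \<partial>\<pi>)"
  by (rule nn_integral_kernel_eq[OF q_measurable' _ _ _ f]) (use \<pi> in \<open>simp_all add: invariant_measure_def\<close>)

lemma max_partial_sum_measurable:
  assumes \<phi> [measurable]: "\<phi> \<in> borel_measurable B"
  shows "max_partial_sum \<phi> n \<in> borel_measurable N"
proof (induction n)
  case (Suc n)
  have tl: "(\<lambda>w k. w (Suc k)) \<in> N \<rightarrow>\<^sub>M N"
    by (rule measurable_PiM_single') (auto simp: space_B space_N)
  have "(\<lambda>w. max_partial_sum \<phi> n (\<lambda>k. w (Suc k))) \<in> borel_measurable N"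
    using measurable_compose[OF tl Suc] .
  moreover have "(\<lambda>w. \<phi> (w 0)) \<in> borel_measurable N"
    by (rule measurable_compose[OF component_measurable \<phi>])
  moreover have "max_partial_sum \<phi> (Suc n) = (\<lambda>w. max 0 (\<phi> (w 0) + max_partial_sum \<phi> n (\<lambda>k. w (Suc k))))"
    by (simp add: fun_eq_iff)
  ultimately show ?case by (simp only: borel_measurable_max borel_measurable_const borel_measurable_add)
qed (simp add: max_partial_sum.simps(1)[abs_def])

lemma law_AE_start_integral:
  assumes x: "x \<in> I" and F: "G \<in> sets N"
  shows "(\<integral>\<^sup>+w. f (w 0) * indicator G w \<partial>law x) = f x * emeasure (law x) G"
proof -
  have "(\<integral>\<^sup>+w. f (w 0) * indicator G w \<partial>law x) = (\<integral>\<^sup>+w. f x * indicator G w \<partial>law x)"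
    using law_start[OF x] by (intro nn_integral_cong_AE) auto
  then show ?thesis using F by (simp add: nn_integral_cmult_indicator)
qed

text \<open>Garsia's proof of the maximal ergodic lemma, localized to the shift-invariant event that the
  partial sums are unbounded. Its probability does not depend on the starting point, so it must
  vanish when \<open>\<phi>\<close> has negative integral.\<close>

theorem partial_sums_bounded_above:
  assumes \<pi>: "invariant_measure I q \<pi>" and \<phi>: "integrable \<pi> \<phi>" "(\<integral>y. \<phi> y \<partial>\<pi>) < 0" and x0: "x0 \<in> I"
  shows "AE w in law x0. \<exists>K. \<forall>n. (\<Sum>k<n. \<phi> (w k)) \<le> (K::real)"
proof -
  have sets: "sets \<pi> = sets B" using \<pi> by (simp add: invariant_measure_def)
  have space: "space \<pi> = I" using sets_eq_imp_space_eq[OF sets] by (simp add: space_B)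
  have \<phi>m [measurable]: "\<phi> \<in> borel_measurable B"
    using borel_measurable_integrable[OF \<phi>(1)] unfolding measurable_cong_sets[OF sets refl] .
  define E where "E = {w \<in> space N. \<forall>K::nat. \<exists>n. real K < (\<Sum>k<n. \<phi> (w k))}"
  have E [measurable]: "E \<in> sets N"
    unfolding E_def by measurable
  have inv: "case_nat x w \<in> E \<longleftrightarrow> w \<in> E" if x: "x \<in> I" and w: "w \<in> space N" for x w
  proof -
    have sum: "(\<Sum>k<Suc n. \<phi> (case_nat x w k)) = \<phi> x + (\<Sum>k<n. \<phi> (w k))" for n
      by (simp add: sum.lessThan_Suc_shift del: sum.lessThan_Suc)
    have "\<exists>n. real K < (\<Sum>k<n. \<phi> (w k))"
      if unb: "\<forall>K::nat. \<exists>n. real K < (\<Sum>k<n. \<phi> (case_nat x w k))" for K :: nat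
    proof -
      obtain n where n: "real (K + nat \<lceil>\<bar>\<phi> x\<bar>\<rceil>) < (\<Sum>k<n. \<phi> (case_nat x w k))" using unb by blast
      then have "n \<noteq> 0" by (intro notI) (simp del: of_nat_add)
      then obtain m where m: "n = Suc m" by (cases n) auto
      have "\<phi> x \<le> real (nat \<lceil>\<bar>\<phi> x\<bar>\<rceil>)" by linarith
      then have "real K < (\<Sum>k<m. \<phi> (w k))" using n[unfolded m sum] by simp
      then show ?thesis by blast
    qed
    moreover have "\<exists>n. real K < (\<Sum>k<n. \<phi> (case_nat x w k))"
      if unb: "\<forall>K::nat. \<exists>n. real K < (\<Sum>k<n. \<phi> (w k))" for K :: nat
    proof -
      obtain n where n: "real (K + nat \<lceil>\<bar>\<phi> x\<bar>\<rceil>) < (\<Sum>k<n. \<phi> (w k))" using unb by blast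
      have "- \<phi> x \<le> real (nat \<lceil>\<bar>\<phi> x\<bar>\<rceil>)" by linarith
      then have "real K < (\<Sum>k<Suc n. \<phi> (case_nat x w k))" using n unfolding sum by simp
      then show ?thesis by blast
    qed
    ultimately show ?thesis
      using case_nat_in_N[OF x w] w unfolding E_def by blast
  qed
  obtain c where c: "\<And>x. x \<in> I \<Longrightarrow> measure (law x) E = c"
    using invariant_event_constant[OF E inv] by metis
  have em: "emeasure (law x) G = ennreal (measure (law x) G)" if "x \<in> I" for x G
    using prob_law[OF that] by (simp add: finite_measure.emeasure_eq_measure prob_space.finite_measure)
  let ?M = "max_partial_sum \<phi>"
  note Mm = max_partial_sum_measurable[OF \<phi>m]
  \<comment> \<open>The event on which the maximal inequality applies, cut down to \<open>E\<close>.
    As \<open>E\<close> is shift-invariant, the inequality still relates a path to its shift after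
    this restriction.\<close>
  define pos where "pos n = {w\<in>space N. 0 < ?M (Suc n) w} \<inter> E" for n
  have pos [measurable]: "pos n \<in> sets N" for n
    unfolding pos_def using Mm[of "Suc n", unfolded borel_measurable_iff_greater] by (intro sets.Int E) blast
  define H where "H n x = (\<integral>\<^sup>+w. ennreal (?M n w) * indicator E w \<partial>law x)" for n x
  have Hf: "(\<lambda>w. ennreal (?M n w) * indicator E w) \<in> borel_measurable N" for n
    using Mm[of n] by measurable
  have H [measurable]: "H n \<in> borel_measurable B" for n
    unfolding H_def by (rule measurable_compose[OF law_measurable' nn_integral_measurable_subprob_algebra[OF Hf]])
  have p [measurable]: "(\<lambda>x. emeasure (law x) (pos n)) \<in> borel_measurable B" for n
    by (rule measurable_compose[OF law_measurable' measurable_emeasure_subprob_algebra[OF pos]])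
  have qH [measurable]: "(\<lambda>x. \<integral>\<^sup>+y. H n y \<partial>q x) \<in> borel_measurable B" for n
    by (rule measurable_compose[OF q_measurable' nn_integral_measurable_subprob_algebra[OF H]])
  have tl: "(\<lambda>w k. w (Suc k)) \<in> N \<rightarrow>\<^sub>M N"
    by (rule measurable_PiM_single') (auto simp: space_B space_N)
  have Mtl: "(\<lambda>w. ?M n (\<lambda>k. w (Suc k))) \<in> borel_measurable N" for n
    using measurable_compose[OF tl Mm] .
  have mlaw: "f \<in> borel_measurable (law x)" if "f \<in> borel_measurable N" for f :: "_ \<Rightarrow> ennreal" and x
    using that unfolding measurable_cong_sets[OF sets_law refl] .
  have F1: "(\<lambda>w. ennreal (?M n (\<lambda>k. w (Suc k))) * indicator E w) \<in> borel_measurable N" for n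
    using Mtl[of n] by measurable
  have F2: "(\<lambda>w. ennreal (\<psi> (w 0)) * indicator G w) \<in> borel_measurable N"
    if "\<psi> \<in> borel_measurable B" "G \<in> sets N" for \<psi> :: "real \<Rightarrow> real" and G
    using that measurable_compose[OF component_measurable that(1)] by measurable
  have \<phi>n: "(\<lambda>y. - \<phi> y) \<in> borel_measurable B" "(\<lambda>y. \<bar>\<phi> y\<bar>) \<in> borel_measurable B"
    by measurable
  have shift: "(\<integral>\<^sup>+w. ennreal (?M n (\<lambda>k. w (Suc k))) * indicator E w \<partial>law x) = (\<integral>\<^sup>+y. H n y \<partial>q x)"
    if x: "x \<in> I" for n x
  proof -
    have "(\<integral>\<^sup>+w. ennreal (?M n (\<lambda>k. w (Suc k))) * indicator E w \<partial>law x)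
      = (\<integral>\<^sup>+y. \<integral>\<^sup>+w. ennreal (?M n (\<lambda>k. case_nat x w (Suc k))) * indicator E (case_nat x w) \<partial>law y \<partial>q x)"
      by (rule law_step[OF x F1])
    also have "\<dots> = (\<integral>\<^sup>+y. H n y \<partial>q x)"
      unfolding H_def
    proof (intro nn_integral_cong)
      fix y w assume "w \<in> space (law y)"
      then have "case_nat x w \<in> E \<longleftrightarrow> w \<in> E" using inv[OF x] by simp
      then show "ennreal (?M n (\<lambda>k. case_nat x w (Suc k))) * indicator E (case_nat x w) = ennreal (?M n w) * indicator E w"
        by (simp add: indicator_def)
    qed
    finally show ?thesis .
  qed
  have step: "H (Suc n) x + ennreal (- \<phi> x) * emeasure (law x) (pos n)
    \<le> ennreal (\<phi> x) * emeasure (law x) (pos n) + (\<integral>\<^sup>+y. H (Suc n) y \<partial>q x)" if x: "x \<in> I" for n x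
  proof -
    have "H (Suc n) x + ennreal (- \<phi> x) * emeasure (law x) (pos n)
      = (\<integral>\<^sup>+w. ennreal (?M (Suc n) w) * indicator E w + ennreal (- \<phi> (w 0)) * indicator (pos n) w \<partial>law x)"
      unfolding H_def law_AE_start_integral[OF x pos, where f = "\<lambda>y. ennreal (- \<phi> y)", symmetric]
      by (intro nn_integral_add[symmetric] mlaw Hf F2[OF \<phi>n(1) pos])
    also have "\<dots> \<le> (\<integral>\<^sup>+w. ennreal (\<phi> (w 0)) * indicator (pos n) w
        + ennreal (?M (Suc n) (\<lambda>k. w (Suc k))) * indicator E w \<partial>law x)"
    proof (rule nn_integral_mono)
      fix w assume "w \<in> space (law x)"
      then have w: "w \<in> space N" by simp
      show "ennreal (?M (Suc n) w) * indicator E w + ennreal (- \<phi> (w 0)) * indicator (pos n) w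
        \<le> ennreal (\<phi> (w 0)) * indicator (pos n) w + ennreal (?M (Suc n) (\<lambda>k. w (Suc k))) * indicator E w"
      proof (cases "w \<in> E")
        case True
        show ?thesis
        proof (cases "0 < ?M (Suc n) w")
          case pos: True
          then show ?thesis
            using max_partial_sum_step[OF pos] True w by (simp add: pos_def del: max_partial_sum.simps)
        next
          case False
          then have "?M (Suc n) w = 0" using max_partial_sum_nonneg[of \<phi> "Suc n" w] by simp
          then show ?thesis using False by (simp add: pos_def del: max_partial_sum.simps)
        qed
      qed (simp add: pos_def)
    qed
    also have "\<dots> = ennreal (\<phi> x) * emeasure (law x) (pos n) + (\<integral>\<^sup>+y. H (Suc n) y \<partial>q x)"
      unfolding law_AE_start_integral[OF x pos, where f = "\<lambda>y. ennreal (\<phi> y)", symmetric] shift[OF x, symmetric]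
      by (intro nn_integral_add mlaw F1 F2[OF \<phi>m pos])
    finally show ?thesis .
  qed
  have m\<pi>: "f \<in> borel_measurable \<pi>" if "f \<in> borel_measurable B" for f :: "real \<Rightarrow> ennreal"
    using that unfolding measurable_cong_sets[OF sets refl] by simp
  have meas\<phi>: "(\<lambda>x. ennreal (\<phi> x)) \<in> borel_measurable B" "(\<lambda>x. ennreal (- \<phi> x)) \<in> borel_measurable B"
      "(\<lambda>x. ennreal \<bar>\<phi> x\<bar>) \<in> borel_measurable B"
    by measurable
  have abs_fin: "(\<integral>\<^sup>+y. ennreal \<bar>\<phi> y\<bar> \<partial>\<pi>) < \<infinity>"
    using \<phi>(1) by (simp add: integrable_iff_bounded)
  \<comment> \<open>Finiteness is what allows the integral of \<open>H (Suc n)\<close> to be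
    cancelled from both sides in \<open>main\<close>. It follows by induction, because one more step
    raises the maximum by at most the absolute value of the first summand.\<close>
  have H_fin: "(\<integral>\<^sup>+y. H n y \<partial>\<pi>) < \<infinity>" for n
  proof (induction n)
    case 0
    show ?case by (simp add: H_def)
  next
    case (Suc n)
    have "H (Suc n) x \<le> ennreal \<bar>\<phi> x\<bar> + (\<integral>\<^sup>+y. H n y \<partial>q x)" if x: "x \<in> I" for x
    proof -
      have "H (Suc n) x \<le> (\<integral>\<^sup>+w. ennreal \<bar>\<phi> (w 0)\<bar> * indicator (space N) w
        + ennreal (?M n (\<lambda>k. w (Suc k))) * indicator E w \<partial>law x)"
        unfolding H_def
      proof (rule nn_integral_mono)
        fix w assume "w \<in> space (law x)"
        moreover have "ennreal (?M (Suc n) w) \<le> ennreal \<bar>\<phi> (w 0)\<bar> + ennreal (?M n (\<lambda>k. w (Suc k)))"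
        proof -
          have "ennreal (?M (Suc n) w) \<le> ennreal (\<bar>\<phi> (w 0)\<bar> + ?M n (\<lambda>k. w (Suc k)))"
            using max_partial_sum_nonneg[of \<phi> n "\<lambda>k. w (Suc k)"] by (intro ennreal_leI) auto
          then show ?thesis by (simp only: ennreal_plus[OF abs_ge_zero max_partial_sum_nonneg])
        qed
        ultimately show "ennreal (?M (Suc n) w) * indicator E w \<le> ennreal \<bar>\<phi> (w 0)\<bar> * indicator (space N) w
            + ennreal (?M n (\<lambda>k. w (Suc k))) * indicator E w"
          by (auto simp: indicator_def simp del: max_partial_sum.simps)
      qed
      also have "\<dots> = ennreal \<bar>\<phi> x\<bar> * emeasure (law x) (space N) + (\<integral>\<^sup>+y. H n y \<partial>q x)"
        unfolding law_AE_start_integral[OF x sets.top, where f = "\<lambda>y. ennreal \<bar>\<phi> y\<bar>", symmetric] shift[OF x, symmetric]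
        by (intro nn_integral_add mlaw F1 F2[OF \<phi>n(2) sets.top])
      finally show ?thesis by (simp add: emeasure_law_space[OF x])
    qed
    then have "(\<integral>\<^sup>+y. H (Suc n) y \<partial>\<pi>) \<le> (\<integral>\<^sup>+x. ennreal \<bar>\<phi> x\<bar> + (\<integral>\<^sup>+y. H n y \<partial>q x) \<partial>\<pi>)"
      by (intro nn_integral_mono) (simp add: space)
    also have "\<dots> = (\<integral>\<^sup>+x. ennreal \<bar>\<phi> x\<bar> \<partial>\<pi>) + (\<integral>\<^sup>+x. \<integral>\<^sup>+y. H n y \<partial>q x \<partial>\<pi>)"
      by (intro nn_integral_add m\<pi> meas\<phi> qH)
    also have "\<dots> = (\<integral>\<^sup>+x. ennreal \<bar>\<phi> x\<bar> \<partial>\<pi>) + (\<integral>\<^sup>+x. H n x \<partial>\<pi>)"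
      by (simp add: nn_integral_invariant[OF \<pi> H])
    also have "\<dots> < \<infinity>" using Suc abs_fin by (simp add: less_top[symmetric])
    finally show ?case .
  qed
  \<comment> \<open>For the positive part the event may be enlarged to \<open>E\<close>, whose
    probability is \<open>c\<close> from every point. For the negative part \<open>pos n\<close> has
    to be kept, and only the limit in \<open>n\<close> replaces it by \<open>E\<close>.\<close>
  have main: "(\<integral>\<^sup>+x. ennreal (- \<phi> x) * emeasure (law x) (pos n) \<partial>\<pi>)
    \<le> (\<integral>\<^sup>+x. ennreal (\<phi> x) * ennreal c \<partial>\<pi>)" for n
  proof -
    have "(\<integral>\<^sup>+x. H (Suc n) x \<partial>\<pi>) + (\<integral>\<^sup>+x. ennreal (- \<phi> x) * emeasure (law x) (pos n) \<partial>\<pi>)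
      = (\<integral>\<^sup>+x. H (Suc n) x + ennreal (- \<phi> x) * emeasure (law x) (pos n) \<partial>\<pi>)"
      by (intro nn_integral_add[symmetric] m\<pi> borel_measurable_times_ennreal meas\<phi> p H)
    also have "\<dots> \<le> (\<integral>\<^sup>+x. ennreal (\<phi> x) * emeasure (law x) (pos n) + (\<integral>\<^sup>+y. H (Suc n) y \<partial>q x) \<partial>\<pi>)"
      using step by (intro nn_integral_mono) (simp add: space)
    also have "\<dots> = (\<integral>\<^sup>+x. ennreal (\<phi> x) * emeasure (law x) (pos n) \<partial>\<pi>) + (\<integral>\<^sup>+x. \<integral>\<^sup>+y. H (Suc n) y \<partial>q x \<partial>\<pi>)"
      by (intro nn_integral_add m\<pi> borel_measurable_times_ennreal meas\<phi> p qH)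
    also have "(\<integral>\<^sup>+x. \<integral>\<^sup>+y. H (Suc n) y \<partial>q x \<partial>\<pi>) = (\<integral>\<^sup>+x. H (Suc n) x \<partial>\<pi>)"
      by (rule nn_integral_invariant[OF \<pi> H])
    finally have "(\<integral>\<^sup>+x. ennreal (- \<phi> x) * emeasure (law x) (pos n) \<partial>\<pi>)
      \<le> (\<integral>\<^sup>+x. ennreal (\<phi> x) * emeasure (law x) (pos n) \<partial>\<pi>)"
      using H_fin[of "Suc n"] by (auto simp: add.commute[of _ "\<integral>\<^sup>+x. H (Suc n) x \<partial>\<pi>"] ennreal_add_left_cancel_le)
    also have "\<dots> \<le> (\<integral>\<^sup>+x. ennreal (\<phi> x) * ennreal c \<partial>\<pi>)"
    proof (intro nn_integral_mono mult_left_mono)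
      fix x assume "x \<in> space \<pi>"
      then have x: "x \<in> I" by (simp add: space)
      have "emeasure (law x) (pos n) \<le> emeasure (law x) E"
        by (rule emeasure_mono) (auto simp: pos_def)
      then show "emeasure (law x) (pos n) \<le> ennreal c" using em[OF x] c[OF x] by simp
    qed simp
    finally show ?thesis .
  qed
  have "(\<integral>\<^sup>+x. ennreal (- \<phi> x) * ennreal c \<partial>\<pi>) = (\<integral>\<^sup>+x. (SUP n. ennreal (- \<phi> x) * emeasure (law x) (pos n)) \<partial>\<pi>)"
  proof (rule nn_integral_cong)
    fix x assume "x \<in> space \<pi>"
    then have x: "x \<in> I" by (simp add: space)
    have inc: "incseq pos"
      unfolding pos_def using max_partial_sum_mono[of \<phi>]
      by (intro incseq_SucI) (auto intro: less_le_trans simp del: max_partial_sum.simps)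
    have "(\<Union>n. pos n) = E"
    proof
      show "E \<subseteq> (\<Union>n. pos n)"
      proof
        fix w assume w: "w \<in> E"
        then obtain n where "0 < (\<Sum>k<n. \<phi> (w k))" unfolding E_def by (auto dest: spec[of _ 0])
        also have "\<dots> \<le> ?M n w" by (rule partial_sum_le_max)
        also have "\<dots> \<le> ?M (Suc n) w" by (rule max_partial_sum_mono)
        finally show "w \<in> (\<Union>n. pos n)" using w by (auto simp: pos_def E_def simp del: max_partial_sum.simps)
      qed
    qed (auto simp: pos_def)
    then have "(SUP n. emeasure (law x) (pos n)) = emeasure (law x) E"
      using inc by (subst SUP_emeasure_incseq) auto
    then show "ennreal (- \<phi> x) * ennreal c = (SUP n. ennreal (- \<phi> x) * emeasure (law x) (pos n))"
      by (simp add: SUP_mult_left_ennreal[symmetric] em[OF x] c[OF x])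
  qed
  also have "\<dots> = (SUP n. \<integral>\<^sup>+x. ennreal (- \<phi> x) * emeasure (law x) (pos n) \<partial>\<pi>)"
  proof (intro nn_integral_monotone_convergence_SUP m\<pi>)
    show "incseq (\<lambda>n x. ennreal (- \<phi> x) * emeasure (law x) (pos n))"
    proof (intro incseq_SucI le_funI mult_left_mono emeasure_mono)
      show "pos n \<subseteq> pos (Suc n)" for n
        unfolding pos_def using max_partial_sum_mono[of \<phi> "Suc n"]
        by (auto intro: less_le_trans simp del: max_partial_sum.simps)
    qed simp_all
    show "(\<lambda>x. ennreal (- \<phi> x) * emeasure (law x) (pos n)) \<in> borel_measurable B" for n
      by (intro borel_measurable_times_ennreal meas\<phi> p)
  qed
  also have "\<dots> \<le> (\<integral>\<^sup>+x. ennreal (\<phi> x) * ennreal c \<partial>\<pi>)"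
    using main by (intro SUP_least) auto
  finally have le: "(\<integral>\<^sup>+x. ennreal (- \<phi> x) * ennreal c \<partial>\<pi>) \<le> (\<integral>\<^sup>+x. ennreal (\<phi> x) * ennreal c \<partial>\<pi>)" .
  have m\<pi>1: "(\<lambda>x. ennreal (\<phi> x)) \<in> borel_measurable \<pi>" and m\<pi>2: "(\<lambda>x. ennreal (- \<phi> x)) \<in> borel_measurable \<pi>"
    by (intro m\<pi>; measurable)+
  \<comment> \<open>The inequality \<open>le\<close> compares the integrals of the negative and the
    positive part of \<open>\<phi>\<close>, both multiplied by \<open>c\<close>. For
    \<open>c > 0\<close> it would give \<open>\<phi>\<close> a nonnegative integral.\<close>
  have "c = 0"
  proof (rule ccontr)
    assume "c \<noteq> 0"
    then have cpos: "c > 0" using c[OF x0] by (metis measure_nonneg order_le_less)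
    have fin: "(\<integral>\<^sup>+x. ennreal (\<phi> x) \<partial>\<pi>) < \<infinity>" "(\<integral>\<^sup>+x. ennreal (- \<phi> x) \<partial>\<pi>) < \<infinity>"
      using \<phi>(1) by (auto simp: real_integrable_def less_top)
    have "ennreal c * (\<integral>\<^sup>+x. ennreal (- \<phi> x) \<partial>\<pi>) \<le> ennreal c * (\<integral>\<^sup>+x. ennreal (\<phi> x) \<partial>\<pi>)"
      using le unfolding nn_integral_multc[OF m\<pi>1] nn_integral_multc[OF m\<pi>2] by (simp only: mult.commute)
    then have "(\<integral>\<^sup>+x. ennreal (- \<phi> x) \<partial>\<pi>) \<le> (\<integral>\<^sup>+x. ennreal (\<phi> x) \<partial>\<pi>)"
      using cpos by (simp add: ennreal_mult_le_mult_iff)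
    then have "enn2real (\<integral>\<^sup>+x. ennreal (- \<phi> x) \<partial>\<pi>) \<le> enn2real (\<integral>\<^sup>+x. ennreal (\<phi> x) \<partial>\<pi>)"
      using fin by (intro enn2real_mono) auto
    then show False using \<phi>(2) real_lebesgue_integral_def[OF \<phi>(1)] by simp
  qed
  then have "emeasure (law x0) E = 0" using em[OF x0] c[OF x0] by simp
  then have "AE w in law x0. w \<notin> E" by (intro AE_not_in) (auto intro: null_setsI)
  then show ?thesis
  proof (rule AE_mp, intro AE_I2 impI)
    fix w assume "w \<in> space (law x0)" "w \<notin> E"
    then obtain K :: nat where "\<And>n. \<not> real K < (\<Sum>k<n. \<phi> (w k))" by (auto simp: E_def)
    then show "\<exists>K. \<forall>n. (\<Sum>k<n. \<phi> (w k)) \<le> K" by (meson not_less)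
  qed
qed

text \<open>Some level set \<open>A j\<close> of \<open>h\<close> must be charged by
  \<open>q x0\<close> for a point \<open>x0\<close>: otherwise invariance would make every level set
  null and the integral zero. Recurrence to this level set adds at least 1 / (j + 1) infinitely
  often.\<close>

lemma sum_diverges:
  assumes \<pi>: "invariant_measure I q \<pi>" and h [measurable]: "h \<in> borel_measurable B"
    and nonneg: "\<And>y. y \<in> I \<Longrightarrow> 0 \<le> h y" and nz: "(\<integral>\<^sup>+y. ennreal (h y) \<partial>\<pi>) \<noteq> 0" and x: "x \<in> I"
  shows "AE w in law x. \<forall>K. \<exists>n. (K::real) < (\<Sum>k<n. h (w k))"
proof -
  have sets: "sets \<pi> = sets B" using \<pi> by (simp add: invariant_measure_def)
  have space: "space \<pi> = I" using sets_eq_imp_space_eq[OF sets] by (simp add: space_B)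
  define A where "A k = {y \<in> space B. 1 / real (Suc k) \<le> h y}" for k
  have A [measurable]: "A k \<in> sets B" for k unfolding A_def by measurable
  have "\<exists>k. \<exists>x\<in>I. emeasure (q x) (A k) > 0"
  proof (rule ccontr)
    assume "\<not> ?thesis"
    then have "(\<integral>\<^sup>+x. emeasure (q x) (A k) \<partial>\<pi>) = (\<integral>\<^sup>+x. 0 \<partial>\<pi>)" for k
      by (intro nn_integral_cong) (auto simp: space)
    then have null: "emeasure \<pi> (A k) = 0" for k
      using \<pi> A by (simp add: invariant_measure_def)
    have "AE y in \<pi>. y \<notin> A k" for k
      using null A by (intro AE_not_in null_setsI) (auto simp: sets)
    then have "AE y in \<pi>. \<forall>k. y \<notin> A k" by (simp add: AE_all_countable)
    then have "AE y in \<pi>. ennreal (h y) = 0"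
    proof (rule AE_mp, intro AE_I2 impI)
      fix y assume y: "y \<in> space \<pi>" "\<forall>k. y \<notin> A k"
      then have *: "h y < 1 / real (Suc k)" for k by (auto simp: A_def space space_B not_le)
      have "h y \<le> 0"
      proof (rule ccontr)
        assume "\<not> ?thesis"
        then obtain k where "1 / real (Suc k) < h y" using nat_approx_posE[of "h y"] by auto
        then show False using *[of k] by simp
      qed
      then show "ennreal (h y) = 0" by (simp add: ennreal_neg)
    qed
    then have "(\<integral>\<^sup>+y. ennreal (h y) \<partial>\<pi>) = (\<integral>\<^sup>+y. 0 \<partial>\<pi>)" by (rule nn_integral_cong_AE)
    then show False using nz by simp
  qed
  then obtain j x0 where x0: "x0 \<in> I" "emeasure (q x0) (A j) > 0" by blast
  show ?thesis
    using hits_infinitely_often[OF A x0 x]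
  proof (rule AE_mp, intro AE_I2 impI allI)
    fix w K assume w: "w \<in> space (law x)" and io: "\<forall>m. \<exists>n\<ge>m. w n \<in> A j"
    show "\<exists>n. K < (\<Sum>k<n. h (w k))"
    proof (rule recurrent_sum_unbounded)
      show "0 \<le> h (w n)" for n using w nonneg by (simp add: space_N)
      show "0 < 1 / real (Suc j)" by simp
      show "\<exists>n\<ge>m. 1 / real (Suc j) \<le> h (w n)" for m using io by (auto simp: A_def)
    qed
  qed
qed

text \<open>Since \<open>g\<close> may change sign, its sums can vanish and need not grow. Both
  \<open>f\<close> and \<open>g\<close> are therefore compared with an auxiliary integrable function
  \<open>h\<close> that is strictly positive everywhere, which exists by sigma-finiteness; the two
  limits are then divided.\<close>

theorem ratio_limit:
  fixes f g :: "real \<Rightarrow> real"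
  assumes \<pi>: "invariant_measure I q \<pi>" and fg: "integrable \<pi> f" "integrable \<pi> g" "(\<integral>y. g y \<partial>\<pi>) \<noteq> 0"
    and x: "x \<in> I"
  shows "AE w in law x. (\<lambda>r. (\<Sum>k=0..r. f (w k)) / (\<Sum>k=0..r. g (w k)))
    \<longlonglongrightarrow> (\<integral>y. f y \<partial>\<pi>) / (\<integral>y. g y \<partial>\<pi>)"
proof -
  have sets: "sets \<pi> = sets B" using \<pi> by (simp add: invariant_measure_def)
  have space: "space \<pi> = I" using sets_eq_imp_space_eq[OF sets] by (simp add: space_B)
  interpret sigma_finite_measure \<pi> using \<pi> by (simp add: invariant_measure_def)
  obtain h :: "real \<Rightarrow> real" where h: "h \<in> borel_measurable \<pi>" "\<And>y. h y > 0" "integrable \<pi> h"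
    using obtain_positive_integrable_function by metis
  have hB: "h \<in> borel_measurable B"
    using h(1) unfolding measurable_cong_sets[OF sets refl] .
  have int_h: "(\<integral>\<^sup>+y. ennreal (h y) \<partial>\<pi>) = ennreal (\<integral>y. h y \<partial>\<pi>)"
    using h by (intro nn_integral_eq_integral) (auto intro: less_imp_le)
  have nz: "(\<integral>\<^sup>+y. ennreal (h y) \<partial>\<pi>) \<noteq> 0"
  proof
    assume "(\<integral>\<^sup>+y. ennreal (h y) \<partial>\<pi>) = 0"
    then have "AE y in \<pi>. ennreal (h y) = 0"
      using h(1) by (subst (asm) nn_integral_0_iff_AE) auto
    then have "AE y in \<pi>. False"
      by (rule AE_mp) (use h(2) in \<open>auto simp: ennreal_eq_0_iff not_le intro!: AE_I2\<close>)
    then have "emeasure \<pi> I = 0" using AE_False_emeasure[of \<pi>] by (simp only: space)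
    then show False using \<pi> by (simp add: invariant_measure_def)
  qed
  have h_pos: "(\<integral>y. h y \<partial>\<pi>) > 0" using nz unfolding int_h by (simp add: ennreal_eq_0_iff not_le)
  have div: "AE w in law x. \<forall>K. \<exists>n. (K::real) < (\<Sum>k<n. h (w k))"
    using h(2) by (intro sum_diverges[OF \<pi> hB _ nz x]) (simp add: less_imp_le)
  have ratio_h: "AE w in law x. (\<lambda>n. (\<Sum>k<n. f (w k)) / (\<Sum>k<n. h (w k))) \<longlonglongrightarrow> (\<integral>y. f y \<partial>\<pi>) / (\<integral>y. h y \<partial>\<pi>)"
    if f: "integrable \<pi> f" for f
  proof -
    let ?L = "(\<integral>y. f y \<partial>\<pi>) / (\<integral>y. h y \<partial>\<pi>)"
    have L: "?L * (\<integral>y. h y \<partial>\<pi>) = (\<integral>y. f y \<partial>\<pi>)" using h_pos by simp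
    \<comment> \<open>The constant \<open>?L\<close> is chosen so that \<open>f - ?L * h\<close> has
      integral zero; tilting the slope by 1 / (j + 1) in either direction produces the negative
      integral needed for boundedness from above.\<close>
    have up: "AE w in law x. \<exists>K. \<forall>n. (\<Sum>k<n. f (w k) - (?L + 1 / real (Suc j)) * h (w k)) \<le> K" for j
    proof (rule partial_sums_bounded_above[OF \<pi> _ _ x])
      show "integrable \<pi> (\<lambda>y. f y - (?L + 1 / real (Suc j)) * h y)" using f h by simp
      have "(\<integral>y. f y - (?L + 1 / real (Suc j)) * h y \<partial>\<pi>)
        = (\<integral>y. f y \<partial>\<pi>) - (?L + 1 / real (Suc j)) * (\<integral>y. h y \<partial>\<pi>)"
        using f h by simp
      also have "\<dots> = - (1 / real (Suc j)) * (\<integral>y. h y \<partial>\<pi>)"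
        by (simp only: distrib_right L)
      also have "\<dots> < 0" using h_pos by simp
      finally show "(\<integral>y. f y - (?L + 1 / real (Suc j)) * h y \<partial>\<pi>) < 0" .
    qed
    have lo: "AE w in law x. \<exists>K. \<forall>n. (\<Sum>k<n. (?L - 1 / real (Suc j)) * h (w k) - f (w k)) \<le> K" for j
    proof (rule partial_sums_bounded_above[OF \<pi> _ _ x])
      show "integrable \<pi> (\<lambda>y. (?L - 1 / real (Suc j)) * h y - f y)" using f h by simp
      have "(\<integral>y. (?L - 1 / real (Suc j)) * h y - f y \<partial>\<pi>)
        = (?L - 1 / real (Suc j)) * (\<integral>y. h y \<partial>\<pi>) - (\<integral>y. f y \<partial>\<pi>)"
        using f h by simp
      also have "\<dots> = - (1 / real (Suc j)) * (\<integral>y. h y \<partial>\<pi>)"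
        by (simp only: left_diff_distrib L)
      also have "\<dots> < 0" using h_pos by simp
      finally show "(\<integral>y. (?L - 1 / real (Suc j)) * h y - f y \<partial>\<pi>) < 0" .
    qed
    have "AE w in law x. \<forall>j. \<exists>K. \<forall>n. (\<Sum>k<n. f (w k) - (?L + 1 / real (Suc j)) * h (w k)) \<le> K"
      "AE w in law x. \<forall>j. \<exists>K. \<forall>n. (\<Sum>k<n. (?L - 1 / real (Suc j)) * h (w k) - f (w k)) \<le> K"
      unfolding AE_all_countable using up lo by blast+
    with div show ?thesis
    proof eventually_elim
      case (elim w)
      show ?case
        by (rule ratio_tendsto) (use elim h(2) in \<open>auto intro: less_imp_le\<close>)
    qed
  qed
  from ratio_h[OF fg(1)] ratio_h[OF fg(2)] div show ?thesis
  proof eventually_elim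
    case (elim w)
    let ?S = "\<lambda>f n. \<Sum>k<n. f (w k)"
    have "(\<lambda>n. (?S f n / ?S h n) / (?S g n / ?S h n))
      \<longlonglongrightarrow> ((\<integral>y. f y \<partial>\<pi>) / (\<integral>y. h y \<partial>\<pi>)) / ((\<integral>y. g y \<partial>\<pi>) / (\<integral>y. h y \<partial>\<pi>))"
      using fg(3) h_pos by (intro tendsto_divide[OF elim(1,2)]) simp
    moreover have "((\<integral>y. f y \<partial>\<pi>) / (\<integral>y. h y \<partial>\<pi>)) / ((\<integral>y. g y \<partial>\<pi>) / (\<integral>y. h y \<partial>\<pi>))
      = (\<integral>y. f y \<partial>\<pi>) / (\<integral>y. g y \<partial>\<pi>)"
      using h_pos by (simp add: field_simps)
    ultimately have lim: "(\<lambda>n. (?S f n / ?S h n) / (?S g n / ?S h n)) \<longlonglongrightarrow> (\<integral>y. f y \<partial>\<pi>) / (\<integral>y. g y \<partial>\<pi>)"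
      by (simp only:)
    \<comment> \<open>Sums over \<open>k = 0..r\<close> are sums over \<open>k < Suc r\<close>. The
      shifted index also skips the empty sum, where the quotient by \<open>?S h\<close> would be 0 /
      0.\<close>
    have "(?S f (Suc r) / ?S h (Suc r)) / (?S g (Suc r) / ?S h (Suc r)) = ?S f (Suc r) / ?S g (Suc r)" for r
    proof -
      have "?S h (Suc r) > 0" using h(2) by (intro sum_pos) auto
      then show ?thesis by simp
    qed
    then show ?case
      using LIMSEQ_Suc[OF lim] by (simp only: atLeast0AtMost lessThan_Suc_atMost)
  qed
qed

section \<open>Support and uniqueness of invariant measures\<close>

theorem full_support_invariant:
  assumes \<pi>: "invariant_measure I q \<pi>"
  shows "full_support I \<pi>"
  unfolding full_support_def
proof (intro allI impI)
  fix U assume U: "open U \<and> U \<inter> I \<noteq> {}"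
  have sets: "sets \<pi> = sets B" using \<pi> by (simp add: invariant_measure_def)
  have space: "space \<pi> = I" using sets_eq_imp_space_eq[OF sets] by (simp add: space_B)
  have UI: "U \<inter> I \<in> sets B" using U by (simp add: sets_B_iff)
  \<comment> \<open>If the set were null, invariance would make it null for
    \<open>kernel_power I q n x\<close>, for all \<open>n\<close> at once, at almost every
    \<open>x\<close>. A single such \<open>x\<close> contradicts irreducibility.\<close>
  show "0 < emeasure \<pi> (U \<inter> I)"
  proof (rule ccontr)
    assume "\<not> ?thesis"
    then have null: "emeasure \<pi> (U \<inter> I) = 0" by simp
    have kp: "(\<lambda>x. emeasure (kernel_power I q n x) (U \<inter> I)) \<in> borel_measurable B" for n
      by (rule measurable_compose[OF measurable_prob_algebraD[OF kernel_power_measurable]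
            measurable_emeasure_subprob_algebra[OF UI]])
    have "(\<integral>\<^sup>+x. emeasure (kernel_power I q n x) (U \<inter> I) \<partial>\<pi>) = 0" for n
    proof (induction n)
      case 0
      have "(\<integral>\<^sup>+x. emeasure (kernel_power I q 0 x) (U \<inter> I) \<partial>\<pi>) = (\<integral>\<^sup>+x. indicator (U \<inter> I) x \<partial>\<pi>)"
        using UI by simp
      also have "\<dots> = emeasure \<pi> (U \<inter> I)"
        using UI sets by (intro nn_integral_indicator) simp
      finally show ?case using null by simp
    next
      case (Suc n)
      have "(\<integral>\<^sup>+x. emeasure (kernel_power I q (Suc n) x) (U \<inter> I) \<partial>\<pi>)
        = (\<integral>\<^sup>+x. \<integral>\<^sup>+y. emeasure (kernel_power I q n y) (U \<inter> I) \<partial>q x \<partial>\<pi>)"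
        unfolding kernel_power.simps
        by (intro nn_integral_cong emeasure_bind_prob_algebra[OF q_prob kernel_power_measurable UI]) (simp add: space)
      also have "\<dots> = (\<integral>\<^sup>+x. emeasure (kernel_power I q n x) (U \<inter> I) \<partial>\<pi>)"
        by (rule nn_integral_invariant[OF \<pi> kp])
      finally show ?case using Suc by simp
    qed
    then have "AE x in \<pi>. emeasure (kernel_power I q n x) (U \<inter> I) = 0" for n
      using kp by (subst (asm) nn_integral_0_iff_AE) (simp_all add: measurable_cong_sets[OF sets refl])
    then have "AE x in \<pi>. \<forall>n. emeasure (kernel_power I q n x) (U \<inter> I) = 0"
      by (simp add: AE_all_countable)
    then have "AE x in \<pi>. False"
    proof (rule AE_mp, intro AE_I2 impI)
      fix x assume x: "x \<in> space \<pi>" and z: "\<forall>n. emeasure (kernel_power I q n x) (U \<inter> I) = 0"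
      obtain y where y: "y \<in> U" "y \<in> I" using U by blast
      obtain e where e: "e > 0" "ball y e \<subseteq> U" using U y openE by blast
      obtain n where n: "0 < measure (kernel_power I q n x) ({y - e<..<y + e} \<inter> I)"
        using irreducible[of x y e] x y e by (auto simp: space)
      have kpx: "kernel_power I q n x \<in> space (prob_algebra B)"
        using measurable_space[OF kernel_power_measurable] x by (simp add: space space_B)
      then interpret k: prob_space "kernel_power I q n x" by (simp add: space_prob_algebra)
      have "measure (kernel_power I q n x) ({y - e<..<y + e} \<inter> I) \<le> measure (kernel_power I q n x) (U \<inter> I)"
        using e(2) UI kpx by (intro k.finite_measure_mono) (auto simp: ball_eq_greaterThanLessThan space_prob_algebra)
      then show False using n z by (simp add: measure_def)
    qed
    then have "emeasure \<pi> I = 0" using AE_False_emeasure[of \<pi>] by (simp only: space)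
    then show False using \<pi> by (simp add: invariant_measure_def)
  qed
qed

text \<open>The sums along a path do not know which measure is being considered: the same ratio
  converges almost surely under \<open>law 0\<close> to a limit computed from \<open>\<pi>\<close>
  and to one computed from \<open>\<rho>\<close>, so the two limits coincide.\<close>

theorem invariant_measure_unique:
  assumes \<pi>: "invariant_measure I q \<pi>" and \<rho>: "invariant_measure I q \<rho>"
  shows "\<exists>c>0. \<rho> = scale_measure (ennreal c) \<pi>"
proof -
  have sets: "sets \<pi> = sets B" "sets \<rho> = sets B" using \<pi> \<rho> by (simp_all add: invariant_measure_def)
  have space: "space \<pi> = I" "space \<rho> = I"
    using sets_eq_imp_space_eq[OF sets(1)] sets_eq_imp_space_eq[OF sets(2)] by (simp_all add: space_B)
  interpret P: sigma_finite_measure \<pi> using \<pi> by (simp add: invariant_measure_def)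
  interpret R: sigma_finite_measure \<rho> using \<rho> by (simp add: invariant_measure_def)
  obtain h1 :: "real \<Rightarrow> real" where h1: "h1 \<in> borel_measurable \<pi>" "\<And>y. h1 y > 0" "integrable \<pi> h1"
    using P.obtain_positive_integrable_function by metis
  obtain h2 :: "real \<Rightarrow> real" where h2: "h2 \<in> borel_measurable \<rho>" "\<And>y. h2 y > 0" "integrable \<rho> h2"
    using R.obtain_positive_integrable_function by metis
  have m: "f \<in> borel_measurable \<pi>" "f \<in> borel_measurable \<rho>" if "f \<in> borel_measurable B" for f :: "real \<Rightarrow> real"
    using that unfolding measurable_cong_sets[OF sets(1) refl] measurable_cong_sets[OF sets(2) refl] by auto
  have m': "f \<in> borel_measurable \<pi>" "f \<in> borel_measurable \<rho>" if "f \<in> borel_measurable B" for f :: "real \<Rightarrow> ennreal"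
    using that unfolding measurable_cong_sets[OF sets(1) refl] measurable_cong_sets[OF sets(2) refl] by auto
  have hB [measurable]: "h1 \<in> borel_measurable B" "h2 \<in> borel_measurable B"
    using h1 h2 unfolding measurable_cong_sets[OF sets(1) refl] measurable_cong_sets[OF sets(2) refl] by auto
  \<comment> \<open>The minimum is integrable for both measures at once and still strictly
    positive.\<close>
  define h where "h y = min (h1 y) (h2 y)" for y
  have h: "h \<in> borel_measurable B" "\<And>y. h y > 0"
    using h1 h2 unfolding h_def by auto
  note h(1) [measurable]
  have h_le: "h y \<le> h1 y" "h y \<le> h2 y" for y by (auto simp: h_def)
  have int: "integrable \<pi> (\<lambda>y. h y * indicator A y)" "integrable \<rho> (\<lambda>y. h y * indicator A y)" if A: "A \<in> sets B" for A
  proof -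
    have mA: "(\<lambda>y. h y * indicator A y) \<in> borel_measurable B" using A by simp
    show "integrable \<pi> (\<lambda>y. h y * indicator A y)"
      by (rule Bochner_Integration.integrable_bound[OF h1(3) m(1)[OF mA]])
         (auto simp: indicator_def abs_of_pos[OF h(2)] abs_of_pos[OF h1(2)] h_le less_imp_le[OF h1(2)])
    show "integrable \<rho> (\<lambda>y. h y * indicator A y)"
      by (rule Bochner_Integration.integrable_bound[OF h2(3) m(2)[OF mA]])
         (auto simp: indicator_def abs_of_pos[OF h(2)] abs_of_pos[OF h2(2)] h_le less_imp_le[OF h2(2)])
  qed
  have hpos: "(\<integral>y. h y * indicator I y \<partial>M) > 0"
    if M: "invariant_measure I q M" and intM: "integrable M (\<lambda>y. h y * indicator I y)" for M
  proof -
    have spM: "space M = I"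
      using M sets_eq_imp_space_eq[of M B] by (simp add: invariant_measure_def space_B)
    have "(\<integral>y. h y * indicator I y \<partial>M) \<noteq> 0"
    proof
      assume "(\<integral>y. h y * indicator I y \<partial>M) = 0"
      then have "AE y in M. h y * indicator I y = 0"
        by (subst (asm) integral_nonneg_eq_0_iff_AE[OF intM])
           (auto intro!: AE_I2 mult_nonneg_nonneg less_imp_le[OF h(2)])
      then have "AE y in M. False"
        using AE_space by eventually_elim (use h(2) spM in \<open>auto simp: less_le\<close>)
      then have "emeasure M I = 0" using AE_False_emeasure[of M] by (simp only: spM)
      then show False using M by (simp add: invariant_measure_def)
    qed
    moreover have "(\<integral>y. h y * indicator I y \<partial>M) \<ge> 0"
      by (intro integral_nonneg_AE AE_I2 mult_nonneg_nonneg less_imp_le[OF h(2)]) simp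
    ultimately show ?thesis by simp
  qed
  have I: "I \<in> sets B" by (simp add: sets_B_iff)
  let ?p = "\<lambda>A. \<integral>y. h y * indicator A y \<partial>\<pi>" and ?r = "\<lambda>A. \<integral>y. h y * indicator A y \<partial>\<rho>"
  have pos: "?p I > 0" "?r I > 0"
    using hpos[OF \<pi>] hpos[OF \<rho>] int[OF I] by simp_all
  define c where "c = ?r I / ?p I"
  have c: "c > 0" using pos by (simp add: c_def)
  have eq: "?r A = c * ?p A" if A: "A \<in> sets B" for A
  proof -
    have "AE w in law 0. (\<lambda>r. (\<Sum>k=0..r. h (w k) * indicator A (w k)) / (\<Sum>k=0..r. h (w k) * indicator I (w k))) \<longlonglongrightarrow> ?p A / ?p I"
      using pos by (intro ratio_limit[OF \<pi> int(1)[OF A] int(1)[OF I] _ zero_in_I]) simp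
    moreover have "AE w in law 0. (\<lambda>r. (\<Sum>k=0..r. h (w k) * indicator A (w k)) / (\<Sum>k=0..r. h (w k) * indicator I (w k))) \<longlonglongrightarrow> ?r A / ?r I"
      using pos by (intro ratio_limit[OF \<rho> int(2)[OF A] int(2)[OF I] _ zero_in_I]) simp
    ultimately have "AE w in law 0. ?p A / ?p I = ?r A / ?r I"
      by eventually_elim (rule LIMSEQ_unique)
    then have "?p A / ?p I = ?r A / ?r I"
      using prob_space.AE_const[OF prob_law[OF zero_in_I]] by blast
    then show ?thesis using pos by (simp add: c_def field_simps)
  qed
  have nn: "(\<integral>\<^sup>+y. ennreal (h y) * indicator A y \<partial>M) = ennreal (\<integral>y. h y * indicator A y \<partial>M)"
    if "integrable M (\<lambda>y. h y * indicator A y)" for M A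
  proof -
    have "(\<integral>\<^sup>+y. ennreal (h y) * indicator A y \<partial>M) = (\<integral>\<^sup>+y. ennreal (h y * indicator A y) \<partial>M)"
      by (intro nn_integral_cong) (auto simp: indicator_def)
    then show ?thesis using that h(2) by (simp add: nn_integral_eq_integral less_imp_le)
  qed
  have hm: "(\<lambda>y. ennreal (h y)) \<in> borel_measurable B" by measurable
  \<comment> \<open>The ratio identity compares the finite measures with density \<open>h\<close>;
    dividing by the positive function \<open>h\<close> afterwards gives back \<open>\<pi>\<close>
    and \<open>\<rho>\<close> themselves.\<close>
  have dens: "density \<rho> (\<lambda>y. ennreal (h y)) = scale_measure (ennreal c) (density \<pi> (\<lambda>y. ennreal (h y)))"
  proof (rule measure_eqI)
    fix A assume "A \<in> sets (density \<rho> (\<lambda>y. ennreal (h y)))"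
    then have A: "A \<in> sets B" by (simp add: sets)
    show "emeasure (density \<rho> (\<lambda>y. ennreal (h y))) A
      = emeasure (scale_measure (ennreal c) (density \<pi> (\<lambda>y. ennreal (h y)))) A"
      using A c m'[OF hm] by (simp add: emeasure_density sets nn[OF int(1)[OF A]] nn[OF int(2)[OF A]] eq[OF A] ennreal_mult')
  qed (simp add: sets)
  have "\<rho> = scale_measure (ennreal c) \<pi>"
  proof (rule measure_eqI)
    fix A assume "A \<in> sets \<rho>"
    then have A: "A \<in> sets B" by (simp add: sets)
    have f: "(\<lambda>y. ennreal (1 / h y) * indicator A y) \<in> borel_measurable B" using A by measurable
    have rec: "emeasure M A = (\<integral>\<^sup>+y. ennreal (1 / h y) * indicator A y \<partial>density M (\<lambda>y. ennreal (h y)))"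
      if M: "sets M = sets B" for M
    proof -
      have "(\<integral>\<^sup>+y. ennreal (1 / h y) * indicator A y \<partial>density M (\<lambda>y. ennreal (h y)))
        = (\<integral>\<^sup>+y. ennreal (h y) * (ennreal (1 / h y) * indicator A y) \<partial>M)"
        using f hm by (intro nn_integral_density) (simp_all add: measurable_cong_sets[OF M refl])
      also have "\<dots> = (\<integral>\<^sup>+y. indicator A y \<partial>M)"
        using h(2) by (intro nn_integral_cong)
          (auto simp: mult.assoc[symmetric] ennreal_mult''[symmetric] less_imp_le less_imp_neq[symmetric])
      finally show ?thesis using A M by simp
    qed
    have "emeasure \<rho> A = ennreal c * (\<integral>\<^sup>+y. ennreal (1 / h y) * indicator A y \<partial>density \<pi> (\<lambda>y. ennreal (h y)))"
      unfolding rec[OF sets(2)] dens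
      by (rule nn_integral_scale_measure) (simp add: measurable_cong_sets[OF sets(1) refl] f)
    then show "emeasure \<rho> A = emeasure (scale_measure (ennreal c) \<pi>) A"
      unfolding rec[OF sets(1), symmetric] by simp
  qed (simp add: sets)
  then show ?thesis using c by blast
qed

section \<open>Transfer to an arbitrary realization of the chain\<close>

lemma markov_chain_law:
  assumes X: "markov_chain I q x0 Q X" and x0: "x0 \<in> I"
  shows "(\<lambda>\<omega> n. X n \<omega>) \<in> Q \<rightarrow>\<^sub>M N" and "distr Q N (\<lambda>\<omega> n. X n \<omega>) = law x0"
proof -
  interpret Q: prob_space Q using X by (simp add: markov_chain_def)
  have Xm [measurable]: "X n \<in> Q \<rightarrow>\<^sub>M B" for n using X by (simp add: markov_chain_def)
  have XI: "X n \<omega> \<in> I" if "\<omega> \<in> space Q" for n \<omega>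
    using measurable_space[OF Xm that] by (simp add: space_B)
  show path [measurable]: "(\<lambda>\<omega> n. X n \<omega>) \<in> Q \<rightarrow>\<^sub>M N"
    by (rule measurable_PiM_single'[OF Xm]) (auto simp: XI space_B)
  have start: "AE \<omega> in Q. X 0 \<omega> = x0" using X by (simp add: markov_chain_def)
  have nn_distr: "(\<integral>\<^sup>+w. F w \<partial>distr Q N (\<lambda>\<omega> n. X n \<omega>)) = (\<integral>\<^sup>+\<omega>. F (\<lambda>n. X n \<omega>) \<partial>Q)"
    if "F \<in> borel_measurable N" for F
    using that by (intro nn_integral_distr path) simp
  show "distr Q N (\<lambda>\<omega> n. X n \<omega>) = law x0"
  proof (rule markov_measure_unique)
    show "prob_space (distr Q N (\<lambda>\<omega> n. X n \<omega>))" by (rule Q.prob_space_distr[OF path])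
    show "prob_space (law x0)" by (rule prob_law[OF x0])
    fix C assume C: "C \<in> sets B"
    have mC: "(\<lambda>w. indicator C (w n) :: ennreal) \<in> borel_measurable N" for n
      by (rule measurable_compose[OF component_measurable borel_measurable_indicator[OF C]])
    have "(\<integral>\<^sup>+w. indicator C (w 0) \<partial>distr Q N (\<lambda>\<omega> n. X n \<omega>)) = (\<integral>\<^sup>+\<omega>. indicator C (X 0 \<omega>) \<partial>Q)"
      by (rule nn_distr[OF mC])
    also have "\<dots> = (\<integral>\<^sup>+\<omega>. indicator C x0 \<partial>Q)"
      using start by (intro nn_integral_cong_AE) auto
    also have "\<dots> = indicator C x0" by (simp add: Q.emeasure_space_1)
    also have "\<dots> = (\<integral>\<^sup>+w. indicator C x0 \<partial>law x0)" by (simp add: emeasure_law_space[OF x0])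
    also have "\<dots> = (\<integral>\<^sup>+w. indicator C (w 0) \<partial>law x0)"
      using law_start[OF x0] by (intro nn_integral_cong_AE) auto
    finally show "(\<integral>\<^sup>+w. indicator C (w 0) \<partial>distr Q N (\<lambda>\<omega> n. X n \<omega>)) = (\<integral>\<^sup>+w. indicator C (w 0) \<partial>law x0)" .
  next
    fix n and A :: "nat \<Rightarrow> real set" and C assume A: "\<And>i. A i \<in> sets B" and C: "C \<in> sets B"
    show "(\<integral>\<^sup>+w. (\<Prod>i\<le>n. indicator (A i) (w i)) * indicator C (w (Suc n)) \<partial>law x0)
      = (\<integral>\<^sup>+w. (\<Prod>i\<le>n. indicator (A i) (w i)) * emeasure (q (w n)) C \<partial>law x0)"
      by (rule markov_property_law[OF x0 A C])
    note [measurable] = A C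
    have qC [measurable]: "(\<lambda>y. emeasure (q y) C) \<in> borel_measurable B"
      by (rule measurable_compose[OF q_measurable' measurable_emeasure_subprob_algebra[OF C]])
    have qC' [measurable]: "(\<lambda>y. measure (q y) C) \<in> borel_measurable B"
      by (rule measurable_compose[OF q_measurable' measurable_measure_subprob_algebra[OF C]])
    \<comment> \<open>This event belongs to the filtration at time \<open>n\<close>, so the
      conditional probability of the next step may be integrated over it. The result is the product
      identity demanded by \<open>markov_measure_unique\<close>.\<close>
    define G where "G = {\<omega> \<in> space Q. \<forall>i\<le>n. X i \<omega> \<in> A i}"
    have mA: "(\<lambda>w. indicator (A i) (w i) :: ennreal) \<in> borel_measurable N" for i
      by (rule measurable_compose[OF component_measurable borel_measurable_indicator[OF A]])
    have mC: "(\<lambda>w. indicator C (w (Suc n)) :: ennreal) \<in> borel_measurable N"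
      by (rule measurable_compose[OF component_measurable borel_measurable_indicator[OF C]])
    have mq: "(\<lambda>w. emeasure (q (w n)) C) \<in> borel_measurable N"
      by (rule measurable_compose[OF component_measurable qC])
    let ?F = "natural_filtration I Q X n"
    have gen: "{X i -` A \<inter> space Q | i A. i \<le> n \<and> A \<in> sets B} \<subseteq> Pow (space Q)" by auto
    have sets_F: "sets ?F = sigma_sets (space Q) {X i -` A \<inter> space Q | i A. i \<le> n \<and> A \<in> sets B}"
      unfolding natural_filtration_def by (rule sets_measure_of[OF gen])
    have FQ: "sets ?F \<subseteq> sets Q"
      unfolding sets_F by (intro sets.sigma_sets_subset) (auto intro: measurable_sets[OF Xm])
    then have sub: "subalgebra Q ?F"
      by (simp add: subalgebra_def natural_filtration_def space_measure_of[OF gen])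
    have GF: "G \<in> sets ?F"
    proof -
      have "X i -` A i \<inter> space Q \<in> sets ?F" if "i \<le> n" for i
        unfolding sets_F using that A by (intro sigma_sets.Basic) blast
      then have "(\<Inter>i\<in>{..n}. X i -` A i \<inter> space Q) \<in> sets ?F"
        by (intro sets.finite_INT) auto
      also have "(\<Inter>i\<in>{..n}. X i -` A i \<inter> space Q) = G" by (auto simp: G_def)
      finally show ?thesis .
    qed
    have S: "sigma_finite_subalgebra Q ?F"
      by (intro finite_measure_subalgebra_is_sigma_finite finite_measure_subalgebra.intro
          finite_measure_subalgebra_axioms.intro Q.finite_measure_axioms sub)
    have GQ [measurable]: "G \<in> sets Q" by (rule subsetD[OF FQ GF])
    let ?f = "\<lambda>\<omega>. indicator C (X (Suc n) \<omega>) :: real"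
    have int_f: "integrable Q ?f"
      by (rule Q.integrable_const_bound[where B = 1]) (auto intro!: AE_I2)
    have ce: "AE \<omega> in Q. real_cond_exp Q ?F ?f \<omega> = measure (q (X n \<omega>)) C"
      using X C by (simp add: markov_chain_def)
    have "(\<integral>\<omega>\<in>G. ?f \<omega> \<partial>Q) = (\<integral>\<omega>\<in>G. real_cond_exp Q ?F ?f \<omega> \<partial>Q)"
      by (rule sigma_finite_subalgebra.real_cond_exp_intA[OF S int_f GF])
    also have "\<dots> = (\<integral>\<omega>\<in>G. measure (q (X n \<omega>)) C \<partial>Q)"
      unfolding set_lebesgue_integral_def
    proof (rule integral_cong_AE)
      have "real_cond_exp Q ?F ?f \<in> borel_measurable Q" by (rule borel_measurable_cond_exp2)
      then show "(\<lambda>\<omega>. indicator G \<omega> *\<^sub>R real_cond_exp Q ?F ?f \<omega>) \<in> borel_measurable Q"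
        using GQ by measurable
      show "(\<lambda>\<omega>. indicator G \<omega> *\<^sub>R measure (q (X n \<omega>)) C) \<in> borel_measurable Q"
        using GQ measurable_compose[OF Xm qC'] by measurable
    qed (use ce in auto)
    finally have eq: "(\<integral>\<omega>. indicator G \<omega> * ?f \<omega> \<partial>Q) = (\<integral>\<omega>. indicator G \<omega> * measure (q (X n \<omega>)) C \<partial>Q)"
      by (simp add: set_lebesgue_integral_def)
    have em: "emeasure (q y) C = ennreal (measure (q y) C)" if "y \<in> I" for y
      using prob_q[OF that] by (simp add: finite_measure.emeasure_eq_measure prob_space.finite_measure)
    have ind: "(\<Prod>i\<le>n. indicator (A i) (X i \<omega>)) = (indicator G \<omega> :: ennreal)" if "\<omega> \<in> space Q" for \<omega>
      using that by (auto simp: indicator_def G_def)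
    have int1: "integrable Q (\<lambda>\<omega>. indicator G \<omega> * ?f \<omega>)"
      by (rule Q.integrable_const_bound[where B = 1]) (auto intro!: AE_I2 simp: indicator_def)
    have int2: "integrable Q (\<lambda>\<omega>. indicator G \<omega> * measure (q (X n \<omega>)) C)"
      by (rule Q.integrable_const_bound[where B = 1])
         (auto intro!: AE_I2 simp: indicator_def prob_space.prob_le_1[OF prob_q[OF XI]])
    have "(\<integral>\<^sup>+w. (\<Prod>i\<le>n. indicator (A i) (w i)) * indicator C (w (Suc n)) \<partial>distr Q N (\<lambda>\<omega> n. X n \<omega>))
      = (\<integral>\<^sup>+\<omega>. (\<Prod>i\<le>n. indicator (A i) (X i \<omega>)) * indicator C (X (Suc n) \<omega>) \<partial>Q)"
      by (intro nn_distr borel_measurable_times_ennreal borel_measurable_prod_ennreal mA mC)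
    also have "\<dots> = (\<integral>\<^sup>+\<omega>. ennreal (indicator G \<omega> * ?f \<omega>) \<partial>Q)"
      by (rule nn_integral_cong) (simp only: ind, simp split: split_indicator)
    also have "\<dots> = ennreal (\<integral>\<omega>. indicator G \<omega> * measure (q (X n \<omega>)) C \<partial>Q)"
      unfolding eq[symmetric] using int1 by (intro nn_integral_eq_integral) auto
    also have "\<dots> = (\<integral>\<^sup>+\<omega>. ennreal (indicator G \<omega> * measure (q (X n \<omega>)) C) \<partial>Q)"
      using int2 by (intro nn_integral_eq_integral[symmetric]) auto
    also have "\<dots> = (\<integral>\<^sup>+\<omega>. (\<Prod>i\<le>n. indicator (A i) (X i \<omega>)) * emeasure (q (X n \<omega>)) C \<partial>Q)"
      by (rule nn_integral_cong) (simp only: ind em[OF XI], simp split: split_indicator)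
    also have "\<dots> = (\<integral>\<^sup>+w. (\<Prod>i\<le>n. indicator (A i) (w i)) * emeasure (q (w n)) C \<partial>distr Q N (\<lambda>\<omega> n. X n \<omega>))"
      by (intro nn_distr[symmetric] borel_measurable_times_ennreal borel_measurable_prod_ennreal mA mq)
    finally show "(\<integral>\<^sup>+w. (\<Prod>i\<le>n. indicator (A i) (w i)) * indicator C (w (Suc n)) \<partial>distr Q N (\<lambda>\<omega> n. X n \<omega>))
      = (\<integral>\<^sup>+w. (\<Prod>i\<le>n. indicator (A i) (w i)) * emeasure (q (w n)) C \<partial>distr Q N (\<lambda>\<omega> n. X n \<omega>))" .
  qed (rule sets_distr sets_law)+
qed

theorem ratio_limit_markov_chain:
  fixes f g :: "real \<Rightarrow> real"
  assumes "invariant_measure I q \<pi>" "integrable \<pi> f" "integrable \<pi> g" "(\<integral>y. g y \<partial>\<pi>) \<noteq> 0"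
    and "x0 \<in> I" "markov_chain I q x0 Q X"
  shows "AE \<omega> in Q. (\<lambda>r. (\<Sum>k=0..r. f (X k \<omega>)) / (\<Sum>k=0..r. g (X k \<omega>)))
    \<longlonglongrightarrow> (\<integral>y. f y \<partial>\<pi>) / (\<integral>y. g y \<partial>\<pi>)"
proof -
  have "AE w in distr Q N (\<lambda>\<omega> n. X n \<omega>). (\<lambda>r. (\<Sum>k=0..r. f (w k)) / (\<Sum>k=0..r. g (w k)))
    \<longlonglongrightarrow> (\<integral>y. f y \<partial>\<pi>) / (\<integral>y. g y \<partial>\<pi>)"
    unfolding markov_chain_law(2)[OF assms(6,5)] by (rule ratio_limit[OF assms(1-5)])
  then show ?thesis
    by (rule AE_distrD[OF markov_chain_law(1)[OF assms(6,5)]])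
qed

end

section \<open>Minorization\<close>

context feller_chain
begin

abbreviation two_step :: "real \<Rightarrow> real measure" where
  "two_step x \<equiv> q x \<bind> q"

text \<open>By the strong Feller property it suffices to dominate \<open>q x\<close> for \<open>x\<close> in a countable dense set.\<close>

lemma dominating_measure:
  obtains \<Lambda> where "\<Lambda> \<in> space (prob_algebra B)"
    "\<And>x A. x \<in> I \<Longrightarrow> A \<in> sets B \<Longrightarrow> emeasure \<Lambda> A = 0 \<Longrightarrow> emeasure (q x) A = 0"
proof -
  obtain T where T: "countable T" "T \<subseteq> I" "I \<subseteq> closure T" using separable[of I] by blast
  have "T \<noteq> {}" using T(3) zero_in_I by auto
  define d where "d = from_nat_into T"
  have d: "d k \<in> I" for k using from_nat_into[OF \<open>T \<noteq> {}\<close>] T(2) by (auto simp: d_def)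
  have range_d: "range d = T" unfolding d_def by (rule range_from_nat_into[OF \<open>T \<noteq> {}\<close> T(1)])
  \<comment> \<open>Any law on the naturals that charges every number would do; its weights turn the
    dense sequence of kernels into one probability measure dominating all of them.\<close>
  let ?g = "measure_pmf (geometric_pmf (1/2))"
  have qd: "(\<lambda>k. q (d k)) \<in> ?g \<rightarrow>\<^sub>M prob_algebra B"
    using q_prob[OF d] by auto
  have g: "?g \<in> space (prob_algebra (count_space UNIV))"
    by (simp add: space_prob_algebra measure_pmf.prob_space_axioms)
  have qd': "(\<lambda>k. q (d k)) \<in> count_space UNIV \<rightarrow>\<^sub>M prob_algebra B"
    using q_prob[OF d] by auto
  define \<Lambda> where "\<Lambda> = ?g \<bind> (\<lambda>k. q (d k))"
  have em: "emeasure \<Lambda> A = (\<integral>\<^sup>+k. emeasure (q (d k)) A \<partial>?g)" if "A \<in> sets B" for A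
    unfolding \<Lambda>_def by (rule emeasure_bind_prob_algebra[OF g qd' that])
  show thesis
  proof (rule that[of \<Lambda>])
    show "\<Lambda> \<in> space (prob_algebra B)"
      unfolding \<Lambda>_def using prob_space_bind'[OF g qd'] sets_bind'[OF g qd'] by (simp add: space_prob_algebra)
    fix x A assume x: "x \<in> I" and A: "A \<in> sets B" and "emeasure \<Lambda> A = 0"
    then have "AE k in ?g. emeasure (q (d k)) A = 0"
      unfolding em[OF A] by (subst (asm) nn_integral_0_iff_AE) auto
    then have z: "emeasure (q (d k)) A = 0" for k
      by (simp add: AE_measure_pmf_iff set_pmf_geometric)
    have cl: "closure T = I" using T closed_I closure_minimal by blast
    have "measure (q x) A = 0"
    proof (rule continuous_constant_on_closure[where f = "\<lambda>x. measure (q x) A" and S = T and x = x])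
      show "continuous_on (closure T) (\<lambda>x. measure (q x) A)" unfolding cl by (rule feller_set[OF A])
      show "x \<in> closure T" using x cl by simp
      show "measure (q y) A = 0" if "y \<in> T" for y
        using that range_d z by (auto simp: measure_def)
    qed
    then show "emeasure (q x) A = 0"
      using prob_q[OF x] by (simp add: finite_measure.emeasure_eq_measure prob_space.finite_measure)
  qed
qed

lemma sections_measurable:
  "E \<in> sets (B \<Otimes>\<^sub>M B) \<Longrightarrow> Pair y -` E \<in> sets B"
  by (rule sets_Pair1)

text \<open>Differentiating each \<open>q y\<close> separately would give no measurability in
  \<open>y\<close>. Instead the joint law \<open>R\<close> of a \<open>\<Lambda>\<close>-distributed
  point and its successor is differentiated once with respect to the product measure. The price is
  an exceptional null set of points \<open>y\<close> that depends on \<open>A\<close>.\<close>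

lemma transition_density:
  assumes \<Lambda>: "\<Lambda> \<in> space (prob_algebra B)"
    and dom: "\<And>x A. x \<in> I \<Longrightarrow> A \<in> sets B \<Longrightarrow> emeasure \<Lambda> A = 0 \<Longrightarrow> emeasure (q x) A = 0"
  obtains p :: "real \<times> real \<Rightarrow> ennreal" where "p \<in> borel_measurable (B \<Otimes>\<^sub>M B)"
    "\<And>A. A \<in> sets B \<Longrightarrow> AE y in \<Lambda>. emeasure (q y) A = (\<integral>\<^sup>+w. p (y, w) * indicator A w \<partial>\<Lambda>)"
proof -
  interpret L: prob_space \<Lambda> using \<Lambda> by (simp add: space_prob_algebra)
  have sets_\<Lambda>: "sets \<Lambda> = sets B" using \<Lambda> by (simp add: space_prob_algebra)
  have space_\<Lambda>: "space \<Lambda> = I" using sets_eq_imp_space_eq[OF sets_\<Lambda>] by (simp add: space_B)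
  interpret LL: pair_prob_space \<Lambda> \<Lambda> ..
  have sets_LL: "sets (\<Lambda> \<Otimes>\<^sub>M \<Lambda>) = sets (B \<Otimes>\<^sub>M B)" by (rule sets_pair_measure_cong[OF sets_\<Lambda> sets_\<Lambda>])
  define k where "k y = distr (q y) (B \<Otimes>\<^sub>M B) (Pair y)" for y
  have k: "k \<in> B \<rightarrow>\<^sub>M prob_algebra (B \<Otimes>\<^sub>M B)"
    unfolding k_def[abs_def] by (rule measurable_distr_prob_space2[OF q_measurable]) simp
  have em_k: "emeasure (k y) E = emeasure (q y) (Pair y -` E)" if y: "y \<in> I" and E: "E \<in> sets (B \<Otimes>\<^sub>M B)" for y E
  proof -
    have "Pair y \<in> q y \<rightarrow>\<^sub>M B \<Otimes>\<^sub>M B"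
      using y unfolding measurable_cong_sets[OF sets_q[OF y] refl] by (intro measurable_Pair1') (simp add: space_B)
    then have "emeasure (k y) E = emeasure (q y) (Pair y -` E \<inter> space (q y))"
      unfolding k_def using E by (rule emeasure_distr)
    also have "Pair y -` E \<inter> space (q y) = Pair y -` E"
      using sets.sets_into_space[OF E] by (auto simp: space_pair_measure space_B space_q[OF y])
    finally show ?thesis .
  qed
  define R where "R = \<Lambda> \<bind> k"
  have sets_R: "sets R = sets (B \<Otimes>\<^sub>M B)" unfolding R_def by (rule sets_bind'[OF \<Lambda> k])
  have em_R: "emeasure R E = (\<integral>\<^sup>+y. emeasure (q y) (Pair y -` E) \<partial>\<Lambda>)" if E: "E \<in> sets (B \<Otimes>\<^sub>M B)" for E
    unfolding R_def emeasure_bind_prob_algebra[OF \<Lambda> k E]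
    by (intro nn_integral_cong em_k E) (simp add: space_\<Lambda>)
  \<comment> \<open>By Fubini a null set of the product has null sections at almost every
    \<open>y\<close>, and domination makes these sections null for \<open>q y\<close>.\<close>
  have ac: "absolutely_continuous (\<Lambda> \<Otimes>\<^sub>M \<Lambda>) R"
    unfolding absolutely_continuous_def
  proof
    fix E assume "E \<in> null_sets (\<Lambda> \<Otimes>\<^sub>M \<Lambda>)"
    then have E: "E \<in> sets (\<Lambda> \<Otimes>\<^sub>M \<Lambda>)" and z: "emeasure (\<Lambda> \<Otimes>\<^sub>M \<Lambda>) E = 0" by auto
    have EB: "E \<in> sets (B \<Otimes>\<^sub>M B)" using E sets_LL by simp
    have "(\<integral>\<^sup>+y. emeasure \<Lambda> (Pair y -` E) \<partial>\<Lambda>) = 0"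
      using z L.emeasure_pair_measure_alt[OF E] by simp
    then have "AE y in \<Lambda>. emeasure \<Lambda> (Pair y -` E) = 0"
      using L.measurable_emeasure_Pair[OF E] by (simp add: nn_integral_0_iff_AE)
    then have "AE y in \<Lambda>. emeasure (q y) (Pair y -` E) = 0"
      using AE_space by eventually_elim (use dom sections_measurable[OF EB] space_\<Lambda> in blast)
    then have "emeasure R E = (\<integral>\<^sup>+y. 0 \<partial>\<Lambda>)"
      unfolding em_R[OF EB] by (rule nn_integral_cong_AE)
    then show "E \<in> null_sets R" using EB sets_R by (simp add: null_setsI)
  qed
  define p where "p = RN_deriv (\<Lambda> \<Otimes>\<^sub>M \<Lambda>) R"
  have pm': "p \<in> borel_measurable (\<Lambda> \<Otimes>\<^sub>M \<Lambda>)" unfolding p_def by (rule borel_measurable_RN_deriv)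
  have dens: "density (\<Lambda> \<Otimes>\<^sub>M \<Lambda>) p = R"
    unfolding p_def by (rule LL.density_RN_deriv[OF ac]) (simp add: sets_R sets_LL)
  show thesis
  proof (rule that)
    show pm: "p \<in> borel_measurable (B \<Otimes>\<^sub>M B)" using pm' unfolding measurable_cong_sets[OF sets_LL refl] .
    fix A assume A: "A \<in> sets B"
    let ?f = "\<lambda>y. emeasure (q y) A" and ?g = "\<lambda>y. \<integral>\<^sup>+w. p (y, w) * indicator A w \<partial>\<Lambda>"
    have f: "?f \<in> borel_measurable \<Lambda>"
      unfolding measurable_cong_sets[OF sets_\<Lambda> refl]
      by (rule measurable_compose[OF q_measurable' measurable_emeasure_subprob_algebra[OF A]])
    have indA: "(\<lambda>z. indicator A (snd z) :: ennreal) \<in> borel_measurable (\<Lambda> \<Otimes>\<^sub>M \<Lambda>)"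
      using A sets_\<Lambda> by (intro measurable_compose[OF measurable_snd borel_measurable_indicator]) simp
    have pA: "(\<lambda>z. p z * indicator A (snd z)) \<in> borel_measurable (\<Lambda> \<Otimes>\<^sub>M \<Lambda>)"
      by (intro borel_measurable_times_ennreal pm' indA)
    have g: "?g \<in> borel_measurable \<Lambda>"
      using L.borel_measurable_nn_integral_fst[OF pA] by simp
    have "density \<Lambda> ?f = density \<Lambda> ?g"
    proof (rule measure_eqI)
      fix A1 assume "A1 \<in> sets (density \<Lambda> ?f)"
      then have A1: "A1 \<in> sets \<Lambda>" "A1 \<in> sets B" using sets_\<Lambda> by auto
      have A12: "A1 \<times> A \<in> sets (B \<Otimes>\<^sub>M B)" using A1 A by (intro pair_measureI)
      have "(\<integral>\<^sup>+y. ?f y * indicator A1 y \<partial>\<Lambda>) = emeasure R (A1 \<times> A)"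
        unfolding em_R[OF A12] by (intro nn_integral_cong) (auto split: split_indicator)
      also have "\<dots> = (\<integral>\<^sup>+z. p z * indicator (A1 \<times> A) z \<partial>(\<Lambda> \<Otimes>\<^sub>M \<Lambda>))"
        unfolding dens[symmetric] using A12 sets_LL by (intro emeasure_density pm') simp
      also have "\<dots> = (\<integral>\<^sup>+y. \<integral>\<^sup>+w. p (y, w) * indicator (A1 \<times> A) (y, w) \<partial>\<Lambda> \<partial>\<Lambda>)"
        using A12 sets_LL by (intro L.nn_integral_fst[symmetric] borel_measurable_times_ennreal pm' borel_measurable_indicator) simp
      also have "\<dots> = (\<integral>\<^sup>+y. ?g y * indicator A1 y \<partial>\<Lambda>)"
      proof (rule nn_integral_cong)
        fix y assume "y \<in> space \<Lambda>"
        show "(\<integral>\<^sup>+w. p (y, w) * indicator (A1 \<times> A) (y, w) \<partial>\<Lambda>) = ?g y * indicator A1 y"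
          by (cases "y \<in> A1") (simp_all add: indicator_def)
      qed
      finally show "emeasure (density \<Lambda> ?f) A1 = emeasure (density \<Lambda> ?g) A1"
        using A1 f g by (simp add: emeasure_density)
    qed simp
    then show "AE y in \<Lambda>. ?f y = ?g y" using f g by (simp add: L.density_unique_iff)
  qed
qed

text \<open>In one step, a common minorizing measure near a point need not exist. In two steps it does:
  with the truncated transition density \<open>p \<and> 1\<close>, the function \<open>z \<mapsto> \<integral> (p(y, w) \<and> 1) q(z, dy)\<close>
  is continuous for every fixed \<open>w\<close>, so positivity at \<open>0\<close> spreads to a neighbourhood whose size
  can be chosen uniformly on a set of \<open>w\<close> of positive measure.\<close>

theorem minorization:
  obtains \<nu> s r where "\<nu> \<in> space (prob_algebra B)" "emeasure \<nu> (I - {-r..r}) = 0"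
    "continuous_on I s" "\<And>x. 0 \<le> s x" "s 0 > (0::real)"
    "\<And>x A. x \<in> I \<Longrightarrow> A \<in> sets B \<Longrightarrow> ennreal (s x) * emeasure \<nu> A \<le> emeasure (two_step x) A"
proof -
  obtain \<Lambda> where \<Lambda>: "\<Lambda> \<in> space (prob_algebra B)"
    and dom: "\<And>x A. x \<in> I \<Longrightarrow> A \<in> sets B \<Longrightarrow> emeasure \<Lambda> A = 0 \<Longrightarrow> emeasure (q x) A = 0"
    using dominating_measure by blast
  obtain p :: "real \<times> real \<Rightarrow> ennreal" where p: "p \<in> borel_measurable (B \<Otimes>\<^sub>M B)"
    and p_dens: "\<And>A. A \<in> sets B \<Longrightarrow> AE y in \<Lambda>. emeasure (q y) A = (\<integral>\<^sup>+w. p (y, w) * indicator A w \<partial>\<Lambda>)"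
    using transition_density[OF \<Lambda> dom] by blast
  interpret L: prob_space \<Lambda> using \<Lambda> by (simp add: space_prob_algebra)
  have sets_\<Lambda>: "sets \<Lambda> = sets B" using \<Lambda> by (simp add: space_prob_algebra)
  have space_\<Lambda>: "space \<Lambda> = I" using sets_eq_imp_space_eq[OF sets_\<Lambda>] by (simp add: space_B)
  \<comment> \<open>Domination makes the exceptional sets of the density harmless: after one step
    from any point \<open>x\<close> they are avoided almost surely. This is where the first of the
    two steps is used.\<close>
  have AE_q: "AE y in q x. Q y" if x: "x \<in> I" and Q: "AE y in \<Lambda>. Q y" for x Q
  proof -
    obtain Z where Z: "{y \<in> space \<Lambda>. \<not> Q y} \<subseteq> Z" "emeasure \<Lambda> Z = 0" "Z \<in> sets \<Lambda>"
      using AE_E[OF Q] by blast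
    then have "emeasure (q x) Z = 0" using dom[OF x, of Z] sets_\<Lambda> by simp
    then show ?thesis
      using Z sets_\<Lambda> sets_q[OF x] space_\<Lambda> space_q[OF x] by (intro AE_I[of _ _ Z]) auto
  qed
  \<comment> \<open>Truncation makes the integrand bounded, as the strong Feller property requires,
    and loses no positivity: \<open>p1\<close> vanishes exactly where \<open>p\<close> does.\<close>
  define p1 where "p1 z = min (p z) 1" for z
  have p1: "p1 \<in> borel_measurable (B \<Otimes>\<^sub>M B)" unfolding p1_def using p by measurable
  have p1': "p1 \<in> borel_measurable (q x \<Otimes>\<^sub>M \<Lambda>)" if x: "x \<in> I" for x
    using p1 unfolding measurable_cong_sets[OF sets_pair_measure_cong[OF sets_q[OF x] sets_\<Lambda>] refl] .
  have two_step: "emeasure (two_step x) A = (\<integral>\<^sup>+y. \<integral>\<^sup>+w. p (y, w) * indicator A w \<partial>\<Lambda> \<partial>q x)"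
    if x: "x \<in> I" and A: "A \<in> sets B" for x A
    unfolding emeasure_bind_prob_algebra[OF q_prob[OF x] q_measurable A]
    by (rule nn_integral_cong_AE[OF AE_q[OF x p_dens[OF A]]])
  define H where "H w x = (\<integral>\<^sup>+y. p1 (y, w) \<partial>q x)" for w x
  have p1w: "(\<lambda>y. p1 (y, w)) \<in> borel_measurable B" if w: "w \<in> I" for w
    using measurable_compose[OF measurable_Pair2'[of w B B] p1] w by (simp add: space_B)
  have p1w': "(\<lambda>y. p1 (y, w)) \<in> borel_measurable (q x)" if "w \<in> I" "x \<in> I" for w x
    using p1w[OF that(1)] unfolding measurable_cong_sets[OF sets_q[OF that(2)] refl] .
  have H_le: "H w x \<le> 1" if x: "x \<in> I" for w x
  proof -
    interpret prob_space "q x" using prob_q[OF x] .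
    have "H w x \<le> (\<integral>\<^sup>+y. 1 \<partial>q x)" unfolding H_def p1_def by (intro nn_integral_mono) simp
    then show ?thesis by (simp add: emeasure_space_1)
  qed
  define h where "h w x = (\<integral>y. enn2real (p1 (y, w)) \<partial>q x)" for w x
  have h_cont: "continuous_on I (h w)" if w: "w \<in> I" for w
    unfolding h_def
  proof (rule strong_feller)
    show "(\<lambda>y. enn2real (p1 (y, w))) \<in> borel_measurable B" using p1w[OF w] by measurable
    show "\<bar>enn2real (p1 (y, w))\<bar> \<le> 1" for y
      using enn2real_mono[of "p1 (y, w)" 1] by (simp add: p1_def)
  qed
  have h_nonneg: "0 \<le> h w x" for w x unfolding h_def by (intro integral_nonneg_AE) auto
  have H_h: "H w x = ennreal (h w x)" if w: "w \<in> I" and x: "x \<in> I" for w x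
  proof -
    have "H w x = (\<integral>\<^sup>+y. ennreal (enn2real (p1 (y, w))) \<partial>q x)"
      unfolding H_def by (intro nn_integral_cong) (simp add: p1_def min_less_iff_disj)
    also have "\<dots> = ennreal (\<integral>y. enn2real (p1 (y, w)) \<partial>q x)"
    proof (rule nn_integral_q_eq[OF x, where c = 1])
      show "(\<lambda>y. enn2real (p1 (y, w))) \<in> borel_measurable B" using p1w[OF w] by measurable
      show "enn2real (p1 (y, w)) \<le> 1" for y
        using enn2real_mono[of "p1 (y, w)" 1] by (simp add: p1_def)
    qed simp
    finally show ?thesis by (simp add: h_def)
  qed
  have H_meas: "(\<lambda>w. H w x) \<in> borel_measurable B" if x: "x \<in> I" for x
  proof -
    interpret prob_space "q x" using prob_q[OF x] .
    interpret PP: pair_prob_space \<Lambda> "q x" ..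
    have "(\<lambda>z. p1 (snd z, fst z)) \<in> borel_measurable (\<Lambda> \<Otimes>\<^sub>M q x)"
      using p1'[OF x] by (rule measurable_compose_rev) measurable
    then have "(\<lambda>w. \<integral>\<^sup>+y. p1 (y, w) \<partial>q x) \<in> borel_measurable \<Lambda>"
      using borel_measurable_nn_integral_fst[of "\<lambda>z. p1 (snd z, fst z)" \<Lambda>] by simp
    then show ?thesis unfolding H_def measurable_cong_sets[OF sets_\<Lambda> refl] .
  qed
  have minor_H: "(\<integral>\<^sup>+w. H w x * indicator A w \<partial>\<Lambda>) \<le> emeasure (two_step x) A"
    and fubini_H: "(\<integral>\<^sup>+w. H w x * indicator A w \<partial>\<Lambda>) = (\<integral>\<^sup>+y. \<integral>\<^sup>+w. p1 (y, w) * indicator A w \<partial>\<Lambda> \<partial>q x)"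
    if x: "x \<in> I" and A: "A \<in> sets B" for x A
  proof -
    interpret Q: prob_space "q x" using prob_q[OF x] .
    interpret PP: pair_prob_space "q x" \<Lambda> ..
    have "(\<integral>\<^sup>+w. H w x * indicator A w \<partial>\<Lambda>) = (\<integral>\<^sup>+w. \<integral>\<^sup>+y. p1 (y, w) * indicator A w \<partial>q x \<partial>\<Lambda>)"
      unfolding H_def
      by (intro nn_integral_cong nn_integral_multc[symmetric] p1w' x) (simp add: space_\<Lambda>)
    also have "\<dots> = (\<integral>\<^sup>+y. \<integral>\<^sup>+w. p1 (y, w) * indicator A w \<partial>\<Lambda> \<partial>q x)"
    proof (rule PP.Fubini')
      have "(\<lambda>z. indicator A (snd z) :: ennreal) \<in> borel_measurable (q x \<Otimes>\<^sub>M \<Lambda>)"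
        using A sets_\<Lambda> by (intro measurable_compose[OF measurable_snd borel_measurable_indicator]) simp
      then show "(\<lambda>(y, w). p1 (y, w) * indicator A w) \<in> borel_measurable (q x \<Otimes>\<^sub>M \<Lambda>)"
        using p1'[OF x] by (simp add: split_beta' borel_measurable_times_ennreal)
    qed
    finally show eq: "(\<integral>\<^sup>+w. H w x * indicator A w \<partial>\<Lambda>) = (\<integral>\<^sup>+y. \<integral>\<^sup>+w. p1 (y, w) * indicator A w \<partial>\<Lambda> \<partial>q x)" .
    show "(\<integral>\<^sup>+w. H w x * indicator A w \<partial>\<Lambda>) \<le> emeasure (two_step x) A"
      unfolding eq two_step[OF x A] p1_def by (intro nn_integral_mono mult_right_mono) auto
  qed
  obtain T where T: "countable T" "T \<subseteq> I" "I \<subseteq> closure T" using separable[of I] by blast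
  \<comment> \<open>The infimum runs over a countable dense set so that it is measurable in
    \<open>w\<close>; continuity of \<open>h w\<close> extends the bound to all \<open>x\<close> in
    the window (\<open>m_le\<close>). The value 1 outside the window never lowers the infimum, since
    \<open>H\<close> is at most 1.\<close>
  define m where "m n w = (INF z\<in>T. if \<bar>z\<bar> < 1 / real (Suc n) then H w z else 1)" for n w
  have m_meas: "m n \<in> borel_measurable B" for n
    unfolding m_def using T H_meas by (intro borel_measurable_INF) auto
  have m_le: "m n w \<le> H w x" if w: "w \<in> I" and x: "x \<in> I" "\<bar>x\<bar> < 1 / real (Suc n)" for n w x
  proof (rule ennreal_le_epsilon)
    fix e :: real assume e: "e > 0"
    obtain a where a: "a > 0" "\<And>z. z \<in> I \<Longrightarrow> dist z x < a \<Longrightarrow> dist (h w z) (h w x) < e"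
      using h_cont[OF w] x(1) e unfolding continuous_on_iff by blast
    define b where "b = min a (1 / real (Suc n) - \<bar>x\<bar>)"
    have "b > 0" using a x by (simp add: b_def)
    then obtain z where z: "z \<in> T" "dist z x < b"
      using T(3) x(1) closure_approachable by blast
    have "\<bar>z - x\<bar> < 1 / real (Suc n) - \<bar>x\<bar>" using z(2) unfolding b_def dist_real_def by simp
    then have "\<bar>z\<bar> < 1 / real (Suc n)" by linarith
    then have "m n w \<le> H w z" unfolding m_def using z(1) by (intro INF_lower2[of z]) auto
    also have "\<dots> \<le> ennreal (h w x + e)"
    proof -
      have zI: "z \<in> I" using z(1) T(2) by blast
      have "dist z x < a" using z(2) by (simp add: b_def)
      then have "h w z \<le> h w x + e" using a(2)[OF zI] by (simp add: dist_real_def)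
      then show ?thesis unfolding H_h[OF w zI] by (rule ennreal_leI)
    qed
    also have "\<dots> = H w x + ennreal e" using H_h[OF w x(1)] e h_nonneg by simp
    finally show "m n w \<le> H w x + ennreal e" .
  qed
  have m_ge: "\<exists>n0. \<forall>n\<ge>n0. 0 < m n w" if w: "w \<in> I" and pos: "0 < H w 0" for w
  proof -
    have hp: "0 < h w 0" using pos H_h[OF w zero_in_I] by simp
    obtain a where a: "a > 0" "\<And>z. z \<in> I \<Longrightarrow> dist z 0 < a \<Longrightarrow> dist (h w z) (h w 0) < h w 0 / 2"
      using h_cont[OF w] zero_in_I hp unfolding continuous_on_iff by (meson half_gt_zero)
    obtain n0 where n0: "1 / real (Suc n0) < a" using a(1) nat_approx_posE by blast
    have "0 < m n w" if "n \<ge> n0" for n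
    proof -
      have "1 / real (Suc n) \<le> 1 / real (Suc n0)" using that by (simp add: frac_le)
      then have n: "1 / real (Suc n) < a" using n0 by simp
      have "min 1 (ennreal (h w 0 / 2)) \<le> m n w"
        unfolding m_def
      proof (rule INF_greatest)
        fix z assume z: "z \<in> T"
        show "min 1 (ennreal (h w 0 / 2)) \<le> (if \<bar>z\<bar> < 1 / real (Suc n) then H w z else 1)"
        proof (cases "\<bar>z\<bar> < 1 / real (Suc n)")
          case True
          have zI: "z \<in> I" using z T(2) by blast
          have "dist (h w z) (h w 0) < h w 0 / 2" using a(2)[OF zI] True n by (simp add: dist_real_def)
          then have "h w 0 / 2 \<le> h w z" unfolding dist_real_def by linarith
          then show ?thesis using True H_h[OF w zI] by (auto intro!: min.coboundedI2 ennreal_leI)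
        qed simp
      qed
      moreover have "0 < min 1 (ennreal (h w 0 / 2))" using hp by simp
      ultimately show ?thesis by (rule less_le_trans[rotated])
    qed
    then show ?thesis by blast
  qed
  \<comment> \<open>The same index fixes the window around 0 and the cut-off in \<open>w\<close>;
    the cut-off gives the minorizing measure bounded support.\<close>
  define f where "f n w = m n w * indicator {- real n..real n} w" for n w
  have f_meas: "f n \<in> borel_measurable B" for n
  proof -
    have "(indicator {- real n..real n} :: _ \<Rightarrow> ennreal) \<in> borel_measurable B"
      by (intro measurable_restrict_space1 borel_measurable_indicator) simp
    then show ?thesis unfolding f_def using m_meas by (intro borel_measurable_times_ennreal)
  qed
  have f_meas': "f n \<in> borel_measurable \<Lambda>" for n
    using f_meas unfolding measurable_cong_sets[OF sets_\<Lambda> refl] .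
  \<comment> \<open>If all these integrals vanished, then \<open>H w 0 = 0\<close> for almost every
    \<open>w\<close>. After one step from 0 the truncated density, and with it \<open>p\<close>,
    would vanish almost everywhere, leaving no mass for the second step.\<close>
  have "\<exists>n. (\<integral>\<^sup>+w. f n w \<partial>\<Lambda>) \<noteq> 0"
  proof (rule ccontr)
    assume "\<not> ?thesis"
    then have "AE w in \<Lambda>. f n w = 0" for n
      using nn_integral_0_iff_AE[OF f_meas'[of n]] by simp
    then have "AE w in \<Lambda>. \<forall>n. f n w = 0" by (simp add: AE_all_countable)
    then have "AE w in \<Lambda>. H w 0 = 0"
      using AE_space
    proof eventually_elim
      case (elim w)
      show ?case
      proof (rule ccontr)
        assume "H w 0 \<noteq> 0"
        then have "0 < H w 0" by (simp add: zero_less_iff_neq_zero)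
        then obtain n0 where n0: "\<And>n. n \<ge> n0 \<Longrightarrow> 0 < m n w" using m_ge elim space_\<Lambda> by blast
        obtain n1 where n1: "\<bar>w\<bar> \<le> real n1" using real_arch_simple by blast
        define n where "n = max n0 n1"
        have "w \<in> {- real n..real n}" using n1 by (auto simp: n_def)
        then have "f n w = m n w" by (simp add: f_def)
        then show False using n0[of n] elim by (simp add: n_def)
      qed
    qed
    then have "(\<integral>\<^sup>+w. H w 0 * indicator I w \<partial>\<Lambda>) = (\<integral>\<^sup>+w. 0 \<partial>\<Lambda>)"
      by (intro nn_integral_cong_AE) auto
    then have "(\<integral>\<^sup>+y. \<integral>\<^sup>+w. p1 (y, w) * indicator I w \<partial>\<Lambda> \<partial>q 0) = 0"
      using fubini_H[OF zero_in_I, of I] by (simp add: sets_B_iff)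
    moreover have "(\<lambda>y. \<integral>\<^sup>+w. p1 (y, w) * indicator I w \<partial>\<Lambda>) \<in> borel_measurable (q 0)"
    proof -
      have "(\<lambda>z. indicator I (snd z) :: ennreal) \<in> borel_measurable (q 0 \<Otimes>\<^sub>M \<Lambda>)"
        using sets_\<Lambda> by (intro measurable_compose[OF measurable_snd borel_measurable_indicator]) (simp add: sets_B_iff)
      then have "(\<lambda>z. p1 z * indicator I (snd z)) \<in> borel_measurable (q 0 \<Otimes>\<^sub>M \<Lambda>)"
        using p1'[OF zero_in_I] by (intro borel_measurable_times_ennreal)
      then show ?thesis
        using L.borel_measurable_nn_integral_fst[of "\<lambda>z. p1 z * indicator I (snd z)" "q 0"] by simp
    qed
    ultimately have "AE y in q 0. (\<integral>\<^sup>+w. p1 (y, w) * indicator I w \<partial>\<Lambda>) = 0"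
      by (simp add: nn_integral_0_iff_AE)
    moreover have "AE y in q 0. emeasure (q y) I = (\<integral>\<^sup>+w. p (y, w) * indicator I w \<partial>\<Lambda>)"
      using AE_q[OF zero_in_I p_dens[of I]] by (simp add: sets_B_iff)
    ultimately have "AE y in q 0. False"
      using AE_space
    proof eventually_elim
      case (elim y)
      then have y: "y \<in> I" using space_q[OF zero_in_I] by simp
      have my: "(\<lambda>w. p (y, w)) \<in> borel_measurable \<Lambda>"
        using measurable_compose[OF measurable_Pair1'[of y B B] p] y
        unfolding measurable_cong_sets[OF sets_\<Lambda> refl] by (simp add: space_B)
      have indI: "(indicator I :: _ \<Rightarrow> ennreal) \<in> borel_measurable \<Lambda>"
        by (intro borel_measurable_indicator) (simp add: sets_\<Lambda> sets_B_iff)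
      have m1: "(\<lambda>w. p1 (y, w) * indicator I w) \<in> borel_measurable \<Lambda>"
        unfolding p1_def using my indI by (intro borel_measurable_times_ennreal borel_measurable_min) auto
      have "AE w in \<Lambda>. p1 (y, w) * indicator I w = 0"
        using elim(1) m1 by (simp add: nn_integral_0_iff_AE)
      then have "AE w in \<Lambda>. p (y, w) * indicator I w = 0"
        by eventually_elim (auto simp: p1_def min_def split: if_splits)
      then have "(\<integral>\<^sup>+w. p (y, w) * indicator I w \<partial>\<Lambda>) = (\<integral>\<^sup>+w. 0 \<partial>\<Lambda>)" by (rule nn_integral_cong_AE)
      then have "emeasure (q y) I = 0" using elim(2) by simp
      then show False using prob_space.emeasure_space_1[OF prob_q[OF y]] space_q[OF y] by simp
    qed
    then show False using prob_space.AE_const[OF prob_q[OF zero_in_I]] by blast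
  qed
  then obtain n where n: "(\<integral>\<^sup>+w. f n w \<partial>\<Lambda>) \<noteq> 0" by blast
  define \<kappa> where "\<kappa> = (\<integral>\<^sup>+w. f n w \<partial>\<Lambda>)"
  have f_le_H: "f n w \<le> H w x" if "w \<in> I" "x \<in> I" "\<bar>x\<bar> < 1 / real (Suc n)" for w x
    using m_le[OF that] by (auto simp: f_def split: split_indicator)
  have \<kappa>_le: "\<kappa> \<le> 1"
  proof -
    have "\<kappa> \<le> (\<integral>\<^sup>+w. 1 \<partial>\<Lambda>)"
      unfolding \<kappa>_def using f_le_H[OF _ zero_in_I] H_le[OF zero_in_I] space_\<Lambda>
      by (intro nn_integral_mono) (auto intro: order_trans)
    then show ?thesis by (simp add: L.emeasure_space_1)
  qed
  define k where "k = enn2real \<kappa>"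
  have k: "\<kappa> = ennreal k" "k > 0" "k \<le> 1"
  proof -
    show "\<kappa> = ennreal k" unfolding k_def using \<kappa>_le by (intro ennreal_enn2real[symmetric]) (simp add: order_le_less_trans)
    then show "k > 0" using n unfolding \<kappa>_def[symmetric] by (cases "k > 0") (auto simp: ennreal_neg)
    show "k \<le> 1" unfolding k_def using enn2real_mono[OF \<kappa>_le] by simp
  qed
  define \<nu> where "\<nu> = scale_measure (ennreal (1 / k)) (density \<Lambda> (f n))"
  have sets_\<nu>: "sets \<nu> = sets B" by (simp add: \<nu>_def sets_\<Lambda>)
  have em_\<nu>: "emeasure \<nu> A = ennreal (1 / k) * (\<integral>\<^sup>+w. f n w * indicator A w \<partial>\<Lambda>)" if "A \<in> sets B" for A
    using that f_meas' sets_\<Lambda> by (simp add: \<nu>_def emeasure_density)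
  define s where "s x = k * max 0 (1 - real (Suc n) * \<bar>x\<bar>)" for x
  show thesis
  proof (rule that)
    have "emeasure \<nu> I = ennreal (1 / k) * (\<integral>\<^sup>+w. f n w * indicator I w \<partial>\<Lambda>)" by (rule em_\<nu>) (simp add: sets_B_iff)
    also have "(\<integral>\<^sup>+w. f n w * indicator I w \<partial>\<Lambda>) = \<kappa>"
      unfolding \<kappa>_def by (intro nn_integral_cong) (simp add: space_\<Lambda>)
    also have "ennreal (1 / k) * \<kappa> = 1" unfolding k(1) using k(2) by (simp add: ennreal_mult''[symmetric])
    finally have "prob_space \<nu>"
      using sets_eq_imp_space_eq[OF sets_\<nu>] by (intro prob_spaceI) (simp add: space_B)
    then show "\<nu> \<in> space (prob_algebra B)" using sets_\<nu> by (simp add: space_prob_algebra)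
    have "I - {- real n..real n} \<in> sets B" by (auto simp: sets_B_iff)
    then have "emeasure \<nu> (I - {- real n..real n})
      = ennreal (1 / k) * (\<integral>\<^sup>+w. f n w * indicator (I - {- real n..real n}) w \<partial>\<Lambda>)" by (rule em_\<nu>)
    also have "(\<integral>\<^sup>+w. f n w * indicator (I - {- real n..real n}) w \<partial>\<Lambda>) = (\<integral>\<^sup>+w. 0 \<partial>\<Lambda>)"
      by (intro nn_integral_cong) (auto simp: f_def split: split_indicator)
    finally show "emeasure \<nu> (I - {- real n..real n}) = 0" by simp
    show "continuous_on I s" unfolding s_def by (intro continuous_intros)
    show "0 \<le> s x" for x using k by (simp add: s_def)
    show "s 0 > 0" using k by (simp add: s_def)
    fix x A assume x: "x \<in> I" and A: "A \<in> sets B"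
    show "ennreal (s x) * emeasure \<nu> A \<le> emeasure (two_step x) A"
    proof (cases "\<bar>x\<bar> < 1 / real (Suc n)")
      case True
      have "s x \<le> k" using k by (simp add: s_def mult_left_le)
      then have "ennreal (s x) * emeasure \<nu> A \<le> ennreal k * emeasure \<nu> A"
        by (intro mult_right_mono ennreal_leI) auto
      also have "\<dots> = (\<integral>\<^sup>+w. f n w * indicator A w \<partial>\<Lambda>)"
        unfolding em_\<nu>[OF A] using k(2) by (simp add: mult.assoc[symmetric] ennreal_mult''[symmetric])
      also have "\<dots> \<le> (\<integral>\<^sup>+w. H w x * indicator A w \<partial>\<Lambda>)"
        using f_le_H[OF _ x True] space_\<Lambda> by (intro nn_integral_mono mult_right_mono) auto
      also have "\<dots> \<le> emeasure (two_step x) A" by (rule minor_H[OF x A])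
      finally show ?thesis .
    next
      case False
      then have "s x = 0" by (simp add: s_def field_simps max_def)
      then show ?thesis by simp
    qed
  qed
qed

end

section \<open>Existence of an invariant measure\<close>

text \<open>The sum is viewed as a kernel integrated against a base measure with weights 1 and
  \<open>c\<close> on two points, which reduces it to \<open>nn_integral_kernel_eq\<close>.\<close>

lemma nn_integral_sum_measure:
  assumes M: "M1 \<in> space (subprob_algebra C)" "M2 \<in> space (subprob_algebra C)" "sets M' = sets C"
    and eq: "\<And>A. A \<in> sets C \<Longrightarrow> emeasure M' A = emeasure M1 A + c * emeasure M2 A"
    and f: "f \<in> borel_measurable C"
  shows "(\<integral>\<^sup>+y. f y \<partial>M') = (\<integral>\<^sup>+y. f y \<partial>M1) + c * (\<integral>\<^sup>+y. f y \<partial>M2)"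
proof -
  let ?D = "density (count_space UNIV) (\<lambda>b. if b then 1 else c)"
  let ?k = "\<lambda>b. if b then M1 else M2"
  have D: "(\<integral>\<^sup>+b. g b \<partial>?D) = g True + c * g False" for g
    by (simp add: nn_integral_density nn_integral_count_space_finite UNIV_bool)
  have "(\<integral>\<^sup>+b. \<integral>\<^sup>+y. f y \<partial>?k b \<partial>?D) = (\<integral>\<^sup>+y. f y \<partial>M')"
    by (rule nn_integral_kernel_eq[where L = "count_space UNIV", OF _ _ M(3) _ f])
       (use M eq in \<open>auto simp: D\<close>)
  then show ?thesis by (simp add: D)
qed

definition mixture :: "real \<Rightarrow> 'a measure \<Rightarrow> 'a measure \<Rightarrow> 'a measure" where
  "mixture p M1 M2 = measure_pmf (bernoulli_pmf p) \<bind> (\<lambda>b. if b then M1 else M2)"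

lemma
  assumes M: "M1 \<in> space (subprob_algebra C)" "M2 \<in> space (subprob_algebra C)" and p: "0 \<le> p" "p \<le> 1"
  shows nn_integral_mixture: "f \<in> borel_measurable C \<Longrightarrow>
      (\<integral>\<^sup>+y. f y \<partial>mixture p M1 M2) = ennreal p * (\<integral>\<^sup>+y. f y \<partial>M1) + ennreal (1 - p) * (\<integral>\<^sup>+y. f y \<partial>M2)"
    and mixture_subprob: "mixture p M1 M2 \<in> space (subprob_algebra C)"
proof -
  have k: "(\<lambda>b. if b then M1 else M2) \<in> measure_pmf (bernoulli_pmf p) \<rightarrow>\<^sub>M subprob_algebra C"
    using M by auto
  show "(\<integral>\<^sup>+y. f y \<partial>mixture p M1 M2) = ennreal p * (\<integral>\<^sup>+y. f y \<partial>M1) + ennreal (1 - p) * (\<integral>\<^sup>+y. f y \<partial>M2)"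
    if "f \<in> borel_measurable C"
    unfolding mixture_def nn_integral_bind[OF that k] using p by (simp add: mult.commute)
  have "sets (mixture p M1 M2) = sets C"
    unfolding mixture_def by (rule sets_bind[OF _ ]) (use M in \<open>auto simp: space_subprob_algebra\<close>)
  moreover have "subprob_space (mixture p M1 M2)"
    unfolding mixture_def by (rule subprob_space_bind[OF _ k])
      (simp add: measure_pmf.prob_space_axioms prob_space_imp_subprob_space)
  ultimately show "mixture p M1 M2 \<in> space (subprob_algebra C)" by (simp add: space_subprob_algebra)
qed

lemma countable_sum_measure:
  assumes k: "\<And>n::nat. k n \<in> space (subprob_algebra C)"
  obtains M where "sets M = sets C"
    "\<And>f. f \<in> borel_measurable C \<Longrightarrow> (\<integral>\<^sup>+y. f y \<partial>M) = (\<Sum>n. \<integral>\<^sup>+y. f y \<partial>k n)"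
proof -
  have sets_k: "sets (k n) = sets C" for n using k by (simp add: space_subprob_algebra)
  let ?\<mu> = "\<lambda>A. \<integral>\<^sup>+n. emeasure (k n) A \<partial>count_space UNIV"
  define M where "M = measure_of (space C) (sets C) ?\<mu>"
  have sets_M: "sets M = sets C" unfolding M_def by (rule sets.sets_measure_of_eq)
  have em: "emeasure M A = ?\<mu> A" if "A \<in> sets C" for A
    unfolding M_def
  proof (rule emeasure_measure_of_sigma[OF sets.sigma_algebra_axioms _ _ that])
    show "positive (sets C) ?\<mu>" by (simp add: positive_def)
    show "countably_additive (sets C) ?\<mu>"
    proof (rule countably_additiveI)
      fix A :: "nat \<Rightarrow> _" assume A: "range A \<subseteq> sets C" "disjoint_family A"
      have "(\<Sum>i. ?\<mu> (A i)) = (\<integral>\<^sup>+n. (\<Sum>i. emeasure (k n) (A i)) \<partial>count_space UNIV)"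
        by (rule nn_integral_suminf[symmetric]) simp
      also have "\<dots> = ?\<mu> (\<Union>i. A i)"
        using A sets_k by (intro nn_integral_cong suminf_emeasure) auto
      finally show "(\<Sum>i. ?\<mu> (A i)) = ?\<mu> (\<Union>i. A i)" .
    qed
  qed
  show thesis
  proof (rule that[OF sets_M])
    fix f :: "'a \<Rightarrow> ennreal" assume f: "f \<in> borel_measurable C"
    have "(\<integral>\<^sup>+n. \<integral>\<^sup>+y. f y \<partial>k n \<partial>count_space UNIV) = (\<integral>\<^sup>+y. f y \<partial>M)"
      by (rule nn_integral_kernel_eq[where L = "count_space UNIV", OF _ _ sets_M _ f]) (use k em in auto)
    then show "(\<integral>\<^sup>+y. f y \<partial>M) = (\<Sum>n. \<integral>\<^sup>+y. f y \<partial>k n)" by (simp add: nn_integral_count_space_nat)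
  qed
qed

text \<open>\<open>V\<close> is to bound the accumulated 1 / (1 + x^2), and this bound pays for the
  error term in the drift of \<open>W a\<close>, which in turn controls the interval around
  \<open>a\<close>. The condition \<open>escape\<close> is there because the drift will be iterated
  once: the compactly supported error \<open>b * indicator {-R..R}\<close> then reappears under
  \<open>q\<close>, where it is no longer compactly supported but must be absorbed by
  \<open>c / (1 + x\<^sup>2)\<close>.\<close>

locale drift_chain = feller_chain +
  fixes V :: "real \<Rightarrow> real" and W :: "real \<Rightarrow> real \<Rightarrow> real" and R b c \<beta> \<delta> :: real
  assumes V_cont: "continuous_on I V" and V_nonneg: "\<And>x. 0 \<le> V x"
    and V_proper: "\<And>M. \<exists>r. \<forall>x\<in>I. V x \<le> M \<longrightarrow> \<bar>x\<bar> \<le> r"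
    and V_integrable: "\<And>x. x \<in> I \<Longrightarrow> integrable (q x) V"
    and V_drift: "\<And>x. x \<in> I \<Longrightarrow> (\<integral>y. V y \<partial>q x) + c / (1 + x\<^sup>2) \<le> V x + b * indicator {-R..R} x"
    and constants: "0 < c" "0 \<le> b" "0 \<le> R" "0 \<le> \<beta>" "0 < \<delta>"
    and escape: "\<And>r e. 0 < e \<Longrightarrow> \<exists>r'. \<forall>x\<in>I. r' < \<bar>x\<bar> \<longrightarrow> measure (q x) (I \<inter> {-r..r}) \<le> e / (1 + x\<^sup>2)"
    and W_cont: "\<And>a. continuous_on I (W a)" and W_nonneg: "\<And>a x. 0 \<le> W a x"
    and W_le: "\<And>a x. W a x \<le> 2 * \<bar>x\<bar> + 3"
    and W_integrable: "\<And>a x. x \<in> I \<Longrightarrow> integrable (q x) (W a)"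
    and W_drift: "\<And>a x. x \<in> I \<Longrightarrow>
      (\<integral>y. W a y \<partial>q x) + \<delta> * indicator {a-1..a+1} x \<le> W a x + \<beta> / (1 + x\<^sup>2)"

sublocale drift_chain \<subseteq> lyapunov_chain I q V R
proof
  fix x assume x: "x \<in> I" "R < \<bar>x\<bar>"
  have ind: "indicator {-R..R} x = (0::real)" using x(2) by (auto simp: indicator_def)
  have "0 \<le> c / (1 + x\<^sup>2)" using constants by (simp add: add_nonneg_nonneg)
  then show "(\<integral>y. V y \<partial>q x) \<le> V x" using V_drift[OF x(1)] ind by simp
qed (use V_cont V_nonneg V_proper V_integrable constants in auto)

text \<open>Nummelin's splitting for the kernel \<open>(q + q\<^sup>2) / 2\<close>. This average, rather than \<open>q\<^sup>2\<close>,
  is used since \<open>q\<^sup>2\<close> need not be irreducible.\<close>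

locale split_chain = drift_chain +
  fixes \<nu> :: "real measure" and \<sigma> :: "real \<Rightarrow> real" and r\<^sub>0 :: real
  assumes \<nu>: "\<nu> \<in> space (prob_algebra (borel_on I))"
    and \<nu>_support: "emeasure \<nu> (I - {-r\<^sub>0..r\<^sub>0}) = 0"
    and \<sigma>_cont: "continuous_on I \<sigma>" and \<sigma>_nonneg: "\<And>x. 0 \<le> \<sigma> x" and \<sigma>_pos: "0 < \<sigma> 0"
    and minor: "\<And>x A. x \<in> I \<Longrightarrow> A \<in> sets (borel_on I) \<Longrightarrow>
      ennreal (2 * \<sigma> x) * emeasure \<nu> A \<le> emeasure (two_step x) A"
begin

lemma prob_\<nu>: "prob_space \<nu>" and sets_\<nu>: "sets \<nu> = sets B" and space_\<nu>: "space \<nu> = I"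
  using \<nu> sets_eq_imp_space_eq[of \<nu> B] by (auto simp: space_prob_algebra space_B)

lemma subprob_\<nu>: "\<nu> \<in> space (subprob_algebra B)"
  using prob_\<nu> sets_\<nu> by (simp add: space_subprob_algebra prob_space_imp_subprob_space)

lemma subprob_q: "x \<in> I \<Longrightarrow> q x \<in> space (subprob_algebra B)"
  using measurable_space[OF q_measurable'] by (simp add: space_B)

lemma two_step_measurable: "two_step \<in> B \<rightarrow>\<^sub>M prob_algebra B"
  by (rule measurable_bind_prob_space[OF q_measurable q_measurable])

lemma subprob_two_step: "x \<in> I \<Longrightarrow> two_step x \<in> space (subprob_algebra B)"
  using measurable_space[OF measurable_prob_algebraD[OF two_step_measurable]] by (simp add: space_B)

abbreviation qop :: "(real \<Rightarrow> ennreal) \<Rightarrow> real \<Rightarrow> ennreal" where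
  "qop f x \<equiv> \<integral>\<^sup>+y. f y \<partial>q x"

lemma qop_measurable: "f \<in> borel_measurable B \<Longrightarrow> qop f \<in> borel_measurable B"
  by (rule measurable_compose[OF q_measurable' nn_integral_measurable_subprob_algebra])

lemma mq: "x \<in> I \<Longrightarrow> f \<in> borel_measurable B \<Longrightarrow> f \<in> borel_measurable (q x)"
  unfolding measurable_cong_sets[OF sets_q refl] .

lemma nn_integral_two_step:
  assumes x: "x \<in> I" and f: "f \<in> borel_measurable B"
  shows "(\<integral>\<^sup>+y. f y \<partial>two_step x) = qop (qop f) x"
  by (rule nn_integral_bind[OF f]) (use q_measurable' in \<open>simp add: measurable_cong_sets[OF sets_q[OF x] refl]\<close>)

definition Q :: "real \<Rightarrow> real measure" where
  "Q x = mixture (1/2) (q x) (two_step x)"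

lemma nn_integral_Q:
  assumes x: "x \<in> I" and f: "f \<in> borel_measurable B"
  shows "(\<integral>\<^sup>+y. f y \<partial>Q x) = ennreal (1/2) * qop f x + ennreal (1/2) * qop (qop f) x"
  unfolding Q_def nn_integral_two_step[OF x f, symmetric]
  using nn_integral_mixture[OF subprob_q[OF x] subprob_two_step[OF x] _ _ f, of "1/2"] by simp

lemma subprob_Q: "x \<in> I \<Longrightarrow> Q x \<in> space (subprob_algebra B)"
  unfolding Q_def by (intro mixture_subprob subprob_q subprob_two_step) auto

text \<open>The residual kernel of the splitting: at rate \<open>\<sigma> x\<close> the chain
  regenerates from \<open>\<nu>\<close>, otherwise it moves by \<open>T\<close>. It is thus a chain
  killed with probability \<open>\<sigma> x\<close> per step.\<close>

definition T :: "real \<Rightarrow> real measure" where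
  "T x = diff_measure (Q x) (scale_measure (ennreal (\<sigma> x)) \<nu>)"

lemma sets_Q: "x \<in> I \<Longrightarrow> sets (Q x) = sets B"
  using subprob_Q by (simp add: space_subprob_algebra)

lemma sets_T: "x \<in> I \<Longrightarrow> sets (T x) = sets B"
  by (simp add: T_def sets_Q)

lemma half_double: "ennreal (1/2) * (2 * a) = a"
proof -
  have "ennreal (1/2) * (2 * a) = ennreal (1/2) * ennreal 2 * a" by (simp add: mult.assoc)
  also have "ennreal (1/2) * ennreal 2 = 1" by (subst ennreal_mult''[symmetric]) auto
  finally show ?thesis by simp
qed

lemma emeasure_Q:
  assumes x: "x \<in> I" and A: "A \<in> sets B"
  shows "emeasure (Q x) A = ennreal (1/2) * emeasure (q x) A + ennreal (1/2) * emeasure (two_step x) A"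
proof -
  have "emeasure (Q x) A = (\<integral>\<^sup>+y. indicator A y \<partial>Q x)" using A sets_Q[OF x] by simp
  also have "\<dots> = ennreal (1/2) * (\<integral>\<^sup>+y. indicator A y \<partial>q x) + ennreal (1/2) * (\<integral>\<^sup>+y. indicator A y \<partial>two_step x)"
    unfolding nn_integral_Q[OF x borel_measurable_indicator[OF A]]
      nn_integral_two_step[OF x borel_measurable_indicator[OF A]] ..
  also have "(\<integral>\<^sup>+y. indicator A y \<partial>q x) = emeasure (q x) A" using A sets_q[OF x] by simp
  also have "(\<integral>\<^sup>+y. indicator A y \<partial>two_step x) = emeasure (two_step x) A"
    using A subprob_two_step[OF x] by (intro nn_integral_indicator) (simp add: space_subprob_algebra)
  finally show ?thesis .
qed

text \<open>The factor 2 in \<open>minor\<close> compensates the weight 1/2 of the two-step kernel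
  in \<open>Q\<close>.\<close>

lemma minor_Q:
  assumes x: "x \<in> I" and A: "A \<in> sets B"
  shows "ennreal (\<sigma> x) * emeasure \<nu> A \<le> emeasure (Q x) A"
proof -
  have "ennreal (\<sigma> x) * emeasure \<nu> A = ennreal (1/2) * (ennreal (2 * \<sigma> x) * emeasure \<nu> A)"
    using half_double[of "ennreal (\<sigma> x)"] \<sigma>_nonneg[of x] by (simp add: mult.assoc[symmetric] ennreal_mult)
  also have "\<dots> \<le> ennreal (1/2) * emeasure (two_step x) A"
    by (intro mult_left_mono minor x A) simp
  also have "\<dots> \<le> emeasure (Q x) A" unfolding emeasure_Q[OF x A] by simp
  finally show ?thesis .
qed

lemma emeasure_T:
  assumes x: "x \<in> I" and A: "A \<in> sets B"
  shows "emeasure (T x) A = emeasure (Q x) A - ennreal (\<sigma> x) * emeasure \<nu> A"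
    and "emeasure (Q x) A = emeasure (T x) A + ennreal (\<sigma> x) * emeasure \<nu> A"
proof -
  have fin1: "finite_measure (Q x)"
    using subprob_Q[OF x] by (auto simp: space_subprob_algebra subprob_space_def)
  have fin2: "finite_measure (scale_measure (ennreal (\<sigma> x)) \<nu>)"
    using prob_space.emeasure_space_1[OF prob_\<nu>] by (intro finite_measureI) (simp add: space_scale_measure ennreal_mult_eq_top_iff)
  show eq: "emeasure (T x) A = emeasure (Q x) A - ennreal (\<sigma> x) * emeasure \<nu> A"
    unfolding T_def
    by (subst emeasure_diff_measure[OF fin1 fin2]) (use A minor_Q[OF x] in \<open>simp_all add: sets_Q[OF x] sets_\<nu>\<close>)
  show "emeasure (Q x) A = emeasure (T x) A + ennreal (\<sigma> x) * emeasure \<nu> A"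
    unfolding eq by (rule diff_add_cancel_ennreal[OF minor_Q[OF x A], symmetric])
qed

lemma T_measurable: "T \<in> B \<rightarrow>\<^sub>M subprob_algebra B"
proof (rule measurable_subprob_algebra)
  fix x assume "x \<in> space B"
  then have x: "x \<in> I" by (simp add: space_B)
  show "sets (T x) = sets B" by (rule sets_T[OF x])
  then have sp: "space (T x) = I" using sets_eq_imp_space_eq space_B by blast
  have "emeasure (T x) I \<le> emeasure (Q x) I"
    unfolding emeasure_T(1)[OF x, of I, simplified sets_B_iff, simplified] by (simp add: diff_le_self_ennreal)
  also have "\<dots> \<le> 1"
    using subprob_Q[OF x] subprob_space.subprob_emeasure_le_1 by (auto simp: space_subprob_algebra)
  finally show "subprob_space (T x)"
    using zero_in_I sp by (intro subprob_spaceI) auto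
next
  fix A assume A: "A \<in> sets B"
  have m1: "(\<lambda>x. emeasure (q x) A) \<in> borel_measurable B"
    by (rule measurable_compose[OF q_measurable' measurable_emeasure_subprob_algebra[OF A]])
  have m2: "(\<lambda>x. emeasure (two_step x) A) \<in> borel_measurable B"
    by (rule measurable_compose[OF measurable_prob_algebraD[OF two_step_measurable] measurable_emeasure_subprob_algebra[OF A]])
  have m3: "\<sigma> \<in> borel_measurable B" by (rule continuous_measurable[OF \<sigma>_cont])
  have "(\<lambda>x. (ennreal (1/2) * emeasure (q x) A + ennreal (1/2) * emeasure (two_step x) A)
      - ennreal (\<sigma> x) * emeasure \<nu> A) \<in> borel_measurable B"
    by (intro borel_measurable_minus_ennreal borel_measurable_add borel_measurable_times_ennreal
        borel_measurable_const m1 m2 measurable_compose[OF m3 measurable_ennreal])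
  then show "(\<lambda>x. emeasure (T x) A) \<in> borel_measurable B"
    by (rule measurable_cong[THEN iffD1, rotated]) (simp add: space_B emeasure_T(1)[OF _ A] emeasure_Q[OF _ A])
qed

abbreviation Top :: "(real \<Rightarrow> ennreal) \<Rightarrow> real \<Rightarrow> ennreal" where
  "Top f x \<equiv> \<integral>\<^sup>+y. f y \<partial>T x"

lemma Top_measurable: "f \<in> borel_measurable B \<Longrightarrow> Top f \<in> borel_measurable B"
  by (rule measurable_compose[OF T_measurable nn_integral_measurable_subprob_algebra])

lemma subprob_T: "x \<in> I \<Longrightarrow> T x \<in> space (subprob_algebra B)"
  using measurable_space[OF T_measurable] by (simp add: space_B)

lemma mT: "x \<in> I \<Longrightarrow> f \<in> borel_measurable B \<Longrightarrow> f \<in> borel_measurable (T x)"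
  unfolding measurable_cong_sets[OF sets_T refl] .

lemma space_T: "x \<in> I \<Longrightarrow> space (T x) = I"
  using sets_eq_imp_space_eq[OF sets_T] by (simp add: space_B)

lemma m\<nu>: "f \<in> borel_measurable B \<Longrightarrow> f \<in> borel_measurable \<nu>"
  unfolding measurable_cong_sets[OF sets_\<nu> refl] .

text \<open>Twice the decomposition of \<open>Q\<close> into \<open>T\<close> and the regeneration
  part, which removes the fractions. Properties of \<open>T\<close> are deduced from those of
  \<open>q\<close> through this identity.\<close>

lemma split_identity:
  assumes x: "x \<in> I" and f: "f \<in> borel_measurable B"
  shows "2 * Top f x + 2 * ennreal (\<sigma> x) * (\<integral>\<^sup>+y. f y \<partial>\<nu>) = qop f x + qop (qop f) x"
proof -
  have two: "2 * (ennreal (1/2) * a) = a" for a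
    using half_double[of a] by (simp add: mult.left_commute)
  have "(\<integral>\<^sup>+y. f y \<partial>Q x) = Top f x + ennreal (\<sigma> x) * (\<integral>\<^sup>+y. f y \<partial>\<nu>)"
    by (rule nn_integral_sum_measure[OF subprob_T[OF x] subprob_\<nu> sets_Q[OF x] emeasure_T(2)[OF x] f])
  then have "2 * (Top f x + ennreal (\<sigma> x) * (\<integral>\<^sup>+y. f y \<partial>\<nu>)) = 2 * (ennreal (1/2) * qop f x + ennreal (1/2) * qop (qop f) x)"
    unfolding nn_integral_Q[OF x f] by simp
  then show ?thesis by (simp only: distrib_left two mult.assoc)
qed

lemma Top_const_le:
  assumes x: "x \<in> I"
  shows "(\<integral>\<^sup>+y. a \<partial>T x) \<le> a"
proof -
  have "emeasure (T x) (space (T x)) \<le> 1"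
    using subprob_T[OF x] subprob_space.subprob_emeasure_le_1 by (auto simp: space_subprob_algebra)
  then have "a * emeasure (T x) (space (T x)) \<le> a * 1" by (rule mult_left_mono) simp
  then show ?thesis by simp
qed

section \<open>The killed chain dies almost surely\<close>

primrec survival :: "nat \<Rightarrow> real \<Rightarrow> ennreal" where
  "survival 0 = (\<lambda>x. 1)"
| "survival (Suc n) = (\<lambda>x. \<integral>\<^sup>+y. survival n y \<partial>T x)"

lemma survival_measurable: "survival n \<in> borel_measurable B"
  by (induction n) (simp_all add: Top_measurable)

lemma survival_decreasing: "x \<in> I \<Longrightarrow> survival (Suc n) x \<le> survival n x"
proof (induction n arbitrary: x)
  case 0
  then show ?case using Top_const_le[of x 1] by simp
next
  case (Suc n)
  have "(\<integral>\<^sup>+y. survival (Suc n) y \<partial>T x) \<le> (\<integral>\<^sup>+y. survival n y \<partial>T x)"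
    using Suc space_T[OF Suc.prems] by (intro nn_integral_mono) blast
  then show ?case by simp
qed

lemma survival_antimono: "x \<in> I \<Longrightarrow> m \<le> n \<Longrightarrow> survival n x \<le> survival m x"
  using survival_decreasing[of x] by (rule lift_Suc_antimono_le)

lemma survival_le_1: "x \<in> I \<Longrightarrow> survival n x \<le> 1"
  using survival_antimono[of x 0 n] by simp

text \<open>The chain killed at rate \<open>\<sigma>\<close> dies almost surely: the survival probability \<open>h\<close> satisfies
  \<open>(q h + q\<^sup>2 h) / 2 = h + a \<sigma>\<close> with \<open>a \<ge> 0\<close>, so that \<open>2 h + q h\<close> is subharmonic.\<close>

lemma survival_tendsto_0:
  assumes x0: "x0 \<in> I"
  shows "(INF n. survival n x0) = 0"
proof -
  define H where "H x = (INF n. survival n x)" for x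
  have H_meas: "H \<in> borel_measurable B"
    unfolding H_def by (intro borel_measurable_INF survival_measurable) simp
  have H_le: "H x \<le> 1" if "x \<in> I" for x
    unfolding H_def using survival_le_1[OF that, of 0] by (rule INF_lower2[OF UNIV_I])
  \<comment> \<open>The limiting survival probability is a fixed point of \<open>T\<close>;
    convergence from above is legitimate because all masses are at most 1.\<close>
  have TH: "Top H x = H x" if x: "x \<in> I" for x
  proof -
    have "Top H x = (INF n. \<integral>\<^sup>+y. survival n y \<partial>T x)"
      unfolding H_def
    proof (rule nn_integral_monotone_convergence_INF_AE')
      show "AE y in T x. survival (Suc n) y \<le> survival n y" for n
        using survival_decreasing space_T[OF x] by (intro AE_I2) blast
      show "survival n \<in> borel_measurable (T x)" for n by (rule mT[OF x survival_measurable])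
      have "(\<integral>\<^sup>+y. survival 0 y \<partial>T x) \<le> 1" using Top_const_le[OF x, of 1] by simp
      then show "(\<integral>\<^sup>+y. survival 0 y \<partial>T x) < \<infinity>" by (rule order_le_less_trans) simp
    qed
    also have "\<dots> = (INF n. survival (Suc n) x)" by simp
    also have "\<dots> = H x"
      unfolding H_def
    proof (rule antisym)
      show "(INF n. survival (Suc n) x) \<le> (INF n. survival n x)"
        by (rule INF_mono) (use survival_decreasing[OF x] in blast)
      show "(INF n. survival n x) \<le> (INF n. survival (Suc n) x)"
        by (rule INF_mono) blast
    qed
    finally show ?thesis .
  qed
  define h where "h x = enn2real (H x)" for x
  have H_h: "H x = ennreal (h x)" if "x \<in> I" for x
    unfolding h_def using H_le[OF that] by (intro ennreal_enn2real[symmetric]) (simp add: order_le_less_trans)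
  have h_meas: "h \<in> borel_measurable B" unfolding h_def by (rule measurable_compose[OF H_meas]) simp
  have h_nn: "0 \<le> h x" for x by (simp add: h_def)
  have h_le: "h x \<le> 1" if "x \<in> I" for x unfolding h_def using enn2real_mono[OF H_le[OF that]] by simp
  define qh where "qh x = (\<integral>y. h y \<partial>q x)" for x
  have qH: "qop H x = ennreal (qh x)" if x: "x \<in> I" for x
  proof -
    have "qop H x = (\<integral>\<^sup>+y. ennreal (h y) \<partial>q x)"
      using H_h space_q[OF x] by (intro nn_integral_cong) simp
    also have "\<dots> = ennreal (qh x)" unfolding qh_def
      using h_nn h_le by (intro nn_integral_q_eq[OF x h_meas, where c = 1]) auto
    finally show ?thesis .
  qed
  have h_abs: "\<bar>h x\<bar> \<le> 1" if "x \<in> I" for x using h_nn[of x] h_le[OF that] by simp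
  have qh_cont: "continuous_on I qh" unfolding qh_def by (rule strong_feller[OF h_meas h_abs])
  have qh_meas: "qh \<in> borel_measurable B" by (rule continuous_measurable[OF qh_cont])
  have qh_nn: "0 \<le> qh x" for x unfolding qh_def by (intro integral_nonneg_AE AE_I2 h_nn)
  have qh_le: "qh x \<le> 1" if x: "x \<in> I" for x
  proof -
    interpret prob_space "q x" using prob_q[OF x] .
    have "qh x \<le> (\<integral>y. 1 \<partial>q x)" unfolding qh_def
      using h_le space_q[OF x] by (intro integral_mono integrable_bounded[OF x h_meas h_abs]) auto
    then show ?thesis by (simp add: prob_space)
  qed
  have qh_abs: "\<bar>qh x\<bar> \<le> 1" if "x \<in> I" for x using qh_nn[of x] qh_le[OF that] by simp
  define qqh where "qqh x = (\<integral>y. qh y \<partial>q x)" for x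
  have qqH: "qop (qop H) x = ennreal (qqh x)" if x: "x \<in> I" for x
  proof -
    have "qop (qop H) x = (\<integral>\<^sup>+y. ennreal (qh y) \<partial>q x)"
      using qH space_q[OF x] by (intro nn_integral_cong) simp
    also have "\<dots> = ennreal (qqh x)" unfolding qqh_def
      using qh_nn qh_le by (intro nn_integral_q_eq[OF x qh_meas, where c = 1]) auto
    finally show ?thesis .
  qed
  have qqh_nn: "0 \<le> qqh x" for x unfolding qqh_def by (intro integral_nonneg_AE AE_I2 qh_nn)
  have \<nu>H_le: "(\<integral>\<^sup>+y. H y \<partial>\<nu>) \<le> 1"
  proof -
    have "(\<integral>\<^sup>+y. H y \<partial>\<nu>) \<le> (\<integral>\<^sup>+y. 1 \<partial>\<nu>)" using H_le space_\<nu> by (intro nn_integral_mono) simp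
    then show ?thesis using prob_space.emeasure_space_1[OF prob_\<nu>] by simp
  qed
  define a where "a = enn2real (\<integral>\<^sup>+y. H y \<partial>\<nu>)"
  have a: "(\<integral>\<^sup>+y. H y \<partial>\<nu>) = ennreal a" "0 \<le> a"
    unfolding a_def using \<nu>H_le by (auto intro!: ennreal_enn2real[symmetric] simp: order_le_less_trans)
  have id: "2 * h x + 2 * \<sigma> x * a = qh x + qqh x" if x: "x \<in> I" for x
  proof -
    have "2 * H x + 2 * ennreal (\<sigma> x) * (\<integral>\<^sup>+y. H y \<partial>\<nu>) = qop H x + qop (qop H) x"
      using split_identity[OF x H_meas] unfolding TH[OF x] .
    then have "ennreal (2 * h x + 2 * \<sigma> x * a) = ennreal (qh x + qqh x)"
      unfolding a(1) H_h[OF x] qH[OF x] qqH[OF x] ennreal_plus[OF qh_nn qqh_nn]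
      using h_nn[of x] \<sigma>_nonneg[of x] a(2) by (subst ennreal_plus) (simp_all add: ennreal_mult)
    then show ?thesis
      using h_nn[of x] \<sigma>_nonneg[of x] a(2) qh_nn[of x] qqh_nn[of x] by (subst (asm) ennreal_inj) auto
  qed
  \<comment> \<open>With this choice
    \<open>q g - g = q\<^sup>2 h + q h - 2 h = 2 a \<sigma>\<close>, so an identity involving two
    steps becomes a submean inequality for one step.\<close>
  define g where "g x = 2 * h x + qh x" for x
  have g_meas: "g \<in> borel_measurable B" unfolding g_def using h_meas qh_meas by simp
  have qg: "(\<integral>y. g y \<partial>q x) = 2 * qh x + qqh x" if x: "x \<in> I" for x
    unfolding g_def using integrable_bounded[OF x h_meas h_abs] integrable_bounded[OF x qh_meas qh_abs]
    by (simp add: qh_def qqh_def)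
  have qg': "(\<integral>y. g y \<partial>q x) = g x + 2 * \<sigma> x * a" if x: "x \<in> I" for x
    using qg[OF x] id[OF x] by (simp add: g_def)
  have g_abs: "\<bar>g x\<bar> \<le> 3" if "x \<in> I" for x
    using h_nn[of x] h_le[OF that] qh_nn[of x] qh_le[OF that] by (simp add: g_def)
  obtain C where C: "\<And>x. x \<in> I \<Longrightarrow> (\<integral>y. g y \<partial>q x) = C"
  proof (rule liouville[OF g_meas g_abs])
    show "g x \<le> (\<integral>y. g y \<partial>q x)" if "x \<in> I" for x
      using qg'[OF that] \<sigma>_nonneg[of x] a(2) by simp
  qed blast+
  have g_eq: "g x = C - 2 * \<sigma> x * a" if "x \<in> I" for x using qg'[OF that] C[OF that] by simp
  have \<sigma>_meas: "\<sigma> \<in> borel_measurable B" by (rule continuous_measurable[OF \<sigma>_cont])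
  \<comment> \<open>The Liouville theorem gives \<open>g = C - 2 a \<sigma>\<close> while
    \<open>q g = C\<close>. If \<open>a > 0\<close>, then \<open>\<sigma>\<close> vanishes almost
    surely after one step from any point, so the set where it is positive is never entered, although
    it is open and contains 0.\<close>
  have "a = 0"
  proof (rule ccontr)
    assume "a \<noteq> 0"
    then have apos: "a > 0" using a by simp
    have \<sigma>0: "AE y in q x. \<sigma> y = 0" if x: "x \<in> I" for x
    proof -
      interpret prob_space "q x" using prob_q[OF x] .
      have int_g: "integrable (q x) g" by (rule integrable_bounded[OF x g_meas g_abs])
      have "(\<integral>y. C - g y \<partial>q x) = 0"
        using int_g C[OF x] by (simp add: prob_space)
      moreover have nn: "0 \<le> C - g y" if "y \<in> I" for y
        using g_eq[OF that] \<sigma>_nonneg[of y] a(2) by simp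
      moreover have "integrable (q x) (\<lambda>y. C - g y)" using int_g by simp
      moreover have "AE y in q x. 0 \<le> C - g y" by (intro AE_I2 nn) (simp add: space_q[OF x])
      ultimately have "AE y in q x. C - g y = 0" by (simp only: integral_nonneg_eq_0_iff_AE)
      then show ?thesis
      proof (rule AE_mp, intro AE_I2 impI)
        fix y assume y: "y \<in> space (q x)" "C - g y = 0"
        then have "2 * \<sigma> y * a = 0" using g_eq[of y] space_q[OF x] by simp
        then show "\<sigma> y = 0" using apos by simp
      qed
    qed
    obtain S where S: "open S" "S \<inter> I = \<sigma> -` {0<..} \<inter> I"
      using \<sigma>_cont[unfolded continuous_on_open_invariant, rule_format, of "{0<..}"] by auto
    have SI: "S \<inter> I \<in> sets B" using S(1) by (simp add: sets_B_iff)
    have null: "emeasure (q x) (S \<inter> I) = 0" if x: "x \<in> I" for x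
    proof -
      have "AE y in q x. y \<notin> S \<inter> I" using \<sigma>0[OF x] by eventually_elim (use S(2) in auto)
      then show ?thesis
        using AE_iff_measurable[of "S \<inter> I" "q x" "\<lambda>y. y \<notin> S \<inter> I"] SI sets_q[OF x] space_q[OF x] by auto
    qed
    have "0 \<in> S" using S(2) \<sigma>_pos zero_in_I by auto
    show False
    proof (cases "I \<subseteq> S")
      case True
      then have "emeasure (q 0) I = 0" using null[OF zero_in_I] by (simp add: Int_absorb1)
      then show False using prob_space.emeasure_space_1[OF prob_q[OF zero_in_I]] space_q[OF zero_in_I] by simp
    next
      case False
      then obtain y where y: "y \<in> I" "y \<notin> S" by blast
      have "S \<inter> (I - S) \<noteq> {}"
      proof (rule absorbing_meets_open[OF _ _ _ S(1) \<open>0 \<in> S\<close> zero_in_I])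
        show "I - S \<in> sets B" using S(1) by (simp add: sets_B_iff)
        show "y \<in> I - S" using y by simp
        show "emeasure (q z) (I - (I - S)) = 0" if "z \<in> I - S" for z
          using null[of z] that by (simp add: Diff_Diff_Int Int_commute)
      qed
      then show False by blast
    qed
  qed
  have hC: "2 * h x + qh x = C" if "x \<in> I" for x using g_eq[OF that] \<open>a = 0\<close> by (simp add: g_def)
  \<comment> \<open>With \<open>a = 0\<close> the relation \<open>2 h + q h = C\<close> says that
    \<open>h - C / 3\<close> is minus one half of its image under \<open>q\<close>. The factor 1/2
    makes it a contraction, so \<open>h\<close> is constant; the constant equals the integral
    \<open>a = 0\<close> of \<open>h\<close> under \<open>\<nu>\<close>.\<close>
  have bnd: "\<bar>h x - C / 3\<bar> \<le> (1 + \<bar>C / 3\<bar>) / 2 ^ n" if "x \<in> I" for x n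
    using that
  proof (induction n arbitrary: x)
    case 0
    then show ?case using h_abs[OF 0] by simp
  next
    case (Suc n)
    interpret prob_space "q x" using prob_q[OF Suc.prems] .
    have int_h: "integrable (q x) h" by (rule integrable_bounded[OF Suc.prems h_meas h_abs])
    have "h x - C / 3 = - (qh x - C / 3) / 2" using hC[OF Suc.prems] by simp
    also have "qh x - C / 3 = (\<integral>y. h y - C / 3 \<partial>q x)" unfolding qh_def using int_h by (simp add: prob_space)
    finally have eq: "\<bar>h x - C / 3\<bar> = \<bar>\<integral>y. h y - C / 3 \<partial>q x\<bar> / 2" by (simp add: abs_divide)
    have "\<bar>\<integral>y. h y - C / 3 \<partial>q x\<bar> \<le> (\<integral>y. \<bar>h y - C / 3\<bar> \<partial>q x)" by (rule integral_abs_bound)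
    also have "\<dots> \<le> (\<integral>y. (1 + \<bar>C / 3\<bar>) / 2 ^ n \<partial>q x)"
      using int_h Suc.IH space_q[OF Suc.prems] by (intro integral_mono) auto
    finally have "\<bar>\<integral>y. h y - C / 3 \<partial>q x\<bar> \<le> (1 + \<bar>C / 3\<bar>) / 2 ^ n" by (simp add: prob_space)
    then have "\<bar>\<integral>y. h y - C / 3 \<partial>q x\<bar> / 2 \<le> (1 + \<bar>C / 3\<bar>) / 2 ^ n / 2" by (rule divide_right_mono) simp
    then show ?case unfolding eq by (simp only: power_Suc2 divide_divide_eq_left)
  qed
  have h_const: "h x = C / 3" if x: "x \<in> I" for x
  proof -
    have "(\<lambda>n. (1 + \<bar>C / 3\<bar>) / 2 ^ n) \<longlonglongrightarrow> 0" by (rule LIMSEQ_divide_realpow_zero) simp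
    then have "\<bar>h x - C / 3\<bar> \<le> 0"
      using bnd[OF x] by (intro LIMSEQ_le_const[of _ 0]) auto
    then show ?thesis by simp
  qed
  have "ennreal a = (\<integral>\<^sup>+y. H y \<partial>\<nu>)" using a by simp
  also have "\<dots> = (\<integral>\<^sup>+y. ennreal (C / 3) \<partial>\<nu>)"
    using H_h h_const space_\<nu> by (intro nn_integral_cong) simp
  also have "\<dots> = ennreal (C / 3)" using prob_space.emeasure_space_1[OF prob_\<nu>] by simp
  finally have "ennreal (C / 3) = 0" using \<open>a = 0\<close> by simp
  then have "H x0 = 0" using H_h[OF x0] h_const[OF x0] by simp
  then show ?thesis by (simp add: H_def)
qed

text \<open>Solving \<open>split_identity\<close> for \<open>T\<close> expresses it through
  \<open>q\<close>, its square and \<open>\<sigma>\<close>. The strong Feller property of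
  \<open>q\<close> and the continuity of \<open>\<sigma>\<close> then carry over to
  \<open>T\<close>.\<close>

lemma Top_continuous:
  assumes h: "h \<in> borel_measurable B" "\<And>x. x \<in> I \<Longrightarrow> 0 \<le> h x" "\<And>x. x \<in> I \<Longrightarrow> h x \<le> (1::real)"
  shows "continuous_on I (\<lambda>x. enn2real (Top (\<lambda>y. ennreal (h y)) x))"
proof -
  let ?H = "\<lambda>y. ennreal (h y)"
  have H: "?H \<in> borel_measurable B" by (rule measurable_compose[OF h(1)]) simp
  define g where "g x = (\<integral>y. h y \<partial>q x)" for x
  define k where "k x = (\<integral>y. g y \<partial>q x)" for x
  define a where "a = enn2real (\<integral>\<^sup>+y. ?H y \<partial>\<nu>)"
  have h_abs: "\<bar>h x\<bar> \<le> 1" if "x \<in> I" for x using h that by simp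
  have g_cont: "continuous_on I g" unfolding g_def by (rule strong_feller[OF h(1) h_abs])
  have g_meas: "g \<in> borel_measurable B" by (rule continuous_measurable[OF g_cont])
  have g_nn: "0 \<le> g x" if "x \<in> I" for x
    unfolding g_def by (intro integral_nonneg_AE AE_I2 h(2)) (simp add: space_q[OF that])
  have g_le: "g x \<le> 1" if x: "x \<in> I" for x
  proof -
    interpret prob_space "q x" using prob_q[OF x] .
    have "g x \<le> (\<integral>y. 1 \<partial>q x)" unfolding g_def
      using h(3) space_q[OF x] by (intro integral_mono integrable_bounded[OF x h(1) h_abs]) auto
    then show ?thesis by (simp add: prob_space)
  qed
  have g_abs: "\<bar>g x\<bar> \<le> 1" if "x \<in> I" for x using g_nn[OF that] g_le[OF that] by simp
  have k_cont: "continuous_on I k" unfolding k_def by (rule strong_feller[OF g_meas g_abs])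
  have k_nn: "0 \<le> k x" if "x \<in> I" for x
    unfolding k_def by (intro integral_nonneg_AE AE_I2 g_nn) (simp add: space_q[OF that])
  have qH: "qop ?H x = ennreal (g x)" if "x \<in> I" for x
    unfolding g_def using h by (intro nn_integral_q_eq[OF that h(1), where c = 1]) auto
  have qqH: "qop (qop ?H) x = ennreal (k x)" if x: "x \<in> I" for x
  proof -
    have "qop (qop ?H) x = (\<integral>\<^sup>+y. ennreal (g y) \<partial>q x)"
      using qH space_q[OF x] by (intro nn_integral_cong) simp
    also have "\<dots> = ennreal (k x)" unfolding k_def
      using g_nn g_le by (intro nn_integral_q_eq[OF x g_meas, where c = 1]) auto
    finally show ?thesis .
  qed
  have "(\<integral>\<^sup>+y. ?H y \<partial>\<nu>) \<le> (\<integral>\<^sup>+y. 1 \<partial>\<nu>)" using h(3) space_\<nu> by (intro nn_integral_mono) (simp add: ennreal_le_1)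
  also have "\<dots> = 1" using prob_space.emeasure_space_1[OF prob_\<nu>] by simp
  finally have a: "(\<integral>\<^sup>+y. ?H y \<partial>\<nu>) = ennreal a" "0 \<le> a"
    unfolding a_def by (auto intro!: ennreal_enn2real[symmetric] simp: order_le_less_trans)
  have "continuous_on I (\<lambda>x. (g x + k x) / 2 - \<sigma> x * a)"
    by (intro continuous_intros g_cont k_cont \<sigma>_cont) simp
  then show ?thesis
  proof (rule continuous_on_eq)
    fix x assume x: "x \<in> I"
    have "Top ?H x \<le> Top (\<lambda>_. 1) x" using h(3) space_T[OF x] by (intro nn_integral_mono) (simp add: ennreal_le_1)
    also have "\<dots> \<le> 1" by (rule Top_const_le[OF x])
    finally have fin: "Top ?H x \<le> 1" .
    define t where "t = enn2real (Top ?H x)"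
    have t: "Top ?H x = ennreal t" "0 \<le> t"
      unfolding t_def using fin by (auto intro!: ennreal_enn2real[symmetric] simp: order_le_less_trans)
    have "2 * ennreal t + 2 * ennreal (\<sigma> x) * ennreal a = ennreal (g x) + ennreal (k x)"
      using split_identity[OF x H] unfolding t(1) a(1) qH[OF x] qqH[OF x] .
    then have "ennreal (2 * t + 2 * \<sigma> x * a) = ennreal (g x + k x)"
      unfolding ennreal_plus[OF g_nn[OF x] k_nn[OF x]]
      using t(2) \<sigma>_nonneg[of x] a(2) by (subst ennreal_plus) (simp_all add: ennreal_mult)
    then have "2 * t + 2 * \<sigma> x * a = g x + k x"
      using t(2) \<sigma>_nonneg[of x] a(2) g_nn[OF x] k_nn[OF x] by (subst (asm) ennreal_inj) auto
    then show "(g x + k x) / 2 - \<sigma> x * a = enn2real (Top ?H x)"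
      unfolding t_def[symmetric] by (simp add: field_simps)
  qed
qed

lemma survival_continuous: "continuous_on I (\<lambda>x. enn2real (survival n x))"
proof (induction n)
  case (Suc n)
  have le: "enn2real (survival n x) \<le> 1" if "x \<in> I" for x
    using enn2real_mono[OF survival_le_1[OF that]] by simp
  have "continuous_on I (\<lambda>x. enn2real (Top (\<lambda>y. ennreal (enn2real (survival n y))) x))"
    by (rule Top_continuous) (use le survival_measurable in \<open>auto intro: measurable_compose[OF survival_measurable]\<close>)
  then show ?case
  proof (rule continuous_on_eq)
    fix x assume x: "x \<in> I"
    have "Top (\<lambda>y. ennreal (enn2real (survival n y))) x = Top (survival n) x"
      using space_T[OF x] by (intro nn_integral_cong ennreal_enn2real order_le_less_trans[OF survival_le_1]) auto
    then show "enn2real (Top (\<lambda>y. ennreal (enn2real (survival n y))) x) = enn2real (survival (Suc n) x)" by simp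
  qed
qed simp

text \<open>Dini's argument: the sets of points in the compact interval whose survival probability
  is still at least 1/2 are compact and decreasing, and a common point would survive forever with
  positive probability.\<close>

lemma survival_uniform: "\<exists>n>0. \<forall>x\<in>I \<inter> {-L..L}. survival n x \<le> ennreal (1/2)"
proof (rule ccontr)
  assume no: "\<not> ?thesis"
  let ?C = "I \<inter> {-L..L}"
  \<comment> \<open>The index is shifted by one because the time found here is required to be
    positive.\<close>
  define F where "F n = ?C \<inter> (\<lambda>x. enn2real (survival (Suc n) x)) -` {1/2..}" for n
  have C: "compact ?C" using closed_I by (simp add: closed_Int_compact)
  have cont: "continuous_on ?C (\<lambda>x. enn2real (survival (Suc n) x))" for n
    by (rule continuous_on_subset[OF survival_continuous]) simp
  have "closed (F n)" for n
    unfolding F_def by (rule continuous_closed_preimage[OF cont compact_imp_closed[OF C]]) simp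
  then have "compact (F n)" for n
    using compact_Int_closed[OF C, of "F n"] by (simp add: F_def Int_absorb1 inf.assoc[symmetric])
  moreover have "F n \<noteq> {}" for n
  proof -
    obtain x where x: "x \<in> ?C" "\<not> survival (Suc n) x \<le> ennreal (1/2)" using no by blast
    then have "ennreal (1/2) \<le> survival (Suc n) x" by simp
    then have "enn2real (ennreal (1/2)) \<le> enn2real (survival (Suc n) x)"
      using x(1) by (intro enn2real_mono order_le_less_trans[OF survival_le_1]) auto
    then have "1/2 \<le> enn2real (survival (Suc n) x)" by (subst (asm) enn2real_ennreal) simp_all
    then show ?thesis using x(1) by (auto simp: F_def)
  qed
  moreover have "F n \<subseteq> F m" if "m \<le> n" for m n
  proof -
    have "enn2real (survival (Suc n) x) \<le> enn2real (survival (Suc m) x)" if x: "x \<in> I" for x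
      by (rule enn2real_mono[OF survival_antimono[OF x]])
         (use \<open>m \<le> n\<close> survival_le_1[OF x, of "Suc m"] in \<open>auto simp del: survival.simps simp: order_le_less_trans\<close>)
    then show ?thesis unfolding F_def by (auto simp del: survival.simps intro: order_trans)
  qed
  ultimately have "\<Inter>(range F) \<noteq> {}" by (rule compact_nest)
  then obtain x where x: "\<And>n. x \<in> F n" by blast
  then have xI: "x \<in> I" using x[of 0] by (simp add: F_def)
  have "ennreal (1/2) \<le> survival n x" for n
  proof -
    have "ennreal (1/2) \<le> ennreal (enn2real (survival (Suc n) x))" using x[of n] by (intro ennreal_leI) (simp add: F_def del: survival.simps)
    also have "\<dots> = survival (Suc n) x"
      using survival_le_1[OF xI, of "Suc n"] by (intro ennreal_enn2real) (simp add: order_le_less_trans del: survival.simps)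
    also have "\<dots> \<le> survival n x" by (rule survival_decreasing[OF xI])
    finally show ?thesis .
  qed
  then have "ennreal (1/2) \<le> (INF n. survival n x)" by (rule INF_greatest)
  then show False unfolding survival_tendsto_0[OF xI] by simp
qed

section \<open>Occupation of compact sets before death\<close>

primrec visits :: "real set \<Rightarrow> nat \<Rightarrow> real \<Rightarrow> ennreal" where
  "visits C 0 = (\<lambda>x. 0)"
| "visits C (Suc n) = (\<lambda>x. indicator C x + (\<integral>\<^sup>+y. visits C n y \<partial>T x))"

lemma visits_measurable: "C \<in> sets B \<Longrightarrow> visits C n \<in> borel_measurable B"
  by (induction n) (auto intro!: borel_measurable_add Top_measurable)

text \<open>The first \<open>n\<close> time points contribute at most \<open>n\<close> visits, and
  later ones at most \<open>D\<close>, but only if the chain has survived \<open>n\<close>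
  steps.\<close>

lemma visits_add_le:
  assumes C: "C \<in> sets B" and D: "\<And>y. y \<in> I \<Longrightarrow> visits C m y \<le> D" and x: "x \<in> I"
  shows "visits C (n + m) x \<le> of_nat n + D * survival n x"
  using x
proof (induction n arbitrary: x)
  case 0
  then show ?case using D by simp
next
  case (Suc n)
  have m: "(\<lambda>y. D * survival n y) \<in> borel_measurable (T x)"
    by (intro borel_measurable_times_ennreal borel_measurable_const mT[OF Suc.prems survival_measurable])
  have "visits C (Suc n + m) x \<le> 1 + (\<integral>\<^sup>+y. of_nat n + D * survival n y \<partial>T x)"
    using Suc.IH space_T[OF Suc.prems]
    by (simp, intro add_mono nn_integral_mono) (auto simp: indicator_def)
  also have "(\<integral>\<^sup>+y. of_nat n + D * survival n y \<partial>T x) = (\<integral>\<^sup>+y. of_nat n \<partial>T x) + (\<integral>\<^sup>+y. D * survival n y \<partial>T x)"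
    by (rule nn_integral_add[OF _ m]) simp
  also have "\<dots> \<le> of_nat n + D * survival (Suc n) x"
    using nn_integral_cmult[OF mT[OF Suc.prems survival_measurable], of D n] Top_const_le[OF Suc.prems]
    by (simp add: add_right_mono del: nn_integral_const)
  finally show ?case by (simp add: add.assoc[symmetric] add_left_mono)
qed

text \<open>A start in \<open>C\<close> costs at most \<open>K\<close> visits before at least half
  of the mass has died, so a uniform bound \<open>D\<close> is reproduced as soon as
  \<open>K + D / 2 \<le> D\<close>; this is the origin of \<open>2 * K\<close>. The induction is
  strong because a start in \<open>C\<close> advances time by \<open>K\<close>, and a start outside
  by a single step.\<close>

lemma visits_bounded:
  assumes C: "C = I \<inter> {-L..L}" and K: "K > 0" "\<And>x. x \<in> C \<Longrightarrow> survival K x \<le> ennreal (1/2)"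
    and x: "x \<in> I"
  shows "visits C n x \<le> of_nat (2 * K)"
  using x
proof (induction n arbitrary: x rule: less_induct)
  case (less n)
  have CB: "C \<in> sets B" unfolding C by (simp add: sets_B_iff)
  show ?case
  proof (cases "x \<in> C")
    case True
    show ?thesis
    proof (cases "n < K")
      case True
      have "visits C (n + 0) x \<le> of_nat n + 0 * survival n x"
        by (rule visits_add_le[OF CB _ less.prems]) simp
      also have "\<dots> \<le> of_nat (2 * K)" using True by (simp only: mult_zero_left add_0_right of_nat_le_iff)
      finally show ?thesis by simp
    next
      case False
      define m where "m = n - K"
      have n: "n = K + m" "m < n" using False K(1) by (auto simp: m_def)
      have "visits C (K + m) x \<le> of_nat K + of_nat (2 * K) * survival K x"
        by (rule visits_add_le[OF CB less.IH[OF n(2)] less.prems])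
      also have "\<dots> \<le> of_nat K + of_nat (2 * K) * ennreal (1/2)"
        by (intro add_left_mono mult_left_mono K(2) True) simp
      also have "\<dots> = of_nat (2 * K)"
      proof -
        have "of_nat (2 * K) * ennreal (1/2) = of_nat K"
          using half_double[of "of_nat K"] by (simp only: of_nat_mult of_nat_numeral mult.commute)
        then show ?thesis by (simp add: mult_2)
      qed
      finally show ?thesis using n by simp
    qed
  next
    case False
    show ?thesis
    proof (cases n)
      case (Suc m)
      have "visits C n x = Top (visits C m) x" using False Suc by simp
      also have "\<dots> \<le> (\<integral>\<^sup>+y. of_nat (2 * K) \<partial>T x)"
        using less.IH[of m] Suc space_T[OF less.prems] by (intro nn_integral_mono) simp
      also have "\<dots> \<le> of_nat (2 * K)" by (rule Top_const_le[OF less.prems])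
      finally show ?thesis .
    qed simp
  qed
qed

section \<open>The occupation measure of an excursion\<close>

primrec \<nu>_iter :: "nat \<Rightarrow> real measure" where
  "\<nu>_iter 0 = \<nu>"
| "\<nu>_iter (Suc n) = \<nu>_iter n \<bind> T"

lemma \<nu>_iter_subprob: "\<nu>_iter n \<in> space (subprob_algebra B)"
proof (induction n)
  case 0
  show ?case using subprob_\<nu> by simp
next
  case (Suc n)
  have sets: "sets (\<nu>_iter n) = sets B" and sub: "subprob_space (\<nu>_iter n)"
    using Suc by (auto simp: space_subprob_algebra)
  have T: "T \<in> \<nu>_iter n \<rightarrow>\<^sub>M subprob_algebra B"
    using T_measurable unfolding measurable_cong_sets[OF sets refl] .
  have "sets (\<nu>_iter n \<bind> T) = sets B"
    using sets_eq_imp_space_eq[OF sets] zero_in_I space_B sets_T by (intro sets_bind) auto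
  then show ?case
    using subprob_space_bind[OF sub T] by (simp add: space_subprob_algebra)
qed

lemma sets_\<nu>_iter: "sets (\<nu>_iter n) = sets B"
  using \<nu>_iter_subprob by (simp add: space_subprob_algebra)

lemma space_\<nu>_iter: "space (\<nu>_iter n) = I"
  using sets_eq_imp_space_eq[OF sets_\<nu>_iter] by (simp add: space_B)

lemma m\<nu>_iter: "f \<in> borel_measurable B \<Longrightarrow> f \<in> borel_measurable (\<nu>_iter n)"
  unfolding measurable_cong_sets[OF sets_\<nu>_iter refl] .

lemma nn_integral_\<nu>_iter_Suc:
  assumes f: "f \<in> borel_measurable B"
  shows "(\<integral>\<^sup>+y. f y \<partial>\<nu>_iter (Suc n)) = (\<integral>\<^sup>+x. Top f x \<partial>\<nu>_iter n)"
proof -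
  have T: "T \<in> \<nu>_iter n \<rightarrow>\<^sub>M subprob_algebra B"
    using T_measurable unfolding measurable_cong_sets[OF sets_\<nu>_iter refl] .
  show ?thesis unfolding \<nu>_iter.simps by (rule nn_integral_bind[OF f T])
qed

text \<open>The Green functional of the killed chain: the expected sum of \<open>f\<close> along one
  excursion, from a start with law \<open>\<nu>\<close> until death.\<close>

abbreviation G :: "(real \<Rightarrow> ennreal) \<Rightarrow> ennreal" where
  "G f \<equiv> \<Sum>n. \<integral>\<^sup>+y. f y \<partial>\<nu>_iter n"

lemma G_add:
  "f \<in> borel_measurable B \<Longrightarrow> g \<in> borel_measurable B \<Longrightarrow> G (\<lambda>x. f x + g x) = G f + G g"
  by (simp add: nn_integral_add m\<nu>_iter suminf_add[symmetric])

lemma G_cmult: "f \<in> borel_measurable B \<Longrightarrow> G (\<lambda>x. k * f x) = k * G f"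
  by (simp add: nn_integral_cmult m\<nu>_iter)

lemma G_cong: "(\<And>x. x \<in> I \<Longrightarrow> f x = g x) \<Longrightarrow> G f = G g"
  by (intro suminf_cong nn_integral_cong) (simp add: space_\<nu>_iter)

lemma G_Top:
  assumes f: "f \<in> borel_measurable B"
  shows "G (Top f) + (\<integral>\<^sup>+y. f y \<partial>\<nu>) = G f"
proof -
  have "G f = (\<Sum>n. \<integral>\<^sup>+y. f y \<partial>\<nu>_iter (n + 1)) + (\<Sum>n<1. \<integral>\<^sup>+y. f y \<partial>\<nu>_iter n)"
    by (rule suminf_offset) simp
  then show ?thesis using nn_integral_\<nu>_iter_Suc[OF f] by simp
qed

text \<open>As \<open>\<sigma>\<close> is the killing rate, this expected sum is the probability
  that the excursion ever ends. It equals 1 because survival tends to 0, and the exact value 1 is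
  what makes the occupation measure invariant.\<close>

lemma G_sigma: "G (\<lambda>x. ennreal (\<sigma> x)) = 1"
proof -
  have \<sigma>_meas: "(\<lambda>x. ennreal (\<sigma> x)) \<in> borel_measurable B"
    by (rule measurable_compose[OF continuous_measurable[OF \<sigma>_cont]]) simp
  have mass: "(\<integral>\<^sup>+y. survival j y \<partial>\<nu>_iter n) = (\<integral>\<^sup>+y. 1 \<partial>\<nu>_iter (n + j))" for n j
  proof (induction j arbitrary: n)
    case (Suc j)
    have "(\<integral>\<^sup>+y. survival (Suc j) y \<partial>\<nu>_iter n) = (\<integral>\<^sup>+y. survival j y \<partial>\<nu>_iter (Suc n))"
      unfolding nn_integral_\<nu>_iter_Suc[OF survival_measurable] by simp
    also have "\<dots> = (\<integral>\<^sup>+y. 1 \<partial>\<nu>_iter (Suc n + j))" by (rule Suc)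
    finally show ?case by (simp only: add_Suc_right add_Suc)
  qed simp
  have T1: "Top (\<lambda>_. 1) x + ennreal (\<sigma> x) = 1" if x: "x \<in> I" for x
  proof -
    interpret prob_space "q x" using prob_q[OF x] .
    have q1: "qop (\<lambda>_. 1) y = 1" if "y \<in> I" for y
      using prob_space.emeasure_space_1[OF prob_q[OF that]] by simp
    have qq1: "qop (qop (\<lambda>_. 1)) x = 1"
    proof -
      have "qop (qop (\<lambda>_. 1)) x = qop (\<lambda>_. 1) x" using q1 space_q[OF x] by (intro nn_integral_cong) simp
      then show ?thesis using q1[OF x] by simp
    qed
    have \<nu>1: "(\<integral>\<^sup>+y. 1 \<partial>\<nu>) = 1" using prob_space.emeasure_space_1[OF prob_\<nu>] by simp
    have id: "2 * Top (\<lambda>_. 1) x + 2 * ennreal (\<sigma> x) = 2"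
      using split_identity[OF x, of "\<lambda>_. 1"] unfolding \<nu>1 qq1 q1[OF x] by simp
    have "2 * (Top (\<lambda>_. 1) x + ennreal (\<sigma> x)) = 2 * 1" unfolding distrib_left id by simp
    then have "ennreal (1/2) * (2 * (Top (\<lambda>_. 1) x + ennreal (\<sigma> x))) = ennreal (1/2) * (2 * 1)" by simp
    then show ?thesis by (simp only: half_double)
  qed
  \<comment> \<open>Mass balance: what is killed before time \<open>k\<close> and what still
    survives at time \<open>k\<close> add up to the initial mass.\<close>
  have tele: "(\<Sum>n<k. \<integral>\<^sup>+x. ennreal (\<sigma> x) \<partial>\<nu>_iter n) + (\<integral>\<^sup>+x. survival k x \<partial>\<nu>) = 1" for k
  proof (induction k)
    case 0
    show ?case using prob_space.emeasure_space_1[OF prob_\<nu>] by simp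
  next
    case (Suc k)
    have "(\<integral>\<^sup>+x. ennreal (\<sigma> x) \<partial>\<nu>_iter k) + (\<integral>\<^sup>+x. survival (Suc k) x \<partial>\<nu>) = (\<integral>\<^sup>+x. survival k x \<partial>\<nu>)"
    proof -
      have "(\<integral>\<^sup>+x. survival (Suc k) x \<partial>\<nu>) = (\<integral>\<^sup>+x. Top (\<lambda>_. 1) x \<partial>\<nu>_iter k)"
        using mass[where n = 0 and j = "Suc k"] nn_integral_\<nu>_iter_Suc[of "\<lambda>_. 1" k] by (simp del: nn_integral_const survival.simps)
      then have "(\<integral>\<^sup>+x. ennreal (\<sigma> x) \<partial>\<nu>_iter k) + (\<integral>\<^sup>+x. survival (Suc k) x \<partial>\<nu>)
        = (\<integral>\<^sup>+x. ennreal (\<sigma> x) + Top (\<lambda>_. 1) x \<partial>\<nu>_iter k)"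
        using nn_integral_add[OF m\<nu>_iter[OF \<sigma>_meas] m\<nu>_iter[OF Top_measurable[of "\<lambda>_. 1"]], of k]
        by (simp del: nn_integral_const survival.simps)
      also have "\<dots> = (\<integral>\<^sup>+x. 1 \<partial>\<nu>_iter k)"
        using T1 space_\<nu>_iter by (intro nn_integral_cong) (simp add: add.commute del: nn_integral_const)
      also have "\<dots> = (\<integral>\<^sup>+x. survival k x \<partial>\<nu>)" using mass[where n = 0 and j = k] by simp
      finally show ?thesis .
    qed
    then show ?case using Suc by (simp add: add.assoc del: survival.simps)
  qed
  have lim: "(INF k. \<integral>\<^sup>+x. survival k x \<partial>\<nu>) = 0"
  proof -
    have "(INF k. \<integral>\<^sup>+x. survival k x \<partial>\<nu>) = (\<integral>\<^sup>+x. (INF k. survival k x) \<partial>\<nu>)"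
    proof (rule nn_integral_monotone_convergence_INF_AE'[symmetric])
      show "AE y in \<nu>. survival (Suc n) y \<le> survival n y" for n
        using survival_decreasing space_\<nu> by (intro AE_I2) blast
      show "survival n \<in> borel_measurable \<nu>" for n by (rule m\<nu>[OF survival_measurable])
      show "(\<integral>\<^sup>+y. survival 0 y \<partial>\<nu>) < \<infinity>" using prob_space.emeasure_space_1[OF prob_\<nu>] by simp
    qed
    also have "\<dots> = (\<integral>\<^sup>+x. 0 \<partial>\<nu>)" using survival_tendsto_0 space_\<nu> by (intro nn_integral_cong) simp
    finally show ?thesis by simp
  qed
  show ?thesis
  proof (rule antisym)
    show "G (\<lambda>x. ennreal (\<sigma> x)) \<le> 1"
    proof (rule suminf_le_const)
      show "(\<Sum>n<k. \<integral>\<^sup>+x. ennreal (\<sigma> x) \<partial>\<nu>_iter n) \<le> 1" for k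
        using tele[of k] by (metis le_iff_add)
    qed simp
    have "1 \<le> G (\<lambda>x. ennreal (\<sigma> x)) + (\<integral>\<^sup>+x. survival k x \<partial>\<nu>)" for k
      unfolding tele[of k, symmetric] by (intro add_right_mono sum_le_suminf summableI) auto
    then have "1 \<le> (INF k. G (\<lambda>x. ennreal (\<sigma> x)) + (\<integral>\<^sup>+x. survival k x \<partial>\<nu>))" by (rule INF_greatest)
    also have "\<dots> = G (\<lambda>x. ennreal (\<sigma> x)) + (INF k. \<integral>\<^sup>+x. survival k x \<partial>\<nu>)"
      by (rule INF_ennreal_const_add)
    finally show "1 \<le> G (\<lambda>x. ennreal (\<sigma> x))" unfolding lim by simp
  qed
qed

lemma G_compact: "G (indicator (I \<inter> {-L..L})) < \<infinity>"
proof -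
  let ?C = "I \<inter> {-L..L}"
  have C: "?C \<in> sets B" by (simp add: sets_B_iff)
  obtain K where K: "K > 0" "\<And>x. x \<in> ?C \<Longrightarrow> survival K x \<le> ennreal (1/2)"
    using survival_uniform by blast
  have sum: "(\<Sum>i<j. \<integral>\<^sup>+y. indicator ?C y \<partial>\<nu>_iter (n + i)) = (\<integral>\<^sup>+y. visits ?C j y \<partial>\<nu>_iter n)" for j n
  proof (induction j arbitrary: n)
    case (Suc j)
    have "(\<Sum>i<Suc j. \<integral>\<^sup>+y. indicator ?C y \<partial>\<nu>_iter (n + i))
      = (\<integral>\<^sup>+y. indicator ?C y \<partial>\<nu>_iter n) + (\<Sum>i<j. \<integral>\<^sup>+y. indicator ?C y \<partial>\<nu>_iter (Suc n + i))"
      by (simp only: sum.lessThan_Suc_shift add_0_right add_Suc_right add_Suc)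
    also have "\<dots> = (\<integral>\<^sup>+y. indicator ?C y \<partial>\<nu>_iter n) + (\<integral>\<^sup>+x. Top (visits ?C j) x \<partial>\<nu>_iter n)"
      unfolding Suc nn_integral_\<nu>_iter_Suc[OF visits_measurable[OF C]] ..
    also have "\<dots> = (\<integral>\<^sup>+y. indicator ?C y + Top (visits ?C j) y \<partial>\<nu>_iter n)"
      by (intro nn_integral_add[symmetric] m\<nu>_iter borel_measurable_indicator Top_measurable visits_measurable C)
    finally show ?case by simp
  qed simp
  have "G (indicator ?C) \<le> of_nat (2 * K)"
  proof (rule suminf_le_const)
    fix k
    have "(\<Sum>i<k. \<integral>\<^sup>+y. indicator ?C y \<partial>\<nu>_iter i) = (\<integral>\<^sup>+y. visits ?C k y \<partial>\<nu>)"
      using sum[where n = 0 and j = k] by simp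
    also have "\<dots> \<le> (\<integral>\<^sup>+y. of_nat (2 * K) \<partial>\<nu>)"
      using visits_bounded[OF refl K] space_\<nu> by (intro nn_integral_mono) simp
    also have "\<dots> = of_nat (2 * K)" using prob_space.emeasure_space_1[OF prob_\<nu>] by simp
    finally show "(\<Sum>i<k. \<integral>\<^sup>+y. indicator ?C y \<partial>\<nu>_iter i) \<le> of_nat (2 * K)" .
  qed simp
  also have "\<dots> < \<infinity>" by (simp add: ennreal_mult_less_top of_nat_less_top)
  finally show ?thesis .
qed

text \<open>The drift inequality is summed along the successive laws of the killed chain. Every term
  stays on the side where it is added, so no possibly infinite quantity is cancelled; the integral
  of \<open>w\<close> at the last time is simply dropped.\<close>

lemma G_comparison:
  assumes meas: "w \<in> borel_measurable B" "f \<in> borel_measurable B" "g \<in> borel_measurable B"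
    and le: "\<And>x. x \<in> I \<Longrightarrow> Top w x + f x \<le> w x + g x"
  shows "G f \<le> (\<integral>\<^sup>+y. w y \<partial>\<nu>) + G g"
proof (rule suminf_le_const)
  fix k
  have "(\<integral>\<^sup>+y. w y \<partial>\<nu>_iter k) + (\<Sum>n<k. \<integral>\<^sup>+y. f y \<partial>\<nu>_iter n) \<le> (\<integral>\<^sup>+y. w y \<partial>\<nu>) + (\<Sum>n<k. \<integral>\<^sup>+y. g y \<partial>\<nu>_iter n)"
  proof (induction k)
    case (Suc k)
    have "(\<integral>\<^sup>+y. w y \<partial>\<nu>_iter (Suc k)) + (\<integral>\<^sup>+y. f y \<partial>\<nu>_iter k) = (\<integral>\<^sup>+y. Top w y + f y \<partial>\<nu>_iter k)"
      unfolding nn_integral_\<nu>_iter_Suc[OF meas(1)]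
      by (intro nn_integral_add[symmetric] m\<nu>_iter Top_measurable meas)
    also have "\<dots> \<le> (\<integral>\<^sup>+y. w y + g y \<partial>\<nu>_iter k)"
      using le space_\<nu>_iter by (intro nn_integral_mono) simp
    also have "\<dots> = (\<integral>\<^sup>+y. w y \<partial>\<nu>_iter k) + (\<integral>\<^sup>+y. g y \<partial>\<nu>_iter k)"
      by (intro nn_integral_add m\<nu>_iter meas)
    finally have step: "(\<integral>\<^sup>+y. w y \<partial>\<nu>_iter (Suc k)) + (\<integral>\<^sup>+y. f y \<partial>\<nu>_iter k)
      \<le> (\<integral>\<^sup>+y. w y \<partial>\<nu>_iter k) + (\<integral>\<^sup>+y. g y \<partial>\<nu>_iter k)" .
    have "(\<integral>\<^sup>+y. w y \<partial>\<nu>_iter (Suc k)) + (\<Sum>n<Suc k. \<integral>\<^sup>+y. f y \<partial>\<nu>_iter n)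
      = ((\<integral>\<^sup>+y. w y \<partial>\<nu>_iter (Suc k)) + (\<integral>\<^sup>+y. f y \<partial>\<nu>_iter k)) + (\<Sum>n<k. \<integral>\<^sup>+y. f y \<partial>\<nu>_iter n)"
      by (simp only: sum.lessThan_Suc ac_simps)
    also have "\<dots> \<le> ((\<integral>\<^sup>+y. w y \<partial>\<nu>_iter k) + (\<integral>\<^sup>+y. g y \<partial>\<nu>_iter k)) + (\<Sum>n<k. \<integral>\<^sup>+y. f y \<partial>\<nu>_iter n)"
      by (rule add_right_mono[OF step])
    also have "\<dots> = ((\<integral>\<^sup>+y. w y \<partial>\<nu>_iter k) + (\<Sum>n<k. \<integral>\<^sup>+y. f y \<partial>\<nu>_iter n)) + (\<integral>\<^sup>+y. g y \<partial>\<nu>_iter k)"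
      by (simp only: ac_simps)
    also have "\<dots> \<le> ((\<integral>\<^sup>+y. w y \<partial>\<nu>) + (\<Sum>n<k. \<integral>\<^sup>+y. g y \<partial>\<nu>_iter n)) + (\<integral>\<^sup>+y. g y \<partial>\<nu>_iter k)"
      by (rule add_right_mono[OF Suc])
    finally show ?case by (simp only: sum.lessThan_Suc ac_simps)
  qed simp
  then have "(\<Sum>n<k. \<integral>\<^sup>+y. f y \<partial>\<nu>_iter n) \<le> (\<integral>\<^sup>+y. w y \<partial>\<nu>) + (\<Sum>n<k. \<integral>\<^sup>+y. g y \<partial>\<nu>_iter n)"
    by (rule order_trans[rotated]) simp
  also have "\<dots> \<le> (\<integral>\<^sup>+y. w y \<partial>\<nu>) + G g"
    by (intro add_left_mono sum_le_suminf summableI) auto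
  finally show "(\<Sum>n<k. \<integral>\<^sup>+y. f y \<partial>\<nu>_iter n) \<le> (\<integral>\<^sup>+y. w y \<partial>\<nu>) + G g" .
qed simp

text \<open>Since \<open>2 T \<le> q + q\<^sup>2\<close>, the drift inequality is used both at
  \<open>x\<close> and once more under \<open>q x\<close>. This explains why \<open>f\<close> and
  \<open>g\<close> occur with weight 2 and also through \<open>qop\<close>.\<close>

lemma Top_drift:
  assumes meas: "w \<in> borel_measurable B" "f \<in> borel_measurable B" "g \<in> borel_measurable B"
    and le: "\<And>x. x \<in> I \<Longrightarrow> qop w x + f x \<le> w x + g x" and x: "x \<in> I"
  shows "2 * Top w x + (2 * f x + qop f x) \<le> 2 * w x + (2 * g x + qop g x)"
proof -
  have "2 * Top w x \<le> qop w x + qop (qop w) x"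
    unfolding split_identity[OF x meas(1), symmetric] by simp
  then have "2 * Top w x + (2 * f x + qop f x) \<le> (qop w x + qop (qop w) x) + (2 * f x + qop f x)"
    by (rule add_right_mono)
  also have "\<dots> = (qop (qop w) x + qop f x) + (qop w x + 2 * f x)" by (simp only: ac_simps)
  also have "qop (qop w) x + qop f x = (\<integral>\<^sup>+y. qop w y + f y \<partial>q x)"
    by (intro nn_integral_add[symmetric] mq[OF x] qop_measurable meas)
  also have "\<dots> \<le> (\<integral>\<^sup>+y. w y + g y \<partial>q x)" using le space_q[OF x] by (intro nn_integral_mono) simp
  also have "\<dots> = qop w x + qop g x" by (intro nn_integral_add mq[OF x] meas)
  also have "(qop w x + qop g x) + (qop w x + 2 * f x) = 2 * (qop w x + f x) + qop g x"
    by (simp only: mult_2 add.assoc add.commute add.left_commute)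
  also have "\<dots> \<le> 2 * (w x + g x) + qop g x" by (intro add_right_mono mult_left_mono le x) simp
  also have "\<dots> = 2 * w x + (2 * g x + qop g x)" by (simp only: distrib_left ac_simps)
  finally show ?thesis by (simp add: add_right_mono)
qed

lemma nn_integral_\<nu>_le:
  assumes "\<And>x. x \<in> I \<Longrightarrow> x \<in> {-r\<^sub>0..r\<^sub>0} \<Longrightarrow> f x \<le> a"
  shows "(\<integral>\<^sup>+x. f x \<partial>\<nu>) \<le> a"
proof -
  have "AE x in \<nu>. x \<notin> I - {-r\<^sub>0..r\<^sub>0}"
    by (rule AE_not_in) (use \<nu>_support in \<open>auto simp: null_sets_def sets_\<nu> sets_B_iff\<close>)
  then have "AE x in \<nu>. f x \<le> a"
    by (rule AE_mp) (use assms space_\<nu> in \<open>auto intro!: AE_I2\<close>)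
  then have "(\<integral>\<^sup>+x. f x \<partial>\<nu>) \<le> (\<integral>\<^sup>+x. a \<partial>\<nu>)" by (rule nn_integral_mono_AE)
  then show ?thesis using prob_space.emeasure_space_1[OF prob_\<nu>] by simp
qed

lemma qop_cmult: "x \<in> I \<Longrightarrow> f \<in> borel_measurable B \<Longrightarrow> qop (\<lambda>y. k * f y) x = k * qop f x"
  by (rule nn_integral_cmult[OF mq])

lemma Top_cmult: "x \<in> I \<Longrightarrow> f \<in> borel_measurable B \<Longrightarrow> Top (\<lambda>y. k * f y) x = k * Top f x"
  by (rule nn_integral_cmult[OF mT])

lemma qop_indicator: "x \<in> I \<Longrightarrow> A \<in> sets B \<Longrightarrow> qop (indicator A) x = emeasure (q x) A"
  by (simp add: sets_q)

abbreviation \<rho> :: "real \<Rightarrow> ennreal" where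
  "\<rho> x \<equiv> ennreal (1 / (1 + x\<^sup>2))"

lemma \<rho>_measurable: "\<rho> \<in> borel_measurable B"
  by (rule measurable_restrict_space1) measurable

text \<open>The iterated drift of \<open>V\<close> gains \<open>c (2 \<rho> + q \<rho>)\<close> and
  costs indicators of a compact set, whose occupation is finite, together with their image under
  \<open>q\<close>. By \<open>escape\<close> this image is at most \<open>c \<rho>\<close> plus a
  compactly supported term, and one of the two gained copies of \<open>c \<rho>\<close> pays for it.
  The term with \<open>qop\<close> is bounded as well, because the invariant measure will involve
  one extra step after the excursion.\<close>

lemma G_rho: "G \<rho> + G (qop \<rho>) < \<infinity>"
proof -
  let ?V = "\<lambda>x. ennreal (V x)"
  let ?C = "\<lambda>r. I \<inter> {-r..r}"
  have C: "?C r \<in> sets B" for r by (simp add: sets_B_iff)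
  have indC: "(indicator (?C r) :: real \<Rightarrow> ennreal) \<in> borel_measurable B" for r
    by (rule borel_measurable_indicator[OF C])
  have V_meas: "?V \<in> borel_measurable B"
    by (rule measurable_compose[OF continuous_measurable[OF V_cont]]) simp
  have qV: "qop ?V x = ennreal (\<integral>y. V y \<partial>q x)" if "x \<in> I" for x
    using V_integrable[OF that] V_nonneg by (intro nn_integral_eq_integral) auto
  have cmul: "(\<lambda>x. k * f x) \<in> borel_measurable B" if "f \<in> borel_measurable B" for k :: ennreal and f
    using that by (intro borel_measurable_times_ennreal borel_measurable_const)
  have drift: "qop ?V x + ennreal c * \<rho> x \<le> ?V x + ennreal b * indicator (?C R) x" if x: "x \<in> I" for x
  proof -
    have int: "0 \<le> (\<integral>y. V y \<partial>q x)" using V_nonneg by (intro integral_nonneg_AE) auto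
    have c: "0 \<le> 1 / (1 + x\<^sup>2)" by (simp add: add_nonneg_nonneg)
    have "qop ?V x + ennreal c * \<rho> x = ennreal ((\<integral>y. V y \<partial>q x) + c / (1 + x\<^sup>2))"
    proof -
      have "ennreal c * \<rho> x = ennreal (c * (1 / (1 + x\<^sup>2)))"
        using constants c by (intro ennreal_mult[symmetric]) auto
      moreover have "0 \<le> c * (1 / (1 + x\<^sup>2))" using constants c by (intro mult_nonneg_nonneg) auto
      ultimately show ?thesis unfolding qV[OF x] using int by (simp only: ennreal_plus[symmetric]) simp
    qed
    also have "\<dots> \<le> ennreal (V x + b * indicator {-R..R} x)" by (intro ennreal_leI V_drift x)
    also have "\<dots> = ?V x + ennreal (b * indicator {-R..R} x)"
      using V_nonneg[of x] constants by (intro ennreal_plus) auto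
    also have "ennreal (b * indicator {-R..R} x) = ennreal b * indicator (?C R) x"
      using x by (simp add: indicator_def)
    finally show ?thesis .
  qed
  \<comment> \<open>The threshold is \<open>c / (b + 1)\<close> so that multiplication by
    \<open>b\<close> leaves at most \<open>c\<close>, without dividing by zero when
    \<open>b = 0\<close>.\<close>
  obtain r where r: "\<And>x. x \<in> I \<Longrightarrow> r < \<bar>x\<bar> \<Longrightarrow> measure (q x) (?C R) \<le> c / (b + 1) / (1 + x\<^sup>2)"
  proof -
    have "0 < c / (b + 1)" using constants by simp
    from escape[OF this, of R] show ?thesis using that by blast
  qed
  have esc: "ennreal b * emeasure (q x) (?C R) \<le> ennreal c * \<rho> x + ennreal b * indicator (?C r) x" if x: "x \<in> I" for x
  proof -
    interpret prob_space "q x" using prob_q[OF x] .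
    show ?thesis
    proof (cases "r < \<bar>x\<bar>")
      case True
      have "b * measure (q x) (?C R) \<le> b * (c / (b + 1) / (1 + x\<^sup>2))"
        using r[OF x True] constants by (intro mult_left_mono) auto
      also have "\<dots> = b / (b + 1) * (c / (1 + x\<^sup>2))" by (simp add: field_simps)
      also have "\<dots> \<le> 1 * (c / (1 + x\<^sup>2))"
        using constants by (intro mult_right_mono) (auto simp: add_nonneg_nonneg)
      finally have "ennreal (b * measure (q x) (?C R)) \<le> ennreal (c * (1 / (1 + x\<^sup>2)))" by (intro ennreal_leI) simp
      also have "ennreal (c * (1 / (1 + x\<^sup>2))) = ennreal c * \<rho> x"
        using constants by (intro ennreal_mult) (auto simp: add_nonneg_nonneg)
      also have "ennreal (b * measure (q x) (?C R)) = ennreal b * emeasure (q x) (?C R)"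
        using constants by (simp add: emeasure_eq_measure ennreal_mult)
      finally show ?thesis by (rule order_trans) simp
    next
      case False
      then have "x \<in> ?C r" using x by auto
      moreover have "ennreal b * emeasure (q x) (?C R) \<le> ennreal b * 1" by (intro mult_left_mono emeasure_le_1) simp
      ultimately have "ennreal b * emeasure (q x) (?C R) \<le> ennreal b * indicator (?C r) x" by simp
      then show ?thesis by (rule order_trans) simp
    qed
  qed
  let ?w = "\<lambda>x. 2 * ?V x" and ?f = "\<lambda>x. ennreal c * \<rho> x + ennreal c * qop \<rho> x"
  let ?g = "\<lambda>x. 2 * (ennreal b * indicator (?C R) x) + ennreal b * indicator (?C r) x"
  have f_meas: "?f \<in> borel_measurable B"
    by (intro borel_measurable_add cmul \<rho>_measurable qop_measurable)
  have g_meas: "?g \<in> borel_measurable B" by (intro borel_measurable_add cmul indC)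
  \<comment> \<open>Separates one copy \<open>u\<close> of the gain on each side, to be cancelled;
    cancellation is allowed because \<open>ennreal c * \<rho> x\<close> is finite.\<close>
  have rearrange: "u + (2 * t + (u + v)) \<le> u + (2 * w + (2 * y + z))"
    if "2 * t + (2 * u + v) \<le> 2 * w + (2 * y + (u + z))" for t u v w y z :: ennreal
    using that by (simp only: mult_2 add.assoc add.commute add.left_commute)
  have main: "Top ?w x + ?f x \<le> ?w x + ?g x" if x: "x \<in> I" for x
  proof -
    have "2 * Top ?V x + (2 * (ennreal c * \<rho> x) + ennreal c * qop \<rho> x)
      \<le> 2 * ?V x + (2 * (ennreal b * indicator (?C R) x) + ennreal b * emeasure (q x) (?C R))"
      using Top_drift[OF V_meas cmul[OF \<rho>_measurable] cmul[OF indC] drift x]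
      unfolding qop_cmult[OF x \<rho>_measurable] qop_cmult[OF x indC] qop_indicator[OF x C] .
    also have "\<dots> \<le> 2 * ?V x + (2 * (ennreal b * indicator (?C R) x) + (ennreal c * \<rho> x + ennreal b * indicator (?C r) x))"
      by (intro add_left_mono esc x)
    finally have "ennreal c * \<rho> x + (2 * Top ?V x + ?f x) \<le> ennreal c * \<rho> x + (?w x + ?g x)"
      by (rule rearrange)
    moreover have "ennreal c * \<rho> x \<noteq> \<top>" by (simp add: ennreal_mult_eq_top_iff)
    ultimately have "2 * Top ?V x + ?f x \<le> ?w x + ?g x" by (simp only: ennreal_add_left_cancel_le infinity_ennreal_def) blast
    then show ?thesis by (simp only: Top_cmult[OF x V_meas])
  qed
  have "G ?f \<le> (\<integral>\<^sup>+y. ?w y \<partial>\<nu>) + G ?g"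
    by (rule G_comparison[OF cmul[OF V_meas] f_meas g_meas main])
  also have "\<dots> < \<infinity>"
  proof -
    have "compact (?C r\<^sub>0)" using closed_I by (simp add: closed_Int_compact)
    then have "compact (V ` ?C r\<^sub>0)"
      by (rule compact_continuous_image[OF continuous_on_subset[OF V_cont Int_lower1]])
    then obtain v where v: "\<And>z. z \<in> V ` ?C r\<^sub>0 \<Longrightarrow> norm z \<le> v"
      using compact_imp_bounded bounded_iff by metis
    have "(\<integral>\<^sup>+y. ?w y \<partial>\<nu>) \<le> 2 * ennreal v"
    proof (rule nn_integral_\<nu>_le)
      fix x assume "x \<in> I" "x \<in> {-r\<^sub>0..r\<^sub>0}"
      then have "norm (V x) \<le> v" by (intro v imageI IntI)
      then have "V x \<le> v" by simp
      then show "2 * ?V x \<le> 2 * ennreal v" by (intro mult_left_mono ennreal_leI) simp_all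
    qed
    also have "\<dots> < \<infinity>" by (simp add: ennreal_mult_less_top)
    finally have w_fin: "(\<integral>\<^sup>+y. ?w y \<partial>\<nu>) < \<infinity>" .
    have "G ?g = 2 * (ennreal b * G (indicator (?C R))) + ennreal b * G (indicator (?C r))"
      unfolding G_add[OF cmul[OF cmul[OF indC]] cmul[OF indC]] G_cmult[OF cmul[OF indC]] G_cmult[OF indC] ..
    moreover have "2 * (ennreal b * X) + ennreal b * Y < \<infinity>" if "X < \<infinity>" "Y < \<infinity>" for X Y
      using that by (simp add: ennreal_mult_less_top)
    ultimately have "G ?g < \<infinity>"
      using G_compact[of R] G_compact[of r] by (simp only:)
    with w_fin show ?thesis by (simp only: infinity_ennreal_def ennreal_add_less_top)
  qed
  finally have fin: "ennreal c * (G \<rho> + G (qop \<rho>)) < \<infinity>"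
    unfolding G_add[OF cmul[OF \<rho>_measurable] cmul[OF qop_measurable[OF \<rho>_measurable]]]
      G_cmult[OF \<rho>_measurable] G_cmult[OF qop_measurable[OF \<rho>_measurable]] distrib_left .
  have "X < \<infinity>" if "ennreal c * X < \<infinity>" for X
    using that constants by (auto simp: ennreal_mult_less_top)
  then show ?thesis using fin by blast
qed

text \<open>Nothing in the bound depends on \<open>a\<close>: on the support of \<open>\<nu>\<close>
  the function \<open>W a\<close> is at most \<open>2 * \<bar>r\<^sub>0\<bar> + 3\<close> for every
  \<open>a\<close>, and its error term is \<open>\<beta> \<rho>\<close>, whose accumulated size is
  the subject of \<open>G_rho\<close>.\<close>

lemma G_interval:
  obtains K where "K < \<infinity>" "\<And>a. G (indicator (I \<inter> {a-1..a+1})) + G (qop (indicator (I \<inter> {a-1..a+1}))) \<le> K"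
proof -
  define K where "K = ennreal (1 / \<delta>) * (2 * ennreal (2 * \<bar>r\<^sub>0\<bar> + 3) + 2 * ennreal \<beta> * (G \<rho> + G (qop \<rho>)))"
  have "K < \<infinity>" using G_rho by (simp add: K_def ennreal_mult_less_top)
  moreover have "G (indicator (I \<inter> {a-1..a+1})) + G (qop (indicator (I \<inter> {a-1..a+1}))) \<le> K" for a
  proof -
    let ?J = "I \<inter> {a-1..a+1}" and ?W = "\<lambda>x. ennreal (W a x)"
    have J: "?J \<in> sets B" by (simp add: sets_B_iff)
    have indJ: "(indicator ?J :: real \<Rightarrow> ennreal) \<in> borel_measurable B" by (rule borel_measurable_indicator[OF J])
    have W_meas: "?W \<in> borel_measurable B"
      by (rule measurable_compose[OF continuous_measurable[OF W_cont]]) simp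
    have cmul: "(\<lambda>x. k * f x) \<in> borel_measurable B" if "f \<in> borel_measurable B" for k :: ennreal and f
      using that by (intro borel_measurable_times_ennreal borel_measurable_const)
    have drift: "qop ?W x + ennreal \<delta> * indicator ?J x \<le> ?W x + ennreal \<beta> * \<rho> x" if x: "x \<in> I" for x
    proof -
      have int: "0 \<le> (\<integral>y. W a y \<partial>q x)" using W_nonneg by (intro integral_nonneg_AE) auto
      have "qop ?W x = ennreal (\<integral>y. W a y \<partial>q x)"
        using W_integrable[OF x] W_nonneg by (intro nn_integral_eq_integral) auto
      moreover have "ennreal \<delta> * indicator ?J x = ennreal (\<delta> * indicator {a-1..a+1} x)"
        using x by (simp add: indicator_def)
      ultimately have "qop ?W x + ennreal \<delta> * indicator ?J x = ennreal ((\<integral>y. W a y \<partial>q x) + \<delta> * indicator {a-1..a+1} x)"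
        using int constants by (simp add: ennreal_plus del: ennreal_plus[symmetric])
      also have "\<dots> \<le> ennreal (W a x + \<beta> * (1 / (1 + x\<^sup>2)))" using W_drift[OF x, of a] by (intro ennreal_leI) simp
      also have "\<dots> = ?W x + ennreal (\<beta> * (1 / (1 + x\<^sup>2)))"
        using W_nonneg[of a x] constants by (intro ennreal_plus) (auto simp: add_nonneg_nonneg)
      also have "ennreal (\<beta> * (1 / (1 + x\<^sup>2))) = ennreal \<beta> * \<rho> x"
        using constants by (intro ennreal_mult) (auto simp: add_nonneg_nonneg)
      finally show ?thesis .
    qed
    let ?w = "\<lambda>x. 2 * ?W x"
    let ?f = "\<lambda>x. 2 * (ennreal \<delta> * indicator ?J x) + ennreal \<delta> * qop (indicator ?J) x"
    let ?g = "\<lambda>x. 2 * (ennreal \<beta> * \<rho> x) + ennreal \<beta> * qop \<rho> x"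
    have f_meas: "?f \<in> borel_measurable B" by (intro borel_measurable_add cmul indJ qop_measurable)
    have g_meas: "?g \<in> borel_measurable B" by (intro borel_measurable_add cmul \<rho>_measurable qop_measurable)
    have main: "Top ?w x + ?f x \<le> ?w x + ?g x" if x: "x \<in> I" for x
      using Top_drift[OF W_meas cmul[OF indJ] cmul[OF \<rho>_measurable] drift x]
      unfolding qop_cmult[OF x \<rho>_measurable] qop_cmult[OF x indJ] Top_cmult[OF x W_meas] .
    have "ennreal \<delta> * (G (indicator ?J) + G (qop (indicator ?J))) \<le> G ?f"
      unfolding G_add[OF cmul[OF cmul[OF indJ]] cmul[OF qop_measurable[OF indJ]]] G_cmult[OF cmul[OF indJ]]
        G_cmult[OF indJ] G_cmult[OF qop_measurable[OF indJ]] distrib_left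
      by (intro add_right_mono) (simp add: mult_2)
    also have "G ?f \<le> (\<integral>\<^sup>+y. ?w y \<partial>\<nu>) + G ?g"
      by (rule G_comparison[OF cmul[OF W_meas] f_meas g_meas main])
    also have "\<dots> \<le> 2 * ennreal (2 * \<bar>r\<^sub>0\<bar> + 3) + 2 * ennreal \<beta> * (G \<rho> + G (qop \<rho>))"
    proof (rule add_mono)
      have "W a x \<le> 2 * \<bar>r\<^sub>0\<bar> + 3" if "x \<in> {-r\<^sub>0..r\<^sub>0}" for x
        using W_le[of a x] that by auto
      then show "(\<integral>\<^sup>+y. ?w y \<partial>\<nu>) \<le> 2 * ennreal (2 * \<bar>r\<^sub>0\<bar> + 3)"
        by (intro nn_integral_\<nu>_le mult_left_mono ennreal_leI) auto
      show "G ?g \<le> 2 * ennreal \<beta> * (G \<rho> + G (qop \<rho>))"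
        unfolding G_add[OF cmul[OF cmul[OF \<rho>_measurable]] cmul[OF qop_measurable[OF \<rho>_measurable]]] G_cmult[OF cmul[OF \<rho>_measurable]]
          G_cmult[OF \<rho>_measurable] G_cmult[OF qop_measurable[OF \<rho>_measurable]] distrib_left mult.assoc
        by (intro add_left_mono) (simp add: mult_2)
    qed
    finally have "ennreal (1 / \<delta>) * (ennreal \<delta> * (G (indicator ?J) + G (qop (indicator ?J)))) \<le> K"
      unfolding K_def by (rule mult_left_mono) simp
    moreover have "ennreal (1 / \<delta>) * ennreal \<delta> = 1"
      using constants by (simp add: ennreal_mult''[symmetric])
    ultimately show ?thesis by (simp only: mult.assoc[symmetric] mult_1)
  qed
  ultimately show thesis using that by blast
qed

text \<open>The occupation measure \<open>G\<close> is invariant for the average of \<open>q\<close>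
  and its square, that is, \<open>G q + G q\<^sup>2 = 2 G\<close>. To pass to \<open>q\<close>
  itself take \<open>\<pi> = (2 G + G q) / 3\<close>: then \<open>\<pi> q = (2 G q + G q\<^sup>2) /
  3 = (G q + 2 G) / 3 = \<pi>\<close>. The division by 3 only serves to write each summand as a
  mixture of subprobabilities.\<close>

theorem split_invariant_measure:
  "\<exists>\<pi>. invariant_measure I q \<pi> \<and> (\<exists>K<\<infinity>. \<forall>a. emeasure \<pi> (I \<inter> {a-1..a+1}) \<le> K)"
proof -
  define k where "k n = mixture (2/3) (\<nu>_iter n) (\<nu>_iter n \<bind> q)" for n
  have q\<nu>: "q \<in> \<nu>_iter n \<rightarrow>\<^sub>M subprob_algebra B" for n
    using q_measurable' unfolding measurable_cong_sets[OF sets_\<nu>_iter refl] .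
  have \<nu>q: "\<nu>_iter n \<bind> q \<in> space (subprob_algebra B)" for n
  proof -
    have "subprob_space (\<nu>_iter n)" using \<nu>_iter_subprob by (simp add: space_subprob_algebra)
    then have "subprob_space (\<nu>_iter n \<bind> q)" by (rule subprob_space_bind[OF _ q\<nu>])
    moreover have "sets (\<nu>_iter n \<bind> q) = sets B"
      using space_\<nu>_iter zero_in_I sets_q by (intro sets_bind) auto
    ultimately show ?thesis by (simp add: space_subprob_algebra)
  qed
  have k: "k n \<in> space (subprob_algebra B)" for n
    unfolding k_def by (rule mixture_subprob[OF \<nu>_iter_subprob \<nu>q]) auto
  obtain \<pi> where sets_\<pi>: "sets \<pi> = sets B"
    and nn: "\<And>f. f \<in> borel_measurable B \<Longrightarrow> (\<integral>\<^sup>+y. f y \<partial>\<pi>) = (\<Sum>n. \<integral>\<^sup>+y. f y \<partial>k n)"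
    using countable_sum_measure[of k B, OF k] by blast
  have space_\<pi>: "space \<pi> = I" using sets_eq_imp_space_eq[OF sets_\<pi>] by (simp add: space_B)
  have nn_\<pi>: "(\<integral>\<^sup>+y. f y \<partial>\<pi>) = ennreal (2/3) * G f + ennreal (1/3) * G (qop f)" if f: "f \<in> borel_measurable B" for f
  proof -
    have "(\<integral>\<^sup>+y. f y \<partial>k n) = ennreal (2/3) * (\<integral>\<^sup>+y. f y \<partial>\<nu>_iter n) + ennreal (1/3) * (\<integral>\<^sup>+y. qop f y \<partial>\<nu>_iter n)" for n
      unfolding k_def using nn_integral_mixture[OF \<nu>_iter_subprob \<nu>q _ _ f, of "2/3" n n]
      by (simp add: nn_integral_bind[OF f q\<nu>])
    then have "(\<integral>\<^sup>+y. f y \<partial>\<pi>) = (\<Sum>n. ennreal (2/3) * (\<integral>\<^sup>+y. f y \<partial>\<nu>_iter n) + ennreal (1/3) * (\<integral>\<^sup>+y. qop f y \<partial>\<nu>_iter n))"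
      unfolding nn[OF f] by simp
    then show ?thesis by (simp add: suminf_add[symmetric])
  qed
  have em_\<pi>: "emeasure \<pi> A = ennreal (2/3) * G (indicator A) + ennreal (1/3) * G (qop (indicator A))" if A: "A \<in> sets B" for A
    using nn_\<pi>[OF borel_measurable_indicator[OF A]] A sets_\<pi> by simp
  have inv: "(\<integral>\<^sup>+x. emeasure (q x) A \<partial>\<pi>) = emeasure \<pi> A" if A: "A \<in> sets B" for A
  proof -
    let ?f = "indicator A :: real \<Rightarrow> ennreal"
    have f: "?f \<in> borel_measurable B" by (rule borel_measurable_indicator[OF A])
    have qf: "qop ?f \<in> borel_measurable B" and qqf: "qop (qop ?f) \<in> borel_measurable B"
      using f by (auto intro: qop_measurable)
    have \<sigma>_meas: "(\<lambda>x. ennreal (\<sigma> x)) \<in> borel_measurable B"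
      by (rule measurable_compose[OF continuous_measurable[OF \<sigma>_cont]]) simp
    have "G (qop ?f) + G (qop (qop ?f)) = G (\<lambda>x. qop ?f x + qop (qop ?f) x)"
      by (rule G_add[OF qf qqf, symmetric])
    also have "\<dots> = G (\<lambda>x. 2 * Top ?f x + (2 * (\<integral>\<^sup>+y. ?f y \<partial>\<nu>)) * ennreal (\<sigma> x))"
      by (rule G_cong) (simp only: split_identity[OF _ f, symmetric] ac_simps)
    also have "\<dots> = 2 * G (Top ?f) + 2 * (\<integral>\<^sup>+y. ?f y \<partial>\<nu>) * G (\<lambda>x. ennreal (\<sigma> x))"
      by (subst G_add, intro borel_measurable_times_ennreal borel_measurable_const Top_measurable f,
          intro borel_measurable_times_ennreal borel_measurable_const \<sigma>_meas)
         (simp only: G_cmult[OF Top_measurable[OF f]] G_cmult[OF \<sigma>_meas])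
    also have "\<dots> = 2 * (G (Top ?f) + (\<integral>\<^sup>+y. ?f y \<partial>\<nu>))" by (simp only: G_sigma distrib_left mult_1_right)
    also have "\<dots> = 2 * G ?f" by (simp only: G_Top[OF f])
    finally have key: "G (qop ?f) + G (qop (qop ?f)) = 2 * G ?f" .
    have third: "ennreal (2/3) = 2 * ennreal (1/3)"
      by (simp only: ennreal_numeral[symmetric] ennreal_mult''[symmetric]) simp
    have "(\<integral>\<^sup>+x. emeasure (q x) A \<partial>\<pi>) = (\<integral>\<^sup>+x. qop ?f x \<partial>\<pi>)"
      using A space_\<pi> by (intro nn_integral_cong) (simp only: qop_indicator)
    also have "\<dots> = ennreal (1/3) * (G (qop ?f) + (G (qop ?f) + G (qop (qop ?f))))"
      unfolding nn_\<pi>[OF qf] third by (simp only: mult_2 distrib_left distrib_right ac_simps)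
    also have "\<dots> = ennreal (2/3) * G ?f + ennreal (1/3) * G (qop ?f)"
      unfolding key third by (simp only: mult_2 distrib_left distrib_right ac_simps)
    finally show ?thesis unfolding em_\<pi>[OF A] .
  qed
  obtain K where K: "K < \<infinity>" "\<And>a. G (indicator (I \<inter> {a-1..a+1})) + G (qop (indicator (I \<inter> {a-1..a+1}))) \<le> K"
    using G_interval by blast
  have bound: "emeasure \<pi> (I \<inter> {a-1..a+1}) \<le> K" for a
  proof -
    have A: "I \<inter> {a-1..a+1} \<in> sets B" by (simp add: sets_B_iff)
    have "emeasure \<pi> (I \<inter> {a-1..a+1}) \<le> 1 * G (indicator (I \<inter> {a-1..a+1})) + 1 * G (qop (indicator (I \<inter> {a-1..a+1})))"
      unfolding em_\<pi>[OF A] by (intro add_mono mult_right_mono) (auto simp: ennreal_le_1)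
    also have "\<dots> \<le> K" using K(2)[of a] by simp
    finally show ?thesis .
  qed
  have "sigma_finite_measure \<pi>"
  proof
    define A where "A a = I \<inter> {real_of_int a - 1..real_of_int a + 1}" for a :: int
    have "countable (range A)" by (rule countable_image) simp
    moreover have "A a \<in> sets \<pi>" for a unfolding A_def sets_\<pi> by (simp add: sets_B_iff)
    then have "range A \<subseteq> sets \<pi>" by blast
    moreover have "\<Union>(range A) = space \<pi>"
    proof
      show "space \<pi> \<subseteq> \<Union>(range A)"
      proof
        fix x assume "x \<in> space \<pi>"
        then have "x \<in> I" using space_\<pi> by simp
        moreover have "of_int \<lfloor>x\<rfloor> - 1 \<le> x" "x \<le> of_int \<lfloor>x\<rfloor> + 1" by linarith+
        ultimately have "x \<in> A \<lfloor>x\<rfloor>" by (simp add: A_def)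
        then show "x \<in> \<Union>(range A)" by blast
      qed
    qed (auto simp: space_\<pi> A_def)
    moreover have "emeasure \<pi> (A a) \<noteq> \<infinity>" for a
      using order_le_less_trans[OF bound[of "real_of_int a"] K(1)] by (simp add: A_def)
    then have "\<forall>a\<in>range A. emeasure \<pi> a \<noteq> \<infinity>" by blast
    ultimately show "\<exists>A. countable A \<and> A \<subseteq> sets \<pi> \<and> \<Union>A = space \<pi> \<and> (\<forall>a\<in>A. emeasure \<pi> a \<noteq> \<infinity>)"
      by blast
  qed
  \<comment> \<open>The excursion starts with law \<open>\<nu>\<close>, so its occupation measure
    has mass at least 1.\<close>
  moreover have "emeasure \<pi> I \<noteq> 0"
  proof -
    have IB: "I \<in> sets B" by (simp add: sets_B_iff)
    have "1 = (\<integral>\<^sup>+y. indicator I y \<partial>\<nu>)"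
      using prob_space.emeasure_space_1[OF prob_\<nu>] IB sets_\<nu> space_\<nu> by simp
    also have "\<dots> \<le> G (indicator I)"
      unfolding G_Top[OF borel_measurable_indicator[OF IB], symmetric] by simp
    finally have "G (indicator I) \<noteq> 0" by auto
    then show ?thesis unfolding em_\<pi>[OF IB] by simp
  qed
  ultimately have "invariant_measure I q \<pi>"
    using sets_\<pi> inv by (simp add: invariant_measure_def)
  then show ?thesis using K(1) bound by blast
qed

end

theorem (in drift_chain) invariant_measure_exists:
  "\<exists>\<pi>. invariant_measure I q \<pi> \<and> (\<exists>K<\<infinity>. \<forall>a. emeasure \<pi> (I \<inter> {a-1..a+1}) \<le> K)"
proof (rule minorization)
  fix \<nu> s r
  assume s: "\<nu> \<in> space (prob_algebra B)" "emeasure \<nu> (I - {-r..r}) = 0"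
    "continuous_on I s" "\<And>x. 0 \<le> s x" "s 0 > (0::real)"
    "\<And>x A. x \<in> I \<Longrightarrow> A \<in> sets B \<Longrightarrow> ennreal (s x) * emeasure \<nu> A \<le> emeasure (two_step x) A"
  \<comment> \<open>The minorization provides \<open>s\<close>, and the splitting wants
    \<open>2 * \<sigma>\<close> in its place.\<close>
  have cont: "continuous_on I (\<lambda>x. s x / 2)" by (intro continuous_intros s) simp
  interpret split_chain I q V W R b c \<beta> \<delta> \<nu> "\<lambda>x. s x / 2" r
    by (intro split_chain.intro split_chain_axioms.intro drift_chain_axioms s(1,2) cont) (use s(4-6) in auto)
  show ?thesis by (rule split_invariant_measure)
qed

section \<open>Drift from moments\<close>

text \<open>The derivative of the gap is x^3 / (1 + x), which has the sign of x, so the gap is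
  smallest at 0. An odd-order Taylor polynomial bounds the logarithm from above on its whole domain,
  which spares a truncation of large jumps; order three keeps the quadratic coefficient
  exact.\<close>

lemma ln_one_plus_le_cubic:
  fixes t :: real
  assumes "-1 < t"
  shows "ln (1 + t) \<le> t - t\<^sup>2 / 2 + t ^ 3 / 3"
proof -
  let ?f = "\<lambda>t::real. t - t\<^sup>2 / 2 + t ^ 3 / 3 - ln (1 + t)"
  have deriv: "(?f has_real_derivative x ^ 3 / (1 + x)) (at x)" if "-1 < x" for x
  proof -
    have "(?f has_real_derivative (1 - x + x\<^sup>2 - 1 / (1 + x))) (at x)"
      using that by (auto intro!: derivative_eq_intros simp: power2_eq_square)
    moreover have "1 - x + x\<^sup>2 - 1 / (1 + x) = x ^ 3 / (1 + x)"
      using that by (simp add: field_simps power2_eq_square power3_eq_cube)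
    ultimately show ?thesis by simp
  qed
  have "?f 0 \<le> ?f t"
  proof (cases "0 \<le> t")
    case True
    then show ?thesis
    proof (rule DERIV_nonneg_imp_nondecreasing[where f = ?f and a = 0 and b = t])
      show "\<exists>y. (?f has_real_derivative y) (at x) \<and> 0 \<le> y" if "0 \<le> x" "x \<le> t" for x
        using deriv[of x] that by (intro exI[of _ "x ^ 3 / (1 + x)"] conjI) auto
    qed
  next
    case False
    have neg: "x ^ 3 / (1 + x) \<le> 0" if "t \<le> x" "x \<le> 0" for x
    proof -
      have "x ^ 3 \<le> 0" using that by (simp add: power3_eq_cube mult_nonneg_nonpos)
      then show ?thesis using that assms by (simp add: divide_nonpos_nonneg)
    qed
    show ?thesis
    proof (rule DERIV_nonpos_imp_nonincreasing[where f = ?f and a = t and b = 0])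
      show "t \<le> 0" using False by simp
      show "\<exists>y. (?f has_real_derivative y) (at x) \<and> y \<le> 0" if "t \<le> x" "x \<le> 0" for x
        using deriv[of x] neg[OF that] that assms by (intro exI conjI) auto
    qed
  qed
  then show ?thesis by simp
qed

text \<open>With \<open>u = sqrt (1 + t)\<close> the gap becomes a polynomial in \<open>u\<close>
  that factors as (u - 1)^4 (u^2 + 4 u + 5) / 16.\<close>

lemma sqrt_one_plus_le_cubic:
  fixes t :: real
  assumes "-1 \<le> t"
  shows "sqrt (1 + t) \<le> 1 + t / 2 - t\<^sup>2 / 8 + t ^ 3 / 16"
proof -
  define u where "u = sqrt (1 + t)"
  have u: "0 \<le> u" "t = u\<^sup>2 - 1" using assms by (simp_all add: u_def)
  have "1 + t / 2 - t\<^sup>2 / 8 + t ^ 3 / 16 - u = (u - 1) ^ 4 * (u\<^sup>2 + 4 * u + 5) / 16"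
    unfolding u(2) by (simp add: power2_eq_square power3_eq_cube power4_eq_xxxx field_simps)
  also have "\<dots> \<ge> 0" using u(1) by (intro divide_nonneg_pos mult_nonneg_nonneg) auto
  finally show ?thesis by (simp add: u_def)
qed

text \<open>The Japanese bracket, a smooth substitute for the absolute value. Centred increments
  leave it unchanged in mean up to an error of order 1 / (1 + x^2).\<close>

definition japanese :: "real \<Rightarrow> real" where
  "japanese x = sqrt (1 + x\<^sup>2)"

lemma japanese_square: "japanese x ^ 2 = 1 + x\<^sup>2"
  by (simp add: japanese_def add_nonneg_nonneg)

lemma japanese_ge_1: "1 \<le> japanese x"
  by (simp add: japanese_def)

lemma abs_le_japanese: "\<bar>x\<bar> \<le> japanese x"
  unfolding japanese_def by (rule real_le_rsqrt) simp

lemma japanese_le: "japanese x \<le> 1 + \<bar>x\<bar>"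
  unfolding japanese_def by (rule real_le_lsqrt) (auto simp: power2_sum)

lemma continuous_japanese: "continuous_on S (\<lambda>x. japanese (x - a))"
  unfolding japanese_def by (intro continuous_intros)

lemma shift_square: "1 + (x + z)\<^sup>2 = (1 + x\<^sup>2) * (1 + (2 * x * z + z\<^sup>2) / (1 + x\<^sup>2))" for x z :: real
proof -
  have "1 + x\<^sup>2 \<noteq> 0" by (smt (verit) zero_le_power2)
  then show ?thesis by (simp add: field_simps power2_eq_square)
qed

lemma shift_ratio_gt: "-1 < (2 * x * z + z\<^sup>2) / (1 + x\<^sup>2)" for x z :: real
proof -
  have pos: "0 < 1 + x\<^sup>2" by (simp add: add_pos_nonneg)
  have "0 < 1 + (x + z)\<^sup>2" by (simp add: add_pos_nonneg)
  then have "0 < 1 + (2 * x * z + z\<^sup>2) / (1 + x\<^sup>2)"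
    unfolding shift_square using pos by (simp add: zero_less_mult_iff)
  then show ?thesis by simp
qed

text \<open>The powers of the increment that occur in the remainders: up to the sixth, because
  \<open>t\<close> is quadratic in \<open>z\<close> and enters to the third power. The first power
  is missing since the linear term is kept exactly and integrates to zero.\<close>

definition moment_sum :: "real \<Rightarrow> real" where
  "moment_sum z = z\<^sup>2 + \<bar>z\<bar> ^ 3 + \<bar>z\<bar> ^ 4 + \<bar>z\<bar> ^ 5 + \<bar>z\<bar> ^ 6"

text \<open>Expanding \<open>t = (2xz + z\<^sup>2) / r\<^sup>2\<close> with \<open>r\<^sup>2 = 1 + x\<^sup>2\<close> in the cubic upper bounds; in the
  first-order and second-order terms the exact coefficients are kept.\<close>

lemma expansion_bounds:
  fixes x z r t :: real
  assumes r: "r\<^sup>2 = 1 + x\<^sup>2" "1 \<le> r" and t: "t = (2 * x * z + z\<^sup>2) / r\<^sup>2"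
  shows "t - t\<^sup>2 / 2 + t ^ 3 / 3 \<le> 2 * x / r\<^sup>2 * z + (1 - x\<^sup>2) / r ^ 4 * z\<^sup>2 + 5 * moment_sum z / r ^ 3"
    and "r * (1 + t / 2 - t\<^sup>2 / 8 + t ^ 3 / 16) \<le> r + x / r * z + moment_sum z / r\<^sup>2"
proof -
  have xr: "\<bar>x\<bar> \<le> r" using r(1) by (metis abs_le_square_iff abs_of_nonneg le_add_same_cancel2 order_trans r(2) zero_le_one)
  have r0: "r > 0" "r \<noteq> 0" using r by auto
  \<comment> \<open>In the normalized variables \<open>y = x / r\<close> and
    \<open>e = 1 / r\<close> one has \<open>\<bar>y\<bar> \<le> 1\<close>,
    \<open>0 < e \<le> 1\<close> and \<open>y\<^sup>2 + e\<^sup>2 = 1\<close>, so each monomial is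
    bounded by its coefficient, a power of \<open>e\<close> and a power of the increment.\<close>
  define y where "y = x / r"
  have y: "x = y * r" "\<bar>y\<bar> \<le> 1" using xr r0 by (auto simp: y_def abs_divide)
  define e where "e = 1 / r"
  have e: "0 < e" "e \<le> 1" using r r0 by (auto simp: e_def)
  have re: "r * e = 1" using r0 by (simp add: e_def)
  have ye: "y\<^sup>2 + e\<^sup>2 = 1"
  proof -
    have "y\<^sup>2 + e\<^sup>2 = (1 + x\<^sup>2) / r\<^sup>2" by (simp add: y_def e_def power_divide add_divide_distrib)
    then show ?thesis using r0 by (simp add: r(1)[symmetric])
  qed
  have te: "t = 2 * y * e * z + e\<^sup>2 * z\<^sup>2"
    unfolding t y_def e_def using r0 by (simp add: field_simps power2_eq_square)
  let ?a = "\<bar>z\<bar>"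
  have y2: "y\<^sup>2 \<le> 1" using y(2) by (simp add: abs_square_le_1)
  have bound: "c * w \<le> d * \<bar>w\<bar>" if "\<bar>c\<bar> \<le> d" for c d w :: real
  proof -
    have "c * w \<le> \<bar>c\<bar> * \<bar>w\<bar>" by (metis abs_ge_self abs_mult)
    also have "\<dots> \<le> d * \<bar>w\<bar>" using that by (intro mult_right_mono) auto
    finally show ?thesis .
  qed
  have ep: "e ^ n \<le> e ^ m" if "m \<le> n" for m n using e that by (intro power_decreasing) auto
  have yp: "\<bar>y ^ n\<bar> \<le> 1" for n using y(2) by (simp add: power_abs power_le_one)
  have prod: "\<bar>k * y ^ i * e ^ n\<bar> \<le> \<bar>k\<bar> * e ^ m" if "m \<le> n" for k :: real and i m n
  proof -
    have "\<bar>k * y ^ i * e ^ n\<bar> = \<bar>k\<bar> * (\<bar>y ^ i\<bar> * e ^ n)" using e by (simp add: abs_mult)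
    also have "\<dots> \<le> \<bar>k\<bar> * (1 * e ^ m)"
      using yp[of i] ep[OF that] e by (intro mult_left_mono mult_mono) auto
    finally show ?thesis by simp
  qed
  have z_abs: "\<bar>z ^ 3\<bar> = ?a ^ 3" "\<bar>z ^ 4\<bar> = ?a ^ 4" "\<bar>z ^ 5\<bar> = ?a ^ 5" "\<bar>z ^ 6\<bar> = ?a ^ 6" "\<bar>z\<^sup>2\<bar> = z\<^sup>2"
    by (simp_all add: power_abs)
  have t1: "t - t\<^sup>2 / 2 + t ^ 3 / 3 = 2 * y * e * z + (1 - 2 * y\<^sup>2) * e\<^sup>2 * z\<^sup>2
      + (- 2 * y ^ 1 * e ^ 3) * z ^ 3 + (8/3 * y ^ 3 * e ^ 3) * z ^ 3 - e ^ 4 * z ^ 4 / 2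
      + (4 * y ^ 2 * e ^ 4) * z ^ 4 + (2 * y ^ 1 * e ^ 5) * z ^ 5 + (1/3 * y ^ 0 * e ^ 6) * z ^ 6"
    unfolding te by (simp add: field_simps power2_eq_square power3_eq_cube power4_eq_xxxx numeral_eq_Suc)
  have "t - t\<^sup>2 / 2 + t ^ 3 / 3 \<le> 2 * y * e * z + (1 - 2 * y\<^sup>2) * e\<^sup>2 * z\<^sup>2
      + 2 * e ^ 3 * ?a ^ 3 + 8/3 * e ^ 3 * ?a ^ 3 + 4 * e ^ 3 * ?a ^ 4 + 2 * e ^ 3 * ?a ^ 5 + 1/3 * e ^ 3 * ?a ^ 6"
  proof -
    have b3: "(- 2 * y ^ 1 * e ^ 3) * z ^ 3 \<le> 2 * e ^ 3 * ?a ^ 3"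
      using bound[OF prod[of 3 3 "-2" 1], of "z ^ 3"] unfolding z_abs by simp
    have b3': "(8/3 * y ^ 3 * e ^ 3) * z ^ 3 \<le> 8/3 * e ^ 3 * ?a ^ 3"
      using bound[OF prod[of 3 3 "8/3" 3], of "z ^ 3"] unfolding z_abs by simp
    have b4: "(4 * y ^ 2 * e ^ 4) * z ^ 4 \<le> 4 * e ^ 3 * ?a ^ 4"
      using bound[OF prod[of 3 4 4 2], of "z ^ 4"] unfolding z_abs by simp
    have b5: "(2 * y ^ 1 * e ^ 5) * z ^ 5 \<le> 2 * e ^ 3 * ?a ^ 5"
      using bound[OF prod[of 3 5 2 1], of "z ^ 5"] unfolding z_abs by simp
    have b6: "(1/3 * y ^ 0 * e ^ 6) * z ^ 6 \<le> 1/3 * e ^ 3 * ?a ^ 6"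
      using bound[OF prod[of 3 6 "1/3" 0], of "z ^ 6"] unfolding z_abs by simp
    have "0 \<le> e ^ 4 * z ^ 4 / 2" by simp
    then show ?thesis unfolding t1 using b3 b3' b4 b5 b6 by linarith
  qed
  also have "\<dots> \<le> 2 * y * e * z + (1 - 2 * y\<^sup>2) * e\<^sup>2 * z\<^sup>2 + 5 * moment_sum z * e ^ 3"
  proof -
    have nn: "0 \<le> e ^ 3 * ?a ^ n" "0 \<le> e ^ 3 * z\<^sup>2" for n using e by auto
    have "5 * moment_sum z * e ^ 3 = 5 * (e ^ 3 * z\<^sup>2) + 5 * (e ^ 3 * ?a ^ 3) + 5 * (e ^ 3 * ?a ^ 4) + 5 * (e ^ 3 * ?a ^ 5) + 5 * (e ^ 3 * ?a ^ 6)"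
      by (simp add: moment_sum_def algebra_simps)
    then show ?thesis using nn(1)[of 3] nn(1)[of 4] nn(1)[of 5] nn(1)[of 6] nn(2) by (simp only: mult.assoc)
  qed
  also have "2 * y * e * z = 2 * x / r\<^sup>2 * z" using r0 by (simp add: y_def e_def power2_eq_square)
  also have "(1 - 2 * y\<^sup>2) * e\<^sup>2 * z\<^sup>2 = (1 - x\<^sup>2) / r ^ 4 * z\<^sup>2"
  proof -
    have "1 - 2 * y\<^sup>2 = (r\<^sup>2 - 2 * x\<^sup>2) / r\<^sup>2" using r0 by (simp add: y_def power_divide diff_divide_distrib)
    also have "r\<^sup>2 - 2 * x\<^sup>2 = 1 - x\<^sup>2" using r(1) by simp
    finally have eq: "1 - 2 * y\<^sup>2 = (1 - x\<^sup>2) / r\<^sup>2" .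
    have "e\<^sup>2 = 1 / r\<^sup>2" "r ^ 4 = r\<^sup>2 * r\<^sup>2" by (simp_all add: e_def power_divide power4_eq_xxxx power2_eq_square mult.assoc)
    then show ?thesis unfolding eq by simp
  qed
  also have "5 * moment_sum z * e ^ 3 = 5 * moment_sum z / r ^ 3" by (simp add: e_def power_divide)
  finally show "t - t\<^sup>2 / 2 + t ^ 3 / 3 \<le> 2 * x / r\<^sup>2 * z + (1 - x\<^sup>2) / r ^ 4 * z\<^sup>2 + 5 * moment_sum z / r ^ 3" .
  have t2: "1 + t / 2 - t\<^sup>2 / 8 + t ^ 3 / 16 = 1 + y * e * z + (1 - y\<^sup>2) / 2 * e\<^sup>2 * z\<^sup>2
      + (- 1/2 * y ^ 1 * e ^ 3) * z ^ 3 + (1/2 * y ^ 3 * e ^ 3) * z ^ 3 - e ^ 4 * z ^ 4 / 8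
      + (3/4 * y ^ 2 * e ^ 4) * z ^ 4 + (3/8 * y ^ 1 * e ^ 5) * z ^ 5 + (1/16 * y ^ 0 * e ^ 6) * z ^ 6"
    unfolding te by (simp add: field_simps power2_eq_square power3_eq_cube power4_eq_xxxx numeral_eq_Suc)
  have "1 + t / 2 - t\<^sup>2 / 8 + t ^ 3 / 16 \<le> 1 + y * e * z + moment_sum z * e ^ 3"
  proof -
    \<comment> \<open>Here the quadratic coefficient already has the order of the remainder, in
      contrast to the logarithm: \<open>1 - y\<^sup>2 = e\<^sup>2\<close> gives two additional
      powers of \<open>e\<close>. This is why no variance term appears in the bound for the
      bracket.\<close>
    have "(1 - y\<^sup>2) / 2 * e\<^sup>2 = 1/2 * y ^ 0 * e ^ 4" 
    proof -
      have "1 - y\<^sup>2 = e\<^sup>2" using ye by simp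
      then show ?thesis by (simp add: power4_eq_xxxx power2_eq_square)
    qed
    then have b2: "(1 - y\<^sup>2) / 2 * e\<^sup>2 * z\<^sup>2 \<le> 1/2 * (e ^ 3 * z\<^sup>2)"
      using bound[OF prod[of 3 4 "1/2" 0], of "z\<^sup>2"] unfolding z_abs by simp
    have b3: "(- 1/2 * y ^ 1 * e ^ 3) * z ^ 3 \<le> 1/2 * (e ^ 3 * ?a ^ 3)"
      using bound[OF prod[of 3 3 "-1/2" 1], of "z ^ 3"] unfolding z_abs by simp
    have b3': "(1/2 * y ^ 3 * e ^ 3) * z ^ 3 \<le> 1/2 * (e ^ 3 * ?a ^ 3)"
      using bound[OF prod[of 3 3 "1/2" 3], of "z ^ 3"] unfolding z_abs by simp
    have b4: "(3/4 * y ^ 2 * e ^ 4) * z ^ 4 \<le> 3/4 * (e ^ 3 * ?a ^ 4)"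
      using bound[OF prod[of 3 4 "3/4" 2], of "z ^ 4"] unfolding z_abs by simp
    have b5: "(3/8 * y ^ 1 * e ^ 5) * z ^ 5 \<le> 3/8 * (e ^ 3 * ?a ^ 5)"
      using bound[OF prod[of 3 5 "3/8" 1], of "z ^ 5"] unfolding z_abs by simp
    have b6: "(1/16 * y ^ 0 * e ^ 6) * z ^ 6 \<le> 1/16 * (e ^ 3 * ?a ^ 6)"
      using bound[OF prod[of 3 6 "1/16" 0], of "z ^ 6"] unfolding z_abs by simp
    have nn: "0 \<le> e ^ 3 * ?a ^ n" "0 \<le> e ^ 3 * z\<^sup>2" for n using e by auto
    have ms: "moment_sum z * e ^ 3 = e ^ 3 * z\<^sup>2 + e ^ 3 * ?a ^ 3 + e ^ 3 * ?a ^ 4 + e ^ 3 * ?a ^ 5 + e ^ 3 * ?a ^ 6"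
      by (simp add: moment_sum_def algebra_simps)
    have "0 \<le> e ^ 4 * z ^ 4 / 8" by simp
    then show ?thesis unfolding t2 ms
      using b2 b3 b3' b4 b5 b6 nn(1)[of 3] nn(1)[of 4] nn(1)[of 5] nn(1)[of 6] nn(2) by linarith
  qed
  then have "r * (1 + t / 2 - t\<^sup>2 / 8 + t ^ 3 / 16) \<le> r * (1 + y * e * z + moment_sum z * e ^ 3)"
    using r0 by (intro mult_left_mono) auto
  also have "\<dots> = r + x / r * z + moment_sum z / r\<^sup>2"
  proof -
    have "r * (1 + y * e * z + moment_sum z * e ^ 3) = r + (r * e) * (y * z) + (r * e) * (moment_sum z * e\<^sup>2)"
      by (simp add: algebra_simps power3_eq_cube power2_eq_square)
    then show ?thesis unfolding re by (simp add: y_def e_def power_divide)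
  qed
  finally show "r * (1 + t / 2 - t\<^sup>2 / 8 + t ^ 3 / 16) \<le> r + x / r * z + moment_sum z / r\<^sup>2" .
qed

lemma ln_shift_le:
  fixes x z :: real
  shows "ln (1 + (x + z)\<^sup>2) \<le> ln (1 + x\<^sup>2) + 2 * x / (1 + x\<^sup>2) * z
    + (1 - x\<^sup>2) / (1 + x\<^sup>2)\<^sup>2 * z\<^sup>2 + 5 * moment_sum z / japanese x ^ 3"
proof -
  let ?t = "(2 * x * z + z\<^sup>2) / (1 + x\<^sup>2)"
  have pos: "0 < 1 + x\<^sup>2" by (simp add: add_pos_nonneg)
  have "ln (1 + (x + z)\<^sup>2) = ln (1 + x\<^sup>2) + ln (1 + ?t)"
    unfolding shift_square using pos shift_ratio_gt[of x z] by (subst ln_mult_pos) auto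
  also have "ln (1 + ?t) \<le> ?t - ?t\<^sup>2 / 2 + ?t ^ 3 / 3"
    by (rule ln_one_plus_le_cubic[OF shift_ratio_gt])
  also have "\<dots> \<le> 2 * x / japanese x ^ 2 * z + (1 - x\<^sup>2) / japanese x ^ 4 * z\<^sup>2 + 5 * moment_sum z / japanese x ^ 3"
    by (rule expansion_bounds(1)[OF japanese_square japanese_ge_1]) (simp only: japanese_square)
  also have "japanese x ^ 4 = (1 + x\<^sup>2)\<^sup>2" by (simp add: japanese_square[symmetric] power_mult[symmetric])
  finally show ?thesis by (simp add: japanese_square)
qed

lemma japanese_shift_le:
  "japanese (x + z) \<le> japanese x + x / japanese x * z + moment_sum z / (1 + x\<^sup>2)"
proof -
  let ?t = "(2 * x * z + z\<^sup>2) / (1 + x\<^sup>2)"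
  have "japanese (x + z) = japanese x * sqrt (1 + ?t)"
    unfolding japanese_def shift_square by (rule real_sqrt_mult)
  also have "\<dots> \<le> japanese x * (1 + ?t / 2 - ?t\<^sup>2 / 8 + ?t ^ 3 / 16)"
    using japanese_ge_1[of x] shift_ratio_gt[of x z] by (intro mult_left_mono sqrt_one_plus_le_cubic) auto
  also have "\<dots> \<le> japanese x + x / japanese x * z + moment_sum z / japanese x ^ 2"
    by (rule expansion_bounds(2)[OF japanese_square japanese_ge_1]) (simp only: japanese_square)
  finally show ?thesis by (simp add: japanese_square)
qed

text \<open>The Cauchy-Schwarz defect for the vectors (1, v) and (1, v + z) is exact: the product of
  their squared lengths minus the square of their inner product is z^2. Factoring this difference of
  squares, and bounding the larger factor by twice the product of the lengths, gives the
  quantitative gap above the tangent line.\<close>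

lemma japanese_convex:
  "z\<^sup>2 / (2 * japanese (v + z) * (japanese v)\<^sup>2) \<le> japanese (v + z) - japanese v - v / japanese v * z"
proof -
  let ?w = "v + z"
  define A where "A = japanese v" define C where "C = japanese ?w"
  have A: "1 \<le> A" "A\<^sup>2 = 1 + v\<^sup>2" and C: "1 \<le> C" "C\<^sup>2 = 1 + ?w\<^sup>2"
    by (simp_all add: A_def C_def japanese_ge_1 japanese_square)
  have sq: "(C * A)\<^sup>2 - (1 + v * ?w)\<^sup>2 = z\<^sup>2"
    unfolding power_mult_distrib A C by (simp add: power2_eq_square algebra_simps)
  then have "(1 + v * ?w)\<^sup>2 \<le> (C * A)\<^sup>2" by (smt (verit) zero_le_power2)
  then have le: "\<bar>1 + v * ?w\<bar> \<le> C * A" using A C by (simp add: abs_le_square_iff[symmetric])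
  have prod: "(C * A - (1 + v * ?w)) * (C * A + (1 + v * ?w)) = z\<^sup>2"
    using sq by (simp add: power2_eq_square algebra_simps)
  have CA: "0 < C * A" using A C by simp
  have "z\<^sup>2 \<le> (C * A - (1 + v * ?w)) * (2 * (C * A))"
  proof -
    have "C * A + (1 + v * ?w) \<le> 2 * (C * A)" "0 \<le> C * A - (1 + v * ?w)" using le by linarith+
    then show ?thesis unfolding prod[symmetric] by (rule mult_left_mono)
  qed
  then have "z\<^sup>2 / (2 * (C * A)) \<le> C * A - (1 + v * ?w)"
    using CA by (simp add: pos_divide_le_eq)
  then have "z\<^sup>2 / (2 * (C * A)) / A \<le> (C * A - (1 + v * ?w)) / A"
    using A by (intro divide_right_mono) auto
  also have "(C * A - (1 + v * ?w)) / A = C - A - v / A * z"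
  proof -
    have "1 + v * ?w = A\<^sup>2 + v * z" unfolding A(2) by (simp add: algebra_simps power2_eq_square)
    then show ?thesis using A by (simp add: field_simps power2_eq_square)
  qed
  also have "z\<^sup>2 / (2 * (C * A)) / A = z\<^sup>2 / (2 * C * A\<^sup>2)" by (simp add: power2_eq_square mult.assoc)
  finally show ?thesis by (simp only: A_def C_def)
qed

section \<open>Chains with centred increments and bounded moments\<close>

locale moment_chain = feller_chain +
  fixes M R\<^sub>0 :: real
  assumes mean: "\<And>x. x \<in> I \<Longrightarrow> (\<integral>y. y - x \<partial>q x) = 0"
    and moment_integrable: "\<And>x k. x \<in> I \<Longrightarrow> integrable (q x) (\<lambda>y. \<bar>y - x\<bar> ^ k)"
    and moment_bound: "\<And>x k. x \<in> I \<Longrightarrow> k \<in> {2..6} \<Longrightarrow> (\<integral>y. \<bar>y - x\<bar> ^ k \<partial>q x) \<le> M"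
    and variance: "\<And>x. x \<in> I \<Longrightarrow> R\<^sub>0 \<le> \<bar>x\<bar> \<Longrightarrow> 1 \<le> (\<integral>y. (y - x)\<^sup>2 \<partial>q x)"
    and M: "1 \<le> M" and R\<^sub>0: "1 \<le> R\<^sub>0"
begin

lemma measurable_q_borel: "x \<in> I \<Longrightarrow> f \<in> borel_measurable borel \<Longrightarrow> f \<in> borel_measurable (q x)"
  unfolding measurable_cong_sets[OF sets_q refl] by (rule measurable_restrict_space1)

lemma int_z: "x \<in> I \<Longrightarrow> integrable (q x) (\<lambda>y. y - x)"
  using moment_integrable[of x 1] by (subst integrable_abs_iff[symmetric]) (auto intro!: measurable_q_borel)

lemma int_z2: "x \<in> I \<Longrightarrow> integrable (q x) (\<lambda>y. (y - x)\<^sup>2)"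
  using moment_integrable[of x 2] by simp

lemma int_moment_sum: "x \<in> I \<Longrightarrow> integrable (q x) (\<lambda>y. moment_sum (y - x))"
  unfolding moment_sum_def by (intro Bochner_Integration.integrable_add int_z2 moment_integrable)

lemma z2_bound: "x \<in> I \<Longrightarrow> (\<integral>y. (y - x)\<^sup>2 \<partial>q x) \<le> M"
  using moment_bound[of x 2] by simp

lemma moment_sum_bound:
  assumes x: "x \<in> I"
  shows "(\<integral>y. moment_sum (y - x) \<partial>q x) \<le> 5 * M"
proof -
  have "(\<integral>y. moment_sum (y - x) \<partial>q x) = (\<integral>y. (y - x)\<^sup>2 \<partial>q x) + (\<integral>y. \<bar>y - x\<bar> ^ 3 \<partial>q x)
    + (\<integral>y. \<bar>y - x\<bar> ^ 4 \<partial>q x) + (\<integral>y. \<bar>y - x\<bar> ^ 5 \<partial>q x) + (\<integral>y. \<bar>y - x\<bar> ^ 6 \<partial>q x)"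
    unfolding moment_sum_def
    by (simp only: Bochner_Integration.integral_add Bochner_Integration.integrable_add int_z2[OF x] moment_integrable[OF x])
  then show ?thesis
    using z2_bound[OF x] moment_bound[OF x, of 3] moment_bound[OF x, of 4] moment_bound[OF x, of 5] moment_bound[OF x, of 6]
    by simp
qed

lemma integrable_const_q: "x \<in> I \<Longrightarrow> integrable (q x) (\<lambda>y. a::real)"
  using prob_q by (simp add: prob_space.finite_measure finite_measure.integrable_const)

abbreviation V :: "real \<Rightarrow> real" where "V x \<equiv> ln (1 + x\<^sup>2)"

lemma V_nonneg': "0 \<le> V x"
  by simp

lemma V_int: assumes x: "x \<in> I" shows "integrable (q x) V"
proof (rule Bochner_Integration.integrable_bound)
  show "integrable (q x) (\<lambda>y. 2 * x\<^sup>2 + 2 * (y - x)\<^sup>2)"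
    by (intro Bochner_Integration.integrable_add integrable_const_q x integrable_mult_right int_z2)
  show "V \<in> borel_measurable (q x)" by (rule measurable_q_borel[OF x]) measurable
  show "AE y in q x. norm (V y) \<le> norm (2 * x\<^sup>2 + 2 * (y - x)\<^sup>2)"
  proof (intro AE_I2)
    fix y
    have "V y \<le> y\<^sup>2" using ln_add_one_self_le_self[of "y\<^sup>2"] by simp
    also have "\<dots> \<le> 2 * x\<^sup>2 + 2 * (y - x)\<^sup>2"
    proof -
      have "2 * x\<^sup>2 + 2 * (y - x)\<^sup>2 - y\<^sup>2 = (y - 2 * x)\<^sup>2" by (simp add: power2_eq_square algebra_simps)
      then show ?thesis by (smt (verit) zero_le_power2)
    qed
    finally show "norm (V y) \<le> norm (2 * x\<^sup>2 + 2 * (y - x)\<^sup>2)" by (simp add: add_nonneg_nonneg)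
  qed
qed

lemma V_step:
  assumes x: "x \<in> I"
  shows "(\<integral>y. V y \<partial>q x) \<le> V x + (1 - x\<^sup>2) / (1 + x\<^sup>2)\<^sup>2 * (\<integral>y. (y - x)\<^sup>2 \<partial>q x) + 25 * M / japanese x ^ 3"
proof -
  let ?a = "2 * x / (1 + x\<^sup>2)" and ?b = "(1 - x\<^sup>2) / (1 + x\<^sup>2)\<^sup>2" and ?j = "japanese x ^ 3"
  let ?g = "\<lambda>y. V x + ?a * (y - x) + ?b * (y - x)\<^sup>2 + 5 / ?j * moment_sum (y - x)"
  have int: "integrable (q x) ?g"
    by (intro Bochner_Integration.integrable_add integrable_const_q x integrable_mult_right int_z int_z2 int_moment_sum)
  have "(\<integral>y. V y \<partial>q x) \<le> (\<integral>y. ?g y \<partial>q x)"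
  proof (rule integral_mono[OF V_int[OF x] int])
    fix y
    show "V y \<le> ?g y" using ln_shift_le[of x "y - x"] by simp
  qed
  also have "\<dots> = V x + ?b * (\<integral>y. (y - x)\<^sup>2 \<partial>q x) + 5 / ?j * (\<integral>y. moment_sum (y - x) \<partial>q x)"
    using int_z[OF x] int_z2[OF x] int_moment_sum[OF x] integrable_const_q[OF x]
    by (simp add: Bochner_Integration.integral_add mean[OF x] prob_space.prob_space[OF prob_q[OF x]])
  also have "5 / ?j * (\<integral>y. moment_sum (y - x) \<partial>q x) \<le> 5 / ?j * (5 * M)"
    using moment_sum_bound[OF x] japanese_ge_1[of x] by (intro mult_left_mono) auto
  finally show ?thesis by simp
qed

lemma V_drift':
  obtains R b where "0 \<le> R" "0 \<le> b"
    "\<And>x. x \<in> I \<Longrightarrow> (\<integral>y. V y \<partial>q x) + 1/2 / (1 + x\<^sup>2) \<le> V x + b * indicator {-R..R} x"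
proof -
  \<comment> \<open>Beyond this radius the variance is at least 1 and
    \<open>100 * M \<le> r\<close>, so the two error terms 2 / r^4 and 25 M / r^3 are each at most a
    quarter of the gain 1 / r^2. One half of the gain remains.\<close>
  define R where "R = R\<^sub>0 + 100 * M"
  \<comment> \<open>Inside the interval the crude bounds suffice: \<open>M\<close> from the second
    moment, \<open>25 * M\<close> from the remainder and 1 for the added term.\<close>
  define b where "b = 26 * M + 1"
  have R: "0 \<le> R" "R\<^sub>0 \<le> R" using M R\<^sub>0 by (simp_all add: R_def)
  have b: "0 \<le> b" using M by (simp add: b_def)
  have "(\<integral>y. V y \<partial>q x) + 1/2 / (1 + x\<^sup>2) \<le> V x + b * indicator {-R..R} x" if x: "x \<in> I" for x
  proof -
    define v where "v = (\<integral>y. (y - x)\<^sup>2 \<partial>q x)"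
    define r where "r = japanese x"
    have r: "1 \<le> r" "r\<^sup>2 = 1 + x\<^sup>2" by (simp_all add: r_def japanese_ge_1 japanese_square)
    have v: "0 \<le> v" "v \<le> M" using z2_bound[OF x] by (auto simp: v_def intro!: integral_nonneg_AE)
    have step: "(\<integral>y. V y \<partial>q x) \<le> V x + (1 - x\<^sup>2) / r ^ 4 * v + 25 * M / r ^ 3"
      using V_step[OF x] by (simp add: v_def r_def japanese_square[symmetric] power_mult[symmetric])
    show ?thesis
    proof (cases "x \<in> {-R..R}")
      case True
      have "(1 - x\<^sup>2) / r ^ 4 * v \<le> 1 * v"
      proof (rule mult_right_mono[OF _ v(1)])
        have "1 - x\<^sup>2 \<le> 1" by simp
        also have "1 \<le> r ^ 4" using r(1) by (rule one_le_power)
        finally show "(1 - x\<^sup>2) / r ^ 4 \<le> 1" using r(1) by (simp add: pos_divide_le_eq)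
      qed
      moreover have "25 * M / r ^ 3 \<le> 25 * M"
        using M r(1) one_le_power[OF r(1), of 3] divide_left_mono[of 1 "r ^ 3" "25 * M"] by simp
      moreover have "1/2 / (1 + x\<^sup>2) \<le> 1" by (simp add: pos_divide_le_eq add_pos_nonneg)
      ultimately show ?thesis using step v True by (simp add: b_def)
    next
      case False
      then have ax: "R < \<bar>x\<bar>" by auto
      then have "R\<^sub>0 \<le> \<bar>x\<bar>" using R by simp
      then have v1: "1 \<le> v" unfolding v_def by (rule variance[OF x])
      have rx: "\<bar>x\<bar> \<le> r" unfolding r_def by (rule abs_le_japanese)
      have r100: "100 * M \<le> r" using ax rx R\<^sub>0 by (simp add: R_def)
      have "1 \<le> \<bar>x\<bar>" using ax R R\<^sub>0 by simp
      from one_le_power[OF this, of 2] have "1 \<le> x\<^sup>2" by simp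
      then have x2: "1 - x\<^sup>2 \<le> 0" by simp
      have "(1 - x\<^sup>2) / r ^ 4 * v \<le> (1 - x\<^sup>2) / r ^ 4 * 1"
        using x2 v1 r(1) by (intro mult_left_mono_neg divide_nonpos_nonneg) auto
      also have "(1 - x\<^sup>2) / r ^ 4 * 1 = 2 / r ^ 4 - 1 / r\<^sup>2"
      proof -
        have "1 - x\<^sup>2 = 2 - r\<^sup>2" using r(2) by simp
        then show ?thesis
          using r(1) unfolding \<open>1 - x\<^sup>2 = 2 - r\<^sup>2\<close> by (simp add: diff_divide_distrib power4_eq_xxxx power2_eq_square)
      qed
      finally have s: "(\<integral>y. V y \<partial>q x) \<le> V x + 2 / r ^ 4 - 1 / r\<^sup>2 + 25 * M / r ^ 3" using step by simp
      have a1: "2 / r ^ 4 \<le> 1/4 * (1 / r\<^sup>2)"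
      proof -
        have "8 \<le> r" using r100 M by simp
        then have "8 * 1 \<le> r * r" using r(1) by (intro mult_mono) auto
        then have "2 \<le> 1/4 * r\<^sup>2" by (simp add: power2_eq_square)
        then have "2 / r ^ 4 \<le> 1/4 * r\<^sup>2 / r ^ 4" by (intro divide_right_mono) auto
        also have "\<dots> = 1/4 * (1 / r\<^sup>2)" using r(1) by (simp add: power4_eq_xxxx power2_eq_square)
        finally show ?thesis .
      qed
      have a2: "25 * M / r ^ 3 \<le> 1/4 * (1 / r\<^sup>2)"
      proof -
        have "25 * M / r ^ 3 \<le> 1/4 * r / r ^ 3" using r100 r(1) by (intro divide_right_mono) auto
        also have "\<dots> = 1/4 * (1 / r\<^sup>2)" using r(1) by (simp add: power3_eq_cube power2_eq_square)
        finally show ?thesis .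
      qed
      have ind: "indicator {-R..R} x = (0::real)" using False by simp
      have half: "1/2 / (1 + x\<^sup>2) = 1/2 * (1 / r\<^sup>2)" by (simp add: r(2))
      show ?thesis unfolding ind half using s a1 a2 by linarith
    qed
  qed
  then show thesis using that R(1) b by blast
qed

text \<open>Markov's inequality with the fourth moment gives a probability of order x^-4, which
  beats any multiple of 1 / (1 + x^2) at large distance. The second moment would only give the order
  x^-2 with a fixed constant.\<close>

lemma escape':
  assumes e: "0 < (e::real)"
  shows "\<exists>r'. \<forall>x\<in>I. r' < \<bar>x\<bar> \<longrightarrow> measure (q x) (I \<inter> {-r..r}) \<le> e / (1 + x\<^sup>2)"
proof (intro exI ballI impI)
  \<comment> \<open>The summand \<open>2 * \<bar>r\<bar>\<close> forces a jump of length at least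
    \<open>\<bar>x\<bar> / 2\<close>, the summand 1 gives \<open>1 \<le> \<bar>x\<bar>\<close>, and
    the last one turns the fourth-moment bound into the required multiple of
    \<open>e\<close>.\<close>
  fix x assume x: "x \<in> I" and big: "2 * \<bar>r\<bar> + 1 + 32 * M / e < \<bar>x\<bar>"
  interpret prob_space "q x" using prob_q[OF x] .
  have Me: "0 \<le> 32 * M / e" using M e by simp
  have x1: "1 \<le> \<bar>x\<bar>" using big Me by linarith
  have x0: "0 < x\<^sup>2" "x \<noteq> 0" using x1 by auto
  have A: "I \<inter> {-r..r} \<in> sets (q x)" using sets_q[OF x] by (simp add: sets_B_iff)
  have int4: "integrable (q x) (\<lambda>y. 16 / x ^ 4 * \<bar>y - x\<bar> ^ 4)"
    by (intro integrable_mult_right moment_integrable x)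
  have "measure (q x) (I \<inter> {-r..r}) = (\<integral>y. indicator (I \<inter> {-r..r}) y \<partial>q x)"
    using A sets.sets_into_space[OF A] by (simp add: Int_absorb2)
  also have "\<dots> \<le> (\<integral>y. 16 / x ^ 4 * \<bar>y - x\<bar> ^ 4 \<partial>q x)"
  proof (rule integral_mono)
    show "integrable (q x) (indicator (I \<inter> {-r..r}) :: real \<Rightarrow> real)"
      using A by (simp add: emeasure_eq_measure)
    fix y
    show "indicator (I \<inter> {-r..r}) y \<le> 16 / x ^ 4 * \<bar>y - x\<bar> ^ 4"
    proof (cases "y \<in> {-r..r}")
      case True
      then have "\<bar>y\<bar> \<le> \<bar>r\<bar>" by auto
      then have "\<bar>x\<bar> / 2 \<le> \<bar>y - x\<bar>" using big Me by linarith
      then have "(\<bar>x\<bar> / 2) ^ 4 \<le> \<bar>y - x\<bar> ^ 4" by (intro power_mono) auto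
      then have "x ^ 4 / 16 \<le> \<bar>y - x\<bar> ^ 4" by (simp add: power_divide)
      then have "16 / x ^ 4 * (x ^ 4 / 16) \<le> 16 / x ^ 4 * \<bar>y - x\<bar> ^ 4" by (intro mult_left_mono) auto
      then have "1 \<le> 16 / x ^ 4 * \<bar>y - x\<bar> ^ 4" using x0 by simp
      then show ?thesis by (rule order_trans[rotated]) (simp add: indicator_def)
    qed auto
  qed (rule int4)
  also have "\<dots> = 16 / x ^ 4 * (\<integral>y. \<bar>y - x\<bar> ^ 4 \<partial>q x)" by (rule integral_mult_right_zero)
  also have "\<dots> \<le> 16 / x ^ 4 * M" using moment_bound[OF x, of 4] by (intro mult_left_mono) auto
  also have "\<dots> \<le> e / (1 + x\<^sup>2)"
  proof -
    have "32 * M / e \<le> \<bar>x\<bar> * 1" using big by linarith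
    also have "\<dots> \<le> \<bar>x\<bar> * \<bar>x\<bar>" using x1 by (intro mult_left_mono) auto
    finally have "32 * M \<le> e * x\<^sup>2" using e by (simp add: power2_eq_square pos_divide_le_eq mult.commute)
    then have a: "32 * M \<le> e * x\<^sup>2" .
    have "1 \<le> x\<^sup>2" using one_le_power[OF x1, of 2] by simp
    then have c: "1 + x\<^sup>2 \<le> 2 * x\<^sup>2" by simp
    have "16 * M * (1 + x\<^sup>2) \<le> e * x\<^sup>2 * x\<^sup>2"
    proof -
      have "16 * M * (1 + x\<^sup>2) \<le> 16 * M * (2 * x\<^sup>2)" using c M by (intro mult_left_mono) auto
      also have "\<dots> = 32 * M * x\<^sup>2" by simp
      also have "\<dots> \<le> e * x\<^sup>2 * x\<^sup>2" using a by (intro mult_right_mono) auto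
      finally show ?thesis .
    qed
    then have "16 * M \<le> e * x\<^sup>2 * x\<^sup>2 / (1 + x\<^sup>2)" by (subst pos_le_divide_eq) (simp_all add: add_pos_nonneg)
    then have "16 * M / (x\<^sup>2 * x\<^sup>2) \<le> e * x\<^sup>2 * x\<^sup>2 / (1 + x\<^sup>2) / (x\<^sup>2 * x\<^sup>2)"
      by (rule divide_right_mono) simp
    also have "\<dots> = e / (1 + x\<^sup>2)"
    proof -
      have "e * w * w / d / (w * w) = e / d" if "0 < w" for w d :: real using that by simp
      then show ?thesis using x0(1) .
    qed
    also have "16 * M / (x\<^sup>2 * x\<^sup>2) = 16 / x ^ 4 * M" by (simp add: power4_eq_xxxx power2_eq_square mult.assoc)
    finally show ?thesis .
  qed
  finally show "measure (q x) (I \<inter> {-r..r}) \<le> e / (1 + x\<^sup>2)" .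
qed

text \<open>The difference of two brackets is bounded below in \<open>x\<close>, and
  \<open>japanese a + 1\<close> lifts it above zero. Since this lift nearly equals the subtracted
  bracket at bounded \<open>x\<close>, the upper bound stays independent of
  \<open>a\<close>.\<close>

definition W :: "real \<Rightarrow> real \<Rightarrow> real" where
  "W a x = japanese x + japanese a + 1 - japanese (x - a)"

lemma W_nonneg': "0 \<le> W a x"
  using japanese_le[of "x - a"] abs_le_japanese[of x] abs_le_japanese[of a] abs_triangle_ineq4[of x a]
  by (simp add: W_def)

lemma W_le': "W a x \<le> 2 * \<bar>x\<bar> + 3"
  using japanese_le[of x] japanese_le[of a] abs_le_japanese[of "x - a"] by (simp add: W_def)

lemma japanese_int: assumes x: "x \<in> I" shows "integrable (q x) (\<lambda>y. japanese (y - a))"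
proof (rule Bochner_Integration.integrable_bound)
  show "integrable (q x) (\<lambda>y. (1 + \<bar>x - a\<bar>) + \<bar>y - x\<bar> ^ 1)"
    by (intro Bochner_Integration.integrable_add integrable_const_q moment_integrable x)
  show "(\<lambda>y. japanese (y - a)) \<in> borel_measurable (q x)"
    unfolding japanese_def by (rule measurable_q_borel[OF x]) measurable
  show "AE y in q x. norm (japanese (y - a)) \<le> norm ((1 + \<bar>x - a\<bar>) + \<bar>y - x\<bar> ^ 1)"
  proof (intro AE_I2)
    fix y
    have "japanese (y - a) \<le> 1 + \<bar>x - a\<bar> + \<bar>y - x\<bar>" using japanese_le[of "y - a"] by linarith
    then show "norm (japanese (y - a)) \<le> norm ((1 + \<bar>x - a\<bar>) + \<bar>y - x\<bar> ^ 1)"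
      using japanese_ge_1[of "y - a"] by simp
  qed
qed

lemma japanese_upper:
  assumes x: "x \<in> I"
  shows "(\<integral>y. japanese y \<partial>q x) \<le> japanese x + 5 * M / (1 + x\<^sup>2)"
proof -
  let ?g = "\<lambda>y. japanese x + x / japanese x * (y - x) + 1 / (1 + x\<^sup>2) * moment_sum (y - x)"
  have int: "integrable (q x) ?g"
    by (intro Bochner_Integration.integrable_add integrable_const_q x integrable_mult_right int_z int_moment_sum)
  have "(\<integral>y. japanese y \<partial>q x) \<le> (\<integral>y. ?g y \<partial>q x)"
  proof (rule integral_mono[OF _ int])
    show "integrable (q x) japanese" using japanese_int[OF x, of 0] by simp
    show "japanese y \<le> ?g y" for y using japanese_shift_le[of x "y - x"] by simp
  qed
  also have "\<dots> = japanese x + 1 / (1 + x\<^sup>2) * (\<integral>y. moment_sum (y - x) \<partial>q x)"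
    using int_z[OF x] int_moment_sum[OF x] integrable_const_q[OF x]
    by (simp add: Bochner_Integration.integral_add mean[OF x] prob_space.prob_space[OF prob_q[OF x]])
  also have "1 / (1 + x\<^sup>2) * (\<integral>y. moment_sum (y - x) \<partial>q x) \<le> 1 / (1 + x\<^sup>2) * (5 * M)"
    using moment_sum_bound[OF x] by (intro mult_left_mono) (auto simp: add_nonneg_nonneg)
  finally show ?thesis by simp
qed

text \<open>One half of the local convexity constant \<open>\<kappa>\<close> in
  \<open>japanese_lower\<close>; the other factor 1/2 is the lower bound for the truncated second
  moment.\<close>

definition \<delta>\<^sub>0 :: real where "\<delta>\<^sub>0 = 1 / (8 * (2 + 2 * M))"

lemma \<delta>\<^sub>0_pos: "0 < \<delta>\<^sub>0"
  using M by (simp add: \<delta>\<^sub>0_def)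

text \<open>Convexity gives the lower bound without \<open>\<delta>\<^sub>0\<close>. Close to the vertex at \<open>a\<close> the convexity is
  quantitative, and \<open>z\<^sup>2 - z\<^sup>4 / L\<^sup>2\<close> is a lower bound for \<open>z\<^sup>2 1(|z| \<le> L)\<close> with a positive integral.\<close>

lemma japanese_lower:
  assumes x: "x \<in> I"
  shows "japanese (x - a) + (if \<bar>x - a\<bar> \<le> 1 \<and> R\<^sub>0 \<le> \<bar>x\<bar> then \<delta>\<^sub>0 else 0) \<le> (\<integral>y. japanese (y - a) \<partial>q x)"
proof -
  let ?v = "x - a"
  let ?s = "?v / japanese ?v"
  have conv: "japanese (?v + z) - japanese ?v - ?s * z \<ge> 0" for z
    using japanese_ge_1[of "?v + z"] japanese_ge_1[of ?v]
    by (intro order_trans[OF _ japanese_convex] divide_nonneg_nonneg mult_nonneg_nonneg) auto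
  have lin: "(\<integral>y. japanese ?v + ?s * (y - x) + c * g y \<partial>q x) = japanese ?v + c * (\<integral>y. g y \<partial>q x)"
    if "integrable (q x) g" for g :: "real \<Rightarrow> real" and c
    using that int_z[OF x] integrable_const_q[OF x]
    by (simp add: Bochner_Integration.integral_add mean[OF x] prob_space.prob_space[OF prob_q[OF x]])
  show ?thesis
  proof (cases "\<bar>x - a\<bar> \<le> 1 \<and> R\<^sub>0 \<le> \<bar>x\<bar>")
    case False
    have "japanese ?v = (\<integral>y. japanese ?v + ?s * (y - x) + 0 * 0 \<partial>q x)"
      using lin[of "\<lambda>_. 0" 0] by simp
    also have "\<dots> \<le> (\<integral>y. japanese (y - a) \<partial>q x)"
    proof (rule integral_mono[OF _ japanese_int[OF x]])
      show "integrable (q x) (\<lambda>y. japanese ?v + ?s * (y - x) + 0 * 0)"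
        by (intro Bochner_Integration.integrable_add integrable_const_q x integrable_mult_right int_z)
      fix y show "japanese ?v + ?s * (y - x) + 0 * 0 \<le> japanese (y - a)"
        using conv[of "y - x"] by simp
    qed
    finally show ?thesis unfolding if_not_P[OF False] by simp
  next
    case True
    \<comment> \<open>The loss from the truncation is then at most M / L^2 = 1 / (4 M), which is at
      most 1/2 of the variance available.\<close>
    let ?L = "2 * M"
    \<comment> \<open>For a point within distance 1 of the vertex and an increment of length at most
      \<open>?L\<close>, the denominator in \<open>japanese_convex\<close> is at most
      \<open>4 * (2 + ?L)\<close>.\<close>
    define \<kappa> where "\<kappa> = 1 / (4 * (2 + ?L))"
    have \<kappa>: "0 < \<kappa>" using M by (simp add: \<kappa>_def)
    let ?g = "\<lambda>y. (y - x)\<^sup>2 - 1 / ?L\<^sup>2 * \<bar>y - x\<bar> ^ 4"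
    have int_g: "integrable (q x) ?g"
      by (intro Bochner_Integration.integrable_diff integrable_mult_right int_z2 moment_integrable x)
    have "(\<integral>y. ?g y \<partial>q x) = (\<integral>y. (y - x)\<^sup>2 \<partial>q x) - 1 / ?L\<^sup>2 * (\<integral>y. \<bar>y - x\<bar> ^ 4 \<partial>q x)"
      by (simp only: Bochner_Integration.integral_diff[OF int_z2[OF x] integrable_mult_right[OF moment_integrable[OF x]]]
          integral_mult_right_zero)
    also have "\<dots> \<ge> 1 - 1 / ?L\<^sup>2 * M"
      using variance[OF x] True moment_bound[OF x, of 4] by (intro diff_mono mult_left_mono) auto
    finally have g_lower: "1 - 1 / ?L\<^sup>2 * M \<le> (\<integral>y. ?g y \<partial>q x)" .
    have "1 / ?L\<^sup>2 * M \<le> 1/2"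
    proof -
      have "1 / ?L\<^sup>2 * M = 1 / (4 * M)" using M by (simp add: power2_eq_square)
      also have "\<dots> \<le> 1/2" using M by (simp add: pos_divide_le_eq)
      finally show ?thesis .
    qed
    then have g_half: "1/2 \<le> (\<integral>y. ?g y \<partial>q x)" using g_lower by linarith
    have "japanese ?v + \<delta>\<^sub>0 = japanese ?v + \<kappa> * (1/2)" by (simp add: \<delta>\<^sub>0_def \<kappa>_def)
    also have "\<dots> \<le> japanese ?v + \<kappa> * (\<integral>y. ?g y \<partial>q x)"
      using g_half \<kappa> by (intro add_left_mono mult_left_mono) auto
    also have "\<dots> = (\<integral>y. japanese ?v + ?s * (y - x) + \<kappa> * ?g y \<partial>q x)"
      by (rule lin[OF int_g, symmetric])
    also have "\<dots> \<le> (\<integral>y. japanese (y - a) \<partial>q x)"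
    proof (rule integral_mono[OF _ japanese_int[OF x]])
      show "integrable (q x) (\<lambda>y. japanese ?v + ?s * (y - x) + \<kappa> * ?g y)"
        by (intro Bochner_Integration.integrable_add integrable_const_q x integrable_mult_right int_z int_g)
      fix y
      define z where "z = y - x"
      have "\<kappa> * ?g y \<le> japanese (?v + z) - japanese ?v - ?s * z"
      proof (cases "\<bar>z\<bar> \<le> ?L")
        case small: True
        have "\<kappa> * ?g y \<le> \<kappa> * z\<^sup>2" using \<kappa> by (intro mult_left_mono) (auto simp: z_def)
        also have "\<dots> = z\<^sup>2 / (4 * (2 + ?L))" by (simp add: \<kappa>_def)
        also have "\<dots> \<le> z\<^sup>2 / (2 * japanese (?v + z) * (japanese ?v)\<^sup>2)"
        proof (rule divide_left_mono)
          have "\<bar>?v\<bar> \<le> 1" using True by simp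
          then have "?v\<^sup>2 \<le> 1" by (simp add: abs_square_le_1)
          then have j2: "(japanese ?v)\<^sup>2 \<le> 2" by (simp add: japanese_square)
          have j1: "japanese (?v + z) \<le> 2 + ?L" using japanese_le[of "?v + z"] \<open>\<bar>?v\<bar> \<le> 1\<close> small by linarith
          have "2 * japanese (?v + z) * (japanese ?v)\<^sup>2 \<le> 2 * (2 + ?L) * 2"
            using j1 j2 M japanese_ge_1[of "?v + z"] by (intro mult_mono) auto
          then show "2 * japanese (?v + z) * (japanese ?v)\<^sup>2 \<le> 4 * (2 + ?L)" by simp
          show "0 < 4 * (2 + ?L) * (2 * japanese (?v + z) * (japanese ?v)\<^sup>2)"
          proof (intro mult_pos_pos)
            show "0 < japanese (?v + z)" using japanese_ge_1[of "?v + z"] by linarith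
            show "0 < (japanese ?v)\<^sup>2" using japanese_ge_1[of ?v] by simp
          qed (use M in auto)
        qed simp
        also have "\<dots> \<le> japanese (?v + z) - japanese ?v - ?s * z" by (rule japanese_convex)
        finally show ?thesis .
      next
        case False
        have "?L\<^sup>2 \<le> z\<^sup>2" using False M power_mono[of ?L "\<bar>z\<bar>" 2] by simp
        then have "1 \<le> 1 / ?L\<^sup>2 * z\<^sup>2" using M by (simp add: pos_le_divide_eq)
        then have "1 * z\<^sup>2 \<le> 1 / ?L\<^sup>2 * z\<^sup>2 * z\<^sup>2" by (intro mult_right_mono) auto
        moreover have "\<bar>z\<bar> ^ 4 = z\<^sup>2 * z\<^sup>2" by (simp add: power4_eq_xxxx power2_eq_square mult.assoc)
        ultimately have "?g y \<le> 0" by (simp add: z_def mult.assoc)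
        then have "\<kappa> * ?g y \<le> 0" using \<kappa> by (simp add: mult_nonneg_nonpos)
        then show ?thesis using conv[of z] by linarith
      qed
      then show "japanese ?v + ?s * (y - x) + \<kappa> * ?g y \<le> japanese (y - a)" by (simp add: z_def)
    qed
    finally show ?thesis using True by simp
  qed
qed

lemma W_int: "x \<in> I \<Longrightarrow> integrable (q x) (W a)"
  unfolding W_def[abs_def] using japanese_int[of x 0] japanese_int[of x a] integrable_const_q[of x] by simp

text \<open>For \<open>\<bar>x\<bar> < R\<^sub>0\<close> no lower bound on the variance is at hand.
  There the gain \<open>\<delta>\<^sub>0\<close> is simply added to the error term, which is
  possible because \<open>(1 + R\<^sub>0\<^sup>2) / (1 + x\<^sup>2)\<close> is at least 1 on this
  set.\<close>

lemma W_drift':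
  assumes x: "x \<in> I"
  shows "(\<integral>y. W a y \<partial>q x) + \<delta>\<^sub>0 * indicator {a-1..a+1} x \<le> W a x + (5 * M + \<delta>\<^sub>0 * (1 + R\<^sub>0\<^sup>2)) / (1 + x\<^sup>2)"
proof -
  let ?d = "if \<bar>x - a\<bar> \<le> 1 \<and> R\<^sub>0 \<le> \<bar>x\<bar> then \<delta>\<^sub>0 else 0"
  have int: "integrable (q x) japanese" using japanese_int[OF x, of 0] by simp
  have "(\<integral>y. W a y \<partial>q x) = (\<integral>y. japanese y \<partial>q x) + (japanese a + 1) - (\<integral>y. japanese (y - a) \<partial>q x)"
    unfolding W_def using int japanese_int[OF x, of a] integrable_const_q[OF x]
    by (simp add: Bochner_Integration.integral_add prob_space.prob_space[OF prob_q[OF x]])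
  then have "(\<integral>y. W a y \<partial>q x) + ?d \<le> W a x + 5 * M / (1 + x\<^sup>2)"
    using japanese_upper[OF x] japanese_lower[OF x, of a] by (simp add: W_def)
  moreover have "\<delta>\<^sub>0 * indicator {a-1..a+1} x \<le> ?d + \<delta>\<^sub>0 * (1 + R\<^sub>0\<^sup>2) / (1 + x\<^sup>2)"
  proof (cases "R\<^sub>0 \<le> \<bar>x\<bar>")
    case True
    have "0 \<le> \<delta>\<^sub>0 * (1 + R\<^sub>0\<^sup>2) / (1 + x\<^sup>2)" using \<delta>\<^sub>0_pos by (simp add: add_nonneg_nonneg)
    moreover have "x \<in> {a-1..a+1} \<longleftrightarrow> \<bar>x - a\<bar> \<le> 1" by auto
    ultimately show ?thesis using True \<delta>\<^sub>0_pos by (simp add: indicator_def)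
  next
    case False
    then have "x\<^sup>2 \<le> R\<^sub>0\<^sup>2" using R\<^sub>0 by (simp add: abs_le_square_iff[symmetric])
    then have "1 \<le> (1 + R\<^sub>0\<^sup>2) / (1 + x\<^sup>2)" by (simp add: pos_le_divide_eq add_pos_nonneg)
    then have "\<delta>\<^sub>0 * 1 \<le> \<delta>\<^sub>0 * ((1 + R\<^sub>0\<^sup>2) / (1 + x\<^sup>2))" using \<delta>\<^sub>0_pos by (intro mult_left_mono) auto
    moreover have "\<delta>\<^sub>0 * indicator {a-1..a+1} x \<le> \<delta>\<^sub>0 * 1" using \<delta>\<^sub>0_pos by (simp add: indicator_def)
    ultimately show ?thesis using False by simp
  qed
  ultimately show ?thesis by (simp add: add_divide_distrib)
qed

lemma drift_chain_constants:
  obtains R b where "drift_chain I q V W R b (1/2) (5 * M + \<delta>\<^sub>0 * (1 + R\<^sub>0\<^sup>2)) \<delta>\<^sub>0"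
proof -
  obtain R b where Rb: "0 \<le> R" "0 \<le> b"
    "\<And>x. x \<in> I \<Longrightarrow> (\<integral>y. V y \<partial>q x) + 1/2 / (1 + x\<^sup>2) \<le> V x + b * indicator {-R..R} x"
    using V_drift' by blast
  have "drift_chain I q V W R b (1/2) (5 * M + \<delta>\<^sub>0 * (1 + R\<^sub>0\<^sup>2)) \<delta>\<^sub>0"
  proof (intro drift_chain.intro drift_chain_axioms.intro feller_chain_axioms)
    show "continuous_on I V" by (intro continuous_intros) (simp add: add_pos_nonneg less_imp_neq[symmetric])
    show "\<exists>r. \<forall>x\<in>I. V x \<le> D \<longrightarrow> \<bar>x\<bar> \<le> r" for D
    proof (intro exI ballI impI)
      fix x assume "V x \<le> D"
      then have "1 + x\<^sup>2 \<le> exp D" by (metis add_pos_nonneg exp_le_cancel_iff exp_ln zero_le_power2 zero_less_one)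
      then show "\<bar>x\<bar> \<le> sqrt (exp D)" by (intro real_le_rsqrt) simp
    qed
    show "continuous_on I (W a)" for a
      unfolding W_def[abs_def] using continuous_japanese[of I 0] continuous_japanese[of I a]
      by (intro continuous_intros) simp_all
    show "0 \<le> 5 * M + \<delta>\<^sub>0 * (1 + R\<^sub>0\<^sup>2)" using M \<delta>\<^sub>0_pos by (intro add_nonneg_nonneg mult_nonneg_nonneg) auto
    show "(\<integral>y. V y \<partial>q x) + 1/2 / (1 + x\<^sup>2) \<le> V x + b * indicator {-R..R} x" if "x \<in> I" for x
      by (rule Rb(3)[OF that])
    show "(\<integral>y. W a y \<partial>q x) + \<delta>\<^sub>0 * indicator {a-1..a+1} x \<le> W a x + (5 * M + \<delta>\<^sub>0 * (1 + R\<^sub>0\<^sup>2)) / (1 + x\<^sup>2)"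
      if "x \<in> I" for a x by (rule W_drift'[OF that])
    show "0 < (1/2 :: real)" by simp
    show "0 \<le> R" by (rule Rb(1))
    show "0 \<le> b" by (rule Rb(2))
    show "0 < \<delta>\<^sub>0" by (rule \<delta>\<^sub>0_pos)
    show "0 \<le> V x" for x by (rule V_nonneg')
    show "integrable (q x) V" if "x \<in> I" for x by (rule V_int[OF that])
    show "\<exists>r'. \<forall>x\<in>I. r' < \<bar>x\<bar> \<longrightarrow> measure (q x) (I \<inter> {-r..r}) \<le> e / (1 + x\<^sup>2)" if "0 < e" for r e
      by (rule escape'[OF that])
    show "0 \<le> W a x" for a x by (rule W_nonneg')
    show "W a x \<le> 2 * \<bar>x\<bar> + 3" for a x by (rule W_le')
    show "integrable (q x) (W a)" if "x \<in> I" for a x by (rule W_int[OF that])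
  qed
  then show thesis by (rule that)
qed

end

section \<open>Random kernels\<close>

lemma state_space_facts:
  assumes "state_space I"
  shows state_space_closed: "closed I" and state_space_zero: "0 \<in> I"
    and state_space_add: "\<And>x y. x \<in> I \<Longrightarrow> y \<in> I \<Longrightarrow> x + y \<in> I"
    and state_space_uminus: "\<And>x. x \<in> I \<Longrightarrow> - x \<in> I"
proof -
  have "closed I \<and> 0 \<in> I \<and> (\<forall>x\<in>I. \<forall>y\<in>I. x + y \<in> I) \<and> (\<forall>x\<in>I. - x \<in> I)"
  proof (cases "I = UNIV")
    case False
    then obtain c where c: "c > 0" "I = range (\<lambda>k::int. c * of_int k)"
      using assms by (auto simp: state_space_def)
    have "closed ((\<lambda>x. c *\<^sub>R x) ` (\<int> :: real set))" by (intro closed_scaling closed_Ints)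
    moreover have "(\<lambda>x. c *\<^sub>R x) ` \<int> = I" unfolding c(2) by (auto simp: Ints_def)
    moreover have "0 \<in> I" unfolding c(2) by (rule range_eqI[of _ _ 0]) simp
    moreover have "x + y \<in> I" if xy: "x \<in> I" "y \<in> I" for x y
    proof -
      obtain j k where "x = c * of_int j" "y = c * of_int k" using xy unfolding c(2) by blast
      then show ?thesis unfolding c(2) by (intro range_eqI[of _ _ "j + k"]) (simp add: distrib_left)
    qed
    moreover have "- x \<in> I" if x: "x \<in> I" for x
    proof -
      obtain j where "x = c * of_int j" using x unfolding c(2) by blast
      then show ?thesis unfolding c(2) by (intro range_eqI[of _ _ "- j"]) simp
    qed
    ultimately show ?thesis by metis
  qed simp
  then show "closed I" "0 \<in> I" "\<And>x y. x \<in> I \<Longrightarrow> y \<in> I \<Longrightarrow> x + y \<in> I" "\<And>x. x \<in> I \<Longrightarrow> - x \<in> I" by auto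
qed

context
  fixes I :: "real set"
  assumes I: "state_space I"
begin

lemma state_space_borel: "I \<in> sets borel"
  using state_space_closed[OF I] by auto

lemma space_borel_on: "space (borel_on I) = I"
  by (simp add: space_restrict_space)

lemma sets_borel_on_iff: "A \<in> sets (borel_on I) \<longleftrightarrow> A \<in> sets borel \<and> A \<subseteq> I"
  using sets_restrict_space_iff[of I borel A] state_space_borel by auto

lemma bounded_continuous_on_const: "bounded_continuous_on I (\<lambda>_. c)"
  unfolding bounded_continuous_on_def by (rule conjI[OF continuous_on_const bounded_subset[of "{c}"]]) auto

lemma topspace_kernel_topology: "topspace (kernel_topology I) = markov_kernels I"
proof -
  have "markov_kernels I = {K \<in> markov_kernels I. (\<integral>y. 0 \<partial>K 0) \<in> (UNIV :: real set)}" by simp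
  then have "markov_kernels I \<in> {{K \<in> markov_kernels I. (\<integral>y. f y \<partial>K x) \<in> U} | f x U.
      bounded_continuous_on I f \<and> x \<in> I \<and> open U}"
    using bounded_continuous_on_const[of 0] state_space_zero[OF I] open_UNIV by blast
  then show ?thesis unfolding kernel_topology_def topology_generated_by_topspace by blast
qed

lemma open_subset_Pow: "{U. openin (kernel_topology I) U} \<subseteq> Pow (markov_kernels I)"
  using openin_subset topspace_kernel_topology by blast

lemma space_kernel_space: "space (kernel_space I) = markov_kernels I"
  unfolding kernel_space_def by (rule space_measure_of[OF open_subset_Pow])

lemma open_in_kernel_space: "openin (kernel_topology I) U \<Longrightarrow> U \<in> sets (kernel_space I)"
  unfolding kernel_space_def sets_measure_of[OF open_subset_Pow] by (rule sigma_sets.Basic) simp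

lemma markov_kernels_prob:
  "K \<in> markov_kernels I \<Longrightarrow> x \<in> I \<Longrightarrow> K x \<in> space (prob_algebra (borel_on I))"
  by (auto simp: markov_kernels_def)

lemma integral_kernel_measurable:
  assumes f: "bounded_continuous_on I f" and x: "x \<in> I"
  shows "(\<lambda>K. \<integral>y. f y \<partial>K x) \<in> borel_measurable (kernel_space I)"
proof (rule borel_measurableI)
  fix U :: "real set" assume U: "open U"
  have "(\<lambda>K. \<integral>y. f y \<partial>K x) -` U \<inter> space (kernel_space I) = {K \<in> markov_kernels I. (\<integral>y. f y \<partial>K x) \<in> U}"
    by (auto simp: space_kernel_space)
  moreover have "openin (kernel_topology I) {K \<in> markov_kernels I. (\<integral>y. f y \<partial>K x) \<in> U}"
    unfolding kernel_topology_def by (rule topology_generated_by_Basis) (use f x U in blast)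
  ultimately show "(\<lambda>K. \<integral>y. f y \<partial>K x) -` U \<inter> space (kernel_space I) \<in> sets (kernel_space I)"
    using open_in_kernel_space by simp
qed

text \<open>The Borel sigma-algebra of the kernel topology gives direct access only to integrals of
  bounded continuous functions. Half-lines are recovered as limits of such functions, and they form
  an intersection-stable generator of the Borel sets; the detour through measures on all of the
  reals makes this generator available.\<close>

lemma kernel_eval_measurable:
  assumes x: "x \<in> I"
  shows "(\<lambda>K. K x) \<in> kernel_space I \<rightarrow>\<^sub>M prob_algebra (borel_on I)"
proof -
  have K: "prob_space (K x)" "sets (K x) = sets (borel_on I)" "space (K x) = I" if "K \<in> space (kernel_space I)" for K
    using markov_kernels_prob[OF _ x, of K] that sets_eq_imp_space_eq[of "K x" "borel_on I"]
    by (auto simp: space_kernel_space space_prob_algebra space_borel_on)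
  have id: "(\<lambda>y. y) \<in> K x \<rightarrow>\<^sub>M borel" if "K \<in> space (kernel_space I)" for K
    unfolding measurable_cong_sets[OF K(2)[OF that] refl] by (rule measurable_restrict_space1) simp
  have em: "emeasure (distr (K x) borel (\<lambda>y. y)) A = emeasure (K x) (A \<inter> I)"
    if "K \<in> space (kernel_space I)" "A \<in> sets borel" for K A
    using id[OF that(1)] that(2) K(3)[OF that(1)] by (simp add: emeasure_distr)
  have half_lines: "(\<lambda>K. emeasure (K x) ({..t} \<inter> I)) \<in> borel_measurable (kernel_space I)" for t
  proof -
    \<comment> \<open>For positive \<open>n\<close> this is 1 up to \<open>t\<close>, then falls
      linearly to 0 at distance 1/n.\<close>
    define f where "f n y = max 0 (min 1 (1 - real n * (y - t)))" for n y
    have f_bdd: "\<bar>f n y\<bar> \<le> 1" for n y by (auto simp: f_def)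
    have f_cont: "continuous_on S (f n)" for n S unfolding f_def by (intro continuous_intros)
    have "bounded_continuous_on I (f n)" for n
      unfolding bounded_continuous_on_def bounded_iff using f_cont f_bdd by (auto intro: exI[of _ 1])
    then have meas: "(\<lambda>K. \<integral>y. f n y \<partial>K x) \<in> borel_measurable (kernel_space I)" for n
      by (rule integral_kernel_measurable[OF _ x])
    have f_lim: "(\<lambda>n. f n y) \<longlonglongrightarrow> indicator {..t} y" for y
    proof (cases "y \<le> t")
      case True
      then have "f n y = 1" for n
        using mult_nonneg_nonpos[of "real n" "y - t"] by (simp add: f_def)
      then show ?thesis using True by simp
    next
      case False
      obtain n0 where n0: "1 / (y - t) < real n0" using reals_Archimedean2 by blast
      have "f n y = 0" if "n \<ge> n0" for n
      proof -
        have "1 / (y - t) \<le> real n" using n0 that by simp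
        then have "1 \<le> real n * (y - t)" using False by (simp add: pos_divide_le_eq)
        then show ?thesis by (simp add: f_def)
      qed
      then have "\<forall>\<^sub>F n in sequentially. f n y = 0" using eventually_sequentially by blast
      then have "(\<lambda>n. f n y) \<longlonglongrightarrow> 0" by (rule tendsto_eventually)
      then show ?thesis using False by simp
    qed
    have lim: "(\<lambda>n. \<integral>y. f n y \<partial>K x) \<longlonglongrightarrow> measure (K x) ({..t} \<inter> I)" if "K \<in> space (kernel_space I)" for K
    proof -
      interpret prob_space "K x" using K(1)[OF that] .
      have mb: "g \<in> borel_measurable (K x)" if "g \<in> borel_measurable borel" for g :: "real \<Rightarrow> real"
        using measurable_compose[OF id[OF \<open>K \<in> _\<close>] that] .
      have "(\<lambda>n. \<integral>y. f n y \<partial>K x) \<longlonglongrightarrow> (\<integral>y. indicator {..t} y \<partial>K x)"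
      proof (rule integral_dominated_convergence[where w = "\<lambda>_. 1"])
        show "f n \<in> borel_measurable (K x)" for n
          by (intro mb borel_measurable_continuous_onI f_cont)
        show "(indicator {..t} :: real \<Rightarrow> real) \<in> borel_measurable (K x)" by (rule mb[OF borel_measurable_indicator]) simp
      qed (use f_lim f_bdd in auto)
      then show ?thesis by (simp add: K(3)[OF that])
    qed
    have "(\<lambda>K. measure (K x) ({..t} \<inter> I)) \<in> borel_measurable (kernel_space I)"
      by (rule borel_measurable_LIMSEQ_real[where u = "\<lambda>n K. \<integral>y. f n y \<partial>K x"]) (rule lim meas, assumption?)+
    then have "(\<lambda>K. ennreal (measure (K x) ({..t} \<inter> I))) \<in> borel_measurable (kernel_space I)"
      by (rule measurable_compose) simp
    then show ?thesis
      by (rule measurable_cong[THEN iffD1, rotated])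
         (simp add: finite_measure.emeasure_eq_measure[OF prob_space.finite_measure[OF K(1)]])
  qed
  have gen: "(\<lambda>K. distr (K x) borel (\<lambda>y. y)) \<in> kernel_space I \<rightarrow>\<^sub>M prob_algebra borel"
  proof (rule measurable_prob_algebra_generated[where G = "range (\<lambda>a. {..a})" and \<Omega> = UNIV])
    show "sets (borel :: real measure) = sigma_sets UNIV (range (\<lambda>a. {..a}))"
      by (subst borel_eq_atMost) (rule sets_measure_of, simp)
    show "Int_stable (range (\<lambda>a. {..a::real}))" by (auto simp: Int_stable_def)
    show "prob_space (distr (K x) borel (\<lambda>y. y))" if "K \<in> space (kernel_space I)" for K
      by (rule prob_space.prob_space_distr[OF K(1)[OF that] id[OF that]])
    show "(\<lambda>K. emeasure (distr (K x) borel (\<lambda>y. y)) A) \<in> borel_measurable (kernel_space I)"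
      if range: "A \<in> range (\<lambda>a. {..a})" for A
    proof -
      obtain t where A: "A = {..t}" using range by blast
      show ?thesis
        by (rule measurable_cong[THEN iffD2, OF _ half_lines[of t]]) (simp add: A em)
    qed
  qed auto
  show ?thesis
  proof (rule measurable_prob_algebraI)
    show "prob_space (K x)" if "K \<in> space (kernel_space I)" for K by (rule K(1)[OF that])
    show "(\<lambda>K. K x) \<in> kernel_space I \<rightarrow>\<^sub>M subprob_algebra (borel_on I)"
    proof (rule measurable_subprob_algebra)
      fix A assume A: "A \<in> sets (borel_on I)"
      then have Ab: "A \<in> sets borel" "A \<subseteq> I" by (simp_all add: sets_borel_on_iff)
      have "(\<lambda>K. emeasure (distr (K x) borel (\<lambda>y. y)) A) \<in> borel_measurable (kernel_space I)"
        by (rule measurable_compose[OF measurable_prob_algebraD[OF gen] measurable_emeasure_subprob_algebra[OF Ab(1)]])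
      then show "(\<lambda>K. emeasure (K x) A) \<in> borel_measurable (kernel_space I)"
        by (rule measurable_cong[THEN iffD1, rotated]) (simp add: em Ab Int_absorb2)
    qed (use K in \<open>auto intro: prob_space_imp_subprob_space\<close>)
  qed
qed

lemma shift_borel_measurable: "a \<in> I \<Longrightarrow> (\<lambda>y. y - a) \<in> borel_on I \<rightarrow>\<^sub>M borel_on I"
  using state_space_add[OF I _ state_space_uminus[OF I], of _ a]
  by (intro measurable_restrict_space2) (auto simp: space_borel_on intro: measurable_restrict_space1)

lemma integral_shift_kernel:
  assumes K: "K \<in> markov_kernels I" and a: "a \<in> I" and x: "x \<in> I" and f: "bounded_continuous_on I f"
  shows "(\<integral>y. f y \<partial>shift_kernel I a K x) = (\<integral>y. f (y - a) \<partial>K (x + a))"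
proof -
  have xa: "x + a \<in> I" by (rule state_space_add[OF I x a])
  have sets: "sets (K (x + a)) = sets (borel_on I)"
    using markov_kernels_prob[OF K xa] by (simp add: space_prob_algebra)
  have "f \<in> borel_measurable (borel_on I)"
    using f by (intro borel_measurable_continuous_on_restrict) (simp add: bounded_continuous_on_def)
  then have "(\<integral>y. f y \<partial>distr (K (x + a)) (borel_on I) (\<lambda>y. y - a)) = (\<integral>y. f (y - a) \<partial>K (x + a))"
    using shift_borel_measurable[OF a] by (intro integral_distr) (simp_all add: measurable_cong_sets[OF sets refl])
  then show ?thesis using x by (simp add: shift_kernel_def)
qed

lemma bounded_continuous_on_shift:
  assumes f: "bounded_continuous_on I f" and a: "a \<in> I"
  shows "bounded_continuous_on I (\<lambda>y. f (y - a))"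
proof -
  have im: "(\<lambda>y. y - a) ` I \<subseteq> I"
    using state_space_add[OF I _ state_space_uminus[OF I a]] by force
  have "continuous_on I (f \<circ> (\<lambda>y. y - a))"
    using f im by (intro continuous_on_compose continuous_intros) (auto simp: bounded_continuous_on_def intro: continuous_on_subset)
  moreover have "bounded ((\<lambda>y. f (y - a)) ` I)"
    by (rule bounded_subset[of "f ` I"]) (use f im in \<open>auto simp: bounded_continuous_on_def\<close>)
  ultimately show ?thesis by (simp add: bounded_continuous_on_def o_def)
qed

lemma shift_kernel_markov:
  assumes K: "K \<in> markov_kernels I" and a: "a \<in> I"
  shows "shift_kernel I a K \<in> markov_kernels I"
  unfolding markov_kernels_def
proof (intro CollectI conjI allI impI)
  show "shift_kernel I a K \<in> I \<rightarrow>\<^sub>E space (prob_algebra (borel_on I))"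
  proof (rule PiE_I)
    fix x assume x: "x \<in> I"
    have xa: "x + a \<in> I" by (rule state_space_add[OF I x a])
    have Kx: "prob_space (K (x + a))" "sets (K (x + a)) = sets (borel_on I)"
      using markov_kernels_prob[OF K xa] by (simp_all add: space_prob_algebra)
    have "prob_space (distr (K (x + a)) (borel_on I) (\<lambda>y. y - a))"
      using shift_borel_measurable[OF a] by (intro prob_space.prob_space_distr Kx) (simp add: measurable_cong_sets[OF Kx(2) refl])
    then show "shift_kernel I a K x \<in> space (prob_algebra (borel_on I))"
      using x by (simp add: shift_kernel_def space_prob_algebra)
  qed (simp add: shift_kernel_def)
next
  fix f assume f: "bounded_continuous_on I f"
  have "continuous_on I (\<lambda>x. \<integral>y. f (y - a) \<partial>K x)"
    using K bounded_continuous_on_shift[OF f a] by (simp add: markov_kernels_def)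
  then have "continuous_on ((\<lambda>x. x + a) ` I) (\<lambda>x. \<integral>y. f (y - a) \<partial>K x)"
    by (rule continuous_on_subset) (use state_space_add[OF I _ a] in auto)
  then have "continuous_on I ((\<lambda>x. \<integral>y. f (y - a) \<partial>K x) \<circ> (\<lambda>x. x + a))"
    by (intro continuous_on_compose continuous_intros)
  then show "continuous_on I (\<lambda>x. \<integral>y. f y \<partial>shift_kernel I a K x)"
    by (rule continuous_on_eq) (simp add: integral_shift_kernel[OF K a _ f])
qed

text \<open>The shift is continuous: the preimage of a subbasic set given by a function and a point
  is the subbasic set given by the translated function and the translated point.\<close>

lemma shift_kernel_measurable:
  assumes a: "a \<in> I"
  shows "shift_kernel I a \<in> kernel_space I \<rightarrow>\<^sub>M kernel_space I"
proof -
  let ?S = "{{K \<in> markov_kernels I. (\<integral>y. f y \<partial>K x) \<in> U} | f x U. bounded_continuous_on I f \<and> x \<in> I \<and> open U}"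
  have cont: "continuous_map (kernel_topology I) (topology_generated_by ?S) (shift_kernel I a)"
  proof (rule continuous_on_generated_topo)
    fix A assume "A \<in> ?S"
    then obtain f x U where A: "A = {K \<in> markov_kernels I. (\<integral>y. f y \<partial>K x) \<in> U}"
      and f: "bounded_continuous_on I f" and x: "x \<in> I" and U: "open U" by blast
    have "shift_kernel I a -` A \<inter> topspace (kernel_topology I)
      = {K \<in> markov_kernels I. (\<integral>y. f (y - a) \<partial>K (x + a)) \<in> U}"
      unfolding A topspace_kernel_topology using shift_kernel_markov[OF _ a] integral_shift_kernel[OF _ a x f] by auto
    moreover have "{K \<in> markov_kernels I. (\<integral>y. f (y - a) \<partial>K (x + a)) \<in> U} \<in> ?S"
      by (rule CollectI, rule exI[of _ "\<lambda>y. f (y - a)"], rule exI[of _ "x + a"], rule exI[of _ U])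
        (use bounded_continuous_on_shift[OF f a] state_space_add[OF I x a] U in simp)
    ultimately have "shift_kernel I a -` A \<inter> topspace (kernel_topology I) \<in> ?S" by (rule ssubst)
    then show "openin (kernel_topology I) (shift_kernel I a -` A \<inter> topspace (kernel_topology I))"
      unfolding kernel_topology_def by (rule topology_generated_by_Basis)
  next
    have "\<Union>?S = markov_kernels I"
      using topspace_kernel_topology unfolding kernel_topology_def topology_generated_by_topspace .
    moreover have "shift_kernel I a ` topspace (kernel_topology I) \<subseteq> markov_kernels I"
      unfolding topspace_kernel_topology by (rule image_subsetI, rule shift_kernel_markov[OF _ a])
    ultimately show "shift_kernel I a ` topspace (kernel_topology I) \<subseteq> \<Union>?S"
      by (simp only:)
  qed
  show ?thesis
    unfolding kernel_space_def
  proof (rule measurable_measure_of[OF open_subset_Pow])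
    have sp: "space (sigma (markov_kernels I) {U. openin (kernel_topology I) U}) = markov_kernels I"
      using space_kernel_space by (simp add: kernel_space_def)
    show "shift_kernel I a \<in> space (sigma (markov_kernels I) {U. openin (kernel_topology I) U}) \<rightarrow> markov_kernels I"
      unfolding sp using shift_kernel_markov[OF _ a] by blast
    fix U assume "U \<in> {U. openin (kernel_topology I) U}"
    then have "openin (kernel_topology I) {K \<in> topspace (kernel_topology I). shift_kernel I a K \<in> U}"
      by (intro openin_continuous_map_preimage[OF cont[folded kernel_topology_def]]) simp
    moreover have "{K \<in> topspace (kernel_topology I). shift_kernel I a K \<in> U} = shift_kernel I a -` U \<inter> markov_kernels I"
      unfolding topspace_kernel_topology by auto
    ultimately show "shift_kernel I a -` U \<inter> space (sigma (markov_kernels I) {U. openin (kernel_topology I) U})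
      \<in> sets (sigma (markov_kernels I) {U. openin (kernel_topology I) U})"
      unfolding sp using open_in_kernel_space by (simp add: kernel_space_def)
  qed
qed

end

section \<open>Stationary random kernels and the marginals of the k-point motion\<close>

locale random_kernel = prob_space P for P :: "'w measure" +
  fixes I :: "real set" and K :: "'w \<Rightarrow> real \<Rightarrow> real measure"
  assumes I: "state_space I"
    and K: "K \<in> P \<rightarrow>\<^sub>M kernel_space I"
    and stationary: "\<And>a. a \<in> I \<Longrightarrow> distr P (kernel_space I) K = distr P (kernel_space I) (\<lambda>\<omega>. shift_kernel I a (K \<omega>))"
    and exponential_moment: "\<exists>\<eta>>0. integrable (mean_measure P K) (\<lambda>x. exp (\<eta> * \<bar>x\<bar>))"
begin

abbreviation "B \<equiv> borel_on I"
abbreviation "\<mu> \<equiv> mean_measure P K"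

lemma K_measurable: "x \<in> I \<Longrightarrow> (\<lambda>\<omega>. K \<omega> x) \<in> P \<rightarrow>\<^sub>M prob_algebra B"
  by (rule measurable_compose[OF K kernel_eval_measurable[OF I]])

lemma K_prob: "x \<in> I \<Longrightarrow> \<omega> \<in> space P \<Longrightarrow> prob_space (K \<omega> x)"
  using measurable_space[OF K_measurable] by (simp add: space_prob_algebra)

lemma K_sets: "x \<in> I \<Longrightarrow> \<omega> \<in> space P \<Longrightarrow> sets (K \<omega> x) = sets B"
  using measurable_space[OF K_measurable] by (simp add: space_prob_algebra)

lemma P_prob_algebra: "P \<in> space (prob_algebra P)"
  using prob_space_axioms by (simp add: space_prob_algebra)

lemma add_measurable: "a \<in> I \<Longrightarrow> (\<lambda>y. y + a) \<in> B \<rightarrow>\<^sub>M B"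
  using shift_borel_measurable[OF I state_space_uminus[OF I]] by simp

lemma mean_measure_prob: "\<mu> \<in> space (prob_algebra B)"
  unfolding mean_measure_def space_prob_algebra
  using prob_space_bind'[OF P_prob_algebra K_measurable[OF state_space_zero[OF I]]]
    sets_bind'[OF P_prob_algebra K_measurable[OF state_space_zero[OF I]]] by simp

lemma sets_mean_measure: "sets \<mu> = sets B"
  using mean_measure_prob by (simp add: space_prob_algebra)

lemma emeasure_bind_K: "x \<in> I \<Longrightarrow> A \<in> sets B \<Longrightarrow> emeasure (P \<bind> (\<lambda>\<omega>. K \<omega> x)) A = (\<integral>\<^sup>+\<omega>. emeasure (K \<omega> x) A \<partial>P)"
  by (rule emeasure_bind_prob_algebra[OF P_prob_algebra K_measurable])

text \<open>Stationarity identifies two laws on the space of kernels; evaluating both at the point 0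
  identifies the mean transition from \<open>a\<close> with the translated mean transition from
  0.\<close>

lemma bind_K_eq_shift:
  assumes a: "a \<in> I"
  shows "P \<bind> (\<lambda>\<omega>. K \<omega> a) = distr \<mu> B (\<lambda>y. y + a)"
proof (rule measure_eqI)
  have sets: "sets (P \<bind> (\<lambda>\<omega>. K \<omega> a)) = sets B" by (rule sets_bind'[OF P_prob_algebra K_measurable[OF a]])
  then show "sets (P \<bind> (\<lambda>\<omega>. K \<omega> a)) = sets (distr \<mu> B (\<lambda>y. y + a))" by simp
  fix A assume "A \<in> sets (P \<bind> (\<lambda>\<omega>. K \<omega> a))"
  then have A: "A \<in> sets B" by (simp only: sets)
  define A' where "A' = (\<lambda>y. y + a) -` A \<inter> I"
  have A': "A' \<in> sets B"
    using measurable_sets[OF add_measurable[OF a] A] by (simp add: A'_def space_borel_on[OF I])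
  have zero: "0 \<in> I" by (rule state_space_zero[OF I])
  have ev: "(\<lambda>k. emeasure (k 0) A') \<in> borel_measurable (kernel_space I)"
    by (rule measurable_compose[OF measurable_prob_algebraD[OF kernel_eval_measurable[OF I zero]]
        measurable_emeasure_subprob_algebra[OF A']])
  have AI: "A \<subseteq> I" using A by (simp add: sets_borel_on_iff[OF I])
  have "(\<lambda>y. y - a) -` A' \<inter> I = A"
    using AI state_space_add[OF I _ state_space_uminus[OF I a]] by (force simp: A'_def)
  then have shift: "emeasure (shift_kernel I a (K \<omega>) 0) A' = emeasure (K \<omega> a) A" if w: "\<omega> \<in> space P" for \<omega>
    using shift_borel_measurable[OF I a] A' sets_eq_imp_space_eq[OF K_sets[OF a w]] zero
    by (simp add: shift_kernel_def emeasure_distr measurable_cong_sets[OF K_sets[OF a w] refl] space_borel_on[OF I])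
  have "emeasure (P \<bind> (\<lambda>\<omega>. K \<omega> a)) A = (\<integral>\<^sup>+\<omega>. emeasure (K \<omega> a) A \<partial>P)"
    by (rule emeasure_bind_K[OF a A])
  also have "\<dots> = (\<integral>\<^sup>+\<omega>. emeasure (shift_kernel I a (K \<omega>) 0) A' \<partial>P)"
    by (rule nn_integral_cong) (simp add: shift)
  also have "\<dots> = (\<integral>\<^sup>+k. emeasure (k 0) A' \<partial>distr P (kernel_space I) (\<lambda>\<omega>. shift_kernel I a (K \<omega>)))"
    by (rule nn_integral_distr[OF measurable_compose[OF K shift_kernel_measurable[OF I a]], symmetric])
      (simp only: measurable_distr_eq1 ev)
  also have "\<dots> = (\<integral>\<^sup>+k. emeasure (k 0) A' \<partial>distr P (kernel_space I) K)"
    by (simp only: stationary[OF a])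
  also have "\<dots> = (\<integral>\<^sup>+\<omega>. emeasure (K \<omega> 0) A' \<partial>P)" by (rule nn_integral_distr[OF K]) (simp only: measurable_distr_eq1 ev)
  also have "\<dots> = emeasure \<mu> A'" unfolding mean_measure_def by (rule emeasure_bind_K[OF zero A', symmetric])
  also have "\<dots> = emeasure (distr \<mu> B (\<lambda>y. y + a)) A"
    using add_measurable[OF a] A sets_eq_imp_space_eq[OF sets_mean_measure]
    by (simp add: emeasure_distr measurable_cong_sets[OF sets_mean_measure refl] A'_def space_borel_on[OF I])
  finally show "emeasure (P \<bind> (\<lambda>\<omega>. K \<omega> a)) A = emeasure (distr \<mu> B (\<lambda>y. y + a)) A" .
qed

lemma product_sigma_finite_K: "(\<And>i. x i \<in> I) \<Longrightarrow> \<omega> \<in> space P \<Longrightarrow> product_sigma_finite (\<lambda>i. K \<omega> (x i))"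
  by (intro product_sigma_finite.intro prob_space_imp_sigma_finite K_prob)

lemma product_K_measurable:
  fixes x :: "nat \<Rightarrow> real"
  assumes x: "\<And>i. x i \<in> I"
  shows "(\<lambda>\<omega>. \<Pi>\<^sub>M i\<in>{1..k}. K \<omega> (x i)) \<in> P \<rightarrow>\<^sub>M prob_algebra (\<Pi>\<^sub>M i\<in>{1..k}. B)"
proof (rule measurable_prob_algebra_generated)
  show "sets (\<Pi>\<^sub>M i\<in>{1..k}. B) = sigma_sets (\<Pi>\<^sub>E i\<in>{1..k}. space B) (prod_algebra {1..k} (\<lambda>i. B))"
    by (rule sets_PiM)
  show "Int_stable (prod_algebra {1..k} (\<lambda>i. B))" by (rule Int_stable_prod_algebra)
  show "prod_algebra {1..k} (\<lambda>i. B) \<subseteq> Pow (\<Pi>\<^sub>E i\<in>{1..k}. space B)" by (rule prod_algebra_sets_into_space)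
  show "prob_space (\<Pi>\<^sub>M i\<in>{1..k}. K \<omega> (x i))" if "\<omega> \<in> space P" for \<omega>
    by (rule prob_space_PiM) (rule K_prob[OF x that])
  show "sets (\<Pi>\<^sub>M i\<in>{1..k}. K \<omega> (x i)) = sets (\<Pi>\<^sub>M i\<in>{1..k}. B)" if "\<omega> \<in> space P" for \<omega>
    by (rule sets_PiM_cong[OF refl K_sets[OF x that]])
  fix A assume "A \<in> prod_algebra {1..k} (\<lambda>i. B)"
  then have "A \<in> {(\<Pi>\<^sub>E i\<in>{1..k}. X i) |X. X \<in> (\<Pi> i\<in>{1..k}. sets B)}"
    by (simp only: prod_algebra_eq_finite finite_atLeastAtMost)
  then obtain X where A: "A = (\<Pi>\<^sub>E i\<in>{1..k}. X i)" and X': "X \<in> (\<Pi> i\<in>{1..k}. sets B)"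
    by (elim CollectE exE conjE)
  have X: "X i \<in> sets B" if "i \<in> {1..k}" for i using X' that by (rule Pi_mem)
  have "(\<lambda>\<omega>. \<Prod>i\<in>{1..k}. emeasure (K \<omega> (x i)) (X i)) \<in> borel_measurable P"
    by (rule borel_measurable_prod_ennreal)
      (rule measurable_compose[OF measurable_prob_algebraD[OF K_measurable[OF x]] measurable_emeasure_subprob_algebra[OF X]])
  moreover have "emeasure (\<Pi>\<^sub>M i\<in>{1..k}. K \<omega> (x i)) A = (\<Prod>i\<in>{1..k}. emeasure (K \<omega> (x i)) (X i))"
    if w: "\<omega> \<in> space P" for \<omega>
    unfolding A by (rule product_sigma_finite.emeasure_PiM[OF product_sigma_finite_K[OF x w]])
      (simp_all add: X K_sets[OF x w])
  ultimately show "(\<lambda>\<omega>. emeasure (\<Pi>\<^sub>M i\<in>{1..k}. K \<omega> (x i)) A) \<in> borel_measurable P"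
    by (subst measurable_cong)
qed

lemma kpoint_prob:
  assumes x: "\<And>i. x i \<in> I"
  shows "kpoint_kernel P K k x \<in> space (prob_algebra (\<Pi>\<^sub>M i\<in>{1..k}. B))"
  unfolding kpoint_kernel_def space_prob_algebra
  using prob_space_bind'[OF P_prob_algebra product_K_measurable[OF x, of k]]
    sets_bind'[OF P_prob_algebra product_K_measurable[OF x, of k]] by simp

lemma sets_kpoint: "(\<And>i. x i \<in> I) \<Longrightarrow> sets (kpoint_kernel P K k x) = sets (\<Pi>\<^sub>M i\<in>{1..k}. B)"
  using kpoint_prob[of x k] by (simp add: space_prob_algebra)

lemma nn_integral_kpoint:
  assumes x: "\<And>i. x i \<in> I" and f: "\<And>i. i \<in> {1..k} \<Longrightarrow> f i \<in> borel_measurable B"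
  shows "(\<integral>\<^sup>+y. (\<Prod>i\<in>{1..k}. f i (y i)) \<partial>kpoint_kernel P K k x) = (\<integral>\<^sup>+\<omega>. (\<Prod>i\<in>{1..k}. \<integral>\<^sup>+y. f i y \<partial>K \<omega> (x i)) \<partial>P)"
proof -
  have "(\<lambda>y. \<Prod>i\<in>{1..k}. f i (y i)) \<in> borel_measurable (\<Pi>\<^sub>M i\<in>{1..k}. B)"
    by (rule borel_measurable_prod_ennreal) (rule measurable_compose[OF measurable_component_singleton], (assumption | rule f)+)
  from nn_integral_bind[OF this measurable_prob_algebraD[OF product_K_measurable[OF x]]]
  have "(\<integral>\<^sup>+y. (\<Prod>i\<in>{1..k}. f i (y i)) \<partial>kpoint_kernel P K k x)
      = (\<integral>\<^sup>+\<omega>. \<integral>\<^sup>+y. (\<Prod>i\<in>{1..k}. f i (y i)) \<partial>(\<Pi>\<^sub>M i\<in>{1..k}. K \<omega> (x i)) \<partial>P)"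
    by (simp add: kpoint_kernel_def)
  also have "\<dots> = (\<integral>\<^sup>+\<omega>. (\<Prod>i\<in>{1..k}. \<integral>\<^sup>+y. f i y \<partial>K \<omega> (x i)) \<partial>P)"
  proof (rule nn_integral_cong)
    fix \<omega> assume w: "\<omega> \<in> space P"
    show "(\<integral>\<^sup>+y. (\<Prod>i\<in>{1..k}. f i (y i)) \<partial>(\<Pi>\<^sub>M i\<in>{1..k}. K \<omega> (x i))) = (\<Prod>i\<in>{1..k}. \<integral>\<^sup>+y. f i y \<partial>K \<omega> (x i))"
      by (rule product_sigma_finite.product_nn_integral_prod[OF product_sigma_finite_K[OF x w]])
        (simp_all add: f measurable_cong_sets[OF K_sets[OF x w] refl])
  qed
  finally show ?thesis .
qed

text \<open>Projecting to one coordinate integrates out the others before the expectation over the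
  environment is taken, so the dependence between the points is invisible and each marginal is a
  translate of \<open>\<mu>\<close>.\<close>

lemma kpoint_marginal:
  assumes x: "\<And>i. x i \<in> I" and i: "i \<in> {1..k}"
  shows "distr (kpoint_kernel P K k x) B (\<lambda>y. y i) = distr \<mu> B (\<lambda>y. y + x i)"
proof -
  have "distr (kpoint_kernel P K k x) B (\<lambda>y. y i) = P \<bind> (\<lambda>\<omega>. distr (\<Pi>\<^sub>M i\<in>{1..k}. K \<omega> (x i)) B (\<lambda>y. y i))"
    unfolding kpoint_kernel_def
    by (rule distr_bind[OF measurable_prob_algebraD[OF product_K_measurable[OF x]] not_empty measurable_component_singleton[OF i]])
  also have "\<dots> = P \<bind> (\<lambda>\<omega>. K \<omega> (x i))"
  proof (rule bind_cong[OF refl])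
    fix \<omega> assume w: "\<omega> \<in> space P"
    have "distr (\<Pi>\<^sub>M i\<in>{1..k}. K \<omega> (x i)) B (\<lambda>y. y i) = distr (\<Pi>\<^sub>M i\<in>{1..k}. K \<omega> (x i)) (K \<omega> (x i)) (\<lambda>y. y i)"
      by (rule distr_cong) (simp_all add: K_sets[OF x w])
    also have "\<dots> = K \<omega> (x i)"
      using distr_PiM_component[of "{1..k}" "\<lambda>i. K \<omega> (x i)" i] K_prob[OF x w] i by simp
    finally show "distr (\<Pi>\<^sub>M i\<in>{1..k}. K \<omega> (x i)) B (\<lambda>y. y i) = K \<omega> (x i)" .
  qed
  also have "\<dots> = distr \<mu> B (\<lambda>y. y + x i)" by (rule bind_K_eq_shift[OF x])
  finally show ?thesis .
qed

lemma kpoint_integral: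
  fixes f :: "real \<Rightarrow> real"
  assumes x: "\<And>i. x i \<in> I" and i: "i \<in> {1..k}" and f: "f \<in> borel_measurable borel"
  shows integrable_kpoint_iff: "integrable (kpoint_kernel P K k x) (\<lambda>y. f (y i - x i)) \<longleftrightarrow> integrable \<mu> f"
    and integral_kpoint_eq: "(\<integral>y. f (y i - x i) \<partial>kpoint_kernel P K k x) = (\<integral>y. f y \<partial>\<mu>)"
proof -
  have f': "(\<lambda>y. f (y - x i)) \<in> borel_measurable B"
    by (rule measurable_restrict_space1) (rule measurable_compose[OF _ f], simp)
  have m1: "(\<lambda>y. y i) \<in> kpoint_kernel P K k x \<rightarrow>\<^sub>M B"
    unfolding measurable_cong_sets[OF sets_kpoint[OF x] refl] by (rule measurable_component_singleton[OF i])
  have m2: "(\<lambda>y. y + x i) \<in> \<mu> \<rightarrow>\<^sub>M B"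
    unfolding measurable_cong_sets[OF sets_mean_measure refl] by (rule add_measurable[OF x])
  show "integrable (kpoint_kernel P K k x) (\<lambda>y. f (y i - x i)) \<longleftrightarrow> integrable \<mu> f"
    using integrable_distr_eq[OF m1 f'] integrable_distr_eq[OF m2 f'] by (simp add: kpoint_marginal[OF x i])
  show "(\<integral>y. f (y i - x i) \<partial>kpoint_kernel P K k x) = (\<integral>y. f y \<partial>\<mu>)"
    using integral_distr[OF m1 f'] integral_distr[OF m2 f'] by (simp add: kpoint_marginal[OF x i])
qed

lemma measurable_mean: "f \<in> borel_measurable borel \<Longrightarrow> f \<in> borel_measurable \<mu>"
  unfolding measurable_cong_sets[OF sets_mean_measure refl] by (rule measurable_restrict_space1)

lemma integrable_abs_moment: "integrable \<mu> (\<lambda>x. \<bar>x\<bar> ^ k)"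
proof (cases "k = 0")
  case True
  interpret \<mu>: prob_space \<mu> using mean_measure_prob by (simp add: space_prob_algebra)
  show ?thesis using True by simp
next
  case False
  obtain \<eta> where \<eta>: "\<eta> > 0" "integrable \<mu> (\<lambda>x. exp (\<eta> * \<bar>x\<bar>))" using exponential_moment by blast
  show ?thesis
  proof (rule Bochner_Integration.integrable_bound)
    show "integrable \<mu> (\<lambda>x. (k / \<eta>) ^ k * exp (\<eta> * \<bar>x\<bar>))" using \<eta>(2) by simp
    show "(\<lambda>x. \<bar>x\<bar> ^ k) \<in> borel_measurable \<mu>" by (rule measurable_mean) simp
    have "\<bar>x\<bar> ^ k \<le> (k / \<eta>) ^ k * exp (\<eta> * \<bar>x\<bar>)" for x :: real
    proof -
      \<comment> \<open>The inequality u \<le> exp u at u = \<eta> |x| / k, raised to the power k,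
        dominates the moment by the exponential; the division explains the separate case
        \<open>k = 0\<close>.\<close>
      have "\<eta> * \<bar>x\<bar> / k \<le> exp (\<eta> * \<bar>x\<bar> / k)" using exp_ge_add_one_self[of "\<eta> * \<bar>x\<bar> / k"] by linarith
      then have "(\<eta> * \<bar>x\<bar> / k) ^ k \<le> exp (\<eta> * \<bar>x\<bar> / k) ^ k" using \<eta>(1) by (intro power_mono) auto
      also have "\<dots> = exp (\<eta> * \<bar>x\<bar>)" using False by (simp add: exp_of_nat_mult[symmetric])
      finally have "(k / \<eta>) ^ k * (\<eta> * \<bar>x\<bar> / k) ^ k \<le> (k / \<eta>) ^ k * exp (\<eta> * \<bar>x\<bar>)"
        using \<eta>(1) by (intro mult_left_mono) auto
      moreover have "(k / \<eta>) ^ k * (\<eta> * \<bar>x\<bar> / k) ^ k = \<bar>x\<bar> ^ k"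
        using \<eta>(1) False by (simp add: power_mult_distrib[symmetric])
      ultimately show ?thesis by simp
    qed
    then show "AE x in \<mu>. norm (\<bar>x\<bar> ^ k) \<le> norm ((k / \<eta>) ^ k * exp (\<eta> * \<bar>x\<bar>))"
      using \<eta>(1) by (intro AE_I2) simp
  qed
qed

lemma integrable_mean: "integrable \<mu> (\<lambda>x. x)"
  by (rule integrable_abs_cancel[OF _ measurable_mean]) (use integrable_abs_moment[of 1] in simp_all)

end

section \<open>The difference kernel\<close>

context random_kernel
begin

abbreviation "pair x \<equiv> kpoint_kernel P K 2 ((\<lambda>_. 0)(1 := x))"
abbreviation "m k \<equiv> \<integral>x. x ^ k \<partial>\<mu>"

lemma point_in_I: "x \<in> I \<Longrightarrow> ((\<lambda>_::nat. 0)(1 := x)) i \<in> I"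
  using state_space_zero[OF I] by simp

lemma pair_prob: "x \<in> I \<Longrightarrow> prob_space (pair x)"
  using kpoint_prob[of "(\<lambda>_. 0)(1 := x)" 2] point_in_I[of x] by (simp add: space_prob_algebra)

lemma pair_coordinate:
  assumes x: "x \<in> I" and i: "i \<in> {1..2}"
  shows "(\<lambda>y. y i) \<in> pair x \<rightarrow>\<^sub>M B"
  unfolding measurable_cong_sets[OF sets_kpoint[OF point_in_I[OF x]] refl] by (rule measurable_component_singleton[OF i])

lemma pair_coordinate_borel:
  assumes x: "x \<in> I" and i: "i \<in> {1..2}"
  shows "(\<lambda>y. y i) \<in> borel_measurable (pair x)"
  by (rule measurable_compose[OF pair_coordinate[OF x i]]) (rule measurable_restrict_space1, simp)

lemma pair_first:
  fixes f :: "real \<Rightarrow> real"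
  assumes x: "x \<in> I" and f: "f \<in> borel_measurable borel"
  shows pair_first_integrable: "integrable (pair x) (\<lambda>y. f (y 1 - x)) \<longleftrightarrow> integrable \<mu> f"
    and pair_first_integral: "(\<integral>y. f (y 1 - x) \<partial>pair x) = (\<integral>y. f y \<partial>\<mu>)"
  using kpoint_integral[where x = "(\<lambda>_. 0)(1 := x)" and i = 1 and k = 2, OF point_in_I[OF x] _ f] by simp_all

lemma pair_second:
  fixes f :: "real \<Rightarrow> real"
  assumes x: "x \<in> I" and f: "f \<in> borel_measurable borel"
  shows pair_second_integrable: "integrable (pair x) (\<lambda>y. f (y 2)) \<longleftrightarrow> integrable \<mu> f"
    and pair_second_integral: "(\<integral>y. f (y 2) \<partial>pair x) = (\<integral>y. f y \<partial>\<mu>)"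
  using kpoint_integral[where x = "(\<lambda>_. 0)(1 := x)" and i = 2 and k = 2, OF point_in_I[OF x] _ f] by simp_all

lemma pair_difference_measurable: "x \<in> I \<Longrightarrow> (\<lambda>y. y 1 - y 2) \<in> pair x \<rightarrow>\<^sub>M B"
proof (rule measurable_restrict_space2)
  assume x: "x \<in> I"
  have "y 1 - y 2 \<in> I" if y: "y \<in> space (pair x)" for y
    using measurable_space[OF pair_coordinate[OF x, of 1] y] measurable_space[OF pair_coordinate[OF x, of 2] y]
      state_space_add[OF I _ state_space_uminus[OF I], of "y 1" "y 2"] by (simp add: space_borel_on[OF I])
  then show "(\<lambda>y. y 1 - y 2) \<in> space (pair x) \<rightarrow> I" by blast
  show "(\<lambda>y. y 1 - y 2) \<in> borel_measurable (pair x)"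
    by (rule borel_measurable_diff) (rule pair_coordinate_borel[OF x], simp)+
qed

abbreviation "q \<equiv> difference_kernel I P K"

lemma difference_kernel_prob: "x \<in> I \<Longrightarrow> q x \<in> space (prob_algebra B)"
  unfolding difference_kernel_def space_prob_algebra
  using prob_space.prob_space_distr[OF pair_prob pair_difference_measurable] by simp

lemma difference_integral:
  fixes f :: "real \<Rightarrow> real"
  assumes x: "x \<in> I" and f: "f \<in> borel_measurable borel"
  shows difference_integrable: "integrable (q x) f \<longleftrightarrow> integrable (pair x) (\<lambda>y. f (y 1 - y 2))"
    and difference_integral_eq: "(\<integral>y. f y \<partial>q x) = (\<integral>y. f (y 1 - y 2) \<partial>pair x)"
  unfolding difference_kernel_def
  using integrable_distr_eq[OF pair_difference_measurable[OF x] measurable_restrict_space1[OF f]]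
    integral_distr[OF pair_difference_measurable[OF x] measurable_restrict_space1[OF f]] by simp_all

text \<open>The increment of the difference is a difference of two increments whose laws do not
  depend on \<open>x\<close>. Hence the bound is uniform in the starting point, however the two
  increments depend on each other.\<close>

lemma difference_moment:
  assumes x: "x \<in> I"
  shows difference_moment_integrable: "integrable (q x) (\<lambda>y. \<bar>y - x\<bar> ^ k)"
    and difference_moment_le: "(\<integral>y. \<bar>y - x\<bar> ^ k \<partial>q x) \<le> 2 ^ (k + 1) * (\<integral>y. \<bar>y\<bar> ^ k \<partial>\<mu>)"
proof -
  have meas: "(\<lambda>y::real. \<bar>y - x\<bar> ^ k) \<in> borel_measurable borel" by simp
  have abs_meas: "(\<lambda>y::real. \<bar>y\<bar> ^ k) \<in> borel_measurable borel" by simp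
  let ?d = "\<lambda>y::nat \<Rightarrow> real. \<bar>y 1 - y 2 - x\<bar> ^ k"
  let ?g = "\<lambda>y::nat \<Rightarrow> real. 2 ^ k * (\<bar>y 1 - x\<bar> ^ k + \<bar>y 2\<bar> ^ k)"
  have i1: "integrable (pair x) (\<lambda>y. \<bar>y 1 - x\<bar> ^ k)" and i2: "integrable (pair x) (\<lambda>y. \<bar>y 2\<bar> ^ k)"
    using pair_first_integrable[OF x abs_meas] pair_second_integrable[OF x abs_meas] integrable_abs_moment by simp_all
  have ig: "integrable (pair x) ?g" by (intro integrable_mult_right Bochner_Integration.integrable_add i1 i2)
  have le: "?d y \<le> ?g y" for y
  proof -
    have "\<bar>a - b - x\<bar> \<le> 2 * max \<bar>a - x\<bar> \<bar>b\<bar>" for a b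
    proof -
      have "\<bar>a - b - x\<bar> \<le> \<bar>a - x\<bar> + \<bar>b\<bar>" by linarith
      also have "\<dots> \<le> max \<bar>a - x\<bar> \<bar>b\<bar> + max \<bar>a - x\<bar> \<bar>b\<bar>" by (intro add_mono max.cobounded1 max.cobounded2)
      finally show ?thesis by simp
    qed
    then have "?d y \<le> (2 * max \<bar>y 1 - x\<bar> \<bar>y 2\<bar>) ^ k" by (intro power_mono) auto
    also have "\<dots> \<le> ?g y" by (auto simp: power_mult_distrib max_def)
    finally show ?thesis .
  qed
  have dm: "?d \<in> borel_measurable (pair x)"
    by (rule measurable_compose[OF pair_difference_measurable[OF x] measurable_restrict_space1[OF meas]])
  have id: "integrable (pair x) ?d"
    by (rule Bochner_Integration.integrable_bound[OF ig dm]) (use le in \<open>auto intro!: AE_I2 order_trans[OF le]\<close>)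
  then show "integrable (q x) (\<lambda>y. \<bar>y - x\<bar> ^ k)" by (simp add: difference_integrable[OF x meas])
  have "(\<integral>y. ?d y \<partial>pair x) \<le> (\<integral>y. ?g y \<partial>pair x)" by (rule integral_mono[OF id ig le])
  also have "\<dots> = 2 ^ k * ((\<integral>y. \<bar>y 1 - x\<bar> ^ k \<partial>pair x) + (\<integral>y. \<bar>y 2\<bar> ^ k \<partial>pair x))"
    using i1 i2 by simp
  also have "\<dots> = 2 ^ (k + 1) * (\<integral>y. \<bar>y\<bar> ^ k \<partial>\<mu>)"
    by (simp only: pair_first_integral[OF x abs_meas] pair_second_integral[OF x abs_meas]) simp
  finally show "(\<integral>y. \<bar>y - x\<bar> ^ k \<partial>q x) \<le> 2 ^ (k + 1) * (\<integral>y. \<bar>y\<bar> ^ k \<partial>\<mu>)"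
    by (simp add: difference_integral_eq[OF x meas])
qed

lemma integrable_power: "integrable \<mu> (\<lambda>x. x ^ k)"
  by (rule Bochner_Integration.integrable_bound[OF integrable_abs_moment[of k] measurable_mean])
    (auto simp: power_abs)

lemma difference_mean:
  assumes x: "x \<in> I"
  shows "(\<integral>y. y - x \<partial>q x) = 0"
proof -
  note ident = measurable_ident_sets[OF refl]
  have i: "integrable (pair x) (\<lambda>y. y 1 - x)" "integrable (pair x) (\<lambda>y. y 2)"
    by (rule pair_first_integrable[OF x ident, THEN iffD2, OF integrable_mean],
        rule pair_second_integrable[OF x ident, THEN iffD2, OF integrable_mean])
  have *: "y - z - x = (y - x) - z" for y z :: real by simp
  have "(\<integral>y. y - x \<partial>q x) = (\<integral>y. (y 1 - x) - y 2 \<partial>pair x)"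
    by (subst difference_integral_eq[OF x]) (simp, simp only: *)
  also have "\<dots> = (\<integral>y. y 1 - x \<partial>pair x) - (\<integral>y. y 2 \<partial>pair x)" by (rule Bochner_Integration.integral_diff[OF i])
  also have "\<dots> = 0"
    by (simp only: pair_first_integral[OF x ident] pair_second_integral[OF x ident] diff_self)
  finally show ?thesis .
qed

lemma pair_product_integrable:
  fixes f g :: "real \<Rightarrow> real"
  assumes x: "x \<in> I" and f: "f \<in> borel_measurable borel" and g: "g \<in> borel_measurable borel"
    and f2: "integrable \<mu> (\<lambda>y. (f y)\<^sup>2)" and g2: "integrable \<mu> (\<lambda>y. (g y)\<^sup>2)"
  shows "integrable (pair x) (\<lambda>y. f (y 1 - x) * g (y 2))"
proof (rule Bochner_Integration.integrable_bound)
  have "integrable (pair x) (\<lambda>y. (f (y 1 - x))\<^sup>2)"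
    by (rule pair_first_integrable[OF x, THEN iffD2, OF _ f2]) (rule borel_measurable_power[OF f])
  moreover have "integrable (pair x) (\<lambda>y. (g (y 2))\<^sup>2)"
    by (rule pair_second_integrable[OF x, THEN iffD2, OF _ g2]) (rule borel_measurable_power[OF g])
  ultimately show "integrable (pair x) (\<lambda>y. (f (y 1 - x))\<^sup>2 + (g (y 2))\<^sup>2)"
    by (rule Bochner_Integration.integrable_add)
  show "(\<lambda>y. f (y 1 - x) * g (y 2)) \<in> borel_measurable (pair x)"
    by (intro borel_measurable_times measurable_compose[OF _ f] measurable_compose[OF _ g] borel_measurable_diff
        pair_coordinate_borel[OF x] borel_measurable_const) simp_all
  have "\<bar>a * b\<bar> \<le> a\<^sup>2 + b\<^sup>2" for a b :: real
    using sum_squares_bound[of "\<bar>a\<bar>" "\<bar>b\<bar>"] mult_nonneg_nonneg[OF abs_ge_zero abs_ge_zero, of a b]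
    by (simp only: abs_mult power2_abs mult.assoc)
  then show "AE y in pair x. norm (f (y 1 - x) * g (y 2)) \<le> norm ((f (y 1 - x))\<^sup>2 + (g (y 2))\<^sup>2)"
    by (intro AE_I2) simp
qed

lemma difference_variance:
  assumes x: "x \<in> I"
  shows "(\<integral>y. (y - x)\<^sup>2 \<partial>q x) = 2 * m 2 - 2 * (\<integral>y. (y 1 - x) * y 2 \<partial>pair x)"
proof -
  have i: "integrable (pair x) (\<lambda>y. (y 1 - x)\<^sup>2)" "integrable (pair x) (\<lambda>y. (y 2)\<^sup>2)"
    using pair_first_integrable[OF x, of "\<lambda>y. y\<^sup>2"] pair_second_integrable[OF x, of "\<lambda>y. y\<^sup>2"] integrable_power[of 2] by simp_all
  have c: "integrable (pair x) (\<lambda>y. (y 1 - x) * y 2)"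
    by (rule pair_product_integrable[OF x]) (simp_all add: integrable_power)
  have "(\<integral>y. (y - x)\<^sup>2 \<partial>q x) = (\<integral>y. (y 1 - x)\<^sup>2 + (y 2)\<^sup>2 - 2 * ((y 1 - x) * y 2) \<partial>pair x)"
    by (subst difference_integral_eq[OF x]) (simp_all add: algebra_simps power2_eq_square)
  also have "\<dots> = (\<integral>y. (y 1 - x)\<^sup>2 \<partial>pair x) + (\<integral>y. (y 2)\<^sup>2 \<partial>pair x) - 2 * (\<integral>y. (y 1 - x) * y 2 \<partial>pair x)"
    using i c by simp
  also have "\<dots> = 2 * m 2 - 2 * (\<integral>y. (y 1 - x) * y 2 \<partial>pair x)"
    using pair_first_integral[OF x, of "\<lambda>y. y\<^sup>2"] pair_second_integral[OF x, of "\<lambda>y. y\<^sup>2"] by simp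
  finally show ?thesis .
qed

text \<open>Given the environment the two coordinates are independent, so the product with the
  centred second increment factors, and the factor coming from the point 0 vanishes almost surely.
  The factorization is carried out for nonnegative integrands, where
  \<open>nn_integral_kpoint\<close> applies, with positive and negative parts treated
  separately.\<close>

lemma covariance_deterministic_mean:
  assumes x: "x \<in> I" and det: "AE \<omega> in P. (\<integral>y. y \<partial>K \<omega> 0) = m 1"
  shows "(\<integral>y. (y 1 - x) * y 2 \<partial>pair x) = (m 1)\<^sup>2"
proof -
  have zero: "0 \<in> I" by (rule state_space_zero[OF I])
  have K_borel: "f \<in> borel_measurable (K \<omega> 0)" if "\<omega> \<in> space P" "f \<in> borel_measurable borel" for \<omega> and f :: "real \<Rightarrow> real"
    unfolding measurable_cong_sets[OF K_sets[OF zero that(1)] refl] by (rule measurable_restrict_space1[OF that(2)])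
  have abs_meas: "(\<lambda>y. ennreal \<bar>y\<bar>) \<in> borel_measurable B" by (rule measurable_restrict_space1) simp
  have "(\<integral>\<^sup>+\<omega>. \<integral>\<^sup>+y. ennreal \<bar>y\<bar> \<partial>K \<omega> 0 \<partial>P) = (\<integral>\<^sup>+y. ennreal \<bar>y\<bar> \<partial>\<mu>)"
    unfolding mean_measure_def by (rule nn_integral_bind[OF abs_meas measurable_prob_algebraD[OF K_measurable[OF zero]], symmetric])
  moreover have "(\<integral>\<^sup>+y. ennreal \<bar>y\<bar> \<partial>\<mu>) < \<infinity>"
    using integrable_mean by (simp add: integrable_iff_bounded)
  ultimately have fin: "(\<integral>\<^sup>+\<omega>. \<integral>\<^sup>+y. ennreal \<bar>y\<bar> \<partial>K \<omega> 0 \<partial>P) \<noteq> \<infinity>" by simp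
  have "AE \<omega> in P. (\<integral>\<^sup>+y. ennreal \<bar>y\<bar> \<partial>K \<omega> 0) \<noteq> \<infinity>"
    by (rule nn_integral_PInf_AE[OF measurable_compose[OF measurable_prob_algebraD[OF K_measurable[OF zero]]
          nn_integral_measurable_subprob_algebra[OF abs_meas]] fin])
  \<comment> \<open>The mean being equal to \<open>m 1\<close> is expressed as equality of the
    integrals of the positive and the negative part, a form that can be substituted under
    \<open>nn_integral\<close>.\<close>
  then have balanced: "AE \<omega> in P. (\<integral>\<^sup>+y. ennreal (y - m 1) \<partial>K \<omega> 0) = (\<integral>\<^sup>+y. ennreal (- (y - m 1)) \<partial>K \<omega> 0)"
    using det AE_space
  proof eventually_elim
    case (elim \<omega>)
    interpret k: prob_space "K \<omega> 0" by (rule K_prob[OF zero elim(3)])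
    have int: "integrable (K \<omega> 0) (\<lambda>y. y)"
      unfolding integrable_iff_bounded
      by (rule conjI[OF K_borel[OF elim(3)]]) (use elim(1) in \<open>simp_all add: less_top\<close>)
    then have int': "integrable (K \<omega> 0) (\<lambda>y. y - m 1)" by simp
    have "(\<integral>y. y - m 1 \<partial>K \<omega> 0) = 0" using int elim(2) by (simp add: k.prob_space)
    then have eq: "enn2real (\<integral>\<^sup>+y. ennreal (y - m 1) \<partial>K \<omega> 0) = enn2real (\<integral>\<^sup>+y. ennreal (- (y - m 1)) \<partial>K \<omega> 0)"
      using real_lebesgue_integral_def[OF int'] by simp
    show ?case
      using arg_cong[OF eq, of ennreal] int' unfolding real_integrable_def
      by (simp only: ennreal_enn2real less_top infinity_ennreal_def)
  qed
  have square: "integrable \<mu> (\<lambda>y. (y - c)\<^sup>2)" for c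
  proof -
    interpret \<mu>: prob_space \<mu> using mean_measure_prob by (simp add: space_prob_algebra)
    have "integrable \<mu> (\<lambda>y. y\<^sup>2 + c\<^sup>2 - 2 * c * y)"
      by (intro Bochner_Integration.integrable_diff Bochner_Integration.integrable_add
          integrable_mult_right \<mu>.integrable_const integrable_power integrable_mean)
    then show ?thesis by (simp add: power2_diff mult_ac)
  qed
  have int: "integrable (pair x) (\<lambda>y. \<phi> (y 1 - x) * (y 2 - m 1))"
    if "\<phi> \<in> borel_measurable borel" "integrable \<mu> (\<lambda>y. (\<phi> y)\<^sup>2)" for \<phi> :: "real \<Rightarrow> real"
    by (rule pair_product_integrable[OF x that(1) _ that(2) square]) simp
  \<comment> \<open>Nonnegativity of \<open>\<phi>\<close> ensures that the sign of the product is
    decided by the second factor, so the parts of the product are products of parts.\<close>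
  have vanish: "(\<integral>y. \<phi> (y 1 - x) * (y 2 - m 1) \<partial>pair x) = 0"
    if \<phi>: "\<phi> \<in> borel_measurable borel" "\<And>y. 0 \<le> \<phi> y" "integrable \<mu> (\<lambda>y. (\<phi> y)\<^sup>2)" for \<phi> :: "real \<Rightarrow> real"
  proof -
    have split: "(\<integral>\<^sup>+y. ennreal (\<phi> (y 1 - x) * s (y 2)) \<partial>pair x)
        = (\<integral>\<^sup>+\<omega>. (\<integral>\<^sup>+y. ennreal (\<phi> (y - x)) \<partial>K \<omega> x) * (\<integral>\<^sup>+y. ennreal (s y) \<partial>K \<omega> 0) \<partial>P)"
      if s: "s \<in> borel_measurable borel" for s :: "real \<Rightarrow> real"
    proof -
      define f where "f = (\<lambda>i::nat. if i = 1 then \<lambda>y. ennreal (\<phi> (y - x)) else (\<lambda>y. ennreal (s y)))"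
      have "f i \<in> borel_measurable borel" for i
        unfolding f_def using \<phi>(1) s by simp
      then have f: "f i \<in> borel_measurable B" for i by (rule measurable_restrict_space1)
      have two: "(\<Prod>i\<in>{1..2}. h i) = h 1 * h 2" for h :: "nat \<Rightarrow> ennreal"
        by (simp add: numeral_2_eq_2)
      have "(\<integral>\<^sup>+y. ennreal (\<phi> (y 1 - x) * s (y 2)) \<partial>pair x) = (\<integral>\<^sup>+y. (\<Prod>i\<in>{1..2}. f i (y i)) \<partial>pair x)"
        by (simp only: two) (simp add: f_def ennreal_mult'[OF \<phi>(2)])
      also have "\<dots> = (\<integral>\<^sup>+\<omega>. (\<Prod>i\<in>{1..2}. \<integral>\<^sup>+y. f i y \<partial>K \<omega> (((\<lambda>_. 0)(1 := x)) i)) \<partial>P)"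
        by (rule nn_integral_kpoint[OF point_in_I[OF x] f])
      also have "\<dots> = (\<integral>\<^sup>+\<omega>. (\<integral>\<^sup>+y. ennreal (\<phi> (y - x)) \<partial>K \<omega> x) * (\<integral>\<^sup>+y. ennreal (s y) \<partial>K \<omega> 0) \<partial>P)"
        by (simp only: two) (simp add: f_def)
      finally show ?thesis .
    qed
    have "(\<integral>\<^sup>+y. ennreal (\<phi> (y 1 - x) * (y 2 - m 1)) \<partial>pair x)
        = (\<integral>\<^sup>+\<omega>. (\<integral>\<^sup>+y. ennreal (\<phi> (y - x)) \<partial>K \<omega> x) * (\<integral>\<^sup>+y. ennreal (y - m 1) \<partial>K \<omega> 0) \<partial>P)"
      by (rule split) simp
    also have "\<dots> = (\<integral>\<^sup>+\<omega>. (\<integral>\<^sup>+y. ennreal (\<phi> (y - x)) \<partial>K \<omega> x) * (\<integral>\<^sup>+y. ennreal (- (y - m 1)) \<partial>K \<omega> 0) \<partial>P)"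
      by (rule nn_integral_cong_AE) (use balanced in eventually_elim, simp)
    also have "\<dots> = (\<integral>\<^sup>+y. ennreal (\<phi> (y 1 - x) * - (y 2 - m 1)) \<partial>pair x)"
      by (rule split[symmetric]) simp
    finally show ?thesis
      unfolding real_lebesgue_integral_def[OF int[OF \<phi>(1,3)]] by (simp only: mult_minus_right diff_self)
  qed
  have bound: "integrable \<mu> (\<lambda>y. (max 0 y)\<^sup>2)" "integrable \<mu> (\<lambda>y. (max 0 (- y))\<^sup>2)"
  proof -
    have le: "norm ((max 0 y)\<^sup>2) \<le> norm (y\<^sup>2)" "norm ((max 0 (- y))\<^sup>2) \<le> norm (y\<^sup>2)" for y :: real
      by (simp_all add: max_def)
    show "integrable \<mu> (\<lambda>y. (max 0 y)\<^sup>2)"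
      by (rule Bochner_Integration.integrable_bound[OF integrable_power[of 2]])
        (rule measurable_mean, simp, rule AE_I2, rule le(1))
    show "integrable \<mu> (\<lambda>y. (max 0 (- y))\<^sup>2)"
      by (rule Bochner_Integration.integrable_bound[OF integrable_power[of 2]])
        (rule measurable_mean, simp, rule AE_I2, rule le(2))
  qed
  have pos: "integrable (pair x) (\<lambda>y. max 0 (y 1 - x) * (y 2 - m 1))"
    and neg: "integrable (pair x) (\<lambda>y. max 0 (- (y 1 - x)) * (y 2 - m 1))"
    by (rule int[OF _ bound(1)], simp, rule int[OF _ bound(2)], simp)
  have pos0: "(\<integral>y. max 0 (y 1 - x) * (y 2 - m 1) \<partial>pair x) = 0"
    and neg0: "(\<integral>y. max 0 (- (y 1 - x)) * (y 2 - m 1) \<partial>pair x) = 0"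
    by (rule vanish[OF _ _ bound(1)], simp, simp, rule vanish[OF _ _ bound(2)], simp, simp)
  have "t * w = max 0 t * w - max 0 (- t) * w" for t w :: real
    by (cases "0 \<le> t") (simp_all add: max_def)
  then have "(\<integral>y. (y 1 - x) * (y 2 - m 1) \<partial>pair x)
      = (\<integral>y. max 0 (y 1 - x) * (y 2 - m 1) - max 0 (- (y 1 - x)) * (y 2 - m 1) \<partial>pair x)"
    by (rule Bochner_Integration.integral_cong[OF refl])
  also have "\<dots> = 0"
    unfolding Bochner_Integration.integral_diff[OF pos neg] pos0 neg0 by simp
  finally have centred: "(\<integral>y. (y 1 - x) * (y 2 - m 1) \<partial>pair x) = 0" .
  have i1: "integrable (pair x) (\<lambda>y. y 1 - x)"
    by (rule pair_first_integrable[OF x measurable_ident_sets[OF refl], THEN iffD2, OF integrable_mean])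
  have e1: "(\<integral>y. y 1 - x \<partial>pair x) = m 1"
    unfolding power_one_right by (rule pair_first_integral[OF x measurable_ident_sets[OF refl]])
  have i2: "integrable (pair x) (\<lambda>y. (y 1 - x) * (y 2 - m 1))"
    by (rule int[OF measurable_ident_sets[OF refl] integrable_power])
  have "t * w = t * (w - m 1) + m 1 * t" for t w :: real by (simp add: algebra_simps)
  then have "(\<integral>y. (y 1 - x) * y 2 \<partial>pair x) = (\<integral>y. (y 1 - x) * (y 2 - m 1) + m 1 * (y 1 - x) \<partial>pair x)"
    by (intro Bochner_Integration.integral_cong refl)
  also have "\<dots> = (\<integral>y. (y 1 - x) * (y 2 - m 1) \<partial>pair x) + m 1 * (\<integral>y. y 1 - x \<partial>pair x)"
    by (simp only: Bochner_Integration.integral_add[OF i2 integrable_mult_right[OF i1]] integral_mult_right_zero)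
  finally show ?thesis unfolding centred e1 by (simp add: power2_eq_square)
qed

text \<open>The tolerance 1/2 in the covariance bound is chosen so that twice the difference of
  \<open>m 2\<close> and the covariance is still at least 2 (m_2 - m_1^2) - 1 = 1. The moment
  constant is one crude sum that bounds all moments up to order six at once and is at least
  1.\<close>

lemma moment_chain_difference_kernel:
  assumes tv: "tv_continuous_kernel I q"
    and irreducible: "\<And>x y \<epsilon>. x \<in> I \<Longrightarrow> y \<in> I \<Longrightarrow> \<epsilon> > 0 \<Longrightarrow>
      \<exists>n. 0 < measure (kernel_power I q n x) ({y - \<epsilon><..<y + \<epsilon>} \<inter> I)"
    and unit_variance: "m 2 - (m 1)\<^sup>2 = 1"
    and covariance: "\<And>x. x \<in> I \<Longrightarrow> R \<le> \<bar>x\<bar> \<Longrightarrow> (\<integral>y. (y 1 - x) * y 2 \<partial>pair x) \<le> (m 1)\<^sup>2 + 1 / 2"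
  shows "moment_chain I q (1 + (\<Sum>k\<le>6. 2 ^ (k + 1) * (\<integral>y. \<bar>y\<bar> ^ k \<partial>\<mu>))) (max 1 R)"
proof
  show "closed I" "0 \<in> I" by (rule state_space_closed[OF I], rule state_space_zero[OF I])
  show "q x \<in> space (prob_algebra B)" if "x \<in> I" for x by (rule difference_kernel_prob[OF that])
  show "continuous_on I (\<lambda>x. measure (q x) A)" if A: "A \<in> sets B" for A
    unfolding continuous_on_def
  proof
    fix x assume x: "x \<in> I"
    have sets: "sets (q z) = sets B" for z by (simp add: difference_kernel_def)
    have le: "\<bar>measure (q z) A - measure (q x) A\<bar> \<le> tv_dist (q z) (q x)" if z: "z \<in> I" for z
      unfolding tv_dist_def
    proof (rule cSUP_upper)
      show "A \<in> sets (q z)" using A by (simp add: sets)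
      have "prob_space (q z)" "prob_space (q x)"
        using difference_kernel_prob[OF x] difference_kernel_prob[OF z] by (simp_all add: space_prob_algebra)
      then have "\<bar>measure (q z) A' - measure (q x) A'\<bar> \<le> 1" for A'
        using prob_space.prob_le_1[of "q z" A'] prob_space.prob_le_1[of "q x" A']
          measure_nonneg[of "q z" A'] measure_nonneg[of "q x" A'] by linarith
      then show "bdd_above ((\<lambda>A. \<bar>measure (q z) A - measure (q x) A\<bar>) ` sets (q z))"
        by (intro bdd_aboveI2)
    qed
    have lim: "((\<lambda>z. tv_dist (q z) (q x)) \<longlongrightarrow> 0) (at x within I)"
      using tv x by (simp add: tv_continuous_kernel_def)
    have "((\<lambda>z. measure (q z) A - measure (q x) A) \<longlongrightarrow> 0) (at x within I)"
      by (rule Lim_null_comparison[OF _ lim]) (simp add: eventually_at_filter le)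
    then show "((\<lambda>z. measure (q z) A) \<longlongrightarrow> measure (q x) A) (at x within I)"
      by (rule LIM_zero_cancel)
  qed
  show "\<exists>n. 0 < measure (kernel_power I q n x) ({y - \<epsilon><..<y + \<epsilon>} \<inter> I)" if "x \<in> I" "y \<in> I" "\<epsilon> > 0" for x y \<epsilon>
    by (rule irreducible[OF that])
  show "(\<integral>y. y - x \<partial>q x) = 0" if "x \<in> I" for x by (rule difference_mean[OF that])
  show "integrable (q x) (\<lambda>y. \<bar>y - x\<bar> ^ k)" if "x \<in> I" for x k by (rule difference_moment_integrable[OF that])
  have nonneg: "0 \<le> 2 ^ (k + 1) * (\<integral>y. \<bar>y\<bar> ^ k \<partial>\<mu>)" for k by simp
  show "(\<integral>y. \<bar>y - x\<bar> ^ k \<partial>q x) \<le> 1 + (\<Sum>k\<le>6. 2 ^ (k + 1) * (\<integral>y. \<bar>y\<bar> ^ k \<partial>\<mu>))"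
    if x: "x \<in> I" and k: "k \<in> {2..6}" for x and k :: nat
  proof -
    have "2 ^ (k + 1) * (\<integral>y. \<bar>y\<bar> ^ k \<partial>\<mu>) \<le> (\<Sum>k\<le>6. 2 ^ (k + 1) * (\<integral>y. \<bar>y\<bar> ^ k \<partial>\<mu>))"
      by (rule member_le_sum[where f = "\<lambda>k. 2 ^ (k + 1) * (\<integral>y. \<bar>y\<bar> ^ k \<partial>\<mu>)"]) (use k nonneg in auto)
    then show ?thesis using difference_moment_le[OF x, of k] by linarith
  qed
  show "1 \<le> (\<integral>y. (y - x)\<^sup>2 \<partial>q x)" if "x \<in> I" "max 1 R \<le> \<bar>x\<bar>" for x
    using covariance[of x] that unit_variance by (simp add: difference_variance)
  show "1 \<le> 1 + (\<Sum>k\<le>6. 2 ^ (k + 1) * (\<integral>y. \<bar>y\<bar> ^ k \<partial>\<mu>))"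
    using sum_nonneg[of "{..6}" "\<lambda>k. 2 ^ (k + 1) * (\<integral>y. \<bar>y\<bar> ^ k \<partial>\<mu>)"] nonneg by simp
  show "1 \<le> max 1 R" by simp
qed

end

text \<open>If \<open>F\<close> stayed above 1/2, then \<open>x * F x\<close> would be at least 1/2
  on the half-line from 1 on and could not be integrable.\<close>

lemma decay_function_small:
  assumes F: "decay_function F"
  obtains R where "0 \<le> R" "\<And>x. R \<le> x \<Longrightarrow> F x \<le> 1 / 2"
proof -
  have mono: "F y \<le> F x" if "0 \<le> x" "x \<le> y" for x y
    using F that by (auto simp: decay_function_def monotone_on_def)
  have "\<exists>R\<ge>0. F R \<le> 1 / 2"
  proof (rule ccontr)
    assume neg: "\<not> (\<exists>R\<ge>0. F R \<le> 1 / 2)"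
    have int: "integrable lborel (\<lambda>x. indicator {0..} x *\<^sub>R (x * F x))"
      using F by (simp add: decay_function_def set_integrable_def)
    have "integrable lborel (\<lambda>x. 1 / 2 * indicator {1::real..} x :: real)"
    proof (rule Bochner_Integration.integrable_bound[OF int])
      have "1 / 2 \<le> x * F x" if "1 \<le> x" for x
      proof -
        have "0 \<le> x" using that by simp
        then have "1 / 2 \<le> F x" using neg by (meson le_cases)
        then have "1 * (1 / 2) \<le> x * F x" using that by (intro mult_mono) auto
        then show ?thesis by simp
      qed
      then show "AE x in lborel. norm (1 / 2 * indicator {1::real..} x :: real) \<le> norm (indicator {0..} x *\<^sub>R (x * F x))"
        by (intro AE_I2) (fastforce simp: indicator_def)
    qed simp
    from integrable_mult_right[OF this, of 2]
    have "integrable lborel (indicator {1::real..} :: real \<Rightarrow> real)" by simp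
    then have "emeasure lborel {1::real..} < \<infinity>" by (simp add: integrable_indicator_iff)
    moreover have "emeasure lborel {1..1 + real n} \<le> emeasure lborel {1::real..}" for n
      by (rule emeasure_mono) auto
    then have "of_nat n \<le> emeasure lborel {1::real..}" for n
      by (simp add: ennreal_of_nat_eq_real_of_nat)
    ultimately show False using ennreal_Ex_less_of_nat not_less by (metis infinity_ennreal_def)
  qed
  then obtain R where "0 \<le> R" "F R \<le> 1 / 2" by blast
  then show ?thesis using mono that by (meson order_trans)
qed

text \<open>The set where \<open>\<bar>x\<bar>\<close> lies between \<open>k\<close> and
  \<open>k + 1\<close> is covered by the two intervals of radius 1 around \<open>k\<close> and
  \<open>- k\<close>. Their total mass is at most \<open>2 * C\<close>, and there \<open>f\<close>
  is bounded by \<open>F k\<close>.\<close>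

lemma nn_integral_decreasing_bound_finite:
  fixes f F :: "real \<Rightarrow> real"
  assumes sets: "sets \<pi> = sets (borel_on I)" and I: "I \<in> sets borel"
    and C: "C < \<infinity>" "\<And>a. emeasure \<pi> (I \<inter> {a - 1..a + 1}) \<le> C"
    and F: "\<And>x. 0 \<le> x \<Longrightarrow> 0 \<le> F x" "antimono_on {0..} F" "summable (\<lambda>k. F (real k))"
    and f: "\<And>x. x \<in> I \<Longrightarrow> \<bar>f x\<bar> \<le> F \<bar>x\<bar>"
  shows "(\<integral>\<^sup>+x. ennreal \<bar>f x\<bar> \<partial>\<pi>) < \<infinity>"
proof -
  define A where "A k = (I \<inter> {real k - 1..real k + 1}) \<union> (I \<inter> {- real k - 1..- real k + 1})" for k
  have sp: "space \<pi> = I" using sets_eq_imp_space_eq[OF sets] by (simp add: space_restrict_space)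
  have int: "I \<inter> {a..b} \<in> sets \<pi>" for a b
    using I by (simp add: sets sets_restrict_space_iff)
  have A: "A k \<in> sets \<pi>" for k unfolding A_def by (rule sets.Un[OF int int])
  have A_le: "emeasure \<pi> (A k) \<le> 2 * C" for k
  proof -
    have "emeasure \<pi> (A k) \<le> emeasure \<pi> (I \<inter> {real k - 1..real k + 1}) + emeasure \<pi> (I \<inter> {- real k - 1..- real k + 1})"
      unfolding A_def by (rule emeasure_subadditive[OF int int])
    also have "\<dots> \<le> C + C" by (intro add_mono C(2))
    finally show ?thesis by (simp add: mult_2)
  qed
  have le: "ennreal \<bar>f x\<bar> \<le> (\<Sum>k. ennreal (F (real k)) * indicator (A k) x)" if x: "x \<in> space \<pi>" for x
  proof -
    define k where "k = nat \<lfloor>\<bar>x\<bar>\<rfloor>"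
    have k: "real k \<le> \<bar>x\<bar>" "\<bar>x\<bar> \<le> real k + 1" unfolding k_def by linarith+
    have xI: "x \<in> I" using x sp by simp
    then have "x \<in> A k" using k by (auto simp: A_def)
    have "\<bar>f x\<bar> \<le> F \<bar>x\<bar>" by (rule f[OF xI])
    also have "\<dots> \<le> F (real k)" using F(2) k(1) by (auto simp: monotone_on_def)
    finally have "ennreal \<bar>f x\<bar> \<le> ennreal (F (real k)) * indicator (A k) x"
      using \<open>x \<in> A k\<close> by (simp add: ennreal_leI)
    also have "\<dots> \<le> (\<Sum>k. ennreal (F (real k)) * indicator (A k) x)"
      using sum_le_suminf[OF summableI, of "{k}" "\<lambda>k. ennreal (F (real k)) * indicator (A k) x"]
      by (simp only: sum.insert sum.empty finite.intros empty_iff simp_thms add_0_right zero_le)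
    finally show ?thesis .
  qed
  have "(\<integral>\<^sup>+x. ennreal \<bar>f x\<bar> \<partial>\<pi>) \<le> (\<integral>\<^sup>+x. (\<Sum>k. ennreal (F (real k)) * indicator (A k) x) \<partial>\<pi>)"
    by (rule nn_integral_mono[OF le])
  also have "\<dots> = (\<Sum>k. \<integral>\<^sup>+x. ennreal (F (real k)) * indicator (A k) x \<partial>\<pi>)"
    by (rule nn_integral_suminf) (use A in simp)
  also have "\<dots> = (\<Sum>k. ennreal (F (real k)) * emeasure \<pi> (A k))"
    by (simp add: nn_integral_cmult_indicator A)
  also have "\<dots> \<le> (\<Sum>k. ennreal (F (real k)) * (2 * C))"
    by (intro suminf_le mult_left_mono A_le summableI) simp
  also have "\<dots> = ennreal (\<Sum>k. F (real k)) * (2 * C)"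
    using F(1,3) by (simp add: suminf_ennreal2)
  also have "\<dots> < \<infinity>" using C(1) by (simp add: ennreal_mult_less_top)
  finally show ?thesis .
qed

context random_kernel
begin

text \<open>The value \<open>p = 0\<close> is excluded, because the zeroth moment is the constant 1.
  For \<open>p = 1\<close> two points with both exponents 1 fall in the range covered by the decay
  assumption. For \<open>p \<ge> 2\<close> the total exponent 2 lies below \<open>2 * p\<close>, but
  then the first moment is deterministic and the covariance term is known exactly.\<close>

lemma covariance_decay:
  assumes deterministic: "\<forall>k\<in>{1..p - 1}. AE \<omega> in P. (\<integral>y. y ^ k \<partial>K \<omega> 0) = m k"
    and nondeterministic: "\<not> (\<exists>c. AE \<omega> in P. (\<integral>y. y ^ p \<partial>K \<omega> 0) = c)"
    and decay: "decay_function F"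
      "\<forall>k\<in>{2 * p..4 * p}. \<forall>x\<in>{1..k} \<rightarrow>\<^sub>E I. \<forall>r :: nat \<Rightarrow> nat.
        (\<forall>j\<in>{1..k}. r j \<le> 4 * p - 1) \<and> (\<Sum>j=1..k. r j) \<in> {2 * p..4 * p} \<longrightarrow>
        \<bar>(\<integral>y. (\<Prod>j=1..k. (y j - x j) ^ r j) \<partial>kpoint_kernel P K k x)
          - (\<integral>y. (\<Prod>j=1..k. y j ^ r j) \<partial>(\<Pi>\<^sub>M j\<in>{1..k}. \<mu>))\<bar>
        \<le> F (Min {\<bar>x i - x j\<bar> | i j. 1 \<le> i \<and> i < j \<and> j \<le> k})"
  obtains R where "\<And>x. x \<in> I \<Longrightarrow> R \<le> \<bar>x\<bar> \<Longrightarrow> (\<integral>y. (y 1 - x) * y 2 \<partial>pair x) \<le> (m 1)\<^sup>2 + 1 / 2"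
proof -
  have zero: "0 \<in> I" by (rule state_space_zero[OF I])
  consider "p = 0" | "p = 1" | "2 \<le> p" by linarith
  then show thesis
  proof cases
    case 1
    have "AE \<omega> in P. (\<integral>y. y ^ p \<partial>K \<omega> 0) = 1"
      by (rule AE_I2) (simp add: 1 prob_space.prob_space K_prob[OF zero])
    then show thesis using nondeterministic by blast
  next
    case 3
    then have "1 \<in> {1..p - 1}" by auto
    then have "AE \<omega> in P. (\<integral>y. y ^ 1 \<partial>K \<omega> 0) = m 1" using deterministic by (rule bspec[rotated])
    then have mean: "AE \<omega> in P. (\<integral>y. y \<partial>K \<omega> 0) = m 1" by (simp only: power_one_right)
    have "(\<integral>y. (y 1 - x) * y 2 \<partial>pair x) \<le> (m 1)\<^sup>2 + 1 / 2" if "x \<in> I" for x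
      unfolding covariance_deterministic_mean[OF that mean] by simp
    then show thesis by (rule that)
  next
    case 2
    obtain R where R: "0 \<le> R" "\<And>x. R \<le> x \<Longrightarrow> F x \<le> 1 / 2" using decay_function_small[OF decay(1)] by blast
    have two: "(\<Prod>i\<in>{1..2}. h i) = h 1 * h 2" for h :: "nat \<Rightarrow> real"
      by (simp add: numeral_2_eq_2)
    interpret prod: product_sigma_finite "\<lambda>_::nat. \<mu>"
      by (rule product_sigma_finite.intro, rule prob_space_imp_sigma_finite)
        (use mean_measure_prob in \<open>simp add: space_prob_algebra\<close>)
    have "(\<integral>y. (\<Prod>j\<in>{1..2}. y j ^ 1) \<partial>(\<Pi>\<^sub>M j\<in>{1..2::nat}. \<mu>)) = (\<Prod>j\<in>{1..2::nat}. m 1)"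
      by (rule prod.product_integral_prod[OF finite_atLeastAtMost integrable_power])
    then have mean_product: "(\<integral>y. (\<Prod>j\<in>{1..2}. y j ^ 1) \<partial>(\<Pi>\<^sub>M j\<in>{1..2::nat}. \<mu>)) = (m 1)\<^sup>2"
      by (simp only: two power2_eq_square)
    show thesis
    proof (rule that[of R])
      fix x assume x: "x \<in> I" and Rx: "R \<le> \<bar>x\<bar>"
      \<comment> \<open>The decay assumption ranges over extensional families of points, so the
        starting configuration is restricted to the two indices; the two-point kernel only reads
        these.\<close>
      define x' :: "nat \<Rightarrow> real" where "x' = restrict ((\<lambda>_. 0)(1 := x)) {1..2}"
      have x': "x' 1 = x" "x' 2 = 0" by (simp_all add: x'_def)
      have x'_in: "x' \<in> {1..2} \<rightarrow>\<^sub>E I" using x zero by (auto simp: x'_def)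
      have "(\<Pi>\<^sub>M i\<in>{1..2}. K \<omega> (x' i)) = (\<Pi>\<^sub>M i\<in>{1..2}. K \<omega> (((\<lambda>_. 0)(1 := x)) i))" for \<omega>
        by (rule PiM_cong) (simp_all add: x'_def)
      then have kernel: "kpoint_kernel P K 2 x' = pair x" by (simp only: kpoint_kernel_def)
      have "{\<bar>x' i - x' j\<bar> | i j. 1 \<le> i \<and> i < j \<and> j \<le> 2} = {\<bar>x\<bar>}"
      proof -
        have "i = 1 \<and> j = 2" if "1 \<le> i" "i < j" "j \<le> 2" for i j :: nat using that by linarith
        then have "{\<bar>x' i - x' j\<bar> | i j. 1 \<le> i \<and> i < j \<and> j \<le> 2} = {\<bar>x' 1 - x' 2\<bar>}" by fastforce
        then show ?thesis by (simp only: x' diff_0_right)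
      qed
      then have min: "Min {\<bar>x' i - x' j\<bar> | i j. 1 \<le> i \<and> i < j \<and> j \<le> 2} = \<bar>x\<bar>" by simp
      have "2 \<in> {2 * p..4 * p}" "\<forall>j\<in>{1..2::nat}. 1 \<le> 4 * p - 1" "(\<Sum>j=1..2::nat. 1) \<in> {2 * p..4 * p}"
        by (simp_all add: 2)
      then have "\<bar>(\<integral>y. (\<Prod>j=1..2. (y j - x' j) ^ 1) \<partial>kpoint_kernel P K 2 x')
          - (\<integral>y. (\<Prod>j=1..2. y j ^ 1) \<partial>(\<Pi>\<^sub>M j\<in>{1..2::nat}. \<mu>))\<bar>
          \<le> F (Min {\<bar>x' i - x' j\<bar> | i j. 1 \<le> i \<and> i < j \<and> j \<le> 2})"
        by (intro decay(2)[THEN bspec, THEN bspec, THEN spec, THEN mp, OF _ x'_in, of "\<lambda>_. 1"] conjI)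
      then have "\<bar>(\<integral>y. (y 1 - x) * y 2 \<partial>pair x) - (m 1)\<^sup>2\<bar> \<le> F \<bar>x\<bar>"
        unfolding kernel min mean_product by (simp only: two power_one_right x' diff_0_right)
      then show "(\<integral>y. (y 1 - x) * y 2 \<partial>pair x) \<le> (m 1)\<^sup>2 + 1 / 2"
        using R(2)[OF Rx] by linarith
    qed
  qed
qed

end

section \<open>The difference of two motions in a common random environment\<close>

theorem proposition1p3:
  fixes I :: "real set"
    and P :: "'w measure"
    and K :: "nat \<Rightarrow> 'w \<Rightarrow> real \<Rightarrow> real measure"
    and p :: nat
    and \<mu> :: "real measure"
    and m :: "nat \<Rightarrow> real"
    and p_dif :: "real \<Rightarrow> real measure"
  defines "\<mu> \<equiv> mean_measure P (K 1)"
    and "m \<equiv> (\<lambda>k. \<integral>x. x ^ k \<partial>\<mu>)"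
    and "p_dif \<equiv> difference_kernel I P (K 1)"
  assumes "state_space I"
    and "prob_space P"
    and independent: "prob_space.indep_vars P (\<lambda>_. kernel_space I) K {1..}"
    and identically_distributed:
      "\<forall>n\<ge>1. distr P (kernel_space I) (K n) = distr P (kernel_space I) (K 1)"
    and stationary:
      "\<forall>a\<in>I. distr P (kernel_space I) (K 1)
              = distr P (kernel_space I) (\<lambda>\<omega>. shift_kernel I a (K 1 \<omega>))"
    and exponential_moment: "\<exists>\<eta>>0. integrable \<mu> (\<lambda>x. exp (\<eta> * \<bar>x\<bar>))"
    and unit_variance: "m 2 - (m 1)\<^sup>2 = 1"
    and deterministic_moments:
      "\<forall>k\<in>{1..p - 1}. AE \<omega> in P. (\<integral>y. y ^ k \<partial>K 1 \<omega> 0) = m k"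
    and nondeterministic_moment:
      "\<not> (\<exists>c. AE \<omega> in P. (\<integral>y. y ^ p \<partial>K 1 \<omega> 0) = c)"
    and moment_decay:
      "\<exists>F. decay_function F \<and>
        (\<forall>k\<in>{2 * p..4 * p}. \<forall>x\<in>{1..k} \<rightarrow>\<^sub>E I. \<forall>r :: nat \<Rightarrow> nat.
          (\<forall>j\<in>{1..k}. r j \<le> 4 * p - 1) \<and> (\<Sum>j=1..k. r j) \<in> {2 * p..4 * p} \<longrightarrow>
          \<bar>(\<integral>y. (\<Prod>j=1..k. (y j - x j) ^ r j) \<partial>kpoint_kernel P (K 1) k x)
            - (\<integral>y. (\<Prod>j=1..k. y j ^ r j) \<partial>(\<Pi>\<^sub>M j\<in>{1..k}. \<mu>))\<bar>
          \<le> F (Min {\<bar>x i - x j\<bar> | i j. 1 \<le> i \<and> i < j \<and> j \<le> k}))"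
    and tv_continuous: "tv_continuous_kernel I p_dif"
    and irreducible:
      "\<forall>x\<in>I. \<forall>y\<in>I. \<forall>\<epsilon>>0. \<exists>n. 0 < measure (kernel_power I p_dif n x) ({y - \<epsilon><..<y + \<epsilon>} \<inter> I)"
  shows "\<exists>\<pi>. invariant_measure I p_dif \<pi> \<and>
    (\<forall>\<pi>'. invariant_measure I p_dif \<pi>' \<longrightarrow> (\<exists>c>0. \<pi>' = scale_measure (ennreal c) \<pi>)) \<and>
    full_support I \<pi> \<and>
    (\<forall>f F. f \<in> borel_measurable (borel_on I) \<and> (\<forall>x\<ge>0. 0 \<le> F x) \<and> antimono_on {0..} F \<and>
        summable (\<lambda>k. F (real k)) \<and> (\<forall>x\<in>I. \<bar>f x\<bar> \<le> F \<bar>x\<bar>)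
      \<longrightarrow> (\<integral>\<^sup>+x. ennreal \<bar>f x\<bar> \<partial>\<pi>) < \<infinity>) \<and>
    (\<forall>f g :: real \<Rightarrow> real. integrable \<pi> f \<and> integrable \<pi> g \<and> (\<integral>x. g x \<partial>\<pi>) \<noteq> 0 \<longrightarrow>
      (\<forall>x\<^sub>0\<in>I. \<forall>(Q :: 'b measure) X. markov_chain I p_dif x\<^sub>0 Q X \<longrightarrow>
        (AE \<omega> in Q. (\<lambda>r. (\<Sum>k=0..r. f (X k \<omega>)) / (\<Sum>k=0..r. g (X k \<omega>)))
          \<longlonglongrightarrow> (\<integral>x. f x \<partial>\<pi>) / (\<integral>x. g x \<partial>\<pi>))))"
proof -
  interpret prob_space P by fact
  interpret random: random_kernel P I "K 1"
  proof (rule random_kernel.intro[OF assms(5) random_kernel_axioms.intro[OF assms(4)]])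
    show "K 1 \<in> P \<rightarrow>\<^sub>M kernel_space I"
      using independent unfolding indep_vars_def by (auto dest: bspec[of _ _ 1])
    show "distr P (kernel_space I) (K 1) = distr P (kernel_space I) (\<lambda>\<omega>. shift_kernel I a (K 1 \<omega>))"
      if "a \<in> I" for a by (rule bspec[OF stationary that])
    show "\<exists>\<eta>>0. integrable (mean_measure P (K 1)) (\<lambda>x. exp (\<eta> * \<bar>x\<bar>))"
      by (rule exponential_moment[unfolded \<mu>_def])
  qed
  obtain F where F: "decay_function F"
    "\<forall>k\<in>{2 * p..4 * p}. \<forall>x\<in>{1..k} \<rightarrow>\<^sub>E I. \<forall>r :: nat \<Rightarrow> nat.
      (\<forall>j\<in>{1..k}. r j \<le> 4 * p - 1) \<and> (\<Sum>j=1..k. r j) \<in> {2 * p..4 * p} \<longrightarrow>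
      \<bar>(\<integral>y. (\<Prod>j=1..k. (y j - x j) ^ r j) \<partial>kpoint_kernel P (K 1) k x)
        - (\<integral>y. (\<Prod>j=1..k. y j ^ r j) \<partial>(\<Pi>\<^sub>M j\<in>{1..k}. \<mu>))\<bar>
      \<le> F (Min {\<bar>x i - x j\<bar> | i j. 1 \<le> i \<and> i < j \<and> j \<le> k})"
    using moment_decay by (elim exE conjE)
  obtain R where cov: "\<And>x. x \<in> I \<Longrightarrow> R \<le> \<bar>x\<bar> \<Longrightarrow> (\<integral>y. (y 1 - x) * y 2 \<partial>random.pair x) \<le> (random.m 1)\<^sup>2 + 1 / 2"
    by (rule random.covariance_decay[OF deterministic_moments[unfolded m_def \<mu>_def] nondeterministic_moment F[unfolded \<mu>_def]]) blast
  interpret moment_chain I p_dif "1 + (\<Sum>k\<le>6. 2 ^ (k + 1) * (\<integral>y. \<bar>y\<bar> ^ k \<partial>\<mu>))" "max 1 R"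
    unfolding p_dif_def \<mu>_def
  proof (rule random.moment_chain_difference_kernel)
    show "tv_continuous_kernel I random.q" using tv_continuous by (simp only: p_dif_def)
    show "\<exists>n. 0 < measure (kernel_power I random.q n x) ({y - \<epsilon><..<y + \<epsilon>} \<inter> I)"
      if "x \<in> I" "y \<in> I" "\<epsilon> > 0" for x y \<epsilon>
      using irreducible[THEN bspec, THEN bspec, THEN spec, THEN mp, OF that] by (simp only: p_dif_def)
    show "random.m 2 - (random.m 1)\<^sup>2 = 1" using unit_variance by (simp only: m_def \<mu>_def)
  qed (rule cov)
  obtain R' b where "drift_chain I p_dif V W R' b (1 / 2)
      (5 * (1 + (\<Sum>k\<le>6. 2 ^ (k + 1) * (\<integral>y. \<bar>y\<bar> ^ k \<partial>\<mu>))) + \<delta>\<^sub>0 * (1 + (max 1 R)\<^sup>2)) \<delta>\<^sub>0"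
    by (rule drift_chain_constants)
  then interpret drift: drift_chain I p_dif V W R' b "1 / 2"
      "5 * (1 + (\<Sum>k\<le>6. 2 ^ (k + 1) * (\<integral>y. \<bar>y\<bar> ^ k \<partial>\<mu>))) + \<delta>\<^sub>0 * (1 + (max 1 R)\<^sup>2)" \<delta>\<^sub>0 .
  obtain \<pi> C where \<pi>: "invariant_measure I p_dif \<pi>"
    and C: "C < \<infinity>" "\<And>a. emeasure \<pi> (I \<inter> {a - 1..a + 1}) \<le> C"
    using drift.invariant_measure_exists by blast
  show ?thesis
  proof (intro exI[of _ \<pi>] conjI allI impI ballI)
    show "invariant_measure I p_dif \<pi>" by (rule \<pi>)
    show "\<exists>c>0. \<pi>' = scale_measure (ennreal c) \<pi>" if "invariant_measure I p_dif \<pi>'" for \<pi>'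
      by (rule drift.invariant_measure_unique[OF \<pi> that])
    show "full_support I \<pi>" by (rule drift.full_support_invariant[OF \<pi>])
    fix f F :: "real \<Rightarrow> real"
    assume "f \<in> borel_measurable (borel_on I) \<and> (\<forall>x\<ge>0. 0 \<le> F x) \<and> antimono_on {0..} F \<and>
        summable (\<lambda>k. F (real k)) \<and> (\<forall>x\<in>I. \<bar>f x\<bar> \<le> F \<bar>x\<bar>)"
    then show "(\<integral>\<^sup>+x. ennreal \<bar>f x\<bar> \<partial>\<pi>) < \<infinity>"
      by (intro nn_integral_decreasing_bound_finite[OF _ state_space_borel[OF assms(4)] C, of F f])
        (use \<pi> in \<open>simp_all add: invariant_measure_def\<close>)
  next
    fix f g :: "real \<Rightarrow> real" and x\<^sub>0 and Q :: "'b measure" and X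
    assume fg: "integrable \<pi> f \<and> integrable \<pi> g \<and> (\<integral>x. g x \<partial>\<pi>) \<noteq> 0" and x\<^sub>0: "x\<^sub>0 \<in> I"
      and X: "markov_chain I p_dif x\<^sub>0 Q X"
    show "AE \<omega> in Q. (\<lambda>r. (\<Sum>k=0..r. f (X k \<omega>)) / (\<Sum>k=0..r. g (X k \<omega>)))
          \<longlonglongrightarrow> (\<integral>x. f x \<partial>\<pi>) / (\<integral>x. g x \<partial>\<pi>)"
      using fg by (intro drift.ratio_limit_markov_chain[OF \<pi> _ _ _ x\<^sub>0 X]) auto
  qed
qed

end
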